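(* Let $t\in\mathbb T_n=(\mathbb C^\times)^n$ have polar decomposition $t=vu$ with $v\in(\mathbb R_{>0})^n$, $u=(z_1,\dots,z_n)\in(S^1)^n$, and suppose that equal entries of $u$ are adjacent, so that $u$ determines $\mathbf n=(n_1,\dots,n_m)$ with $n_1+\dots+n_m=n$: the first $n_1$ entries of $u$ are equal, the next $n_2$ entries are equal, etc., and entries in different blocks are different. Let $\pi$ be a finite-dimensional $\mathcal H_n$-module annihilated by a power of $\mathcal J_{S_nt}$, and let $\sigma$ be a finite-dimensional $\mathcal H_{\mathbf n}$-module annihilated by a power of $\mathcal J_{S_{\mathbf n}t}$ such that $\pi\cong\mathcal H_n\otimes_{\mathcal H_{\mathbf n}}\sigma$. Let $0\le i\le n$ be an integer. Then there is an isomorphism of $\mathcal H_{n-i}$-modules $$\mathbf{BZ}_i(\pi)\cong\bigoplus_{\mathbf i}\mathcal H_{n-i}\otimes_{\mathcal H_{\mathbf n-\mathbf i}}\mathbf{BZ}^{\mathbf n}_{\mathbf i}(\sigma),$$ where the sum is over all $m$-tuples of integers $\mathbf i=(i_1,\dots,i_m)$ with $i_1+\dots+i_m=i$ and $0\le i_k\le n_k$ for $k=1,\dots,m$.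
   Context: Fix $q>1$ a prime power. $\mathcal H_n$ is the complex algebra generated by $T_1,\dots,T_{n-1}$ and $\mathcal A_n=\mathbb C[x_1^{\pm1},\dots,x_n^{\pm1}]$, with the braid relations of the symmetric group $S_n$ and $(T_j+1)(T_j-q)=0$ for the $T_j$, and $T_jf-f^{s_j}T_j=(q-1)x_j\frac{f-f^{s_j}}{x_j-x_{j+1}}$, where $f^{s_j}$ is $f$ with $x_j,x_{j+1}$ exchanged; $\mathcal H_0=\mathbb C$. The $T_j$ generate a finite-dimensional subalgebra with basis $T_w$, $w\in S_n$; $l$ is the length function. The sign projector in $\mathcal H_n$ is $\mathbf S_n=(\sum_{w\in S_n}(1/q)^{l(w)})^{-1}\sum_{w\in S_n}(-1/q)^{l(w)}T_w$. The center of $\mathcal H_n$ is $\mathcal Z_n=\mathcal A_n^{S_n}$. For $0\le i\le n$ there is an embedding $\mathcal H_{n-i}\otimes\mathcal H_i\subseteq\mathcal H_n$ with $T_j\otimes1\mapsto T_j$, $x_j\otimes1\mapsto x_j$, $1\otimes T_j\mapsto T_{j+n-i}$, $1\otimes x_j\mapsto x_{j+n-i}$. $\mathcal H_{n-i}$ is viewed as a subalgebra via $h\mapsto h\otimes1$; $\mathbf S^n_i$ is the image of $1\otimes\mathbf S_i$; and $\mathbf{BZ}_i(\pi):=\mathbf S_i^n(\pi)$, an $\mathcal H_{n-i}$-module. $\mathbb T_n=\mathrm{Hom}(\mathbb Z^n,\mathbb C^\times)$ is identified with $(\mathbb C^\times)^n$. $\mathcal H_{\mathbf n}=\mathcal H_{n_1}\otimes\cdots\otimes\mathcal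 H_{n_m}$ is the Levi subalgebra of $\mathcal H_n$ generated by $\mathcal A_n$ and the $T_j$ with $s_j=(j,j+1)\in S_{\mathbf n}=S_{n_1}\times\cdots\times S_{n_m}$. Its center is $\mathcal Z_{\mathbf n}=\mathcal A_n^{S_{\mathbf n}}$. $\mathcal J_{S_nt}\subset\mathcal Z_n$ (resp. $\mathcal J_{S_{\mathbf n}t}\subset\mathcal Z_{\mathbf n}$) is the maximal ideal of elements vanishing at the orbit $S_nt$ (resp. $S_{\mathbf n}t$). For $\mathbf i=(i_1,\dots,i_m)$ with $0\le i_k\le n_k$, $\mathbf n-\mathbf i=(n_1-i_1,\dots,n_m-i_m)$, $\mathcal H_{\mathbf i}=\mathcal H_{i_1}\otimes\cdots\otimes\mathcal H_{i_m}$ and $\mathcal H_{\mathbf n-\mathbf i}=\mathcal H_{n_1-i_1}\otimes\cdots\otimes\mathcal H_{n_m-i_m}$. The embeddings $\mathcal H_{n_k-i_k}\otimes\mathcal H_{i_k}\subseteq\mathcal H_{n_k}$ combine to $\mathcal H_{\mathbf n-\mathbf i}\otimes\mathcal H_{\mathbf i}\subseteq\mathcal H_{\mathbf n}$. $\mathbf S_{\mathbf i}=\mathbf S_{i_1}\otimes\cdots\otimes\mathbf S_{i_m}$ is the sign projector in $\mathcal H_{\mathbf i}$, and $\mathbf S^{\mathbf n}_{\mathbf i}$ is the image of $1\otimes\mathbf S_{\mathbf i}$ in $\mathcal H_{\mathbf n}$. For an $\mathcal H_{\mathbf n}$-module $\sigma$, $\mathbf{BZ}^{\mathbf n}_{\mathbf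 i}(\sigma):=\mathbf S^{\mathbf n}_{\mathbf i}(\sigma)$, an $\mathcal H_{\mathbf n-\mathbf i}$-module. When $i_1+\dots+i_m=i$, $\mathcal H_{\mathbf n-\mathbf i}$ is also viewed as a Levi subalgebra of $\mathcal H_{n-i}$ (blocks of sizes $n_1-i_1,\dots,n_m-i_m$ in this order). *)

theory Defs
  imports
    "HOL-Library.Poly_Mapping"
    "HOL-Combinatorics.Permutations"
    "HOL-Number_Theory.Prime_Powers"
    "HOL-Algebra.Algebra"
begin

section \<open>Left modules over a non-commutative ring\<close>

text \<open>
  The library's locale \<open>module\<close> wants a commutative ring of scalars. The record type is reused
  here; its fields \<open>mult\<close> and \<open>one\<close> carry no meaning for a module.
\<close>

locale left_module = R?: ring R + M?: abelian_group M
  for R :: "('a, 'r) ring_scheme" (structure) and M :: "('a, 'b, 'm) module_scheme" (structure) +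
  assumes smult_closed:
      "\<lbrakk>a \<in> carrier R; x \<in> carrier M\<rbrakk> \<Longrightarrow> a \<odot>\<^bsub>M\<^esub> x \<in> carrier M"
    and smult_l_distr:
      "\<lbrakk>a \<in> carrier R; b \<in> carrier R; x \<in> carrier M\<rbrakk> \<Longrightarrow>
        (a \<oplus>\<^bsub>R\<^esub> b) \<odot>\<^bsub>M\<^esub> x = a \<odot>\<^bsub>M\<^esub> x \<oplus>\<^bsub>M\<^esub> b \<odot>\<^bsub>M\<^esub> x"
    and smult_r_distr:
      "\<lbrakk>a \<in> carrier R; x \<in> carrier M; y \<in> carrier M\<rbrakk> \<Longrightarrow>
        a \<odot>\<^bsub>M\<^esub> (x \<oplus>\<^bsub>M\<^esub> y) = a \<odot>\<^bsub>M\<^esub> x \<oplus>\<^bsub>M\<^esub> a \<odot>\<^bsub>M\<^esub> y"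
    and smult_assoc1:
      "\<lbrakk>a \<in> carrier R; b \<in> carrier R; x \<in> carrier M\<rbrakk> \<Longrightarrow>
        (a \<otimes>\<^bsub>R\<^esub> b) \<odot>\<^bsub>M\<^esub> x = a \<odot>\<^bsub>M\<^esub> (b \<odot>\<^bsub>M\<^esub> x)"
    and smult_one:
      "x \<in> carrier M \<Longrightarrow> \<one>\<^bsub>R\<^esub> \<odot>\<^bsub>M\<^esub> x = x"

definition left_module_iso ::
    "('a, 'r) ring_scheme \<Rightarrow> ('a, 'b) module \<Rightarrow> ('a, 'c) module \<Rightarrow> ('b \<Rightarrow> 'c) set" where
  "left_module_iso R M N = {\<phi>. bij_betw \<phi> (carrier M) (carrier N) \<and>
     (\<forall>x\<in>carrier M. \<forall>y\<in>carrier M. \<phi> (x \<oplus>\<^bsub>M\<^esub> y) = \<phi> x \<oplus>\<^bsub>N\<^esub> \<phi> y) \<and>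
     (\<forall>a\<in>carrier R. \<forall>x\<in>carrier M. \<phi> (a \<odot>\<^bsub>M\<^esub> x) = a \<odot>\<^bsub>N\<^esub> \<phi> x)}"

definition left_modules_isomorphic ::
    "('a, 'r) ring_scheme \<Rightarrow> ('a, 'b) module \<Rightarrow> ('a, 'c) module \<Rightarrow> bool" where
  "left_modules_isomorphic R M N \<longleftrightarrow>
     left_module R M \<and> left_module R N \<and> left_module_iso R M N \<noteq> {}"

definition direct_sum :: "'i set \<Rightarrow> ('i \<Rightarrow> ('a, 'b) module) \<Rightarrow> ('a, 'i \<Rightarrow> 'b) module" where
  "direct_sum I M = \<lparr>
     carrier = {f \<in> (\<Pi>\<^sub>E i\<in>I. carrier (M i)). finite {i \<in> I. f i \<noteq> \<zero>\<^bsub>M i\<^esub>}},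
     monoid.mult = (\<lambda>_ _. undefined), monoid.one = undefined,
     ring.zero = (\<lambda>i\<in>I. \<zero>\<^bsub>M i\<^esub>),
     ring.add = (\<lambda>f g. \<lambda>i\<in>I. f i \<oplus>\<^bsub>M i\<^esub> g i),
     module.smult = (\<lambda>a f. \<lambda>i\<in>I. a \<odot>\<^bsub>M i\<^esub> f i)\<rparr>"

text \<open>
  The induced module \<open>A \<otimes>\<^sub>R M\<close>, for a subring \<open>R\<close> of \<open>A\<close> and an \<open>R\<close>-module \<open>M\<close>: the free abelian
  group on \<open>A \<times> M\<close> modulo the subgroup generated by the tensor relations. The element \<open>h\<close> of \<open>A\<close>
  sends the coset of a formal sum \<open>c\<close> to the coset of \<open>left_mult_formal A h c\<close>.
\<close>

definition tensor_relations ::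
    "('a, 'r) ring_scheme \<Rightarrow> ('a, 's) ring_scheme \<Rightarrow> ('a, 'b) module \<Rightarrow> (('a \<times> 'b) \<Rightarrow>\<^sub>0 int) set" where
  "tensor_relations A R M =
     {frag_of (a \<oplus>\<^bsub>A\<^esub> a', x) - frag_of (a, x) - frag_of (a', x) | a a' x.
        a \<in> carrier A \<and> a' \<in> carrier A \<and> x \<in> carrier M}
   \<union> {frag_of (a, x \<oplus>\<^bsub>M\<^esub> x') - frag_of (a, x) - frag_of (a, x') | a x x'.
        a \<in> carrier A \<and> x \<in> carrier M \<and> x' \<in> carrier M}
   \<union> {frag_of (a \<otimes>\<^bsub>A\<^esub> r, x) - frag_of (a, r \<odot>\<^bsub>M\<^esub> x) | a r x.
        a \<in> carrier A \<and> r \<in> carrier R \<and> x \<in> carrier M}"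

definition left_mult_formal ::
    "('a, 'r) ring_scheme \<Rightarrow> 'a \<Rightarrow> (('a \<times> 'b) \<Rightarrow>\<^sub>0 int) \<Rightarrow> (('a \<times> 'b) \<Rightarrow>\<^sub>0 int)" where
  "left_mult_formal A h = frag_extend (\<lambda>(a, x). frag_of (h \<otimes>\<^bsub>A\<^esub> a, x))"

definition induced_module ::
    "('a, 'r) ring_scheme \<Rightarrow> ('a, 's) ring_scheme \<Rightarrow> ('a, 'b) module \<Rightarrow>
     ('a, (('a \<times> 'b) \<Rightarrow>\<^sub>0 int) set) module" where
  "induced_module A R M =
    (let F = free_Abelian_group (carrier A \<times> carrier M);
         N = generate F (tensor_relations A R M)
     in \<lparr>carrier = carrier (F Mod N),
         monoid.mult = (\<lambda>_ _. undefined), monoid.one = undefined,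
         ring.zero = monoid.one (F Mod N),
         ring.add = monoid.mult (F Mod N),
         module.smult = (\<lambda>h C. N <#>\<^bsub>F\<^esub> (left_mult_formal A h ` C))\<rparr>)"

text \<open>
  For an idempotent \<open>e\<close> of the ring acting on \<open>M\<close> and a ring homomorphism \<open>\<phi>\<close> into the commutant
  of \<open>e\<close>: the subspace \<open>e M\<close> with scalars acting through \<open>\<phi>\<close>.
\<close>

definition cut_module :: "'a \<Rightarrow> ('c \<Rightarrow> 'a) \<Rightarrow> ('a, 'b) module \<Rightarrow> ('c, 'b) module" where
  "cut_module e \<phi> M = \<lparr>
     carrier = (\<lambda>x. e \<odot>\<^bsub>M\<^esub> x) ` carrier M,
     monoid.mult = (\<lambda>_ _. undefined), monoid.one = undefined,
     ring.zero = \<zero>\<^bsub>M\<^esub>, ring.add = add M,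
     module.smult = (\<lambda>h x. \<phi> h \<odot>\<^bsub>M\<^esub> x)\<rparr>"


section \<open>Laurent polynomials\<close>

text \<open>\<open>\<complex>[x\<^sub>1\<^sup>\<plusminus>\<^sup>1, x\<^sub>2\<^sup>\<plusminus>\<^sup>1, \<dots>]\<close> as the group algebra of its lattice of exponents.\<close>

type_synonym expo = "nat \<Rightarrow>\<^sub>0 int"
type_synonym laurent = "expo \<Rightarrow>\<^sub>0 complex"

definition lconst :: "complex \<Rightarrow> laurent" where
  "lconst c = Poly_Mapping.single 0 c"

definition lvar :: "nat \<Rightarrow> laurent" where
  "lvar k = Poly_Mapping.single (Poly_Mapping.single k 1) 1"

definition laurent_polys :: "nat \<Rightarrow> laurent set" where
  "laurent_polys n = {f. \<forall>a\<in>Poly_Mapping.keys f. Poly_Mapping.keys a \<subseteq> {1..n}}"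

text \<open>The substitution \<open>x\<^sub>k \<mapsto> x\<^bsub>p k\<^esub>\<close>.\<close>

definition lrename :: "(nat \<Rightarrow> nat) \<Rightarrow> laurent \<Rightarrow> laurent" where
  "lrename p f =
     (\<Sum>a\<in>Poly_Mapping.keys f.
        Poly_Mapping.single
          (\<Sum>k\<in>Poly_Mapping.keys a. Poly_Mapping.single (p k) (Poly_Mapping.lookup a k))
          (Poly_Mapping.lookup f a))"

definition leval :: "(nat \<Rightarrow> complex) \<Rightarrow> laurent \<Rightarrow> complex" where
  "leval t f =
     (\<Sum>a\<in>Poly_Mapping.keys f.
        Poly_Mapping.lookup f a *
        (\<Prod>k\<in>Poly_Mapping.keys a. t k powi Poly_Mapping.lookup a k))"


section \<open>Compositions and parabolic subgroups of the symmetric group\<close>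

text \<open>
  A composition of \<open>n\<close> is a list with sum \<open>n\<close>; blocks are numbered from \<open>0\<close>, positions from \<open>1\<close>.
  Parts equal to \<open>0\<close> are allowed and have empty blocks.
\<close>

definition offset :: "nat list \<Rightarrow> nat \<Rightarrow> nat" where
  "offset ns k = sum_list (take k ns)"

definition block :: "nat list \<Rightarrow> nat \<Rightarrow> nat set" where
  "block ns k = {offset ns k + 1 .. offset ns k + ns ! k}"

definition block_index :: "nat list \<Rightarrow> nat \<Rightarrow> nat" where
  "block_index ns j = (THE k. k < length ns \<and> j \<in> block ns k)"

definition parabolic :: "nat list \<Rightarrow> (nat \<Rightarrow> nat) set" where
  "parabolic ns =
     {w. w permutes {1..sum_list ns} \<and> (\<forall>k<length ns. w ` block ns k = block ns k)}"

definition sub_tuples :: "nat list \<Rightarrow> nat \<Rightarrow> nat list set" where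
  "sub_tuples ns i =
     {ks. length ks = length ns \<and> sum_list ks = i \<and> (\<forall>k<length ns. ks ! k \<le> ns ! k)}"

abbreviation tuple_diff :: "nat list \<Rightarrow> nat list \<Rightarrow> nat list" where
  "tuple_diff ns ks \<equiv> map2 (-) ns ks"

abbreviation sref :: "nat \<Rightarrow> nat \<Rightarrow> nat" where
  "sref j \<equiv> transpose j (Suc j)"

definition sref_word :: "nat list \<Rightarrow> nat \<Rightarrow> nat" where
  "sref_word js = foldr (\<lambda>j w. sref j \<circ> w) js id"

definition perm_length :: "nat \<Rightarrow> (nat \<Rightarrow> nat) \<Rightarrow> nat" where
  "perm_length n w =
     (LEAST l. \<exists>js. set js \<subseteq> {1..<n} \<and> sref_word js = w \<and> length js = l)"

definition reduced_word :: "nat \<Rightarrow> (nat \<Rightarrow> nat) \<Rightarrow> nat list \<Rightarrow> bool" where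
  "reduced_word n w js \<longleftrightarrow>
     set js \<subseteq> {1..<n} \<and> sref_word js = w \<and> length js = perm_length n w"


section \<open>The affine Hecke algebra\<close>

subsection \<open>Free algebras\<close>

text \<open>
  The free monoid, written additively so that \<open>'g word \<Rightarrow>\<^sub>0 complex\<close> with the library's
  convolution product is the free complex algebra on \<open>'g\<close>.
\<close>

datatype 'g word = Word (letters: "'g list")

instantiation word :: (type) monoid_add
begin
definition zero_word :: "'a word" where
  "zero_word = Word []"
definition plus_word :: "'a word \<Rightarrow> 'a word \<Rightarrow> 'a word" where
  "plus_word u v = Word (letters u @ letters v)"
instance
  by standard (simp_all add: zero_word_def plus_word_def)
end

type_synonym 'g free = "'g word \<Rightarrow>\<^sub>0 complex"

definition fgen :: "'g \<Rightarrow> 'g free" where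
  "fgen g = Poly_Mapping.single (Word [g]) 1"

definition fconst :: "complex \<Rightarrow> 'g free" where
  "fconst c = Poly_Mapping.single 0 c"

definition free_algebra :: "'g set \<Rightarrow> 'g free ring" where
  "free_algebra G = \<lparr>
     carrier = {a. \<forall>w\<in>Poly_Mapping.keys a. set (letters w) \<subseteq> G},
     monoid.mult = (*), monoid.one = 1, ring.zero = 0, ring.add = (+)\<rparr>"

subsection \<open>Generators and relations\<close>

datatype hgen = GT nat | GA laurent

type_synonym hecke_elt = "hgen free set"

definition hecke_gens :: "nat \<Rightarrow> hgen set" where
  "hecke_gens n = GT ` {1..<n} \<union> GA ` laurent_polys n"

text \<open>
  In the last set \<open>g\<close> stands for \<open>(f - f\<^sup>s) / (x\<^sub>j - x\<^bsub>j+1\<^esub>)\<close>, which always is a (unique) Laurent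
  polynomial.
\<close>

definition hecke_relations :: "nat \<Rightarrow> nat \<Rightarrow> hgen free set" where
  "hecke_relations q n =
     {fgen (GA (lconst c)) - fconst c | c. True}
   \<union> {fgen (GA (f + g)) - (fgen (GA f) + fgen (GA g)) | f g.
        f \<in> laurent_polys n \<and> g \<in> laurent_polys n}
   \<union> {fgen (GA (f * g)) - fgen (GA f) * fgen (GA g) | f g.
        f \<in> laurent_polys n \<and> g \<in> laurent_polys n}
   \<union> {fgen (GT j) * fgen (GT (j + 1)) * fgen (GT j)
        - fgen (GT (j + 1)) * fgen (GT j) * fgen (GT (j + 1)) | j.
        1 \<le> j \<and> j + 1 < n}
   \<union> {fgen (GT j) * fgen (GT k) - fgen (GT k) * fgen (GT j) | j k.
        1 \<le> j \<and> j + 2 \<le> k \<and> k < n}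
   \<union> {(fgen (GT j) + 1) * (fgen (GT j) - fconst (of_nat q)) | j.
        1 \<le> j \<and> j < n}
   \<union> {fgen (GT j) * fgen (GA f) - fgen (GA (lrename (sref j) f)) * fgen (GT j)
        - fconst (of_nat q - 1) * fgen (GA (lvar j * g)) | j f g.
        1 \<le> j \<and> j < n \<and> f \<in> laurent_polys n \<and> g \<in> laurent_polys n \<and>
        g * (lvar j - lvar (j + 1)) = f - lrename (sref j) f}"

definition hecke_ideal :: "nat \<Rightarrow> nat \<Rightarrow> hgen free set" where
  "hecke_ideal q n = genideal (free_algebra (hecke_gens n)) (hecke_relations q n)"

definition hecke :: "nat \<Rightarrow> nat \<Rightarrow> hecke_elt ring" where
  "hecke q n = free_algebra (hecke_gens n) Quot hecke_ideal q n"

definition hecke_gen :: "nat \<Rightarrow> nat \<Rightarrow> hgen \<Rightarrow> hecke_elt" where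
  "hecke_gen q n g = hecke_ideal q n +>\<^bsub>free_algebra (hecke_gens n)\<^esub> fgen g"

abbreviation hT :: "nat \<Rightarrow> nat \<Rightarrow> nat \<Rightarrow> hecke_elt" where
  "hT q n j \<equiv> hecke_gen q n (GT j)"

abbreviation hA :: "nat \<Rightarrow> nat \<Rightarrow> laurent \<Rightarrow> hecke_elt" where
  "hA q n f \<equiv> hecke_gen q n (GA f)"

abbreviation hscalar :: "nat \<Rightarrow> nat \<Rightarrow> complex \<Rightarrow> hecke_elt" where
  "hscalar q n c \<equiv> hA q n (lconst c)"

subsection \<open>Levi subalgebras and their centers\<close>

definition levi_gens :: "nat \<Rightarrow> nat list \<Rightarrow> hecke_elt set" where
  "levi_gens q ns =
    (let n = sum_list ns
     in hA q n ` laurent_polys n \<union> hT q n ` {j \<in> {1..<n}. sref j \<in> parabolic ns})"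

definition levi :: "nat \<Rightarrow> nat list \<Rightarrow> hecke_elt ring" where
  "levi q ns =
    (let H = hecke q (sum_list ns) in H\<lparr>carrier := generate_ring H (levi_gens q ns)\<rparr>)"

definition invariants :: "nat list \<Rightarrow> laurent ring" where
  "invariants ns = \<lparr>
     carrier = {f \<in> laurent_polys (sum_list ns). \<forall>w\<in>parabolic ns. lrename w f = f},
     monoid.mult = (*), monoid.one = 1, ring.zero = 0, ring.add = (+)\<rparr>"

definition orbit_ideal :: "nat list \<Rightarrow> (nat \<Rightarrow> complex) \<Rightarrow> laurent set" where
  "orbit_ideal ns t = {f \<in> carrier (invariants ns). \<forall>w\<in>parabolic ns. leval (t \<circ> w) f = 0}"

definition annihilated_by_power ::
    "nat \<Rightarrow> nat list \<Rightarrow> (nat \<Rightarrow> complex) \<Rightarrow> (hecke_elt, 'b) module \<Rightarrow> bool" where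
  "annihilated_by_power q ns t M \<longleftrightarrow>
     (\<exists>N::nat. \<forall>f\<in>orbit_ideal ns t [^]\<^bsub>ideals_set (invariants ns)\<^esub> N.
        \<forall>x\<in>carrier M. hA q (sum_list ns) f \<odot>\<^bsub>M\<^esub> x = \<zero>\<^bsub>M\<^esub>)"

definition finite_dimensional :: "nat \<Rightarrow> nat \<Rightarrow> (hecke_elt, 'b) module \<Rightarrow> bool" where
  "finite_dimensional q n M \<longleftrightarrow>
     (\<exists>B. finite B \<and> B \<subseteq> carrier M \<and>
        (\<forall>x\<in>carrier M. \<exists>c. x = (\<Oplus>\<^bsub>M\<^esub>b\<in>B. hscalar q n (c b) \<odot>\<^bsub>M\<^esub> b)))"

subsection \<open>Sign projectors\<close>

text \<open>By Matsumoto's theorem \<open>T\<^sub>w\<close> does not depend on the choice of the reduced word.\<close>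

definition hTw :: "nat \<Rightarrow> nat \<Rightarrow> (nat \<Rightarrow> nat) \<Rightarrow> hecke_elt" where
  "hTw q n w =
     foldr (\<lambda>j h. hT q n j \<otimes>\<^bsub>hecke q n\<^esub> h) (SOME js. reduced_word n w js) \<one>\<^bsub>hecke q n\<^esub>"

definition sign_projector :: "nat \<Rightarrow> nat \<Rightarrow> hecke_elt" where
  "sign_projector q n =
     hscalar q n (inverse (\<Sum>w | w permutes {1..n}. (1 / of_nat q) ^ perm_length n w))
     \<otimes>\<^bsub>hecke q n\<^esub>
     (\<Oplus>\<^bsub>hecke q n\<^esub>w\<in>{w. w permutes {1..n}}.
        hscalar q n ((- 1 / of_nat q) ^ perm_length n w) \<otimes>\<^bsub>hecke q n\<^esub> hTw q n w)"

subsection \<open>Embeddings between Levi subalgebras\<close>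

text \<open>
  The algebra homomorphism from the Levi subalgebra for \<open>ms\<close> to \<open>\<H>\<^sub>n\<close> with \<open>x\<^sub>j \<mapsto> x\<^bsub>p j\<^esub>\<close> and
  \<open>T\<^sub>j \<mapsto> T\<^bsub>p j\<^esub>\<close>, where \<open>p\<close> translates each block of \<open>ms\<close> to an interval in \<open>{1..n}\<close>, these intervals
  being disjoint. It is determined on the Levi subalgebra by its values on generators, and it exists
  because that subalgebra is the tensor product of the Hecke algebras of its blocks. It is
  \<open>\<complex>\<close>-linear because it fixes the constants in \<open>\<A>\<close>. The algebra \<open>\<H>\<^sub>k\<close> is the Levi subalgebra for
  the composition \<open>[k]\<close>.
\<close>

definition is_levi_embedding ::
    "nat \<Rightarrow> nat list \<Rightarrow> nat \<Rightarrow> (nat \<Rightarrow> nat) \<Rightarrow> (hecke_elt \<Rightarrow> hecke_elt) \<Rightarrow> bool" where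
  "is_levi_embedding q ms n p \<phi> \<longleftrightarrow>
    (let k = sum_list ms
     in \<phi> \<in> ring_hom (levi q ms) (hecke q n) \<and>
        (\<forall>f\<in>laurent_polys k. \<phi> (hA q k f) = hA q n (lrename p f)) \<and>
        (\<forall>j\<in>{1..<k}. sref j \<in> parabolic ms \<longrightarrow> \<phi> (hT q k j) = hT q n (p j)))"

definition levi_embedding ::
    "nat \<Rightarrow> nat list \<Rightarrow> nat \<Rightarrow> (nat \<Rightarrow> nat) \<Rightarrow> hecke_elt \<Rightarrow> hecke_elt" where
  "levi_embedding q ms n p = (SOME \<phi>. is_levi_embedding q ms n p \<phi>)"

text \<open>\<open>h \<mapsto> h \<otimes> 1\<close> and \<open>h \<mapsto> 1 \<otimes> h\<close> for \<open>\<H>\<^bsub>n-i\<^esub> \<otimes> \<H>\<^sub>i \<subseteq> \<H>\<^sub>n\<close>.\<close>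

definition emb_left :: "nat \<Rightarrow> nat \<Rightarrow> nat \<Rightarrow> hecke_elt \<Rightarrow> hecke_elt" where
  "emb_left q n i = levi_embedding q [n - i] n (\<lambda>j. j)"

definition emb_right :: "nat \<Rightarrow> nat \<Rightarrow> nat \<Rightarrow> hecke_elt \<Rightarrow> hecke_elt" where
  "emb_right q n i = levi_embedding q [i] n (\<lambda>j. j + (n - i))"

text \<open>
  Likewise for \<open>\<H>\<^bsub>ns-ks\<^esub> \<otimes> \<H>\<^bsub>ks\<^esub> \<subseteq> \<H>\<^bsub>ns\<^esub>\<close>, the factors being Levi subalgebras of \<open>\<H>\<^bsub>n-i\<^esub>\<close> and \<open>\<H>\<^sub>i\<close>.
  Block \<open>k\<close> of \<open>ns\<close> is cut into its first \<open>ns ! k - ks ! k\<close> positions, which receive block \<open>k\<close> of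
  \<open>ns - ks\<close>, and its last \<open>ks ! k\<close> positions, which receive block \<open>k\<close> of \<open>ks\<close>.
\<close>

definition pos_left :: "nat list \<Rightarrow> nat list \<Rightarrow> nat \<Rightarrow> nat" where
  "pos_left ns ks j =
    (let k = block_index (tuple_diff ns ks) j
     in offset ns k + (j - offset (tuple_diff ns ks) k))"

definition pos_right :: "nat list \<Rightarrow> nat list \<Rightarrow> nat \<Rightarrow> nat" where
  "pos_right ns ks j =
    (let k = block_index ks j
     in offset ns k + (ns ! k - ks ! k) + (j - offset ks k))"

definition emb_left_levi :: "nat \<Rightarrow> nat list \<Rightarrow> nat list \<Rightarrow> hecke_elt \<Rightarrow> hecke_elt" where
  "emb_left_levi q ns ks = levi_embedding q (tuple_diff ns ks) (sum_list ns) (pos_left ns ks)"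

definition emb_right_levi :: "nat \<Rightarrow> nat list \<Rightarrow> nat list \<Rightarrow> hecke_elt \<Rightarrow> hecke_elt" where
  "emb_right_levi q ns ks = levi_embedding q ks (sum_list ns) (pos_right ns ks)"

text \<open>The \<open>k\<close>-th tensor factor of \<open>\<H>\<^bsub>ks\<^esub>\<close>.\<close>

definition emb_factor :: "nat \<Rightarrow> nat list \<Rightarrow> nat \<Rightarrow> hecke_elt \<Rightarrow> hecke_elt" where
  "emb_factor q ks k = levi_embedding q [ks ! k] (sum_list ks) (\<lambda>j. j + offset ks k)"

definition sign_projector_levi :: "nat \<Rightarrow> nat list \<Rightarrow> hecke_elt" where
  "sign_projector_levi q ks =
    (let H = hecke q (sum_list ks)
     in foldr (\<lambda>k h. emb_factor q ks k (sign_projector q (ks ! k)) \<otimes>\<^bsub>H\<^esub> h)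
          [0..<length ks] \<one>\<^bsub>H\<^esub>)"

subsection \<open>Bernstein--Zelevinsky derivatives\<close>

definition BZ :: "nat \<Rightarrow> nat \<Rightarrow> nat \<Rightarrow> (hecke_elt, 'b) module \<Rightarrow> (hecke_elt, 'b) module" where
  "BZ q n i \<pi> = cut_module (emb_right q n i (sign_projector q i)) (emb_left q n i) \<pi>"

definition BZ_levi ::
    "nat \<Rightarrow> nat list \<Rightarrow> nat list \<Rightarrow> (hecke_elt, 'b) module \<Rightarrow> (hecke_elt, 'b) module" where
  "BZ_levi q ns ks \<sigma> =
     cut_module (emb_right_levi q ns ks (sign_projector_levi q ks)) (emb_left_levi q ns ks) \<sigma>"

end

theory Submission
 imports Defs "HOL-Computational_Algebra.Polynomial"
begin

text \<open>
 Entries of \<open>t\<close> in different blocks have different unitary parts, so \<open>x\<^sub>a - x\<^sub>b\<close> and \<open>x\<^sub>a - q x\<^sub>b\<close> act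
 invertibly on \<open>\<sigma>\<close> whenever \<open>a\<close> and \<open>b\<close> lie in different blocks, with inverses given by Laurent
 polynomials. Solving for the intertwiners, the induced module becomes the space of functions from
 the block labellings of \<open>{1..n}\<close> to \<open>\<sigma>\<close>: a Laurent polynomial acts at each labelling through a
 renaming of its variables, and \<open>T\<^sub>j\<close> acts at \<open>l\<close> as a \<open>T\<close> of the Levi subalgebra if \<open>l j = l (j + 1)\<close>
 and as \<open>\<alpha> - (1 + \<alpha>) s\<^sub>j\<close> with \<open>1 + \<alpha>\<close> invertible otherwise. In this model the sign vectors for the
 last \<open>i\<close> positions are the functions that do not change when the labels of these positions are
 permuted and take sign vectors of \<open>\<sigma>\<close> as values. They are determined by their restrictions to
 the labellings with a sorted tail, and the content of the tail is the tuple \<open>\<^bold>i\<close>.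
\<close>


section \<open>Preliminaries: Laurent polynomials under renaming of variables, two-sided
  ideals\<close>

section \<open>Push-forward of finitely supported functions\<close>

text \<open>The quadratic relation fixes only the product of the two off-diagonal coefficients of
  T_j between l and l s_j. Both are taken of the form -(1 + \<alpha>), with \<alpha> = (q - 1) x_a /
  (x_a - x_b), because then (T_j + 1) \<phi> at l is (1 + \<alpha>)(\<phi>(l) - \<phi>(l s_j)).
  Since 1 + \<alpha> = (q x_a - x_b) / (x_a - x_b), the differences x_a - q x_b have to be inverted
  too. The same model is needed for the derivatives of \<sigma>, over fewer variables. An inverse of
  x_a - x_b that involved other variables would be lost there; so each inverse is built as a
  polynomial with constant coefficients in the one difference that it inverts. The embeddings of
  Levi subalgebras are Hilbert choices, so nothing is known about them before a homomorphism with
  the required values is exhibited. This rests on a presentation of each Levi subalgebra by its own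
  generators and relations, hence on the linear independence of the T_w over the Laurent
  polynomials, which the model itself yields when it is built on a character of \<A> at a generic
  point.\<close>

lemma poly_mapping_eq_sum_single:
 "f = (\<Sum>a\<in>Poly_Mapping.keys f. Poly_Mapping.single a (Poly_Mapping.lookup f a))"
 by (rule poly_mapping_eqI)
  (simp add: lookup_sum lookup_single when_def in_keys_iff sum.delta')

lemma poly_mapping_induct_on [consumes 1, case_names zero single add]:
 fixes f :: "'a \<Rightarrow>\<^sub>0 'b::comm_monoid_add"
 assumes "Poly_Mapping.keys f <= S" and "P 0"
  and "!!a c. a \<in> S ==> P (Poly_Mapping.single a c)"
  and "!!f g. P f ==> P g ==> P (f + g)"
 shows "P f"
proof -
 have "P (\<Sum>a\<in>A. Poly_Mapping.single a (Poly_Mapping.lookup f a))" if "finite A" "A <= S" for A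
  using that by (induction A) (auto intro: assms)
 from this[of "Poly_Mapping.keys f"] show ?thesis
  using assms(1) poly_mapping_eq_sum_single[of f] by simp
qed

lemma poly_mapping_induct [case_names single add]:
 fixes f :: "'a \<Rightarrow>\<^sub>0 'b::comm_monoid_add"
 assumes "!!a c. P (Poly_Mapping.single a c)" and "!!f g. P f ==> P g ==> P (f + g)"
 shows "P f"
proof -
 have "P 0" using assms(1)[of undefined 0] by simp
 thus ?thesis by (rule poly_mapping_induct_on[where S = UNIV and P = P, rotated]) (auto intro: assms)
qed

text \<open>Used at three levels: on exponents, on Laurent polynomials (so that
  \<open>lrename\<close> is a push-forward along a push-forward), and on words of a free algebra in
  \<open>subst\<close>.\<close>

definition pm_push :: "('a => 'c) => ('a \<Rightarrow>\<^sub>0 'b::comm_monoid_add) => ('c \<Rightarrow>\<^sub>0 'b)" where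
 "pm_push h f = (\<Sum>a\<in>Poly_Mapping.keys f. Poly_Mapping.single (h a) (Poly_Mapping.lookup f a))"

lemma pm_push_add: "pm_push h (f + g) = pm_push h f + pm_push h g"
 unfolding pm_push_def by (rule setsum_keys_plus_distrib) (simp_all add: single_add)

lemma pm_push_single [simp]: "pm_push h (Poly_Mapping.single a c) = Poly_Mapping.single (h a) c"
 by (cases "c = 0") (simp_all add: pm_push_def)

lemma pm_push_zero [simp]: "pm_push h 0 = 0"
 by (simp add: pm_push_def)

lemma pm_push_uminus: "pm_push h (- f) = - pm_push h (f :: 'a \<Rightarrow>\<^sub>0 'b::ab_group_add)"
 using pm_push_add[of h f "- f"] by (simp add: minus_unique)

lemma pm_push_diff: "pm_push h (f - g) = pm_push h f - pm_push h (g :: 'a \<Rightarrow>\<^sub>0 'b::ab_group_add)"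
 using pm_push_add[of h f "- g"] by (simp add: pm_push_uminus)

lemma pm_push_comp: "pm_push h (pm_push k f) = pm_push (h \<circ> k) f"
 by (induction f rule: poly_mapping_induct) (simp_all add: pm_push_add)

lemma pm_push_mult:
 fixes f g :: "'a::monoid_add \<Rightarrow>\<^sub>0 'b::semiring_0" and h :: "'a => 'c::monoid_add"
 assumes "!!a b. h (a + b) = h a + h b"
 shows "pm_push h (f * g) = pm_push h f * pm_push h g"
proof (induction f rule: poly_mapping_induct)
 case (single a c)
 show ?case
  by (induction g rule: poly_mapping_induct) (simp_all add: pm_push_add mult_single assms distrib_left)
qed (simp add: pm_push_add distrib_right)

lemma pm_push_cong:
 assumes "!!a. a \<in> Poly_Mapping.keys f ==> h a = k a"
 shows "pm_push h f = pm_push k f"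
 unfolding pm_push_def using assms by simp

lemma pm_push_ident: "(!!a. a \<in> Poly_Mapping.keys f ==> h a = a) ==> pm_push h f = f"
 unfolding pm_push_def using poly_mapping_eq_sum_single[of f] by simp

lemma keys_pm_push: "Poly_Mapping.keys (pm_push h f) <= h ` Poly_Mapping.keys f"
proof -
 have "Poly_Mapping.keys (pm_push h f) <=
   (\<Union>a\<in>Poly_Mapping.keys f. Poly_Mapping.keys (Poly_Mapping.single (h a) (Poly_Mapping.lookup f a)))"
  unfolding pm_push_def by (rule keys_sum)
 thus ?thesis by (auto split: if_splits)
qed

section \<open>Laurent polynomials\<close>

abbreviation "\<A> \<equiv> laurent_polys"

lemma lrename_eq: "lrename p = pm_push (pm_push p)"
 by (rule ext) (simp add: lrename_def pm_push_def)

lemma lrename_add: "lrename p (f + g) = lrename p f + lrename p g"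
 by (simp add: lrename_eq pm_push_add)

lemma lrename_mult: "lrename p (f * g) = lrename p f * lrename p g"
 by (simp add: lrename_eq pm_push_mult pm_push_add)

lemma lrename_diff: "lrename p (f - g) = lrename p f - lrename p g"
 by (simp add: lrename_eq pm_push_diff)

lemma lrename_lconst [simp]: "lrename p (lconst c) = lconst c"
 by (simp add: lrename_eq lconst_def)

lemma lrename_lvar [simp]: "lrename p (lvar k) = lvar (p k)"
 by (simp add: lrename_eq lvar_def)

lemma lconst_0 [simp]: "lconst 0 = 0"
 and lconst_1 [simp]: "lconst 1 = 1"
 by (simp_all add: lconst_def)

lemma lconst_add: "lconst (c + d) = lconst c + lconst d"
 and lconst_mult: "lconst (c * d) = lconst c * lconst d"
 and lconst_uminus: "lconst (- c) = - lconst c"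
 and lconst_diff: "lconst (c - d) = lconst c - lconst d"
 by (simp_all add: lconst_def single_add mult_single single_uminus single_diff)

lemma lrename_zero [simp]: "lrename p 0 = 0"
 using lrename_lconst[of p 0] by simp

lemma lrename_one [simp]: "lrename p 1 = 1"
 using lrename_lconst[of p 1] by simp

lemma lrename_comp: "lrename p (lrename r f) = lrename (p \<circ> r) f"
proof -
 have "pm_push p \<circ> pm_push r = (pm_push (p \<circ> r) :: expo => expo)"
  by (rule ext) (simp add: pm_push_comp)
 thus ?thesis by (simp add: lrename_eq pm_push_comp)
qed

lemma lrename_cong:
 assumes "f \<in> \<A> n" and "!!k. k \<in> {1..n} ==> p k = r k"
 shows "lrename p f = lrename r f"
 unfolding lrename_eq
 by (intro pm_push_cong) (use assms in "auto simp: laurent_polys_def subset_iff")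

lemma lrename_ident:
 assumes "f \<in> \<A> n" and "!!k. k \<in> {1..n} ==> p k = k"
 shows "lrename p f = f"
 unfolding lrename_eq
 by (intro pm_push_ident) (use assms in "auto simp: laurent_polys_def subset_iff")

lemma lrename_laurent:
 assumes "f \<in> \<A> n" and "p ` {1..n} <= {1..m}"
 shows "lrename p f \<in> \<A> m"
proof -
 have "Poly_Mapping.keys a <= {1..m}" if "a \<in> Poly_Mapping.keys (lrename p f)" for a
 proof -
  from that keys_pm_push[of "pm_push p" f]
  obtain b where b: "b \<in> Poly_Mapping.keys f" "a = pm_push p b" unfolding lrename_eq by auto
  have "Poly_Mapping.keys b <= {1..n}" using b assms(1) by (simp add: laurent_polys_def)
  hence "p ` Poly_Mapping.keys b <= {1..m}" using assms(2) by (meson image_mono order_trans)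
  with keys_pm_push[of p b] show ?thesis unfolding b(2) by (rule order_trans)
 qed
 thus ?thesis by (simp add: laurent_polys_def)
qed

lemma laurent_add [intro, simp]: "f \<in> \<A> n ==> g \<in> \<A> n ==> f + g \<in> \<A> n"
 using keys_add[of f g] by (auto simp: laurent_polys_def)

lemma laurent_uminus [intro, simp]: "f \<in> \<A> n ==> - f \<in> \<A> n"
 by (auto simp: laurent_polys_def)

lemma laurent_diff [intro, simp]: "f \<in> \<A> n ==> g \<in> \<A> n ==> f - g \<in> \<A> n"
 using laurent_add[of f n "- g"] by auto

lemma laurent_mult [intro, simp]:
 assumes "f \<in> \<A> n" and "g \<in> \<A> n"
 shows "f * g \<in> \<A> n"
proof -
 have "Poly_Mapping.keys c <= {1..n}" if c: "c \<in> Poly_Mapping.keys (f * g)" for c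
 proof -
  from c keys_mult[of f g] obtain a b where "c = a + b" "a \<in> Poly_Mapping.keys f" "b \<in> Poly_Mapping.keys g"
   by blast
  thus ?thesis using assms keys_add[of a b] unfolding laurent_polys_def by blast
 qed
 thus ?thesis by (simp add: laurent_polys_def)
qed

lemma laurent_lconst [intro, simp]: "lconst c \<in> \<A> n"
 by (auto simp: laurent_polys_def lconst_def)

lemma laurent_zero [simp]: "0 \<in> \<A> n"
 and laurent_one [simp]: "1 \<in> \<A> n"
 using laurent_lconst[of 0] laurent_lconst[of 1] by simp_all

lemma laurent_lvar [simp]: "lvar k \<in> \<A> n \<longleftrightarrow> k \<in> {1..n}"
 by (auto simp: laurent_polys_def lvar_def)

lemma laurent_power [intro, simp]: "f \<in> \<A> n ==> f ^ r \<in> \<A> n"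
 by (induction r) auto

lemma laurent_sum: "(!!x. x \<in> A ==> F x \<in> \<A> n) ==> sum F A \<in> \<A> n"
 by (induction A rule: infinite_finite_induct) auto

lemma laurent_prod: "(!!x. x \<in> A ==> F x \<in> \<A> n) ==> prod F A \<in> \<A> n"
 by (induction A rule: infinite_finite_induct) auto

lemma laurent_mono: "f \<in> \<A> k ==> k \<le> n ==> f \<in> \<A> n"
 unfolding laurent_polys_def using atLeastatMost_subset_iff[of 1 k 1 n] by blast

definition lvar_inv :: "nat => laurent" where
 "lvar_inv k = Poly_Mapping.single (Poly_Mapping.single k (- 1)) 1"

lemma lvar_inv_mult [simp]: "lvar k * lvar_inv k = 1"
 by (simp add: lvar_def lvar_inv_def mult_single flip: single_add)

lemma lrename_lvar_inv [simp]: "lrename p (lvar_inv k) = lvar_inv (p k)"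
 by (simp add: lrename_eq lvar_inv_def)

lemma laurent_lvar_inv [simp]: "lvar_inv k \<in> \<A> n \<longleftrightarrow> k \<in> {1..n}"
 by (auto simp: laurent_polys_def lvar_inv_def)

text \<open>The multiplicative steps involve a single variable or its inverse, so that a twisted
  Leibniz rule can be checked one factor at a time.\<close>

lemma laurent_induct [consumes 1, case_names const add var var_inv]:
 assumes "f \<in> \<A> n"
  and const: "!!c. P (lconst c)"
  and add: "!!f g. f \<in> \<A> n ==> g \<in> \<A> n ==> P f ==> P g ==> P (f + g)"
  and var: "!!k f. k \<in> {1..n} ==> f \<in> \<A> n ==> P f ==> P (lvar k * f)"
  and var_inv: "!!k f. k \<in> {1..n} ==> f \<in> \<A> n ==> P f ==> P (lvar_inv k * f)"
 shows "P f"
proof -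
 \<comment> \<open>The exponents whose monomial may be multiplied on without losing \<open>P\<close>
   are closed under addition, so the unit vectors and their negatives decide the matter.\<close>
 define Q where "Q a \<longleftrightarrow> (\<forall>f. f \<in> \<A> n \<and> P f -->
   Poly_Mapping.single a 1 * f \<in> \<A> n \<and> P (Poly_Mapping.single a 1 * f))" for a :: expo
 have Q_add: "Q (a + b)" if "Q a" "Q b" for a b
 proof -
  have e: "Poly_Mapping.single (a + b) (1::complex) =
    Poly_Mapping.single a 1 * Poly_Mapping.single b 1"
   by (simp add: mult_single)
  show ?thesis using that unfolding Q_def e mult.assoc by blast
 qed
 have Q_zero: "Q 0" by (simp add: Q_def)
 have Q_one: "Q (Poly_Mapping.single k 1)" "Q (Poly_Mapping.single k (- 1))" if "k \<in> {1..n}" for k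
  using that var[of k] var_inv[of k] laurent_lvar[of k n] laurent_lvar_inv[of k n]
  unfolding Q_def lvar_def[symmetric] lvar_inv_def[symmetric] by blast+
 have Q_pos: "Q (Poly_Mapping.single k (int m))" and Q_neg: "Q (Poly_Mapping.single k (- int m))"
  if "k \<in> {1..n}" for k m
 proof (induction m)
  case 0
  show "Q (Poly_Mapping.single k (int 0))" "Q (Poly_Mapping.single k (- int 0))"
   using Q_zero by simp_all
 next
  case (Suc m)
  have 1: "Poly_Mapping.single k (int (Suc m)) = Poly_Mapping.single k 1 + Poly_Mapping.single k (int m)"
   and 2: "Poly_Mapping.single k (- int (Suc m)) = Poly_Mapping.single k (- 1) + Poly_Mapping.single k (- int m)"
   by (simp_all flip: single_add)
  show "Q (Poly_Mapping.single k (int (Suc m)))" unfolding 1 by (rule Q_add[OF Q_one(1)[OF that] Suc(1)])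
  show "Q (Poly_Mapping.single k (- int (Suc m)))" unfolding 2 by (rule Q_add[OF Q_one(2)[OF that] Suc(2)])
 qed
 have Q: "Q a" if "Poly_Mapping.keys a <= {1..n}" for a
  using that
 proof (induction a rule: poly_mapping_induct_on)
  case (single k c)
  thus ?case using Q_pos[of k "nat c"] Q_neg[of k "nat (- c)"] by (cases "c \<ge> 0") simp_all
 qed (use Q_add Q_zero in auto)
 have mono: "Poly_Mapping.single a c \<in> \<A> n \<and> P (Poly_Mapping.single a c)"
  if "Poly_Mapping.keys a <= {1..n}" for a and c :: complex
 proof -
  have "Poly_Mapping.single a c = Poly_Mapping.single a 1 * lconst c"
   by (simp add: lconst_def mult_single)
  thus ?thesis using Q[OF that] const[of c] unfolding Q_def by simp
 qed
 have "Poly_Mapping.keys f <= {a. Poly_Mapping.keys a <= {1..n}}"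
  using assms(1) by (auto simp: laurent_polys_def)
 hence "f \<in> \<A> n \<and> P f"
  by (induction f rule: poly_mapping_induct_on) (use const[of 0] mono add in auto)
 thus ?thesis ..
qed

lemma lrename_sref_laurent:
 "1 \<le> j ==> j < n ==> f \<in> \<A> n ==> lrename (sref j) f \<in> \<A> n"
 by (rule lrename_laurent[of _ n]) (auto simp: transpose_def)

text \<open>Twisted Leibniz rule: writing s for the swap, x f - s(x f) = x (f - s f) + (x - s x) s
  f. Hence only single variables and their inverses require a quotient of their own.\<close>

lemma divided_difference:
 assumes "f \<in> \<A> n" and "1 \<le> j" and "j < n"
 shows "\<exists>g\<in>\<A> n. g * (lvar j - lvar (j + 1)) = f - lrename (sref j) f"
 using assms(1)
proof (induction f rule: laurent_induct)
 case (const c)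
 show ?case by (intro bexI[of _ 0]) simp_all
next
 case (add f g)
 then obtain u v where "u \<in> \<A> n" "u * (lvar j - lvar (j + 1)) = f - lrename (sref j) f"
  "v \<in> \<A> n" "v * (lvar j - lvar (j + 1)) = g - lrename (sref j) g" by blast
 thus ?case by (intro bexI[of _ "u + v"]) (simp_all add: lrename_add distrib_right)
next
 case (var k f)
 then obtain u where u: "u \<in> \<A> n" "u * (lvar j - lvar (j + 1)) = f - lrename (sref j) f"
  by blast
 have "\<exists>h\<in>\<A> n. h * (lvar j - lvar (j + 1)) = lvar k - lvar (sref j k)"
  by (rule bexI[of _ "if k = j then 1 else if k = j + 1 then - 1 else 0"]) (auto simp: transpose_def)
 then obtain h where h: "h \<in> \<A> n" "h * (lvar j - lvar (j + 1)) = lvar k - lvar (sref j k)"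
  by blast
 have "(lvar k * u + h * lrename (sref j) f) * (lvar j - lvar (j + 1)) =
   lvar k * (u * (lvar j - lvar (j + 1))) + (h * (lvar j - lvar (j + 1))) * lrename (sref j) f"
  by (simp only: algebra_simps)
 also have "\<dots> = lvar k * f - lrename (sref j) (lvar k * f)"
  unfolding u h by (simp add: lrename_mult algebra_simps)
 finally show ?case
  using u(1) h(1) var assms lrename_sref_laurent[of j n f]
  by (intro bexI[of _ "lvar k * u + h * lrename (sref j) f"]) auto
next
 case (var_inv k f)
 then obtain u where u: "u \<in> \<A> n" "u * (lvar j - lvar (j + 1)) = f - lrename (sref j) f"
  by blast
 have "\<exists>h\<in>\<A> n. h * (lvar j - lvar (j + 1)) = lvar_inv k - lvar_inv (sref j k)"
 \<comment> \<open>The witness comes from 1/x - 1/y = -(x - y) / (x y).\<close>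
 proof (rule bexI[of _ "if k = j then - (lvar_inv j * lvar_inv (j + 1))
   else if k = j + 1 then lvar_inv j * lvar_inv (j + 1) else 0"])
  have *: "lvar_inv j * lvar_inv (j + 1) * (lvar j - lvar (j + 1)) = lvar_inv (j + 1) - lvar_inv j"
  proof -
   have "lvar_inv j * lvar_inv (j + 1) * (lvar j - lvar (j + 1)) =
    (lvar j * lvar_inv j) * lvar_inv (j + 1) - lvar_inv j * (lvar (j + 1) * lvar_inv (j + 1))"
    by (simp only: algebra_simps)
   thus ?thesis by simp
  qed
  show "(if k = j then - (lvar_inv j * lvar_inv (j + 1))
   else if k = j + 1 then lvar_inv j * lvar_inv (j + 1) else 0) * (lvar j - lvar (j + 1)) =
   lvar_inv k - lvar_inv (sref j k)"
   using * by (auto simp: transpose_def)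
 qed (use assms in auto)
 then obtain h where h: "h \<in> \<A> n" "h * (lvar j - lvar (j + 1)) = lvar_inv k - lvar_inv (sref j k)"
  by blast
 have "(lvar_inv k * u + h * lrename (sref j) f) * (lvar j - lvar (j + 1)) =
   lvar_inv k * (u * (lvar j - lvar (j + 1))) + (h * (lvar j - lvar (j + 1))) * lrename (sref j) f"
  by (simp only: algebra_simps)
 also have "\<dots> = lvar_inv k * f - lrename (sref j) (lvar_inv k * f)"
  unfolding u h by (simp add: lrename_mult algebra_simps)
 finally show ?case
  using u(1) h(1) var_inv assms lrename_sref_laurent[of j n f]
  by (intro bexI[of _ "lvar_inv k * u + h * lrename (sref j) f"]) auto
qed

section \<open>Two-sided ideals\<close>

text \<open>The ideal is taken in the whole type, which spares carrier conditions on the cofactors;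
  \<open>genideal_tideal\<close> leads back to the free algebra on a given alphabet. Signs are
  absorbed by the cofactor \<open>u\<close>.\<close>

inductive_set tideal :: "'a::ring_1 set => 'a set" for R where
 zero: "0 \<in> tideal R"
| gen: "r \<in> R ==> u * r * v \<in> tideal R"
| add: "a \<in> tideal R ==> b \<in> tideal R ==> a + b \<in> tideal R"

lemma tideal_incl: "r \<in> R ==> r \<in> tideal R"
 using tideal.gen[of r R 1 1] by simp

lemma tideal_mult_left: "a \<in> tideal R ==> u * a \<in> tideal R"
proof (induction rule: tideal.induct)
 case (gen r v w)
 thus ?case using tideal.gen[of r R "u * v" w] by (simp add: mult.assoc)
qed (auto simp: distrib_left intro: tideal.intros)

lemma tideal_mult_right: "a \<in> tideal R ==> a * u \<in> tideal R"
proof (induction rule: tideal.induct)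
 case (gen r v w)
 thus ?case using tideal.gen[of r R v "w * u"] by (simp add: mult.assoc)
qed (auto simp: distrib_right intro: tideal.intros)

lemma tideal_uminus: "a \<in> tideal R ==> - a \<in> tideal R"
 using tideal_mult_left[of a R "- 1"] by simp

lemma tideal_diff: "a \<in> tideal R ==> b \<in> tideal R ==> a - b \<in> tideal R"
 using tideal.add[of a R "- b"] tideal_uminus by auto

lemma tideal_sum: "(!!x. x \<in> A ==> F x \<in> tideal R) ==> sum F A \<in> tideal R"
 by (induction A rule: infinite_finite_induct) (auto intro: tideal.intros)

lemma tideal_hom:
 assumes "a \<in> tideal R" and "h 0 = 0" and "!!a b. h (a + b) = h a + h b" and "!!a b. h (a * b) = h a * h b"
  and "!!r. r \<in> R ==> h r \<in> tideal S"
 shows "h a \<in> tideal S"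
 using assms(1)
proof induction
 case (gen r u v)
 thus ?case using tideal_mult_left[OF assms(5)] tideal_mult_right assms(4) by metis
qed (auto simp: assms intro: tideal.intros)

lemma tideal_mono: "a \<in> tideal R ==> R <= S ==> a \<in> tideal S"
 by (rule tideal_hom[of a R "\<lambda>a. a"]) (auto intro: tideal_incl)

definition cong_mod :: "'a::ring_1 set => 'a => 'a => bool" where
 "cong_mod R a b \<longleftrightarrow> a - b \<in> tideal R"

lemma cong_mod_refl [simp]: "cong_mod R a a"
 by (simp add: cong_mod_def tideal.zero)

lemma cong_mod_sym: "cong_mod R a b ==> cong_mod R b a"
 unfolding cong_mod_def using tideal_uminus[of "a - b" R] by simp

lemma cong_mod_trans [trans]: "cong_mod R a b ==> cong_mod R b c ==> cong_mod R a c"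
 unfolding cong_mod_def using tideal.add[of "a - b" R "b - c"] by simp

lemma cong_mod_add: "cong_mod R a b ==> cong_mod R c d ==> cong_mod R (a + c) (b + d)"
 unfolding cong_mod_def using tideal.add[of "a - b" R "c - d"] by (simp add: algebra_simps)

lemma cong_mod_mult_left: "cong_mod R a b ==> cong_mod R (u * a) (u * b)"
 unfolding cong_mod_def using tideal_mult_left[of "a - b" R u] by (simp add: algebra_simps)

lemma cong_mod_mult_right: "cong_mod R a b ==> cong_mod R (a * u) (b * u)"
 unfolding cong_mod_def using tideal_mult_right[of "a - b" R u] by (simp add: algebra_simps)

lemma cong_mod_sum: "(!!x. x \<in> A ==> cong_mod R (F x) (G x)) ==> cong_mod R (sum F A) (sum G A)"
 unfolding cong_mod_def using tideal_sum[of A "\<lambda>x. F x - G x" R] by (simp add: sum_subtractf)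

lemma cong_mod_mono: "cong_mod R a b ==> R <= S ==> cong_mod S a b"
 unfolding cong_mod_def by (rule tideal_mono)

section \<open>The Hecke algebra and its Levi subalgebras as quotients of free algebras\<close>

section \<open>Presentations of Hecke algebras\<close>

text \<open>The relations in which no T_j with j outside \<open>J\<close> occurs.
  \<open>J = full n\<close> defines \<H>_n; for \<open>J = lev ns\<close> they will turn out to
  present the Levi subalgebra.\<close>

definition rels :: "nat => nat => nat set => hgen free set" where
 "rels q n J =
   {fgen (GA (lconst c)) - fconst c | c. True}
  \<union> {fgen (GA (f + g)) - (fgen (GA f) + fgen (GA g)) | f g.
    f \<in> \<A> n \<and> g \<in> \<A> n}
  \<union> {fgen (GA (f * g)) - fgen (GA f) * fgen (GA g) | f g.
    f \<in> \<A> n \<and> g \<in> \<A> n}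
  \<union> {fgen (GT j) * fgen (GT (j + 1)) * fgen (GT j)
    - fgen (GT (j + 1)) * fgen (GT j) * fgen (GT (j + 1)) | j.
    j \<in> J \<and> j + 1 \<in> J}
  \<union> {fgen (GT j) * fgen (GT k) - fgen (GT k) * fgen (GT j) | j k.
    j \<in> J \<and> k \<in> J \<and> j + 2 \<le> k}
  \<union> {(fgen (GT j) + 1) * (fgen (GT j) - fconst (of_nat q)) | j. j \<in> J}
  \<union> {fgen (GT j) * fgen (GA f) - fgen (GA (lrename (sref j) f)) * fgen (GT j)
    - fconst (of_nat q - 1) * fgen (GA (lvar j * g)) | j f g.
    j \<in> J \<and> f \<in> \<A> n \<and> g \<in> \<A> n \<and>
    g * (lvar j - lvar (j + 1)) = f - lrename (sref j) f}"

definition full :: "nat => nat set" where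
 "full n = {1..<n}"

lemma in_full [simp]: "j \<in> full n \<longleftrightarrow> 1 \<le> j \<and> j < n"
 by (auto simp: full_def)

lemma hecke_relations_eq: "hecke_relations q n = rels q n (full n)"
proof -
 have "(1 \<le> j \<and> j + 1 < n) = (j \<in> full n \<and> j + 1 \<in> full n)"
  "(1 \<le> j \<and> j + 2 \<le> k \<and> k < n) = (j \<in> full n \<and> k \<in> full n \<and> j + 2 \<le> k)"
  "(1 \<le> j \<and> j < n) = (j \<in> full n)"
  "(1 \<le> j \<and> j < n \<and> P) = (j \<in> full n \<and> P)" for j k P
  by auto
 thus ?thesis unfolding hecke_relations_def rels_def by (simp only:)
qed

lemma rels_mono: "J <= K ==> rels q n J <= rels q n K"
 unfolding rels_def by blast

lemma rels_const: "fgen (GA (lconst c)) - fconst c \<in> rels q n J"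
 and rels_add: "f \<in> \<A> n ==> g \<in> \<A> n ==>
   fgen (GA (f + g)) - (fgen (GA f) + fgen (GA g)) \<in> rels q n J"
 and rels_mult: "f \<in> \<A> n ==> g \<in> \<A> n ==>
   fgen (GA (f * g)) - fgen (GA f) * fgen (GA g) \<in> rels q n J"
 and rels_braid: "j \<in> J ==> j + 1 \<in> J ==>
   fgen (GT j) * fgen (GT (j + 1)) * fgen (GT j)
    - fgen (GT (j + 1)) * fgen (GT j) * fgen (GT (j + 1)) \<in> rels q n J"
 and rels_far: "j \<in> J ==> k \<in> J ==> j + 2 \<le> k ==>
   fgen (GT j) * fgen (GT k) - fgen (GT k) * fgen (GT j) \<in> rels q n J"
 and rels_quad: "j \<in> J ==> (fgen (GT j) + 1) * (fgen (GT j) - fconst (of_nat q)) \<in> rels q n J"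
 and rels_cross: "j \<in> J ==> f \<in> \<A> n ==> g \<in> \<A> n ==>
   g * (lvar j - lvar (j + 1)) = f - lrename (sref j) f ==>
   fgen (GT j) * fgen (GA f) - fgen (GA (lrename (sref j) f)) * fgen (GT j)
    - fconst (of_nat q - 1) * fgen (GA (lvar j * g)) \<in> rels q n J"
 unfolding rels_def by blast+

lemma rels_cases [consumes 1, case_names const add mult braid far quad cross]:
 assumes "r \<in> rels q n J"
  and "!!c. r = fgen (GA (lconst c)) - fconst c ==> P"
  and "!!f g. r = fgen (GA (f + g)) - (fgen (GA f) + fgen (GA g)) ==>
    f \<in> \<A> n ==> g \<in> \<A> n ==> P"
  and "!!f g. r = fgen (GA (f * g)) - fgen (GA f) * fgen (GA g) ==>
    f \<in> \<A> n ==> g \<in> \<A> n ==> P"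
  and "!!j. r = fgen (GT j) * fgen (GT (j + 1)) * fgen (GT j)
    - fgen (GT (j + 1)) * fgen (GT j) * fgen (GT (j + 1)) ==> j \<in> J ==> j + 1 \<in> J ==> P"
  and "!!j k. r = fgen (GT j) * fgen (GT k) - fgen (GT k) * fgen (GT j) ==>
    j \<in> J ==> k \<in> J ==> j + 2 \<le> k ==> P"
  and "!!j. r = (fgen (GT j) + 1) * (fgen (GT j) - fconst (of_nat q)) ==> j \<in> J ==> P"
  and "!!j f g. r = fgen (GT j) * fgen (GA f) - fgen (GA (lrename (sref j) f)) * fgen (GT j)
    - fconst (of_nat q - 1) * fgen (GA (lvar j * g)) ==>
    j \<in> J ==> f \<in> \<A> n ==> g \<in> \<A> n ==>
    g * (lvar j - lvar (j + 1)) = f - lrename (sref j) f ==> P"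
 shows P
 using assms(1) unfolding rels_def
 by (elim UnE CollectE exE conjE) (rule assms(2-), assumption+)+

section \<open>Free algebras\<close>

definition fsupp :: "'g set => 'g free set" where
 "fsupp G = {a. \<forall>w\<in>Poly_Mapping.keys a. set (letters w) <= G}"

lemma carrier_free_algebra [simp]: "carrier (free_algebra G) = fsupp G"
 and free_algebra_simps [simp]: "monoid.mult (free_algebra G) = (*)" "monoid.one (free_algebra G) = 1"
  "ring.zero (free_algebra G) = 0" "ring.add (free_algebra G) = (+)"
 by (simp_all add: free_algebra_def fsupp_def)

lemma letters_plus [simp]: "letters (u + v) = letters u @ letters v"
 and letters_zero [simp]: "letters 0 = []"
 by (simp_all add: plus_word_def zero_word_def)

lemma fsupp_add [intro, simp]: "a \<in> fsupp G ==> b \<in> fsupp G ==> a + b \<in> fsupp G"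
 using keys_add[of a b] by (auto simp: fsupp_def)

lemma fsupp_uminus [intro, simp]: "a \<in> fsupp G ==> - a \<in> fsupp G"
 by (auto simp: fsupp_def)

lemma fsupp_diff [intro, simp]: "a \<in> fsupp G ==> b \<in> fsupp G ==> a - b \<in> fsupp G"
 using fsupp_add[of a G "- b"] by auto

lemma fsupp_mult [intro, simp]:
 assumes "a \<in> fsupp G" and "b \<in> fsupp G" shows "a * b \<in> fsupp G"
proof -
 have "set (letters w) <= G" if w: "w \<in> Poly_Mapping.keys (a * b)" for w
 proof -
  from w keys_mult[of a b] obtain u v where "w = u + v" "u \<in> Poly_Mapping.keys a" "v \<in> Poly_Mapping.keys b"
   by blast
  thus ?thesis using assms unfolding fsupp_def by auto
 qed
 thus ?thesis by (simp add: fsupp_def)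
qed

lemma fsupp_zero [simp]: "0 \<in> fsupp G" and fsupp_one [simp]: "1 \<in> fsupp G"
 and fsupp_fconst [simp]: "fconst c \<in> fsupp G"
 and fsupp_fgen [simp]: "fgen g \<in> fsupp G \<longleftrightarrow> g \<in> G"
 by (simp_all add: fsupp_def fconst_def fgen_def zero_word_def)

lemma fsupp_sum: "(!!x. x \<in> A ==> F x \<in> fsupp G) ==> sum F A \<in> fsupp G"
 by (induction A rule: infinite_finite_induct) auto

lemma fsupp_prod_list: "(!!x. x \<in> set xs ==> F x \<in> fsupp G) ==> prod_list (map F xs) \<in> fsupp G"
 by (induction xs) auto

lemma fsupp_mono: "a \<in> fsupp G ==> G <= K ==> a \<in> fsupp K"
 by (auto simp: fsupp_def)

lemma fsupp_UNIV [simp]: "a \<in> fsupp UNIV"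
 by (simp add: fsupp_def)

lemma fconst_zero [simp]: "fconst 0 = 0" and fconst_one [simp]: "fconst 1 = 1"
 and fconst_add: "fconst (c + d) = fconst c + fconst d"
 and fconst_mult: "fconst (c * d) = fconst c * fconst d"
 and fconst_uminus: "fconst (- c) = - fconst c"
 and fconst_diff: "fconst (c - d) = fconst c - fconst d"
 and fconst_of_nat: "fconst (of_nat m) = of_nat m"
 by (simp_all add: fconst_def single_add mult_single single_uminus single_diff)

lemma fconst_commute: "fconst c * a = a * fconst c"
 by (induction a rule: poly_mapping_induct)
  (simp_all add: fconst_def mult_single mult.commute distrib_left distrib_right)

lemma free_induct [consumes 1, case_names const add gen]:
 assumes "a \<in> fsupp G" and "!!c. P (fconst c)"
  and "!!a b. a \<in> fsupp G ==> b \<in> fsupp G ==> P a ==> P b ==> P (a + b)"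
  and "!!g a. g \<in> G ==> a \<in> fsupp G ==> P a ==> P (fgen g * a)"
 shows "P a"
proof -
 have word: "Poly_Mapping.single (Word ws) c \<in> fsupp G \<and> P (Poly_Mapping.single (Word ws) c)"
  if "set ws <= G" for ws and c :: complex
  using that
 proof (induction ws)
  case Nil
  thus ?case using assms(2)[of c] by (simp add: fsupp_def fconst_def zero_word_def)
 next
  case (Cons g ws)
  have "Poly_Mapping.single (Word (g # ws)) c = fgen g * Poly_Mapping.single (Word ws) c"
   by (simp add: fgen_def mult_single plus_word_def)
  thus ?case using Cons assms(4)[of g "Poly_Mapping.single (Word ws) c"] by simp
 qed
 have "Poly_Mapping.keys a <= {w. set (letters w) <= G}" using assms(1) by (auto simp: fsupp_def)
 hence "a \<in> fsupp G \<and> P a"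
 proof (induction a rule: poly_mapping_induct_on)
  case zero
  thus ?case using assms(2)[of 0] by simp
 next
  case (single w c)
  thus ?case using word[of "letters w" c] by simp
 qed (use assms(3) in auto)
 thus ?thesis ..
qed

lemma ring_free_algebra: "ring (free_algebra G)"
proof (rule ringI)
 show "abelian_group (free_algebra G)"
 proof (rule abelian_groupI)
  fix a assume "a \<in> carrier (free_algebra G)"
  thus "\<exists>b\<in>carrier (free_algebra G). b \<oplus>\<^bsub>free_algebra G\<^esub> a = \<zero>\<^bsub>free_algebra G\<^esub>"
   by (intro bexI[of _ "- a"]) auto
 qed (auto simp: add.assoc add.commute)
 show "Group.monoid (free_algebra G)"
  by (rule monoidI) (auto simp: mult.assoc)
qed (auto simp: distrib_left distrib_right)

lemma a_minus_free_algebra: "a \<in> fsupp G ==> b \<in> fsupp G ==> a \<ominus>\<^bsub>free_algebra G\<^esub> b = a - b"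
proof -
 interpret ring "free_algebra G" by (rule ring_free_algebra)
 assume "a \<in> fsupp G" "b \<in> fsupp G"
 moreover have "\<ominus>\<^bsub>free_algebra G\<^esub> b = - b"
  by (rule minus_equality) (use \<open>b \<in> fsupp G\<close> in auto)
 ultimately show ?thesis by (simp add: a_minus_def)
qed

text \<open>The ring endomorphism that sends the letters outside \<open>G\<close> to 0: a retraction
  onto the free algebra on \<open>G\<close>.\<close>

definition fprune :: "'g set => 'g free => 'g free" where
 "fprune G a = (\<Sum>w\<in>Poly_Mapping.keys a.
   Poly_Mapping.single w (if set (letters w) <= G then Poly_Mapping.lookup a w else 0))"

lemma fprune_add: "fprune G (a + b) = fprune G a + fprune G b"
 unfolding fprune_def by (rule setsum_keys_plus_distrib) (simp_all add: single_add)

lemma fprune_single: "fprune G (Poly_Mapping.single w c) = (if set (letters w) <= G then Poly_Mapping.single w c else 0)"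
 by (cases "c = 0") (simp_all add: fprune_def)

lemma fprune_zero [simp]: "fprune G 0 = 0"
 by (simp add: fprune_def)

lemma fprune_mult: "fprune G (a * b) = fprune G a * fprune G b"
proof (induction a rule: poly_mapping_induct)
 case (single w c)
 show ?case
  by (induction b rule: poly_mapping_induct)
   (simp_all add: fprune_add fprune_single mult_single distrib_left)
qed (simp add: fprune_add distrib_right)

lemma fprune_supp [simp]: "fprune G a \<in> fsupp G"
 by (induction a rule: poly_mapping_induct) (simp_all add: fprune_add fprune_single, simp add: fsupp_def)

lemma fprune_ident: "a \<in> fsupp G ==> fprune G a = a"
 unfolding fprune_def fsupp_def
 by (subst (4) poly_mapping_eq_sum_single) (auto intro!: sum.cong)

lemma fprune_one [simp]: "fprune G 1 = 1"
 by (rule fprune_ident) simp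

section \<open>The affine Hecke algebra as a quotient\<close>

definition gens :: "nat => nat set => hgen set" where
 "gens n J = GT ` J \<union> GA ` \<A> n"

lemma hecke_gens_eq: "hecke_gens n = gens n (full n)"
 by (simp add: hecke_gens_def gens_def full_def)

lemma GT_in_gens [simp]: "GT j \<in> gens n J \<longleftrightarrow> j \<in> J"
 and GA_in_gens [simp]: "GA f \<in> gens n J \<longleftrightarrow> f \<in> \<A> n"
 by (auto simp: gens_def)

lemma gens_mono: "J <= K ==> gens n J <= gens n K"
 by (auto simp: gens_def)

lemma rels_fsupp: "J <= full n ==> rels q n J <= fsupp (gens n J)"
proof
 fix r assume J: "J <= full n" and "r \<in> rels q n J"
 from this(2) show "r \<in> fsupp (gens n J)"
 proof (cases rule: rels_cases)
  case (cross j f g)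
  hence "lrename (sref j) f \<in> \<A> n" using J by (intro lrename_sref_laurent) auto
  moreover have "j \<in> {1..n}" using J cross by auto
  ultimately show ?thesis unfolding cross(1) using cross J by auto
 qed auto
qed

lemma ideal_tideal:
 assumes "R <= fsupp G"
 shows "ideal (tideal R \<inter> fsupp G) (free_algebra G)"
proof (rule idealI[OF ring_free_algebra])
 show "subgroup (tideal R \<inter> fsupp G) (add_monoid (free_algebra G))"
 proof (rule subgroup.intro)
  fix x assume x: "x \<in> tideal R \<inter> fsupp G"
  interpret ring "free_algebra G" by (rule ring_free_algebra)
  have "inv\<^bsub>add_monoid (free_algebra G)\<^esub> x = - x"
   using minus_equality[of "- x" x] x by (simp add: a_inv_def)
  thus "inv\<^bsub>add_monoid (free_algebra G)\<^esub> x \<in> tideal R \<inter> fsupp G"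
   using x tideal_uminus by auto
 qed (auto intro: tideal.intros)
qed (auto intro: tideal_mult_left tideal_mult_right)

text \<open>The cofactors of an element of \<open>tideal R\<close> may contain foreign letters.
  Pruning removes these and fixes the relations, which brings the element into the ideal of the
  smaller algebra.\<close>

lemma genideal_tideal:
 assumes R: "R <= fsupp G"
 shows "genideal (free_algebra G) R = tideal R \<inter> fsupp G"
proof
 interpret ring "free_algebra G" by (rule ring_free_algebra)
 show "genideal (free_algebra G) R <= tideal R \<inter> fsupp G"
  by (rule genideal_minimal[OF ideal_tideal[OF R]]) (use R in "auto intro: tideal_incl")
 interpret I: ideal "genideal (free_algebra G) R" "free_algebra G"
  by (rule genideal_ideal) (use R in simp)
 have "fprune G a \<in> genideal (free_algebra G) R" if "a \<in> tideal R" for a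
  using that
 proof induction
  case zero
  thus ?case using I.zero_closed by simp
 next
  case (gen r u v)
  hence "r \<in> genideal (free_algebra G) R" "fprune G r = r"
   using genideal_self R by (auto intro: fprune_ident)
  thus ?case
   using I.I_l_closed[of r "fprune G u"] I.I_r_closed[of "fprune G u * r" "fprune G v"]
   by (simp add: fprune_mult)
 next
  case (add a b)
  thus ?case using I.a_closed by (simp add: fprune_add)
 qed
 thus "tideal R \<inter> fsupp G <= genideal (free_algebra G) R"
  using fprune_ident by fastforce
qed

lemma hecke_ideal_eq: "hecke_ideal q n = tideal (rels q n (full n)) \<inter> fsupp (gens n (full n))"
 unfolding hecke_ideal_def hecke_relations_eq hecke_gens_eq
 by (rule genideal_tideal) (rule rels_fsupp, simp)

definition hcls :: "nat => nat => hgen free => hecke_elt" where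
 "hcls q n a = hecke_ideal q n +>\<^bsub>free_algebra (hecke_gens n)\<^esub> a"

abbreviation hfree :: "nat => hgen free set" where
 "hfree n \<equiv> fsupp (gens n (full n))"

lemma ideal_hecke: "ideal (hecke_ideal q n) (free_algebra (hecke_gens n))"
 unfolding hecke_ideal_eq hecke_gens_eq by (rule ideal_tideal) (rule rels_fsupp, simp)

lemma ring_hecke: "ring (hecke q n)"
 unfolding hecke_def by (rule ideal.quotient_is_ring[OF ideal_hecke])

lemma hcls_hom: "hcls q n \<in> ring_hom (free_algebra (hecke_gens n)) (hecke q n)"
 unfolding hcls_def hecke_def by (rule ideal.rcos_ring_hom[OF ideal_hecke])

lemma hcls_closed [simp]: "a \<in> hfree n ==> hcls q n a \<in> carrier (hecke q n)"
 using ring_hom_closed[OF hcls_hom] by (simp add: hecke_gens_eq)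

lemma hcls_add: "a \<in> hfree n ==> b \<in> hfree n ==> hcls q n (a + b) = hcls q n a \<oplus>\<^bsub>hecke q n\<^esub> hcls q n b"
 using ring_hom_add[OF hcls_hom[of q n], of a b] by (simp add: hecke_gens_eq)

lemma hcls_mult: "a \<in> hfree n ==> b \<in> hfree n ==> hcls q n (a * b) = hcls q n a \<otimes>\<^bsub>hecke q n\<^esub> hcls q n b"
 using ring_hom_mult[OF hcls_hom[of q n], of a b] by (simp add: hecke_gens_eq)

lemma hcls_one: "hcls q n 1 = \<one>\<^bsub>hecke q n\<^esub>"
 using ring_hom_one[OF hcls_hom[of q n]] by simp

lemma hcls_zero: "hcls q n 0 = \<zero>\<^bsub>hecke q n\<^esub>"
 using ring_hom_zero[OF hcls_hom[of q n] ring_free_algebra ring_hecke] by simp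

lemma hcls_surj: "h \<in> carrier (hecke q n) ==> \<exists>a\<in>hfree n. h = hcls q n a"
 unfolding hecke_def FactRing_def A_RCOSETS_def'
 by (auto simp: hcls_def hecke_gens_eq)

lemma hcls_eq_iff:
 assumes "a \<in> hfree n" and "b \<in> hfree n"
 shows "hcls q n a = hcls q n b \<longleftrightarrow> cong_mod (rels q n (full n)) a b"
proof -
 interpret ring "free_algebra (hecke_gens n)" by (rule ring_free_algebra)
 have "hcls q n a = hcls q n b \<longleftrightarrow> a - b \<in> hecke_ideal q n"
  using quotient_eq_iff_same_a_r_cos[OF ideal_hecke[of q n], of a b] assms
  by (simp add: hcls_def hecke_gens_eq a_minus_free_algebra)
 also have "\<dots> \<longleftrightarrow> cong_mod (rels q n (full n)) a b"
  using assms by (auto simp: hecke_ideal_eq cong_mod_def)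
 finally show ?thesis .
qed

lemma hecke_gen_eq: "hecke_gen q n g = hcls q n (fgen g)"
 by (simp add: hecke_gen_def hcls_def)

lemma hcls_uminus: "a \<in> hfree n ==> hcls q n (- a) = \<ominus>\<^bsub>hecke q n\<^esub> hcls q n a"
proof -
 interpret ring "hecke q n" by (rule ring_hecke)
 assume a: "a \<in> hfree n"
 hence "hcls q n (- a) \<oplus>\<^bsub>hecke q n\<^esub> hcls q n a = \<zero>\<^bsub>hecke q n\<^esub>"
  using hcls_add[of "- a" n a q] by (simp add: hcls_zero)
 thus ?thesis using a minus_equality by simp
qed

lemma hcls_sum: "finite A ==> (!!x. x \<in> A ==> F x \<in> hfree n) ==>
 hcls q n (sum F A) = (\<Oplus>\<^bsub>hecke q n\<^esub>x\<in>A. hcls q n (F x))"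
proof (induction A rule: finite_induct)
 interpret ring "hecke q n" by (rule ring_hecke)
 case empty
 thus ?case by (simp add: hcls_zero)
next
 interpret ring "hecke q n" by (rule ring_hecke)
 case (insert x A)
 thus ?case using hcls_add[of "F x" n "sum F A" q] fsupp_sum[of A F]
  by (simp add: finsum_insert Pi_def)
qed

section \<open>Levi subalgebras\<close>

definition lev :: "nat list => nat set" where
 "lev ns = {j \<in> full (sum_list ns). sref j \<in> parabolic ns}"

lemma lev_subset: "lev ns <= full (sum_list ns)"
 by (auto simp: lev_def)

lemma fsupp_lev_hfree: "a \<in> fsupp (gens (sum_list ns) (lev ns)) ==> a \<in> hfree (sum_list ns)"
 by (rule fsupp_mono[OF _ gens_mono[OF lev_subset]])

lemma levi_gens_eq: "levi_gens q ns = (\<lambda>g. hcls q (sum_list ns) (fgen g)) ` gens (sum_list ns) (lev ns)"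
 unfolding levi_gens_def gens_def lev_def hecke_gen_eq full_def by (auto simp: Let_def image_Un image_image)

lemma carrier_levi: "carrier (levi q ns) = hcls q (sum_list ns) ` fsupp (gens (sum_list ns) (lev ns))"
proof -
 define n where "n = sum_list ns"
 define G where "G = gens n (lev ns)"
 interpret ring "hecke q n" by (rule ring_hecke)
 have sub: "a \<in> hfree n" if "a \<in> fsupp G" for a
  using that fsupp_lev_hfree unfolding G_def n_def by blast
 have "generate_ring (hecke q n) ((\<lambda>g. hcls q n (fgen g)) ` G) = hcls q n ` fsupp G" (is "?L = ?R")
 proof
  show "?L <= ?R"
  proof
   fix h assume "h \<in> ?L"
   thus "h \<in> ?R"
   proof induction
    case one
    thus ?case by (metis fsupp_one hcls_one image_eqI)
   next
    case (incl h)
    thus ?case by auto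
   next
    case (a_inv h)
    thus ?case using hcls_uminus sub by (auto simp flip: hcls_uminus)
   next
    case (eng_add h1 h2)
    thus ?case by (auto simp: sub simp flip: hcls_add)
   next
    case (eng_mult h1 h2)
    thus ?case by (auto simp: sub simp flip: hcls_mult)
   qed
  qed
  have "hcls q n a \<in> ?L" if "a \<in> fsupp G" for a
   using that
  proof (induction a rule: free_induct)
   case (const c)
   \<comment> \<open>\<open>generate_ring\<close> closes under ring operations only; the scalars
     enter as constant Laurent polynomials.\<close>
   have "hcls q n (fconst c) = hcls q n (fgen (GA (lconst c)))"
    by (subst hcls_eq_iff) (auto intro!: cong_mod_sym[of _ "fgen (GA (lconst c))"] tideal_incl rels_const
      simp: cong_mod_def[of _ "fgen (GA (lconst c))"])
   moreover have "GA (lconst c) \<in> G" by (simp add: G_def)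
   ultimately show ?case by (auto intro: generate_ring.incl)
  next
   case (add a b)
   thus ?case using sub by (auto simp: hcls_add intro: generate_ring.eng_add)
  next
   case (gen g a)
   hence "hcls q n (fgen g * a) = hcls q n (fgen g) \<otimes>\<^bsub>hecke q n\<^esub> hcls q n a"
    by (intro hcls_mult sub) auto
   moreover have "hcls q n (fgen g) \<in> generate_ring (hecke q n) ((\<lambda>g. hcls q n (fgen g)) ` G)"
    using gen by (auto intro: generate_ring.incl)
   ultimately show ?case using gen by (auto intro: generate_ring.eng_mult)
  qed
  thus "?R <= ?L" by auto
 qed
 thus ?thesis by (simp add: levi_def levi_gens_eq n_def G_def)
qed

lemma levi_simps [simp]:
 "monoid.mult (levi q ns) = monoid.mult (hecke q (sum_list ns))"
 "monoid.one (levi q ns) = monoid.one (hecke q (sum_list ns))"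
 "ring.zero (levi q ns) = ring.zero (hecke q (sum_list ns))"
 "ring.add (levi q ns) = ring.add (hecke q (sum_list ns))"
 by (simp_all add: levi_def Let_def)

lemma ring_levi: "ring (levi q ns)"
proof -
 interpret ring "hecke q (sum_list ns)" by (rule ring_hecke)
 have "levi_gens q ns <= carrier (hecke q (sum_list ns))"
  unfolding levi_gens_eq using gens_mono[OF lev_subset, of "sum_list ns" ns] by auto
 from generate_ring_is_ring[OF this] show ?thesis by (simp add: levi_def Let_def)
qed

lemma levi_subset_hecke: "carrier (levi q ns) <= carrier (hecke q (sum_list ns))"
 unfolding carrier_levi using fsupp_lev_hfree by auto

lemma lev_singleton: "lev [k] = full k"
proof -
 have "sref j permutes {1..k}" if "j \<in> full k" for j
  by (rule permutes_swap_id) (use that in auto)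
 thus ?thesis
  using permutes_image by (fastforce simp: lev_def parabolic_def block_def offset_def)
qed

lemma carrier_levi_singleton: "carrier (levi q [k]) = carrier (hecke q k)"
proof
 show "carrier (levi q [k]) <= carrier (hecke q k)"
  using levi_subset_hecke[of q "[k]"] by simp
 show "carrier (hecke q k) <= carrier (levi q [k])"
  using hcls_surj[of _ q k] by (fastforce simp: carrier_levi lev_singleton)
qed

section \<open>Modules as actions of a free algebra that kill relations\<close>

section \<open>Actions of the free algebra on abelian groups\<close>

text \<open>All letters act, also those outside the alphabet of the algebra in question, so that
  computations need no carrier condition on the acting element. Modules over the quotient correspond
  to actions with \<open>kills\<close>.\<close>

locale free_action = abelian_group M for M :: "('s, 'b) module" (structure) +
 fixes act :: "hgen free => 'b => 'b"
 assumes act_closed [simp, intro]: "x \<in> carrier M ==> act a x \<in> carrier M"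
  and act_add: "x \<in> carrier M ==> act (a + b) x = act a x \<oplus> act b x"
  and act_radd: "x \<in> carrier M ==> y \<in> carrier M ==> act a (x \<oplus> y) = act a x \<oplus> act a y"
  and act_mult: "x \<in> carrier M ==> act (a * b) x = act a (act b x)"
  and act_one [simp]: "x \<in> carrier M ==> act 1 x = x"
begin

lemma act_zero [simp]: "x \<in> carrier M ==> act 0 x = \<zero>"
 using act_add[of x 0 0] by simp

lemma act_rzero [simp]: "act a \<zero> = \<zero>"
 using act_radd[of \<zero> \<zero> a] by simp

lemma act_uminus: "x \<in> carrier M ==> act (- a) x = \<ominus> act a x"
 using act_add[of x "- a" a] by (simp add: minus_equality)

lemma act_diff: "x \<in> carrier M ==> act (a - b) x = act a x \<ominus> act b x"
 using act_add[of x a "- b"] by (simp add: act_uminus a_minus_def)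

lemma act_rminus: "x \<in> carrier M ==> act a (\<ominus> x) = \<ominus> act a x"
 using act_radd[of "\<ominus> x" x a] by (simp add: l_neg minus_equality)

lemma act_sum: "finite A ==> x \<in> carrier M ==> act (sum F A) x = (\<Oplus>y\<in>A. act (F y) x)"
 by (induction A rule: finite_induct) (simp_all add: act_add finsum_insert Pi_def)

lemma act_rsum: "finite A ==> (!!y. y \<in> A ==> F y \<in> carrier M) ==>
  act a (\<Oplus>y\<in>A. F y) = (\<Oplus>y\<in>A. act a (F y))"
 by (induction A rule: finite_induct) (simp_all add: act_radd finsum_insert Pi_def)

definition kills :: "hgen free set => bool" where
 "kills R \<longleftrightarrow> (\<forall>r\<in>R. \<forall>x\<in>carrier M. act r x = \<zero>)"

lemma kills_tideal: "a \<in> tideal R ==> kills R ==> x \<in> carrier M ==> act a x = \<zero>"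
 by (induction a arbitrary: x rule: tideal.induct) (auto simp: kills_def act_add act_mult)

lemma act_cong: "kills R ==> cong_mod R a b ==> x \<in> carrier M ==> act a x = act b x"
 using kills_tideal[of "a - b" R x] act_add[of x "a - b" b]
 by (simp add: cong_mod_def)

lemma kills_mono: "kills R ==> S <= R ==> kills S"
 by (auto simp: kills_def)

end

text \<open>Equivariance is checked on letters. A constant is not a letter, but modulo the relations
  it equals the letter \<open>Ag (lconst c)\<close>; for this the relations are assumed to be killed
  on both sides.\<close>

lemma free_action_equivariant:
 fixes M :: "('s, 'b) module" and N :: "('t, 'c) module"
 assumes "free_action M act" and "free_action N act'"
  and "free_action.kills M act (rels q n J)" and "free_action.kills N act' (rels q n J)"
  and closed: "!!x. x \<in> carrier M ==> \<phi> x \<in> carrier N"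
  and add: "!!x y. x \<in> carrier M ==> y \<in> carrier M ==> \<phi> (x \<oplus>\<^bsub>M\<^esub> y) = \<phi> x \<oplus>\<^bsub>N\<^esub> \<phi> y"
  and gen: "!!g x. g \<in> gens n J ==> x \<in> carrier M ==> \<phi> (act (fgen g) x) = act' (fgen g) (\<phi> x)"
  and a: "a \<in> fsupp (gens n J)" and x: "x \<in> carrier M"
 shows "\<phi> (act a x) = act' a (\<phi> x)"
proof -
 interpret M: free_action M act by fact
 interpret N: free_action N act' by fact
 have cn: "cong_mod (rels q n J) (fconst c) (fgen (GA (lconst c)))" for c
  by (rule cong_mod_sym) (simp add: cong_mod_def tideal_incl rels_const)
 show ?thesis using a
 proof (induction a rule: free_induct)
  case (const c)
  show ?case
   using M.act_cong[OF assms(3) cn x] N.act_cong[OF assms(4) cn closed[OF x]] gen[OF _ x] by simp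
 next
  case (add a b)
  thus ?case using x closed by (simp add: M.act_add N.act_add assms(6))
 next
  case (gen g a)
  thus ?case using x closed assms(7) by (simp add: M.act_mult N.act_mult)
 qed
qed

section \<open>Actions from operators attached to the letters\<close>

text \<open>The universal property of the free algebra: additive operators attached to the letters
  and commuting with the scalars extend to an action, \<open>letter_act\<close>.\<close>

locale letter_operators = abelian_group M for M :: "('s, 'b) module" (structure) +
 fixes sc :: "complex => 'b => 'b" and op :: "hgen => 'b => 'b"
 assumes sc_closed [simp]: "x \<in> carrier M ==> sc c x \<in> carrier M"
  and sc_add: "x \<in> carrier M ==> sc (c + d) x = sc c x \<oplus> sc d x"
  and sc_radd: "x \<in> carrier M ==> y \<in> carrier M ==> sc c (x \<oplus> y) = sc c x \<oplus> sc c y"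
  and sc_mult: "x \<in> carrier M ==> sc (c * d) x = sc c (sc d x)"
  and sc_one: "x \<in> carrier M ==> sc 1 x = x"
  and op_closed [simp]: "x \<in> carrier M ==> op g x \<in> carrier M"
  and op_radd: "x \<in> carrier M ==> y \<in> carrier M ==> op g (x \<oplus> y) = op g x \<oplus> op g y"
  and op_sc: "x \<in> carrier M ==> op g (sc c x) = sc c (op g x)"
begin

definition letter_act :: "hgen free => 'b => 'b" where
 "letter_act a x = (\<Oplus>w\<in>Poly_Mapping.keys a. sc (Poly_Mapping.lookup a w) (foldr op (letters w) x))"

lemma foldr_op_closed [simp]: "x \<in> carrier M ==> foldr op ws x \<in> carrier M"
 by (induction ws) simp_all

lemma foldr_op_radd: "x \<in> carrier M ==> y \<in> carrier M ==> foldr op ws (x \<oplus> y) = foldr op ws x \<oplus> foldr op ws y"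
 by (induction ws) (simp_all add: op_radd)

lemma foldr_op_sc: "x \<in> carrier M ==> foldr op ws (sc c x) = sc c (foldr op ws x)"
 by (induction ws) (simp_all add: op_sc)

lemma sc_zero: "x \<in> carrier M ==> sc 0 x = \<zero>"
 using sc_add[of x 0 0] by simp

lemma letter_act_superset:
 assumes "finite S" and "Poly_Mapping.keys a <= S" and "x \<in> carrier M"
 shows "letter_act a x = (\<Oplus>w\<in>S. sc (Poly_Mapping.lookup a w) (foldr op (letters w) x))"
 unfolding letter_act_def
 by (rule add.finprod_mono_neutral_cong_left) (use assms in "auto simp: in_keys_iff sc_zero Pi_def")

lemma letter_act_closed [simp]: "x \<in> carrier M ==> letter_act a x \<in> carrier M"
 unfolding letter_act_def by (rule finsum_closed) simp

lemma letter_act_add: 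
 assumes "x \<in> carrier M" shows "letter_act (a + b) x = letter_act a x \<oplus> letter_act b x"
proof -
 let ?S = "Poly_Mapping.keys a \<union> Poly_Mapping.keys b"
 have "letter_act (a + b) x = (\<Oplus>w\<in>?S. sc (Poly_Mapping.lookup (a + b) w) (foldr op (letters w) x))"
  by (rule letter_act_superset) (use assms keys_add[of a b] in auto)
 also have "\<dots> = (\<Oplus>w\<in>?S. sc (Poly_Mapping.lookup a w) (foldr op (letters w) x) \<oplus>
   sc (Poly_Mapping.lookup b w) (foldr op (letters w) x))"
  using assms by (intro finsum_cong') (auto simp: lookup_add sc_add)
 also have "\<dots> = letter_act a x \<oplus> letter_act b x"
  using assms by (subst finsum_addf) (auto simp: letter_act_superset[of ?S])
 finally show ?thesis .
qed

lemma letter_act_single: "x \<in> carrier M ==>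
  letter_act (Poly_Mapping.single w c) x = sc c (foldr op (letters w) x)"
 using letter_act_superset[of "{w}" "Poly_Mapping.single w c" x] by (auto simp: finsum_insert)

lemma letter_act_radd: "x \<in> carrier M ==> y \<in> carrier M ==>
  letter_act a (x \<oplus> y) = letter_act a x \<oplus> letter_act a y"
 unfolding letter_act_def
 by (subst finsum_addf[symmetric]) (auto simp: foldr_op_radd sc_radd intro!: finsum_cong')

lemma letter_act_mult: "x \<in> carrier M ==> letter_act (a * b) x = letter_act a (letter_act b x)"
proof (induction a rule: poly_mapping_induct)
 case (single v c)
 thus ?case
 proof (induction b rule: poly_mapping_induct)
  case (single w d)
  thus ?case by (simp add: mult_single letter_act_single foldr_op_sc sc_mult)
 next
  case (add f g)
  thus ?case by (simp add: distrib_left letter_act_add letter_act_radd)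
 qed
qed (simp add: distrib_right letter_act_add)

lemma free_action_letter_act: "free_action M letter_act"
proof unfold_locales
 fix x assume "x \<in> carrier M"
 thus "letter_act 1 x = x"
  using letter_act_single[of x 0 1] by (simp add: sc_one)
qed (simp_all add: letter_act_add letter_act_radd letter_act_mult)

lemma letter_act_fgen [simp]: "x \<in> carrier M ==> letter_act (fgen g) x = op g x"
 by (simp add: fgen_def letter_act_single sc_one)

lemma letter_act_fconst [simp]: "x \<in> carrier M ==> letter_act (fconst c) x = sc c x"
 by (simp add: fconst_def letter_act_single)

end

section \<open>Modules over Hecke algebras as actions of free algebras\<close>

lemma (in left_module) smult_zero:
 assumes "x \<in> carrier M" shows "\<zero>\<^bsub>R\<^esub> \<odot>\<^bsub>M\<^esub> x = \<zero>\<^bsub>M\<^esub>"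
 using smult_l_distr[of "\<zero>\<^bsub>R\<^esub>" "\<zero>\<^bsub>R\<^esub>" x] smult_closed[of "\<zero>\<^bsub>R\<^esub>" x] assms
 by simp

lemma (in left_module) smult_rzero:
 assumes "a \<in> carrier R" shows "a \<odot>\<^bsub>M\<^esub> \<zero>\<^bsub>M\<^esub> = \<zero>\<^bsub>M\<^esub>"
 using smult_r_distr[of a "\<zero>\<^bsub>M\<^esub>" "\<zero>\<^bsub>M\<^esub>"] smult_closed[of a "\<zero>\<^bsub>M\<^esub>"] assms
 by simp

lemma (in left_module) smult_rminus:
 assumes "a \<in> carrier R" and "x \<in> carrier M" shows "a \<odot>\<^bsub>M\<^esub> (\<ominus>\<^bsub>M\<^esub> x) = \<ominus>\<^bsub>M\<^esub> (a \<odot>\<^bsub>M\<^esub> x)"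
 using smult_r_distr[of a "\<ominus>\<^bsub>M\<^esub> x" x] smult_closed assms
 by (simp add: M.l_neg smult_rzero M.minus_equality)

text \<open>Words with a letter outside \<open>gens n J\<close> act by zero. This makes the action
  total, and it stays multiplicative because \<open>fprune\<close> is.\<close>

definition mact :: "nat => nat => nat set => (hecke_elt, 'b) module => hgen free => 'b => 'b" where
 "mact q n J M a x = hcls q n (fprune (gens n J) a) \<odot>\<^bsub>M\<^esub> x"

lemma mact_eq: "a \<in> fsupp (gens n J) ==> mact q n J M a x = hcls q n a \<odot>\<^bsub>M\<^esub> x"
 by (simp add: mact_def fprune_ident)

text \<open>\<open>R\<close> is given by its operations alone so that \<H>_n and its Levi
  subalgebras, which share them, are treated at once.\<close>

lemma free_action_mact_aux:
 assumes "left_module R M" and J: "J <= full n"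
  and R: "hcls q n ` fsupp (gens n J) <= carrier R" "monoid.mult R = monoid.mult (hecke q n)"
   "monoid.one R = \<one>\<^bsub>hecke q n\<^esub>" "ring.zero R = \<zero>\<^bsub>hecke q n\<^esub>" "ring.add R = ring.add (hecke q n)"
 shows "free_action M (mact q n J M) \<and> free_action.kills M (mact q n J M) (rels q n J)"
proof -
 interpret left_module R M by fact
 have sub: "a \<in> fsupp (gens n J) ==> a \<in> hfree n" for a
  by (rule fsupp_mono[OF _ gens_mono[OF J]])
 have cl: "hcls q n (fprune (gens n J) a) \<in> carrier R" for a
  using R(1) by auto
 have fa: "free_action M (mact q n J M)"
 proof unfold_locales
  fix x y a b assume x: "x \<in> carrier M"
  show "mact q n J M a x \<in> carrier M" unfolding mact_def by (rule smult_closed[OF cl x])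
  show "mact q n J M (a + b) x = mact q n J M a x \<oplus>\<^bsub>M\<^esub> mact q n J M b x"
   using smult_l_distr[OF cl[of a] cl[of b] x] unfolding mact_def fprune_add
   by (subst hcls_add) (simp_all add: sub R)
  show "mact q n J M (a * b) x = mact q n J M a (mact q n J M b x)"
   using smult_assoc1[OF cl[of a] cl[of b] x] unfolding mact_def fprune_mult
   by (subst hcls_mult) (simp_all add: sub R)
  show "mact q n J M 1 x = x"
   using smult_one[OF x] by (simp add: mact_def hcls_one R)
  assume y: "y \<in> carrier M"
  show "mact q n J M a (x \<oplus>\<^bsub>M\<^esub> y) = mact q n J M a x \<oplus>\<^bsub>M\<^esub> mact q n J M a y"
   unfolding mact_def by (rule smult_r_distr[OF cl x y])
 qed
 have "mact q n J M r x = \<zero>\<^bsub>M\<^esub>" if r: "r \<in> rels q n J" and x: "x \<in> carrier M" for r x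
 proof -
  have rs: "r \<in> fsupp (gens n J)" using rels_fsupp[OF J] r by blast
  have "cong_mod (rels q n (full n)) r 0"
   using tideal_incl[of r "rels q n (full n)"] rels_mono[OF J] r by (auto simp: cong_mod_def)
  hence "hcls q n r = hcls q n 0" using hcls_eq_iff[of r n 0 q] sub[OF rs] by simp
  thus ?thesis using rs x by (simp add: mact_eq hcls_zero R(4)[symmetric] smult_zero)
 qed
 thus ?thesis using fa by (simp add: free_action.kills_def)
qed

lemma
 assumes "left_module (hecke q n) M"
 shows free_action_hecke: "free_action M (mact q n (full n) M)"
  and kills_hecke: "free_action.kills M (mact q n (full n) M) (rels q n (full n))"
 using free_action_mact_aux[OF assms, of "full n" n q] by (auto simp: image_subset_iff)

lemma
 assumes "left_module (levi q ns) M"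
 shows free_action_levi: "free_action M (mact q (sum_list ns) (lev ns) M)"
  and kills_levi: "free_action.kills M (mact q (sum_list ns) (lev ns) M) (rels q (sum_list ns) (lev ns))"
 using free_action_mact_aux[OF assms, of "lev ns" "sum_list ns" q] lev_subset
 by (auto simp: carrier_levi)

text \<open>The choice of a representative is harmless once \<open>act\<close> kills the relations;
  see \<open>act_module_smult\<close>.\<close>

definition act_module :: "nat => nat => ('s, 'b) module => (hgen free => 'b => 'b) => (hecke_elt, 'b) module" where
 "act_module q n M act = \<lparr>carrier = carrier M,
   monoid.mult = (\<lambda>_ _. undefined), monoid.one = undefined,
   ring.zero = \<zero>\<^bsub>M\<^esub>, ring.add = add M,
   module.smult = (\<lambda>h x. act (SOME a. a \<in> hfree n \<and> hcls q n a = h) x)\<rparr>"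

lemma act_module_simps [simp]:
 "carrier (act_module q n M act) = carrier M"
 "\<zero>\<^bsub>act_module q n M act\<^esub> = \<zero>\<^bsub>M\<^esub>"
 "add (act_module q n M act) = add M"
 by (simp_all add: act_module_def)

lemma abelian_group_transfer:
 fixes M :: "('s, 'b) module" and N :: "('t, 'b) module"
 assumes "abelian_group M" and "carrier N = carrier M" "\<zero>\<^bsub>N\<^esub> = \<zero>\<^bsub>M\<^esub>" "add N = add M"
 shows "abelian_group N"
proof -
 interpret abelian_group M by fact
 show ?thesis
 proof (rule abelian_groupI)
  fix x assume "x \<in> carrier N"
  thus "\<exists>y\<in>carrier N. y \<oplus>\<^bsub>N\<^esub> x = \<zero>\<^bsub>N\<^esub>"
   using l_neg[of x] by (intro bexI[of _ "\<ominus>\<^bsub>M\<^esub> x"]) (simp_all add: assms)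
 qed (simp_all add: assms a_ac)
qed

lemma
 fixes M :: "('s, 'b) module"
 assumes "free_action M act" and "free_action.kills M act (rels q n (full n))"
 shows act_module_smult: "a \<in> hfree n ==> x \<in> carrier M ==> hcls q n a \<odot>\<^bsub>act_module q n M act\<^esub> x = act a x"
  and left_module_act_module: "left_module (hecke q n) (act_module q n M act)"
proof -
 let ?N = "act_module q n M act"
 interpret free_action M act by fact
 have sm: "hcls q n a \<odot>\<^bsub>?N\<^esub> x = act a x" if "a \<in> hfree n" "x \<in> carrier M" for a x
 proof -
  let ?b = "SOME b. b \<in> hfree n \<and> hcls q n b = hcls q n a"
  have "?b \<in> hfree n \<and> hcls q n ?b = hcls q n a"
   by (rule someI[of _ a]) (use that in simp)
  hence "cong_mod (rels q n (full n)) ?b a" using hcls_eq_iff that by blast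
  from act_cong[OF assms(2) this that(2)] show ?thesis by (simp add: act_module_def)
 qed
 thus "a \<in> hfree n ==> x \<in> carrier M ==> hcls q n a \<odot>\<^bsub>?N\<^esub> x = act a x" for a x .
 show "left_module (hecke q n) (?N)"
 proof (intro left_module.intro left_module_axioms.intro)
  show "ring (hecke q n)" by (rule ring_hecke)
  show "abelian_group (?N)"
   by (rule abelian_group_transfer[of M]) (simp_all add: abelian_group_axioms)
 next
  fix h x assume h: "h \<in> carrier (hecke q n)" and x: "x \<in> carrier (?N)"
  obtain a where a: "a \<in> hfree n" "h = hcls q n a" using hcls_surj[OF h] by blast
  show "h \<odot>\<^bsub>?N\<^esub> x \<in> carrier (?N)" using a x by (simp add: sm)
  fix y assume y: "y \<in> carrier (?N)"
  show "h \<odot>\<^bsub>?N\<^esub> (x \<oplus>\<^bsub>?N\<^esub> y) =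
   h \<odot>\<^bsub>?N\<^esub> x \<oplus>\<^bsub>?N\<^esub> h \<odot>\<^bsub>?N\<^esub> y"
   using a x y by (simp add: sm act_radd)
 next
  fix h k x assume h: "h \<in> carrier (hecke q n)" and k: "k \<in> carrier (hecke q n)"
   and x: "x \<in> carrier (?N)"
  obtain a where a: "a \<in> hfree n" "h = hcls q n a" using hcls_surj[OF h] by blast
  obtain b where b: "b \<in> hfree n" "k = hcls q n b" using hcls_surj[OF k] by blast
  show "(h \<oplus>\<^bsub>hecke q n\<^esub> k) \<odot>\<^bsub>?N\<^esub> x =
   h \<odot>\<^bsub>?N\<^esub> x \<oplus>\<^bsub>?N\<^esub> k \<odot>\<^bsub>?N\<^esub> x"
   using a b x by (simp add: sm act_add flip: hcls_add)
  show "(h \<otimes>\<^bsub>hecke q n\<^esub> k) \<odot>\<^bsub>?N\<^esub> x =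
   h \<odot>\<^bsub>?N\<^esub> (k \<odot>\<^bsub>?N\<^esub> x)"
   using a b x by (simp add: sm act_mult flip: hcls_mult)
 next
  fix x assume x: "x \<in> carrier (?N)"
  thus "\<one>\<^bsub>hecke q n\<^esub> \<odot>\<^bsub>?N\<^esub> x = x"
   using sm[of 1 x] by (simp add: hcls_one)
 qed
qed

section \<open>Isomorphisms and cut modules\<close>

lemma left_modules_isomorphic_sym:
 assumes "left_modules_isomorphic R M N" shows "left_modules_isomorphic R N M"
proof -
 from assms obtain \<phi> where M: "left_module R M" and N: "left_module R N" and
  \<phi>: "bij_betw \<phi> (carrier M) (carrier N)"
  "!!x y. x \<in> carrier M ==> y \<in> carrier M ==> \<phi> (x \<oplus>\<^bsub>M\<^esub> y) = \<phi> x \<oplus>\<^bsub>N\<^esub> \<phi> y"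
  "!!a x. a \<in> carrier R ==> x \<in> carrier M ==> \<phi> (a \<odot>\<^bsub>M\<^esub> x) = a \<odot>\<^bsub>N\<^esub> \<phi> x"
  unfolding left_modules_isomorphic_def left_module_iso_def by blast
 interpret M: left_module R M by fact
 let ?\<psi> = "inv_into (carrier M) \<phi>"
 have \<psi>: "?\<psi> y \<in> carrier M" "\<phi> (?\<psi> y) = y" if "y \<in> carrier N" for y
  using that \<phi>(1) by (auto simp: bij_betw_def inv_into_into f_inv_into_f)
 have inj: "x = y" if "x \<in> carrier M" "y \<in> carrier M" "\<phi> x = \<phi> y" for x y
  using that \<phi>(1) by (meson bij_betw_imp_inj_on inj_onD)
 have "?\<psi> \<in> left_module_iso R N M"
  unfolding left_module_iso_def
 proof (intro CollectI conjI ballI)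
  show "bij_betw ?\<psi> (carrier N) (carrier M)" by (rule bij_betw_inv_into[OF \<phi>(1)])
  fix x assume x: "x \<in> carrier N"
  { fix y assume y: "y \<in> carrier N"
   have "x \<oplus>\<^bsub>N\<^esub> y \<in> carrier N" using left_module.axioms(2)[OF N] x y
    by (meson abelian_group.axioms(1) abelian_monoid.a_closed)
   thus "?\<psi> (x \<oplus>\<^bsub>N\<^esub> y) = ?\<psi> x \<oplus>\<^bsub>M\<^esub> ?\<psi> y"
    using x y by (intro inj) (simp_all add: \<psi> \<phi>) }
  { fix a assume a: "a \<in> carrier R"
   have "a \<odot>\<^bsub>N\<^esub> x \<in> carrier N" using left_module.smult_closed[OF N a x] .
   thus "?\<psi> (a \<odot>\<^bsub>N\<^esub> x) = a \<odot>\<^bsub>M\<^esub> ?\<psi> x"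
    using x a by (intro inj) (simp_all add: \<psi> \<phi> M.smult_closed) }
 qed
 thus ?thesis using M N by (auto simp: left_modules_isomorphic_def)
qed

lemma left_modules_isomorphic_trans:
 assumes "left_modules_isomorphic R M N" and "left_modules_isomorphic R N P"
 shows "left_modules_isomorphic R M P"
proof -
 from assms obtain \<phi> \<psi> where *: "left_module R M" "left_module R P"
  "\<phi> \<in> left_module_iso R M N" "\<psi> \<in> left_module_iso R N P"
  unfolding left_modules_isomorphic_def by blast
 have "\<phi> x \<in> carrier N" if "x \<in> carrier M" for x
  using * that by (auto simp: left_module_iso_def bij_betw_def)
 hence "\<psi> \<circ> \<phi> \<in> left_module_iso R M P"
  using * by (auto simp: left_module_iso_def intro: bij_betw_trans)
 thus ?thesis using * by (auto simp: left_modules_isomorphic_def)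
qed

lemma cut_module_simps [simp]:
 "carrier (cut_module e \<phi> M) = (\<lambda>x. e \<odot>\<^bsub>M\<^esub> x) ` carrier M"
 "\<zero>\<^bsub>cut_module e \<phi> M\<^esub> = \<zero>\<^bsub>M\<^esub>" "add (cut_module e \<phi> M) = add M"
 "h \<odot>\<^bsub>cut_module e \<phi> M\<^esub> x = \<phi> h \<odot>\<^bsub>M\<^esub> x"
 by (simp_all add: cut_module_def)

text \<open>Stability of the image of \<open>e\<close> is assumed instead of commutation of
  \<open>e\<close> with the image of \<open>\<phi>\<close>. For sign projectors it will follow from
  the description of that image by sign vectors.\<close>

lemma left_module_cut_module:
 fixes M :: "('a, 'b) module"
 assumes "left_module R M" and "ring R'" and e: "e \<in> carrier R" and \<phi>: "\<phi> \<in> ring_hom R' R"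
  and stable: "!!h x. h \<in> carrier R' ==> x \<in> carrier (cut_module e \<phi> M) ==>
   \<phi> h \<odot>\<^bsub>M\<^esub> x \<in> carrier (cut_module e \<phi> M)"
 shows "left_module R' (cut_module e \<phi> M)"
proof -
 interpret left_module R M by fact
 let ?C = "cut_module e \<phi> M"
 have sub: "x \<in> carrier ?C ==> x \<in> carrier M" for x using e by (auto intro: smult_closed)
 have cl: "x \<oplus>\<^bsub>M\<^esub> y \<in> carrier ?C" if "x \<in> carrier ?C" "y \<in> carrier ?C" for x y
  using that e by (auto simp: M.a_closed simp flip: smult_r_distr)
 have ng: "\<ominus>\<^bsub>M\<^esub> x \<in> carrier ?C" if "x \<in> carrier ?C" for x
  using that e by (auto simp flip: smult_rminus)
 have ze: "\<zero>\<^bsub>M\<^esub> \<in> carrier ?C" using smult_rzero[OF e] by (auto intro!: image_eqI[of _ _ "\<zero>\<^bsub>M\<^esub>"])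
 show ?thesis
 proof (intro left_module.intro left_module_axioms.intro)
  show "ring R'" by fact
  show "abelian_group ?C"
  proof (rule abelian_groupI)
   fix x assume x: "x \<in> carrier ?C"
   show "\<exists>y\<in>carrier ?C. y \<oplus>\<^bsub>?C\<^esub> x = \<zero>\<^bsub>?C\<^esub>"
    by (rule bexI[OF _ ng[OF x]]) (simp add: M.l_neg[OF sub[OF x]])
  qed (use sub cl ze in "auto simp del: cut_module_simps(1) simp: M.a_ac")
 qed (use sub stable ring_hom_closed[OF \<phi>] ring_hom_add[OF \<phi>] ring_hom_mult[OF \<phi>] ring_hom_one[OF \<phi>] in
   \<open>auto simp del: cut_module_simps(1) simp: smult_l_distr smult_r_distr smult_assoc1 smult_one\<close>)
qed

section \<open>Reduced words, Matsumoto's theorem and minimal coset representatives\<close>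

section \<open>Canonical reduced words\<close>

abbreviation Tg :: "nat => hgen free" where
 "Tg j \<equiv> fgen (GT j)"

abbreviation pinv :: "(nat => nat) => nat => nat" where
 "pinv \<equiv> inv_into UNIV"

definition Tprod :: "nat list => hgen free" where
 "Tprod js = prod_list (map Tg js)"

lemma Tprod_simps [simp]: "Tprod [] = 1" "Tprod (j # js) = Tg j * Tprod js"
 "Tprod (js @ ks) = Tprod js * Tprod ks"
 by (simp_all add: Tprod_def)

lemma Tprod_fsupp [intro]: "set js <= J ==> Tprod js \<in> fsupp (gens n J)"
 unfolding Tprod_def by (rule fsupp_prod_list) auto

text \<open>If \<open>p\<close> permutes \<open>{1..n + 1}\<close> and \<open>p a = n + 1\<close>, this is the permutation of \<open>{1..n}\<close> whose
 one-line notation arises from that of \<open>p\<close> by deleting the entry \<open>n + 1\<close>.\<close>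

definition del_entry :: "nat => nat => (nat => nat) => nat => nat" where
 "del_entry n a p i = (if i < a then p i else if i \<le> n then p (Suc i) else i)"

text \<open>\<open>canon n p\<close> is a reduced word for the inverse of \<open>p\<close>; with this convention left multiplication by
 a simple reflection becomes \<open>p \<mapsto> p \<circ> sref j\<close>.\<close>

primrec canon :: "nat => (nat => nat) => nat list" where
 "canon 0 p = []"
| "canon (Suc n) p = [pinv p (Suc n)..<Suc n] @ canon n (del_entry n (pinv p (Suc n)) p)"

lemma inv_perm_eq: "p permutes S ==> p a = b ==> pinv p b = a"
 using permutes_inverses(2) by metis

lemma perm_top:
 assumes "p permutes {1..Suc n}"
 obtains a where "a \<in> {1..Suc n}" "p a = Suc n" "pinv p (Suc n) = a"
proof -
 have "pinv p (Suc n) \<in> {1..Suc n}"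
  using permutes_in_image[OF permutes_inv[OF assms], of "Suc n"] by simp
 moreover have "p (pinv p (Suc n)) = Suc n" using permutes_inverses(1)[OF assms] by simp
 ultimately show ?thesis using that by blast
qed

lemma del_entry_permutes:
 assumes p: "p permutes {1..Suc n}" and a: "a \<in> {1..Suc n}" "p a = Suc n"
 shows "del_entry n a p permutes {1..n}"
proof (rule bij_imp_permutes)
 have pin: "p i \<in> {1..n}" if "i \<in> {1..Suc n}" "i ~= a" for i
 proof -
  have "p i \<in> {1..Suc n}" using that permutes_in_image[OF p] by blast
  moreover have "p i ~= Suc n" using a that permutes_inj[OF p] by (metis injD)
  ultimately show ?thesis by auto
 qed
 have "del_entry n a p ` {1..n} <= {1..n}"
 proof
  fix y assume "y \<in> del_entry n a p ` {1..n}"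
  then obtain i where i: "i \<in> {1..n}" "y = del_entry n a p i" by blast
  thus "y \<in> {1..n}" using pin[of i] pin[of "Suc i"] a by (auto simp: del_entry_def split: if_splits)
 qed
 moreover have "inj_on (del_entry n a p) {1..n}"
 proof (rule inj_onI)
  fix i k assume "del_entry n a p i = del_entry n a p k" and "i \<in> {1..n}" "k \<in> {1..n}"
  moreover have "p x = p y \<longleftrightarrow> x = y" for x y using permutes_inj[OF p] by (rule inj_eq)
  ultimately show "i = k" by (auto simp: del_entry_def split: if_splits)
 qed
 ultimately show "bij_betw (del_entry n a p) {1..n} {1..n}"
  by (simp add: bij_betw_def endo_inj_surj)
 show "del_entry n a p x = x" if "x \<notin> {1..n}" for x
  using that a p by (cases "x = 0") (auto simp: del_entry_def permutes_def)
qed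

lemma set_canon: "p permutes {1..n} ==> set (canon n p) <= full n"
proof (induction n arbitrary: p)
 case (Suc n)
 then obtain a where a: "a \<in> {1..Suc n}" "p a = Suc n" "pinv p (Suc n) = a" using perm_top by blast
 have "set (canon n (del_entry n a p)) <= full n"
  by (rule Suc.IH) (rule del_entry_permutes[OF Suc.prems a(1,2)])
 thus ?case using a by (auto simp: full_def)
qed simp

lemma sref_permutes: "j \<in> full n ==> sref j permutes {1..n}"
 by (rule permutes_swap_id) auto

lemma perm_sref: "p permutes {1..n} ==> j \<in> full n ==> p \<circ> sref j permutes {1..n}"
 by (rule permutes_compose[OF sref_permutes])

lemma sref_sref: "sref j \<circ> sref j = id" "f \<circ> sref j \<circ> sref j = f"
 by (auto simp: fun_eq_iff)

text \<open>What matters is where j lies relative to the place \<open>a\<close> of the largest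
  entry. A swap away from \<open>a\<close> becomes a swap of the shortened word; to the right of
  \<open>a\<close> its index drops by one, because the deletion shifts the later positions. A swap
  that moves the largest entry changes the first segment of the word by one letter.\<close>

lemma canon_cases [consumes 3, case_names below extend shrink above]:
 assumes p: "p permutes {1..Suc n}" and j: "j \<in> full (Suc n)" and a: "a = pinv p (Suc n)"
 obtains
  (below) "j + 1 < a" "j \<in> full n" "pinv (p \<circ> sref j) (Suc n) = a"
   "del_entry n a (p \<circ> sref j) = del_entry n a p \<circ> sref j"
   "del_entry n a p j = p j" "del_entry n a p (j + 1) = p (j + 1)"
 | (extend) "j + 1 = a" "canon (Suc n) (p \<circ> sref j) = j # canon (Suc n) p" "p j < p (j + 1)"
 | (shrink) "j = a" "canon (Suc n) p = j # canon (Suc n) (p \<circ> sref j)" "p (j + 1) < p j"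
 | (above) i where "a < j" "j = Suc i" "a \<le> i" "i \<in> full n" "pinv (p \<circ> sref j) (Suc n) = a"
   "del_entry n a (p \<circ> sref j) = del_entry n a p \<circ> sref i"
   "del_entry n a p i = p j" "del_entry n a p (i + 1) = p (j + 1)"
proof -
 from p obtain a' where a': "a' \<in> {1..Suc n}" "p a' = Suc n" "pinv p (Suc n) = a'" using perm_top by blast
 with a have a: "a \<in> {1..Suc n}" "p a = Suc n" "pinv p (Suc n) = a" by auto
 have ps: "p \<circ> sref j permutes {1..Suc n}" by (rule perm_sref[OF p j])
 have less: "p i < Suc n" if "i \<in> {1..Suc n}" "i ~= a" for i
  using that permutes_in_image[OF p, of i] a permutes_inj[OF p] by (metis atLeastAtMost_iff injD le_neq_implies_less)
 consider "j + 1 < a" | "j + 1 = a" | "j = a" | "a < j" by linarith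
 thus ?thesis
 proof cases
  case 1
  have "pinv (p \<circ> sref j) (Suc n) = a" by (rule inv_perm_eq[OF ps]) (use 1 a in "auto simp: transpose_def")
  moreover have "del_entry n a (p \<circ> sref j) = del_entry n a p \<circ> sref j"
   using 1 a by (auto simp: del_entry_def fun_eq_iff transpose_def)
  ultimately show ?thesis using 1 a j by (intro below) (auto simp: del_entry_def)
 next
  case 2
  have "pinv (p \<circ> sref j) (Suc n) = j" by (rule inv_perm_eq[OF ps]) (use 2 a in auto)
  moreover have "del_entry n j (p \<circ> sref j) = del_entry n a p"
   using 2 j by (auto simp: del_entry_def fun_eq_iff transpose_def less_Suc_eq)
  moreover have "[j..<Suc n] = j # [a..<Suc n]" using 2 j upt_conv_Cons[of j "Suc n"] by simp
  ultimately have "canon (Suc n) (p \<circ> sref j) = j # canon (Suc n) p" using a by simp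
  thus ?thesis using 2 a j less[of j] by (intro extend) auto
 next
  case 3
  have "pinv (p \<circ> sref j) (Suc n) = Suc j" by (rule inv_perm_eq[OF ps]) (use 3 a in auto)
  moreover have "del_entry n (Suc j) (p \<circ> sref j) = del_entry n a p"
   using 3 j by (auto simp: del_entry_def fun_eq_iff transpose_def less_Suc_eq)
  moreover have "[j..<Suc n] = j # [Suc j..<Suc n]" using j upt_conv_Cons[of j "Suc n"] by simp
  ultimately have "canon (Suc n) p = j # canon (Suc n) (p \<circ> sref j)" using a 3 by simp
  thus ?thesis using 3 a j less[of "j + 1"] by (intro shrink) auto
 next
  case 4
  then obtain i where i: "j = Suc i" by (cases j) auto
  have "pinv (p \<circ> sref j) (Suc n) = a" by (rule inv_perm_eq[OF ps]) (use 4 a in "auto simp: transpose_def")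
  moreover have "del_entry n a (p \<circ> sref j) = del_entry n a p \<circ> sref i"
   using 4 i j by (auto simp: del_entry_def fun_eq_iff transpose_def)
  ultimately show ?thesis using 4 i a j by (intro above[of i]) (auto simp: del_entry_def)
 qed
qed

lemma length_canon_step:
 assumes "p permutes {1..n}" and "j \<in> full n" and "p j < p (j + 1)"
 shows "length (canon n (p \<circ> sref j)) = Suc (length (canon n p))"
 using assms
proof (induction n arbitrary: p j)
 case (Suc n)
 define a where "a = pinv p (Suc n)"
 from Suc.prems(1) have del: "del_entry n a p permutes {1..n}"
  unfolding a_def by (metis perm_top del_entry_permutes)
 show ?case
 using Suc.prems(1,2) a_def
 proof (cases rule: canon_cases)
  case below
  thus ?thesis using Suc.IH[OF del, of j] Suc.prems
   by (simp add: a_def[symmetric] comp_def)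
 next
  case (above i)
  thus ?thesis using Suc.IH[OF del, of i] Suc.prems
   by (simp add: a_def[symmetric] comp_def)
 qed (use Suc.prems in "auto simp: comp_def simp del: canon.simps")
qed simp

text \<open>This closure keeps the spanning argument for a Levi subalgebra inside its own
  generators.\<close>

lemma set_canon_step:
 assumes "p permutes {1..n}" and "j \<in> full n" and "j \<in> J" and "set (canon n p) <= J"
 shows "set (canon n (p \<circ> sref j)) <= J"
 using assms
proof (induction n arbitrary: p j)
 case (Suc n)
 define a where "a = pinv p (Suc n)"
 from Suc.prems(1) have del: "del_entry n a p permutes {1..n}"
  unfolding a_def by (metis perm_top del_entry_permutes)
 have J: "set [a..<Suc n] <= J" "set (canon n (del_entry n a p)) <= J"
  using Suc.prems(4) by (simp_all add: a_def)
 show ?case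
 using Suc.prems(1,2) a_def
 proof (cases rule: canon_cases)
  case below
  thus ?thesis using Suc.IH[OF del, of j] Suc.prems J
   by (simp add: a_def[symmetric] comp_def)
 next
  case (above i)
  \<comment> \<open>The shifted index i = j - 1 lies between \<open>a\<close> and n, so it already
    occurs in the first segment of the word.\<close>
  hence "i \<in> J" using J(1) by auto
  thus ?thesis using above Suc.IH[OF del, of i] Suc.prems J
   by (simp add: a_def[symmetric] comp_def)
 qed (use Suc.prems in "auto simp: comp_def simp del: canon.simps")
qed simp

lemma Tg_far:
 assumes "j \<in> J" and "k \<in> J" and "j + 2 \<le> k \<or> k + 2 \<le> j"
 shows "cong_mod (rels q N J) (Tg j * Tg k) (Tg k * Tg j)"
 using assms(3)
proof
 assume "j + 2 \<le> k"
 thus ?thesis unfolding cong_mod_def using assms by (intro tideal_incl rels_far)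
next
 assume "k + 2 \<le> j"
 thus ?thesis
  by (intro cong_mod_sym[of _ "Tg k * Tg j"]) (use assms in "auto simp: cong_mod_def intro!: tideal_incl rels_far")
qed

lemma Tprod_far:
 assumes "j \<in> J" and "set ks <= J" and "!!k. k \<in> set ks ==> j + 2 \<le> k \<or> k + 2 \<le> j"
 shows "cong_mod (rels q N J) (Tg j * Tprod ks) (Tprod ks * Tg j)"
 using assms(2,3)
proof (induction ks)
 case (Cons k ks)
 have "cong_mod (rels q N J) (Tg j * Tg k * Tprod ks) (Tg k * Tg j * Tprod ks)"
  using Cons.prems assms(1) by (intro cong_mod_mult_right Tg_far) auto
 also have "cong_mod (rels q N J) (Tg k * Tg j * Tprod ks) (Tg k * (Tprod ks * Tg j))"
  unfolding mult.assoc using Cons by (intro cong_mod_mult_left) auto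
 finally show ?case by (simp add: mult.assoc)
qed simp

lemma Tg_braid:
 "j \<in> J ==> Suc j \<in> J ==> cong_mod (rels q N J) (Tg j * Tg (Suc j) * Tg j) (Tg (Suc j) * Tg j * Tg (Suc j))"
 unfolding cong_mod_def using rels_braid[of j J q N] by (auto intro: tideal_incl)

lemma Tg_quad:
 assumes "j \<in> J"
 shows "cong_mod (rels q N J) (Tg j * Tg j) (fconst (of_nat q - 1) * Tg j + fconst (of_nat q))"
proof -
 have "(Tg j + 1) * (Tg j - fconst (of_nat q)) = Tg j * Tg j - (fconst (of_nat q - 1) * Tg j + fconst (of_nat q))"
  using fconst_commute[of "of_nat q" "Tg j"] by (simp add: algebra_simps fconst_diff)
 thus ?thesis unfolding cong_mod_def using tideal_incl[OF rels_quad[OF assms, of q N]] by simp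
qed

text \<open>T_(i+1) passes T_a, ..., T_(i-1), is exchanged against T_i T_(i+1) by one braid
  relation, and the resulting T_i passes the remaining letters.\<close>

lemma Tg_shift:
 assumes J: "set [a..<Suc n] <= J" and "a \<le> i" and "i < n"
 shows "cong_mod (rels q N J) (Tg (Suc i) * Tprod [a..<Suc n]) (Tprod [a..<Suc n] * Tg i)"
proof -
 have split: "[a..<Suc n] = [a..<i] @ [i, Suc i] @ [Suc (Suc i)..<Suc n]"
 proof -
  have "[a..<Suc n] = [a..<i] @ [i..<Suc n]"
   using upt_add_eq_append[of a i "Suc n - i"] assms by simp
  moreover have "[i..<Suc n] = [i, Suc i] @ [Suc (Suc i)..<Suc n]"
   using assms by (simp add: upt_conv_Cons)
  ultimately show ?thesis by simp
 qed
 have inJ: "i \<in> J" "Suc i \<in> J" "set [a..<i] <= J" "set [Suc (Suc i)..<Suc n] <= J"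
 proof -
  have "{i, Suc i} \<union> {a..<i} \<union> {Suc (Suc i)..<Suc n} <= {a..<Suc n}" using assms(2,3) by auto
  thus "i \<in> J" "Suc i \<in> J" "set [a..<i] <= J" "set [Suc (Suc i)..<Suc n] <= J"
   using J by (auto simp del: upt_Suc)
 qed
 let ?A = "Tprod [a..<i]" and ?B = "Tprod [Suc (Suc i)..<Suc n]"
 have "cong_mod (rels q N J) (Tg (Suc i) * ?A * (Tg i * Tg (Suc i) * ?B)) (?A * Tg (Suc i) * (Tg i * Tg (Suc i) * ?B))"
  by (intro cong_mod_mult_right Tprod_far) (use inJ in auto)
 also have "?A * Tg (Suc i) * (Tg i * Tg (Suc i) * ?B) = ?A * (Tg (Suc i) * Tg i * Tg (Suc i)) * ?B"
  by (simp add: mult.assoc)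
 also have "cong_mod (rels q N J) (?A * (Tg (Suc i) * Tg i * Tg (Suc i)) * ?B) (?A * (Tg i * Tg (Suc i) * Tg i) * ?B)"
  by (intro cong_mod_mult_right cong_mod_mult_left cong_mod_sym[OF Tg_braid]) (use inJ in auto)
 also have "?A * (Tg i * Tg (Suc i) * Tg i) * ?B = ?A * Tg i * Tg (Suc i) * (Tg i * ?B)"
  by (simp add: mult.assoc)
 also have "cong_mod (rels q N J) (?A * Tg i * Tg (Suc i) * (Tg i * ?B)) (?A * Tg i * Tg (Suc i) * (?B * Tg i))"
  by (intro cong_mod_mult_left Tprod_far) (use inJ in auto)
 finally show ?thesis unfolding split by (simp add: mult.assoc)
qed

text \<open>All relations used involve only T's from \<open>J\<close>. This uniformity lets the
  lemma serve \<H>_n and its Levi subalgebras alike.\<close>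

lemma canon_up:
 assumes "p permutes {1..n}" and "j \<in> full n" and "p j < p (j + 1)" and "j \<in> J" and "set (canon n p) <= J"
 shows "cong_mod (rels q N J) (Tg j * Tprod (canon n p)) (Tprod (canon n (p \<circ> sref j)))"
 using assms
proof (induction n arbitrary: p j)
 case (Suc n)
 define a where "a = pinv p (Suc n)"
 from Suc.prems(1) have del: "del_entry n a p permutes {1..n}"
  unfolding a_def by (metis perm_top del_entry_permutes)
 have J: "set [a..<Suc n] <= J" "set (canon n (del_entry n a p)) <= J"
  using Suc.prems(5) by (simp_all add: a_def)
 have c: "Tprod (canon (Suc n) p) = Tprod [a..<Suc n] * Tprod (canon n (del_entry n a p))"
  by (simp add: a_def)
 show ?case
 using Suc.prems(1,2) a_def
 proof (cases rule: canon_cases)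
  case below
  have "cong_mod (rels q N J) (Tg j * Tprod [a..<Suc n] * Tprod (canon n (del_entry n a p)))
    (Tprod [a..<Suc n] * Tg j * Tprod (canon n (del_entry n a p)))"
   by (intro cong_mod_mult_right Tprod_far) (use below J Suc.prems in auto)
  also have "cong_mod (rels q N J) (Tprod [a..<Suc n] * Tg j * Tprod (canon n (del_entry n a p)))
    (Tprod [a..<Suc n] * Tprod (canon n (del_entry n a p \<circ> sref j)))"
   unfolding mult.assoc by (intro cong_mod_mult_left Suc.IH) (use below del J Suc.prems in auto)
  finally show ?thesis using below by (simp add: c mult.assoc a_def[symmetric] comp_def)
 next
  case (above i)
  have "cong_mod (rels q N J) (Tg j * Tprod [a..<Suc n] * Tprod (canon n (del_entry n a p)))
    (Tprod [a..<Suc n] * Tg i * Tprod (canon n (del_entry n a p)))"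
   unfolding above(2) by (intro cong_mod_mult_right Tg_shift) (use above J in auto)
  also have "cong_mod (rels q N J) (Tprod [a..<Suc n] * Tg i * Tprod (canon n (del_entry n a p)))
    (Tprod [a..<Suc n] * Tprod (canon n (del_entry n a p \<circ> sref i)))"
   unfolding mult.assoc by (intro cong_mod_mult_left Suc.IH) (use above del J Suc.prems in auto)
  finally show ?thesis using above by (simp add: c mult.assoc a_def[symmetric] comp_def)
 qed (use Suc.prems in "auto simp: comp_def simp del: canon.simps")
qed simp

text \<open>The word of p is T_j times the word of p s_j by \<open>canon_up\<close>, and then T_j
  squared is replaced by (q - 1) T_j + q.\<close>

lemma canon_down:
 assumes p: "p permutes {1..n}" and j: "j \<in> full n" and "p (j + 1) < p j" and "j \<in> J" and "set (canon n p) <= J"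
 shows "cong_mod (rels q N J) (Tg j * Tprod (canon n p))
  (fconst (of_nat q - 1) * Tprod (canon n p) + fconst (of_nat q) * Tprod (canon n (p \<circ> sref j)))"
proof -
 let ?r = "p \<circ> sref j"
 have r: "?r permutes {1..n}" "set (canon n ?r) <= J"
  using perm_sref[OF p j] set_canon_step[OF p j] assms by auto
 have rj: "?r \<circ> sref j = p" by (rule sref_sref)
 have rj2: "?r j < ?r (j + 1)" using assms by simp
 have up: "cong_mod (rels q N J) (Tg j * Tprod (canon n ?r)) (Tprod (canon n p))"
  using canon_up[OF r(1) j rj2 _ r(2), of q N] assms unfolding rj by simp
 have "cong_mod (rels q N J) (Tg j * Tprod (canon n p)) (Tg j * (Tg j * Tprod (canon n ?r)))"
  by (rule cong_mod_mult_left[OF cong_mod_sym[OF up]])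
 also have "cong_mod (rels q N J) (Tg j * (Tg j * Tprod (canon n ?r)))
   ((fconst (of_nat q - 1) * Tg j + fconst (of_nat q)) * Tprod (canon n ?r))"
  unfolding mult.assoc[symmetric] by (rule cong_mod_mult_right[OF Tg_quad]) (use assms in simp)
 also have "(fconst (of_nat q - 1) * Tg j + fconst (of_nat q)) * Tprod (canon n ?r) =
   fconst (of_nat q - 1) * (Tg j * Tprod (canon n ?r)) + fconst (of_nat q) * Tprod (canon n ?r)"
  by (simp add: algebra_simps)
 also have "cong_mod (rels q N J) \<dots> (fconst (of_nat q - 1) * Tprod (canon n p) + fconst (of_nat q) * Tprod (canon n ?r))"
  by (intro cong_mod_add cong_mod_mult_left up cong_mod_refl)
 finally show ?thesis .
qed

text \<open>Induction from the left gives p j \<ge> j, induction from the right gives p j \<le>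
  j.\<close>

lemma increasing_permutation_id:
 assumes p: "p permutes {1..n}" and asc: "!!j. j \<in> full n ==> p j < p (j + 1)"
 shows "p = id"
proof
 have ge: "j \<le> n ==> j \<le> p j" for j
 proof (induction j)
  case (Suc j)
  show ?case
  proof (cases "j = 0")
   case True
   thus ?thesis using permutes_in_image[OF p, of 1] Suc.prems by simp
  next
   case False
   thus ?thesis using asc[of j] Suc by auto
  qed
 qed simp
 have le: "1 \<le> j ==> j \<le> n ==> p j \<le> j" for j
 proof (induction "n - j" arbitrary: j)
  case 0
  thus ?case using permutes_in_image[OF p, of j] by auto
 next
  case (Suc m)
  hence "j < n" by linarith
  hence "p (Suc j) \<le> Suc j" using Suc(1)[of "Suc j"] Suc(2) by simp
  moreover have "p j < p (Suc j)" using asc[of j] Suc(3) \<open>j < n\<close> by simp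
  ultimately show ?case by simp
 qed
 fix j show "p j = id j"
  using ge[of j] le[of j] p by (cases "j \<in> {1..n}") (auto simp: permutes_def)
qed

lemma descent_exists:
 assumes "p permutes {1..n}" and "p ~= id"
 shows "\<exists>j\<in>full n. p (j + 1) < p j"
proof -
 obtain j where j: "j \<in> full n" "\<not> p j < p (j + 1)" using increasing_permutation_id assms by blast
 moreover have "p j ~= p (j + 1)" using permutes_inj[OF assms(1)] by (simp add: inj_eq)
 ultimately show ?thesis by force
qed

lemma canon_id: "canon n id = []"
proof (induction n)
 case (Suc n)
 have del: "del_entry n (Suc n) id = id" by (auto simp: del_entry_def fun_eq_iff)
 have inv: "pinv id (Suc n) = Suc n" by (simp add: inv_id)
 show ?case by (simp only: canon.simps inv del Suc) simp
qed simp

text \<open>The inverse of \<open>sref_word js\<close>, in the convention of \<open>canon\<close>: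
  prefixing a letter is composition with a simple reflection on the right.\<close>

definition pword :: "nat list => nat => nat" where
 "pword js = foldr (\<lambda>j p. p \<circ> sref j) js id"

lemma pword_simps [simp]: "pword [] = id" "pword (j # js) = pword js \<circ> sref j"
 by (simp_all add: pword_def)

lemma pword_snoc: "pword (js @ [a]) = sref a \<circ> pword js"
 by (induction js) (simp_all add: comp_assoc)

lemma pword_permutes: "set js <= full n ==> pword js permutes {1..n}"
proof (induction js)
 case (Cons j js)
 thus ?case unfolding pword_simps by (intro perm_sref) auto
qed (simp add: permutes_id)

lemma sref_word_pword: "sref_word js \<circ> pword js = id" "pword js \<circ> sref_word js = id"
proof (induction js)
 case (Cons j js)
 have s: "sref_word (j # js) = sref j \<circ> sref_word js" by (simp add: sref_word_def)
 show "sref_word (j # js) \<circ> pword (j # js) = id"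
  unfolding s pword_simps using Cons(1) by (auto simp: fun_eq_iff)
 show "pword (j # js) \<circ> sref_word (j # js) = id"
  unfolding s pword_simps using Cons(2) by (auto simp: fun_eq_iff)
qed (simp_all add: sref_word_def)

lemma inv_sref_word: "pinv (sref_word js) = pword js"
 by (rule inv_unique_comp[OF sref_word_pword])

text \<open>One more letter changes the canonical length by exactly one, up or down, so no word is
  shorter than the canonical one.\<close>

lemma length_canon_pword: "set js <= full n ==> length (canon n (pword js)) \<le> length js"
proof (induction js)
 case (Cons j js)
 have p: "pword js permutes {1..n}" by (rule pword_permutes) (use Cons in simp)
 have j: "j \<in> full n" and le: "length (canon n (pword js)) \<le> length js" using Cons by simp_all
 show ?case
 proof (cases "pword js j < pword js (j + 1)")
  case True
  show ?thesis unfolding pword_simps length_canon_step[OF p j True] using le by simp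
 next
  case False
  moreover have "pword js j ~= pword js (j + 1)" using permutes_inj[OF p] by (simp add: inj_eq)
  ultimately have "(pword js \<circ> sref j) j < (pword js \<circ> sref j) (j + 1)" by simp
  from length_canon_step[OF perm_sref[OF p j] j this] show ?thesis
   unfolding pword_simps sref_sref using le by simp
 qed
qed (simp add: canon_id)

lemma reduced_word_exists:
 "p permutes {1..n} ==> \<exists>js. set js <= full n \<and> pword js = p \<and> length js = length (canon n p)"
proof (induction "length (canon n p)" arbitrary: p rule: less_induct)
 case less
 show ?case
 proof (cases "p = id")
  case True
  thus ?thesis by (intro exI[of _ "[]"]) (simp add: canon_id)
 next
  case False
  then obtain j where j: "j \<in> full n" "p (j + 1) < p j" using descent_exists less.prems by blast
  let ?r = "p \<circ> sref j"
  have r: "?r permutes {1..n}" "?r \<circ> sref j = p"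
   by (rule perm_sref[OF less.prems j(1)], rule sref_sref)
  have len: "length (canon n p) = Suc (length (canon n ?r))"
   using length_canon_step[OF r(1) j(1)] j(2) r(2) by simp
  then obtain js where "set js <= full n" "pword js = ?r" "length js = length (canon n ?r)"
   using less.hyps[of ?r] r by auto
  thus ?thesis using j len r(2) by (intro exI[of _ "j # js"]) simp
 qed
qed

lemma perm_length_eq:
 assumes w: "w permutes {1..n}"
 shows "perm_length n w = length (canon n (pinv w))"
 unfolding perm_length_def
proof (rule Least_equality)
 obtain js where js: "set js <= full n" "pword js = pinv w" "length js = length (canon n (pinv w))"
  using reduced_word_exists[OF permutes_inv[OF w]] by blast
 have "sref_word js = w"
  using js(2) inv_sref_word[of js] sref_word_pword[of js] permutes_inv_inv[OF w]
  by (metis inv_unique_comp)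
 with js show "\<exists>js. set js <= {1..<n} \<and> sref_word js = w \<and> length js = length (canon n (pinv w))"
  by (auto simp: full_def)
next
 fix l assume "\<exists>js. set js <= {1..<n} \<and> sref_word js = w \<and> length js = l"
 thus "length (canon n (pinv w)) \<le> l"
  using length_canon_pword by (auto simp: inv_sref_word full_def)
qed

text \<open>Matsumoto's theorem for the products of the T_j. A suffix of a reduced word is reduced,
  so each letter raises the length and \<open>canon_up\<close> applies.\<close>

lemma Tprod_reduced:
 assumes "set js <= full n" and "length js = length (canon n (pword js))"
 shows "cong_mod (rels q N (full n)) (Tprod js) (Tprod (canon n (pword js)))"
 using assms
proof (induction js)
 case (Cons j js)
 have p: "pword js permutes {1..n}" by (rule pword_permutes) (use Cons in simp)
 have j: "j \<in> full n" using Cons by simp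
 have le: "length (canon n (pword js)) \<le> length js" using length_canon_pword Cons by simp
 have asc: "pword js j < pword js (j + 1)"
 proof (rule ccontr)
  assume "\<not> ?thesis"
  moreover have "pword js j ~= pword js (j + 1)" using permutes_inj[OF p] by (simp add: inj_eq)
  ultimately have "(pword js \<circ> sref j) j < (pword js \<circ> sref j) (j + 1)" by simp
  from length_canon_step[OF perm_sref[OF p j] j this] show False
   using Cons.prems(2) le unfolding pword_simps sref_sref by simp
 qed
 have "length js = length (canon n (pword js))"
  using Cons.prems(2) unfolding pword_simps length_canon_step[OF p j asc] by simp
 hence "cong_mod (rels q N (full n)) (Tprod js) (Tprod (canon n (pword js)))"
  using Cons by simp
 hence "cong_mod (rels q N (full n)) (Tg j * Tprod js) (Tg j * Tprod (canon n (pword js)))"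
  by (rule cong_mod_mult_left)
 also have "cong_mod (rels q N (full n)) \<dots> (Tprod (canon n (pword js \<circ> sref j)))"
  by (rule canon_up[OF p j asc j set_canon[OF p]])
 finally show ?case by (simp add: comp_def)
qed (simp add: canon_id)

text \<open>A reduced word may also be extended at its right end, where \<open>canon\<close> has no
  recursion; \<open>Tprod_reduced\<close> identifies the extended word with the canonical
  one.\<close>

lemma canon_right:
 assumes p: "p permutes {1..n}" and a: "a \<in> full n"
  and len: "length (canon n (sref a \<circ> p)) = Suc (length (canon n p))"
 shows "cong_mod (rels q N (full n)) (Tprod (canon n p) * Tg a) (Tprod (canon n (sref a \<circ> p)))"
proof -
 obtain js where js: "set js <= full n" "pword js = p" "length js = length (canon n p)"
  using reduced_word_exists[OF p] by blast
 have "cong_mod (rels q N (full n)) (Tprod (canon n p) * Tg a) (Tprod js * Tg a)"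
  using Tprod_reduced[of js n q N] js by (intro cong_mod_mult_right cong_mod_sym[of _ "Tprod js"]) auto
 also have "Tprod js * Tg a = Tprod (js @ [a])" by simp
 also have "cong_mod (rels q N (full n)) \<dots> (Tprod (canon n (pword (js @ [a]))))"
  by (rule Tprod_reduced) (use js a len in "auto simp: pword_snoc")
 finally show ?thesis by (simp add: pword_snoc js)
qed

section \<open>Blocks and labellings\<close>

lemma offset_0 [simp]: "offset ns 0 = 0"
 by (simp add: offset_def)

lemma offset_Suc: "k < length ns ==> offset ns (Suc k) = offset ns k + ns ! k"
 by (simp add: offset_def take_Suc_conv_app_nth)

lemma offset_length: "offset ns (length ns) = sum_list ns"
 by (simp add: offset_def)

lemma offset_mono: "k \<le> l ==> l \<le> length ns ==> offset ns k \<le> offset ns l"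
proof (induction l)
 case (Suc l)
 thus ?case using offset_Suc[of l ns] by (cases "k = Suc l") auto
qed simp

lemma block_le: "k < length ns ==> l < length ns ==> k < l ==> a \<in> block ns k ==> b \<in> block ns l ==> a < b"
 using offset_mono[of "Suc k" l ns] offset_Suc[of k ns] by (auto simp: block_def)

lemma block_unique: "k < length ns ==> l < length ns ==> a \<in> block ns k ==> a \<in> block ns l ==> k = l"
 using block_le[of k ns l a a] block_le[of l ns k a a] by (metis less_irrefl nat_neq_iff)

lemma block_subset: "k < length ns ==> block ns k <= {1..sum_list ns}"
 using offset_mono[of "Suc k" "length ns" ns] offset_Suc[of k ns] by (auto simp: block_def offset_length)

lemma block_cover: "j \<in> {1..sum_list ns} ==> \<exists>k<length ns. j \<in> block ns k"
proof -
 assume j: "j \<in> {1..sum_list ns}"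
 have "l \<le> length ns ==> j \<le> offset ns l ==> \<exists>k<l. j \<in> block ns k" for l
 proof (induction l)
  case (Suc l)
  show ?case
  proof (cases "j \<le> offset ns l")
   case True
   thus ?thesis using Suc less_SucI by (meson Suc_leD)
  next
   case False
   thus ?thesis using Suc.prems offset_Suc[of l ns] by (intro exI[of _ l]) (auto simp: block_def)
  qed
 qed (use j in simp)
 from this[of "length ns"] j show ?thesis by (auto simp: offset_length)
qed

lemma block_index_eq: "k < length ns ==> j \<in> block ns k ==> block_index ns j = k"
 unfolding block_index_def using block_unique by blast

lemma block_index_in:
 assumes "j \<in> {1..sum_list ns}"
 shows "block_index ns j < length ns" "j \<in> block ns (block_index ns j)"
 using block_cover[OF assms] block_index_eq by auto

lemma lev_eq: "lev ns = {j \<in> full (sum_list ns). \<exists>k<length ns. j \<in> block ns k \<and> j + 1 \<in> block ns k}"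
proof (intro equalityI subsetI)
 fix j assume "j \<in> lev ns"
 hence j: "j \<in> full (sum_list ns)" and p: "\<forall>k<length ns. sref j ` block ns k = block ns k"
  by (auto simp: lev_def parabolic_def)
 then obtain k where "k < length ns" "j \<in> block ns k" using block_cover[of j ns] by auto
 moreover from this have "sref j j \<in> block ns k" using p by (metis imageI)
 ultimately show "j \<in> {j \<in> full (sum_list ns). \<exists>k<length ns. j \<in> block ns k \<and> j + 1 \<in> block ns k}"
  using j by auto
next
 fix j assume "j \<in> {j \<in> full (sum_list ns). \<exists>k<length ns. j \<in> block ns k \<and> j + 1 \<in> block ns k}"
 then obtain k where j: "j \<in> full (sum_list ns)" and k: "k < length ns" "j \<in> block ns k" "j + 1 \<in> block ns k" by blast
 have "sref j ` block ns l = block ns l" if l: "l < length ns" for l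
 proof (rule transpose_image_eq)
  show "(j \<in> block ns l) = (Suc j \<in> block ns l)"
   using block_unique[OF k(1) l, of j] block_unique[OF k(1) l, of "j + 1"] k by auto
 qed
 thus "j \<in> lev ns" using j sref_permutes[OF j] by (auto simp: lev_def parabolic_def)
qed

definition apart :: "nat list => nat => nat => bool" where
 "apart ns a b \<longleftrightarrow> a \<in> {1..sum_list ns} \<and> b \<in> {1..sum_list ns} \<and> block_index ns a ~= block_index ns b"

lemma apart_sym: "apart ns a b ==> apart ns b a"
 by (auto simp: apart_def)

lemma lev_block_index:
 "j \<in> lev ns \<longleftrightarrow> j \<in> full (sum_list ns) \<and> block_index ns j = block_index ns (j + 1)"
proof (cases "j \<in> full (sum_list ns)")
 case True
 hence j: "j \<in> {1..sum_list ns}" "j + 1 \<in> {1..sum_list ns}" by auto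
 have "block_index ns j = block_index ns (j + 1) \<longleftrightarrow> (\<exists>k<length ns. j \<in> block ns k \<and> j + 1 \<in> block ns k)"
  using block_index_in[OF j(1)] block_index_in[OF j(2)] block_index_eq by metis
 with True show ?thesis unfolding lev_eq by blast
qed (auto simp: lev_eq)

text \<open>A labelling lists the blocks in some order, block \<open>k\<close> occurring \<open>ns ! k\<close> times. Labellings index
 the cosets of the parabolic subgroup, \<open>lpos ns l\<close> being the inverse of the minimal representative:
 it sends the \<open>r\<close>-th occurrence of \<open>k\<close> to the \<open>r\<close>-th element of block \<open>k\<close>.\<close>

definition labellings :: "nat list => (nat => nat) set" where
 "labellings ns = {l \<in> {1..sum_list ns} \<rightarrow>\<^sub>E {..<length ns}.
   \<forall>k<length ns. card {j \<in> {1..sum_list ns}. l j = k} = ns ! k}"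

definition lpos :: "nat list => (nat => nat) => nat => nat" where
 "lpos ns l j = (if j \<in> {1..sum_list ns} then offset ns (l j) + card {i \<in> {1..j}. l i = l j} else j)"

definition base_label :: "nat list => nat => nat" where
 "base_label ns = restrict (block_index ns) {1..sum_list ns}"

lemma finite_labellings [simp]: "finite (labellings ns)"
proof (rule finite_subset)
 show "labellings ns <= {1..sum_list ns} \<rightarrow>\<^sub>E {..<length ns}" by (auto simp: labellings_def)
qed (intro finite_PiE, auto)

lemma labellings_less: "l \<in> labellings ns ==> j \<in> {1..sum_list ns} ==> l j < length ns"
 by (auto simp: labellings_def)

lemma lpos_block:
 assumes l: "l \<in> labellings ns" and j: "j \<in> {1..sum_list ns}"
 shows "lpos ns l j \<in> block ns (l j)"
proof -
 have "card {i \<in> {1..j}. l i = l j} \<le> card {i \<in> {1..sum_list ns}. l i = l j}"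
  using j by (intro card_mono) auto
 also have "\<dots> = ns ! (l j)" using l labellings_less[OF l j] by (auto simp: labellings_def)
 finally have "card {i \<in> {1..j}. l i = l j} \<le> ns ! (l j)" .
 moreover have "0 < card {i \<in> {1..j}. l i = l j}" using j by (auto simp: card_gt_0_iff)
 ultimately show ?thesis using j unfolding lpos_def block_def by auto
qed

lemma block_index_lpos: "l \<in> labellings ns ==> j \<in> {1..sum_list ns} ==> block_index ns (lpos ns l j) = l j"
 using block_index_eq lpos_block labellings_less by blast

lemma lpos_in: "l \<in> labellings ns ==> j \<in> {1..sum_list ns} ==> lpos ns l j \<in> {1..sum_list ns}"
 using lpos_block labellings_less block_subset by blast

lemma lpos_strict:
 assumes "i \<in> {1..sum_list ns}" and "j \<in> {1..sum_list ns}" and "i < j" and "l i = l j"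
 shows "lpos ns l i < lpos ns l j"
proof -
 have "{r \<in> {1..i}. l r = l i} <= {r \<in> {1..j}. l r = l j}"
  "j \<in> {r \<in> {1..j}. l r = l j}" "j \<notin> {r \<in> {1..i}. l r = l i}" using assms by auto
 hence "{r \<in> {1..i}. l r = l i} \<subset> {r \<in> {1..j}. l r = l j}" by blast
 hence "card {r \<in> {1..i}. l r = l i} < card {r \<in> {1..j}. l r = l j}" by (intro psubset_card_mono) auto
 thus ?thesis using assms by (simp add: lpos_def)
qed

lemma lpos_inj:
 assumes l: "l \<in> labellings ns" and "i \<in> {1..sum_list ns}" and "j \<in> {1..sum_list ns}" and "lpos ns l i = lpos ns l j"
 shows "i = j"
proof -
 have "l i = l j" using block_index_lpos[OF l] assms by metis
 thus ?thesis
  using lpos_strict[of i ns j l] lpos_strict[of j ns i l] assms by (metis less_irrefl nat_neq_iff)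
qed

lemma lpos_permutes: "l \<in> labellings ns ==> lpos ns l permutes {1..sum_list ns}"
proof (rule bij_imp_permutes)
 assume l: "l \<in> labellings ns"
 have "inj_on (lpos ns l) {1..sum_list ns}" using lpos_inj[OF l] by (auto intro: inj_onI)
 moreover have "lpos ns l ` {1..sum_list ns} <= {1..sum_list ns}" using lpos_in[OF l] by blast
 ultimately show "bij_betw (lpos ns l) {1..sum_list ns} {1..sum_list ns}"
  by (simp add: bij_betw_def endo_inj_surj)
 show "lpos ns l x = x" if "x \<notin> {1..sum_list ns}" for x using that by (auto simp: lpos_def)
qed

lemma lpos_same:
 assumes "j \<in> full (sum_list ns)" and "l j = l (j + 1)"
 shows "lpos ns l (j + 1) = lpos ns l j + 1"
proof -
 have "{i \<in> {1..j + 1}. l i = l (j + 1)} = insert (j + 1) {i \<in> {1..j}. l i = l j}"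
  using assms by (auto simp: le_Suc_eq)
 thus ?thesis using assms by (simp add: lpos_def)
qed

lemma lpos_less: "l \<in> labellings ns ==> j \<in> full (sum_list ns) ==> l j \<le> l (j + 1) ==> lpos ns l j < lpos ns l (j + 1)"
 using lpos_same[of j ns l] lpos_block[of l ns j] lpos_block[of l ns "j + 1"] labellings_less[of l ns]
  block_le[of "l j" ns "l (j + 1)" "lpos ns l j" "lpos ns l (j + 1)"]
 by (cases "l j = l (j + 1)") auto

lemma lpos_greater: "l \<in> labellings ns ==> j \<in> full (sum_list ns) ==> l (j + 1) < l j ==> lpos ns l (j + 1) < lpos ns l j"
 using lpos_block[of l ns j] lpos_block[of l ns "j + 1"] labellings_less[of l ns]
  block_le[of "l (j + 1)" ns "l j" "lpos ns l (j + 1)" "lpos ns l j"]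
 by auto

lemma lpos_lev:
 assumes "l \<in> labellings ns" and "j \<in> full (sum_list ns)" and "l j = l (j + 1)"
 shows "lpos ns l j \<in> lev ns"
proof -
 have j: "j \<in> {1..sum_list ns}" "j + 1 \<in> {1..sum_list ns}" using assms by auto
 show ?thesis
  using lpos_in[OF assms(1) j(1)] lpos_in[OF assms(1) j(2)] block_index_lpos[OF assms(1) j(1)]
   block_index_lpos[OF assms(1) j(2)] lpos_same[of j ns l] assms
  by (simp add: lev_block_index)
qed

lemma lpos_apart:
 assumes "l \<in> labellings ns" and "i \<in> {1..sum_list ns}" and "j \<in> {1..sum_list ns}"
 shows "apart ns (lpos ns l i) (lpos ns l j) \<longleftrightarrow> l i ~= l j"
 using lpos_in[OF assms(1,2)] lpos_in[OF assms(1,3)] block_index_lpos[OF assms(1,2)] block_index_lpos[OF assms(1,3)]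
 by (simp add: apart_def)

lemma labellings_sref:
 assumes l: "l \<in> labellings ns" and j: "j \<in> full (sum_list ns)"
 shows "l \<circ> sref j \<in> labellings ns"
proof -
 let ?n = "sum_list ns"
 have "card {i \<in> {1..?n}. (l \<circ> sref j) i = k} = card {i \<in> {1..?n}. l i = k}" for k
 proof -
  have "{i \<in> {1..?n}. l i = k} = sref j ` {i \<in> {1..?n}. (l \<circ> sref j) i = k}"
  proof (intro equalityI subsetI)
   fix i assume "i \<in> {i \<in> {1..?n}. l i = k}"
   moreover have "sref j i \<in> {1..?n} \<longleftrightarrow> i \<in> {1..?n}" by (rule permutes_in_image[OF sref_permutes[OF j]])
   ultimately show "i \<in> sref j ` {i \<in> {1..?n}. (l \<circ> sref j) i = k}"
    by (intro image_eqI[of _ _ "sref j i"]) auto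
  next
   fix i assume "i \<in> sref j ` {i \<in> {1..?n}. (l \<circ> sref j) i = k}"
   then obtain r where "i = sref j r" "r \<in> {1..?n}" "l (sref j r) = k" by auto
   thus "i \<in> {i \<in> {1..?n}. l i = k}" using permutes_in_image[OF sref_permutes[OF j], of r] by simp
  qed
  thus ?thesis by (simp add: card_image)
 qed
 moreover have "l \<circ> sref j \<in> {1..?n} \<rightarrow>\<^sub>E {..<length ns}"
 proof (rule PiE_I)
  fix i assume "i \<in> {1..?n}"
  hence "sref j i \<in> {1..?n}" using permutes_in_image[OF sref_permutes[OF j]] by blast
  thus "(l \<circ> sref j) i \<in> {..<length ns}" using labellings_less[OF l] by simp
 next
  fix i assume "i \<notin> {1..?n}"
  moreover from this have "sref j i = i" using sref_permutes[OF j] by (simp add: permutes_def)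
  ultimately show "(l \<circ> sref j) i = undefined" using l by (auto simp: labellings_def PiE_def extensional_def)
 qed
 ultimately show ?thesis using l by (auto simp: labellings_def)
qed

lemma label_sref_same: "l j = l (j + 1) ==> l \<circ> sref j = l"
 by (auto simp: fun_eq_iff transpose_def)

text \<open>Exchanging two neighbours with different labels leaves the rank of every entry among the
  entries with its label unchanged.\<close>

lemma lpos_sref:
 assumes j: "j \<in> full (sum_list ns)" and ne: "l j ~= l (j + 1)"
 shows "lpos ns (l \<circ> sref j) = lpos ns l \<circ> sref j"
proof
 fix i
 let ?n = "sum_list ns"
 have inn: "sref j i \<in> {1..?n} \<longleftrightarrow> i \<in> {1..?n}" by (rule permutes_in_image[OF sref_permutes[OF j]])
 show "lpos ns (l \<circ> sref j) i = (lpos ns l \<circ> sref j) i"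
 proof (cases "i \<in> {1..?n}")
  case False
  hence "sref j i = i" using sref_permutes[OF j] by (simp add: permutes_def)
  with False show ?thesis by (auto simp: lpos_def)
 next
  case True
  have "card {r \<in> {1..i}. (l \<circ> sref j) r = (l \<circ> sref j) i} =
    card (sref j ` {r \<in> {1..i}. (l \<circ> sref j) r = (l \<circ> sref j) i})"
   by (simp add: card_image)
  also have "sref j ` {r \<in> {1..i}. (l \<circ> sref j) r = (l \<circ> sref j) i} = {r \<in> sref j ` {1..i}. l r = l (sref j i)}"
   by auto
  also have "\<dots> = {r \<in> {1..sref j i}. l r = l (sref j i)}"
  proof -
   consider "i = j" | "i = Suc j" | "i < j" | "Suc j < i" by linarith
   thus ?thesis
   proof cases
    case 1
    have "sref j ` {1..j} = {1..<j} \<union> {Suc j}"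
    proof -
     have "{1..j} = insert j {1..<j}" using j by auto
     hence "sref j ` {1..j} = insert (sref j j) (sref j ` {1..<j})" by simp
     also have "sref j ` {1..<j} = {1..<j}" by (rule transpose_image_eq) auto
     finally show ?thesis by auto
    qed
    thus ?thesis using 1 ne j by (auto simp: le_Suc_eq)
   next
    case 2
    have "sref j ` {1..Suc j} = {1..Suc j}" by (rule transpose_image_eq) (use j in auto)
    thus ?thesis using 2 ne by (auto simp: le_Suc_eq)
   next
    case 3
    hence "sref j ` {1..i} = {1..i}" by (intro transpose_image_eq) auto
    thus ?thesis using 3 by simp
   next
    case 4
    hence "sref j ` {1..i} = {1..i}" by (intro transpose_image_eq) (use j in auto)
    thus ?thesis using 4 by simp
   qed
  qed
  finally show ?thesis using True inn by (simp add: lpos_def)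
 qed
qed

lemma base_label_labelling: "base_label ns \<in> labellings ns"
proof -
 have "{j \<in> {1..sum_list ns}. base_label ns j = k} = block ns k" if "k < length ns" for k
  using that block_index_in[of _ ns] block_index_eq[of k ns] block_subset[of k ns]
  by (auto simp: base_label_def)
 thus ?thesis using block_index_in by (auto simp: labellings_def base_label_def block_def)
qed

lemma lpos_id_imp_base:
 assumes "l \<in> labellings ns" and "lpos ns l = id"
 shows "l = base_label ns"
proof
 fix j show "l j = base_label ns j"
  using assms block_index_lpos[of l ns j]
  by (cases "j \<in> {1..sum_list ns}") (auto simp: base_label_def labellings_def PiE_def extensional_def)
qed

lemma lpos_base: "lpos ns (base_label ns) = id"
proof (rule increasing_permutation_id[OF lpos_permutes[OF base_label_labelling]])
 fix j assume j: "j \<in> full (sum_list ns)"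
 hence jn: "j \<in> {1..sum_list ns}" "j + 1 \<in> {1..sum_list ns}" by auto
 have "base_label ns j \<le> base_label ns (j + 1)"
 proof (rule ccontr)
  assume "\<not> ?thesis"
  hence "block_index ns (j + 1) < block_index ns j" using jn by (simp add: base_label_def)
  hence "j + 1 < j"
   using block_le block_index_in[OF jn(1)] block_index_in[OF jn(2)] by blast
  thus False by simp
 qed
 thus "lpos ns (base_label ns) j < lpos ns (base_label ns) (j + 1)"
  by (rule lpos_less[OF base_label_labelling j])
qed

lemma label_descent:
 assumes l: "l \<in> labellings ns" and ne: "l ~= base_label ns"
 shows "\<exists>j\<in>full (sum_list ns). l (j + 1) < l j"
proof -
 have "lpos ns l ~= id" using lpos_id_imp_base[OF l] ne by blast
 then obtain j where j: "j \<in> full (sum_list ns)" "lpos ns l (j + 1) < lpos ns l j"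
  using descent_exists[OF lpos_permutes[OF l]] by blast
 thus ?thesis using lpos_less[OF l j(1)] by (intro bexI[of _ j]) (auto simp: not_le[symmetric])
qed

text \<open>The induction principle follows a reduced word of the coset representative.\<close>

lemma labelling_induct [consumes 1, case_names base step]:
 assumes "l \<in> labellings ns"
  and base: "P (base_label ns)"
  and step: "!!l j. l \<in> labellings ns ==> j \<in> full (sum_list ns) ==> l j < l (j + 1) ==> P l ==> P (l \<circ> sref j)"
 shows "P l"
 using assms(1)
proof (induction "length (canon (sum_list ns) (lpos ns l))" arbitrary: l rule: less_induct)
 case less
 show ?case
 proof (cases "l = base_label ns")
  case True
  thus ?thesis using base by simp
 next
  case False
  then obtain j where j: "j \<in> full (sum_list ns)" "l (j + 1) < l j" using label_descent less.prems by blast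
  let ?m = "l \<circ> sref j"
  have m: "?m \<in> labellings ns" "?m j < ?m (j + 1)" using labellings_sref less.prems j by auto
  have bk: "?m \<circ> sref j = l" by (rule sref_sref)
  have "lpos ns l = lpos ns ?m \<circ> sref j" using lpos_sref[of j ns ?m] j m(2) unfolding bk by simp
  hence "length (canon (sum_list ns) (lpos ns l)) = Suc (length (canon (sum_list ns) (lpos ns ?m)))"
   using length_canon_step[OF lpos_permutes[OF m(1)] j(1)] lpos_less[OF m(1) j(1)] m(2) by auto
  hence "P ?m" using less.hyps m(1) by simp
  from step[OF m(1) j(1) m(2) this] show ?thesis unfolding bk .
 qed
qed

section \<open>The function model: its coefficients, their identities, and the Hecke
  relations\<close>

section \<open>Congruence modulo the annihilator\<close>

context free_action
begin

definition ann :: "hgen free set" where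
 "ann = {a. \<forall>x\<in>carrier M. act a x = \<zero>}"

text \<open>Equality of operators on the module. It is coarser than congruence modulo relations that
  act by zero, and differences of variables can become invertible for it.\<close>

definition sim :: "hgen free => hgen free => bool" where
 "sim a b \<longleftrightarrow> (\<forall>x\<in>carrier M. act a x = act b x)"

lemma simD: "sim a b ==> x \<in> carrier M ==> act a x = act b x"
 by (simp add: sim_def)

lemma sim_iff: "sim a b \<longleftrightarrow> a - b \<in> ann"
proof -
 have "act a x = act b x \<longleftrightarrow> act (a - b) x = \<zero>" if "x \<in> carrier M" for x
  using that act_add[of x "a - b" b] by (auto simp: act_diff a_minus_def r_neg)
 thus ?thesis unfolding sim_def ann_def by auto
qed

lemma sim_refl [simp]: "sim a a"
 by (simp add: sim_def)

lemma sim_sym: "sim a b ==> sim b a"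
 by (simp add: sim_def)

lemma sim_trans [trans]: "sim a b ==> sim b c ==> sim a c"
 by (simp add: sim_def)

lemma sim_eq_trans [trans]: "a = b ==> sim b c ==> sim a c" "sim a b ==> b = c ==> sim a c"
 by simp_all

lemma sim_add: "sim a b ==> sim c d ==> sim (a + c) (b + d)"
 by (simp add: sim_def act_add)

lemma sim_uminus: "sim a b ==> sim (- a) (- b)"
 by (simp add: sim_def act_uminus)

lemma sim_diff: "sim a b ==> sim c d ==> sim (a - c) (b - d)"
 by (simp add: sim_def act_diff)

lemma sim_mult: "sim a b ==> sim c d ==> sim (a * c) (b * d)"
 by (simp add: sim_def act_mult)

lemma sim_cong_mod: "kills R ==> cong_mod R a b ==> sim a b"
 by (simp add: sim_def act_cong)

lemma ann_add: "a \<in> ann ==> b \<in> ann ==> a + b \<in> ann"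
 and ann_diff: "a \<in> ann ==> b \<in> ann ==> a - b \<in> ann"
 and ann_uminus: "a \<in> ann ==> - a \<in> ann"
 and ann_lmult: "a \<in> ann ==> u * a \<in> ann"
 and ann_rmult: "a \<in> ann ==> a * u \<in> ann"
 by (simp_all add: ann_def act_add act_diff act_uminus act_mult a_minus_def)

end

text \<open>To be read with t = T_a, P = \<alpha>(a, c), P' = \<alpha>(a+1, c) and k = q - 1, so
  that k - P and k - P' are \<alpha>(c, a) and \<alpha>(c, a+1). Each left-hand side compares the
  two sides of the braid relation at one labelling; the right-hand side writes the difference in
  terms of r1, ..., r4, which act by zero. The commutation rules for k are stated twice so that
  \<open>algebra_simps\<close> can move k through longer products.\<close>

lemma braid_combinations:
 fixes t P P' k :: "'a::ring_1"
 assumes [simp]: "P * k = k * P" "P' * k = k * P'" "t * k = k * t"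
  "!!z. P * (k * z) = k * (P * z)" "!!z. P' * (k * z) = k * (P' * z)" "!!z. t * (k * z) = k * (t * z)"
 assumes r1: "r1 = t * P - P' * t - P * (k - P')" and r2: "r2 = t * P' - P * t + P * (k - P')"
  and r3: "r3 = t * t - (k * t + (1 + k))" and r4: "r4 = P * P' - P' * P"
 shows "t * P' * t - (P' * t * P' + (- 1 - P') * P * (- 1 - (k - P'))) = r2 * t + P * r3 - P' * r2 + r4 * t + r4"
  and "t * (- 1 - P') * P - (P' * t * (- 1 - P') + (- 1 - P') * P * (k - P')) =
   - r1 - r2 * P - P * r1 + P' * r2 - r4 * t + P * r4"
  and "t * (- 1 - P') * (- 1 - P) - (- 1 - P') * (- 1 - P) * t =
   r1 + r2 + r2 * P + P * r1 + r4 * t - P * r4"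
  and "(k - P) * t * (k - P) + (- 1 - (k - P)) * (k - P') * (- 1 - P) - t * (k - P) * t =
   - ((k - P) * r1) + r1 * t - (k - P') * r3 + r4 + (k - P) * r4"
  and "(k - P) * t * (- 1 - (k - P)) + (- 1 - (k - P)) * (k - P') * P - t * (- 1 - (k - P)) * (k - P') =
   - (- ((k - P) * r1) + r2 + r1 * (k - P') + (k - P') * r2 + r4 * t + (k - P) * r4 + r4 - r4 * (k - P'))"
  and "(- 1 - (k - P)) * (- 1 - (k - P')) * t - t * (- 1 - (k - P)) * (- 1 - (k - P')) =
   - (- r1 - r2 - r1 * (k - P') - (k - P') * r2 - r4 * t + r4 * (k - P'))"
  and "P * (k - P') * P + (- 1 - P) * t * (- 1 - (k - P)) -
    ((k - P') * P * (k - P') + (- 1 - (k - P')) * t * (- 1 - P')) =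
   - ((1 + P) * r1) - (1 + (k - P')) * r2 - r4 * t + P * r4"
  and "P * (k - P') * (- 1 - P) + (- 1 - P) * t * (k - P) - (k - P') * (- 1 - P) * t =
   - (- ((1 + P) * r1) + P * r4 - r4 * t)"
  and "P * (- 1 - (k - P')) * t - ((k - P') * P * (- 1 - (k - P')) + (- 1 - (k - P')) * t * P') =
   (1 + (k - P')) * r2 + r4 * t + r4"
 unfolding r1 r2 r3 r4 by (simp_all add: algebra_simps)

abbreviation Ag :: "laurent => hgen free" where
 "Ag f \<equiv> fgen (GA f)"

locale hecke_action = free_action M act for M :: "('s, 'b) module" and act +
 fixes q n :: nat and J :: "nat set"
 assumes killed: "kills (rels q n J)"
begin

lemma Ag_const: "sim (Ag (lconst c)) (fconst c)"
 using sim_cong_mod[OF killed] rels_const[of c q n J] by (auto simp: cong_mod_def intro: tideal_incl)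

lemma Ag_add: "f \<in> \<A> n ==> g \<in> \<A> n ==> sim (Ag (f + g)) (Ag f + Ag g)"
 using sim_cong_mod[OF killed] rels_add[of f n g q J] by (auto simp: cong_mod_def intro: tideal_incl)

lemma Ag_mult: "f \<in> \<A> n ==> g \<in> \<A> n ==> sim (Ag (f * g)) (Ag f * Ag g)"
 using sim_cong_mod[OF killed] rels_mult[of f n g q J] by (auto simp: cong_mod_def intro: tideal_incl)

lemma Ag_comm: "f \<in> \<A> n ==> g \<in> \<A> n ==> sim (Ag f * Ag g) (Ag g * Ag f)"
 using Ag_mult[of f g] Ag_mult[of g f] by (metis mult.commute sim_sym sim_trans)

lemma Ag_zero: "sim (Ag 0) 0"
 using Ag_const[of 0] by simp

lemma Ag_one: "sim (Ag 1) 1"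
 using Ag_const[of 1] by simp

lemma Ag_uminus: "f \<in> \<A> n ==> sim (Ag (- f)) (- Ag f)"
proof -
 assume f: "f \<in> \<A> n"
 have "sim (Ag (- f) + Ag f) 0"
  using Ag_add[of "- f" f] f Ag_zero by (simp add: sim_def)
 from sim_diff[OF this sim_refl[of "Ag f"]] show ?thesis by simp
qed

lemma Ag_diff: "f \<in> \<A> n ==> g \<in> \<A> n ==> sim (Ag (f - g)) (Ag f - Ag g)"
 using Ag_add[of f "- g"] sim_add[OF sim_refl[of "Ag f"] Ag_uminus[of g]] sim_trans by fastforce

lemma cross:
 assumes "a \<in> J" and "f \<in> \<A> n" and "e \<in> \<A> n"
  and "lrename (sref a) f = f'" and "e * (lvar a - lvar (a + 1)) = f - f'" and "J <= full n"
 shows "sim (Tg a * Ag f) (Ag f' * Tg a + Ag (lconst (of_nat q - 1) * (lvar a * e)))"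
proof -
 have a: "lvar a \<in> \<A> n" using assms(1,6) by auto
 have "sim (Tg a * Ag f) (Ag f' * Tg a + fconst (of_nat q - 1) * Ag (lvar a * e))"
  using sim_cong_mod[OF killed] rels_cross[of a J f n e q] assms
  by (auto simp: cong_mod_def algebra_simps intro: tideal_incl)
 also have "sim \<dots> (Ag f' * Tg a + Ag (lconst (of_nat q - 1) * (lvar a * e)))"
  by (intro sim_add sim_refl sim_sym[OF sim_trans[OF Ag_mult sim_mult[OF Ag_const sim_refl]]])
   (use a assms in auto)
 finally show ?thesis .
qed

lemma Tg_quad_sim: "a \<in> J ==> sim (Tg a * Tg a) (fconst (of_nat q - 1) * Tg a + fconst (of_nat q))"
 by (rule sim_cong_mod[OF killed Tg_quad])

end

text \<open>\<open>g a b\<close> and \<open>h a b\<close> stand for the inverses of x_a - x_b and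
  x_a - q x_b. They are Laurent polynomials, not operators, so that the coefficients built from them
  are letters of the algebra and can be renamed.\<close>

locale label_model = hecke_action M act q "sum_list ns" "lev ns"
 for M :: "('s, 'b) module" (structure) and act and q :: nat and ns :: "nat list" +
 fixes g h :: "nat => nat => laurent"
 assumes g_laurent: "apart ns a b ==> g a b \<in> \<A> (sum_list ns)"
  and g_inverse: "apart ns a b ==> sim (Ag ((lvar a - lvar b) * g a b)) 1"
  and h_laurent: "apart ns a b ==> h a b \<in> \<A> (sum_list ns)"
  and h_inverse: "apart ns a b ==> sim (Ag ((lvar a - lconst (of_nat q) * lvar b) * h a b)) 1"
begin

abbreviation n where "n \<equiv> sum_list ns"
abbreviation \<kappa> :: laurent where "\<kappa> \<equiv> lconst (of_nat q - 1)"
abbreviation K :: "hgen free" where "K \<equiv> fconst (of_nat q - 1)"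

text \<open>The fraction (q - 1) x_a / (x_a - x_b), the diagonal coefficient of T_j in a principal
  series.\<close>

definition al :: "nat => nat => laurent" where
 "al a b = \<kappa> * (lvar a * g a b)"

definition lsim :: "laurent => laurent => bool" where
 "lsim u v \<longleftrightarrow> u \<in> \<A> n \<and> v \<in> \<A> n \<and> sim (Ag u) (Ag v)"

lemma lsim_refl: "u \<in> \<A> n ==> lsim u u"
 and lsim_sym: "lsim u v ==> lsim v u"
 and lsim_trans [trans]: "lsim u v ==> lsim v w ==> lsim u w"
 and lsim_sim: "lsim u v ==> sim (Ag u) (Ag v)"
 by (auto simp: lsim_def intro: sim_sym sim_trans)

lemma lsim_eq_trans [trans]: "u = v ==> lsim v w ==> lsim u w" "lsim u v ==> v = w ==> lsim u w"
 by simp_all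

lemma lsim_add: "lsim u v ==> lsim w z ==> lsim (u + w) (v + z)"
 unfolding lsim_def using Ag_add[of u w] Ag_add[of v z] sim_add[of "Ag u" "Ag v" "Ag w" "Ag z"]
 by (auto intro: sim_sym sim_trans)

lemma lsim_mult: "lsim u v ==> lsim w z ==> lsim (u * w) (v * z)"
 unfolding lsim_def using Ag_mult[of u w] Ag_mult[of v z] sim_mult[of "Ag u" "Ag v" "Ag w" "Ag z"]
 by (auto intro: sim_sym sim_trans)

lemma lsim_lmult: "w \<in> \<A> n ==> lsim u v ==> lsim (w * u) (w * v)"
 by (rule lsim_mult[OF lsim_refl])

lemma lsim_rmult: "lsim u v ==> w \<in> \<A> n ==> lsim (u * w) (v * w)"
 by (rule lsim_mult[OF _ lsim_refl])

lemma lsim_uminus: "lsim u v ==> lsim (- u) (- v)"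
 using lsim_lmult[of "- 1" u v] by simp

lemma lsim_diff: "lsim u v ==> lsim w z ==> lsim (u - w) (v - z)"
 using lsim_add[of u v "- w" "- z"] lsim_uminus[of w z] by simp

lemma lsim_zeroD: "lsim (u - v) 0 ==> v \<in> \<A> n ==> lsim u v"
 using lsim_add[of "u - v" 0 v v] lsim_refl[of v] by simp

lemma apart_lvar: "apart ns a b ==> lvar a \<in> \<A> n" "apart ns a b ==> lvar b \<in> \<A> n"
 by (auto simp: apart_def)

lemma dg: "apart ns a b ==> lsim ((lvar a - lvar b) * g a b) 1"
 using g_inverse[of a b] g_laurent[of a b] apart_lvar[of a b] sim_trans[OF _ sim_sym[OF Ag_one]]
 unfolding lsim_def by auto

lemma al_laurent: "apart ns a b ==> al a b \<in> \<A> n"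
 using g_laurent[of a b] apart_lvar[of a b] by (auto simp: al_def)

lemma cancel:
 assumes "apart ns a b" and "u \<in> \<A> n" and "v \<in> \<A> n"
  and "lsim ((lvar a - lvar b) * u) ((lvar a - lvar b) * v)"
 shows "lsim u v"
proof -
 have e: "lsim w (g a b * ((lvar a - lvar b) * w))" if "w \<in> \<A> n" for w
  using lsim_sym[OF lsim_rmult[OF dg[OF assms(1)] that]] by (simp add: algebra_simps)
 have "lsim u (g a b * ((lvar a - lvar b) * u))" by (rule e) fact
 also have "lsim \<dots> (g a b * ((lvar a - lvar b) * v))" by (rule lsim_lmult[OF g_laurent[OF assms(1)] assms(4)])
 also have "lsim \<dots> v" by (rule lsim_sym[OF e]) fact
 finally show ?thesis .
qed

lemma g_anti: assumes ab: "apart ns a b" shows "lsim (g b a) (- g a b)"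
proof (rule cancel[OF ab])
 have "(lvar a - lvar b) * g b a = - ((lvar b - lvar a) * g b a)" by (simp add: algebra_simps)
 also have "lsim \<dots> (- 1)" by (rule lsim_uminus[OF dg[OF apart_sym[OF ab]]])
 also have "lsim (- 1) (- ((lvar a - lvar b) * g a b))" by (rule lsim_uminus[OF lsim_sym[OF dg[OF ab]]])
 also have "- ((lvar a - lvar b) * g a b) = (lvar a - lvar b) * - g a b" by simp
 finally show "lsim ((lvar a - lvar b) * g b a) ((lvar a - lvar b) * - g a b)" .
qed (use g_laurent[OF ab] g_laurent[OF apart_sym[OF ab]] in auto)

lemma al_add: assumes ab: "apart ns a b" shows "lsim (al a b + al b a) \<kappa>"
proof -
 have "lsim (al a b + al b a) (al a b + \<kappa> * (lvar b * - g a b))"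
  unfolding al_def[of b a]
  by (intro lsim_add lsim_refl lsim_lmult g_anti al_laurent ab) (use apart_lvar[OF ab] in auto)
 also have "al a b + \<kappa> * (lvar b * - g a b) = \<kappa> * ((lvar a - lvar b) * g a b)"
  by (simp add: al_def algebra_simps)
 also have "lsim \<dots> (\<kappa> * 1)" by (rule lsim_lmult[OF _ dg[OF ab]]) simp
 finally show ?thesis by simp
qed

lemma al_neg: assumes ab: "apart ns a b" shows "lsim (al b a) (\<kappa> - al a b)"
 using lsim_diff[OF al_add[OF ab] lsim_refl[OF al_laurent[OF ab]]] by simp

text \<open>Partial fractions: 1/((x_a - x_b)(x_b - x_c)) is 1/(x_a - x_c) times the sum of 1/(x_a -
  x_b) and 1/(x_b - x_c). The term \<open>\<kappa>\<close> arises because \<alpha>(a, b) - \<kappa>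
  = \<kappa> x_b / (x_a - x_b).\<close>

lemma al_mult:
 assumes ab: "apart ns a b" and bc: "apart ns b c" and ac: "apart ns a c"
 shows "lsim (al a b * al b c) (al a c * (al a b + al b c - \<kappa>))"
proof -
 note L = g_laurent[OF ab] g_laurent[OF bc] g_laurent[OF ac] apart_lvar[OF ab] apart_lvar[OF bc]
 have key: "lsim (g a b * g b c) (g a c * (g a b + g b c))"
 proof (rule cancel[OF ac])
  have "(lvar a - lvar c) * (g a b * g b c) =
   ((lvar a - lvar b) * g a b) * g b c + ((lvar b - lvar c) * g b c) * g a b" by (simp add: algebra_simps)
  also have "lsim \<dots> (1 * g b c + 1 * g a b)"
   by (intro lsim_add lsim_rmult dg ab bc L)
  also have "1 * g b c + 1 * g a b = 1 * (g a b + g b c)" by simp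
  also have "lsim \<dots> (((lvar a - lvar c) * g a c) * (g a b + g b c))"
   by (intro lsim_rmult lsim_sym[OF dg[OF ac]]) (use L in auto)
  finally show "lsim ((lvar a - lvar c) * (g a b * g b c)) ((lvar a - lvar c) * (g a c * (g a b + g b c)))"
   by (simp add: mult.assoc)
 qed (use L in auto)
 have "lsim (al a c * (al a b + al b c - \<kappa>)) (al a c * (al b c - al b a))"
 proof (rule lsim_lmult[OF al_laurent[OF ac]])
  have "lsim (al b c - (\<kappa> - al a b)) (al b c - al b a)"
   by (rule lsim_diff[OF lsim_refl[OF al_laurent[OF bc]] lsim_sym[OF al_neg[OF ab]]])
  thus "lsim (al a b + al b c - \<kappa>) (al b c - al b a)" by (simp add: algebra_simps)
 qed
 also have "lsim (al a c * (al b c - al b a)) (al a c * (al b c - \<kappa> * (lvar b * - g a b)))"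
  unfolding al_def[of b a]
  by (intro lsim_lmult lsim_diff lsim_refl g_anti al_laurent ab bc ac L) auto
 also have "al a c * (al b c - \<kappa> * (lvar b * - g a b)) =
   (\<kappa> * \<kappa> * lvar a * lvar b) * (g a c * (g a b + g b c))"
  by (simp add: al_def algebra_simps)
 also have "lsim \<dots> ((\<kappa> * \<kappa> * lvar a * lvar b) * (g a b * g b c))"
  by (rule lsim_lmult[OF _ lsim_sym[OF key]]) (use L in auto)
 also have "(\<kappa> * \<kappa> * lvar a * lvar b) * (g a b * g b c) = al a b * al b c"
  by (simp add: al_def algebra_simps)
 finally show ?thesis by (rule lsim_sym)
qed

lemma sim_cancel:
 assumes ab: "apart ns a b" and "sim (Ag (lvar a - lvar b) * u) v"
 shows "sim u (Ag (g a b) * v)"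
proof -
 have "sim (1 * u) (Ag (g a b * (lvar a - lvar b)) * u)"
  using sim_mult[OF sim_sym[OF g_inverse[OF ab]] sim_refl[of u]] by (simp add: mult.commute)
 also have "sim \<dots> (Ag (g a b) * Ag (lvar a - lvar b) * u)"
  by (intro sim_mult Ag_mult sim_refl) (use g_laurent[OF ab] apart_lvar[OF ab] in auto)
 also have "sim \<dots> (Ag (g a b) * v)"
  unfolding mult.assoc by (intro sim_mult sim_refl assms)
 finally show ?thesis by simp
qed

lemma d_al: assumes ab: "apart ns a b" shows "sim (Ag (lvar a - lvar b) * Ag (al a b)) (Ag (\<kappa> * lvar a))"
proof -
 have "sim (Ag (lvar a - lvar b) * Ag (al a b)) (Ag ((lvar a - lvar b) * al a b))"
  by (rule sim_sym[OF Ag_mult]) (use al_laurent[OF ab] apart_lvar[OF ab] in auto)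
 also have "(lvar a - lvar b) * al a b = (\<kappa> * lvar a) * ((lvar a - lvar b) * g a b)"
  by (simp add: al_def algebra_simps)
 also have "sim (Ag \<dots>) (Ag (\<kappa> * lvar a * 1))"
  by (rule lsim_sim[OF lsim_lmult[OF _ dg[OF ab]]]) (use apart_lvar[OF ab] in auto)
 finally show ?thesis by simp
qed

lemma lev_apart: "a \<in> lev ns ==> apart ns a c \<longleftrightarrow> apart ns (a + 1) c"
 by (auto simp: apart_def lev_block_index)

text \<open>\<open>P\<close> stands for the quotient \<open>w / d\<close>, and \<open>G\<close> for the inverse of \<open>d'\<close>.\<close>

lemma T_quotient:
 assumes d: "sim (Tg a * Ag d) (Ag d' * Tg a + Ag e)" and w: "sim (Tg a * Ag w) (Ag w' * Tg a + Ag z)"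
  and P: "sim (Ag d * Ag P) (Ag w)" and G: "!!u v. sim (Ag d' * u) v ==> sim u (Ag G * v)"
  and lau: "e \<in> \<A> n" "w' \<in> \<A> n" "z \<in> \<A> n" "P \<in> \<A> n" "G \<in> \<A> n"
 shows "sim (Tg a * Ag P) (Ag (G * w') * Tg a + Ag (G * (z - e * P)))"
proof -
 \<comment> \<open>T d P is computed twice: by the rule for d, and, since d P = w, by the rule for
   w. What results is solved for T P by inverting d'.\<close>
 have "sim (Ag d' * (Tg a * Ag P)) ((Tg a * Ag d - Ag e) * Ag P)"
  unfolding mult.assoc[symmetric]
  by (intro sim_mult sim_refl) (use sim_diff[OF sim_sym[OF d] sim_refl[of "Ag e"]] in simp)
 also have "(Tg a * Ag d - Ag e) * Ag P = Tg a * (Ag d * Ag P) - Ag e * Ag P"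
  by (simp add: algebra_simps)
 also have "sim \<dots> (Tg a * Ag w - Ag e * Ag P)" by (intro sim_mult sim_diff sim_refl P)
 also have "sim \<dots> ((Ag w' * Tg a + Ag z) - Ag (e * P))"
  by (intro sim_diff w sim_sym[OF Ag_mult] lau)
 finally have "sim (Tg a * Ag P) (Ag G * ((Ag w' * Tg a + Ag z) - Ag (e * P)))" by (rule G)
 also have "\<dots> = (Ag G * Ag w') * Tg a + Ag G * (Ag z - Ag (e * P))" by (simp add: algebra_simps)
 also have "sim \<dots> (Ag (G * w') * Tg a + Ag (G * (z - e * P)))"
  by (intro sim_add sim_mult sim_refl sim_sym[OF Ag_mult] sim_sym[OF sim_trans[OF Ag_mult sim_mult[OF sim_refl Ag_diff]]])
   (use lau in auto)
 finally show ?thesis .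
qed

text \<open>\<open>T_quotient\<close> with numerator \<kappa> x_a and denominator x_a - x_c, which
  s_a turns into those of \<alpha>(a+1, c). The remainder becomes a product of two \<alpha>'s by
  \<open>al_neg\<close> and \<open>g_anti\<close>.\<close>

lemma T_al:
 assumes a: "a \<in> lev ns" and ac: "apart ns a c"
 shows "sim (Tg a * Ag (al a c)) (Ag (al (a + 1) c) * Tg a + Ag (al a c) * Ag (al c (a + 1)))"
proof -
 have a'c: "apart ns (a + 1) c" using lev_apart[OF a] ac by blast
 have c: "c ~= a" "c ~= a + 1" using ac a'c by (auto simp: apart_def)
 note L = g_laurent[OF ac] g_laurent[OF a'c] apart_lvar[OF ac] apart_lvar[OF a'c] al_laurent[OF ac] al_laurent[OF a'c]
 have 1: "sim (Tg a * Ag (lvar a - lvar c)) (Ag (lvar (a + 1) - lvar c) * Tg a + Ag (\<kappa> * (lvar a * 1)))"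
  by (rule cross[OF a]) (use L c lev_subset in "auto simp: lrename_diff")
 have 2: "sim (Tg a * Ag (\<kappa> * lvar a)) (Ag (\<kappa> * lvar (a + 1)) * Tg a + Ag (\<kappa> * (lvar a * \<kappa>)))"
  by (rule cross[OF a]) (use L lev_subset in "auto simp: lrename_mult right_diff_distrib")
 let ?Z = "\<kappa> * (lvar a * \<kappa>) - \<kappa> * (lvar a * 1) * al a c"
 have "sim (Tg a * Ag (al a c)) (Ag (g (a + 1) c * (\<kappa> * lvar (a + 1))) * Tg a + Ag (g (a + 1) c * ?Z))"
  by (rule T_quotient[OF 1 2 d_al[OF ac] sim_cancel[OF a'c]]) (use L in auto)
 also have "g (a + 1) c * (\<kappa> * lvar (a + 1)) = al (a + 1) c" by (simp add: al_def algebra_simps)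
 also have "sim (Ag (al (a + 1) c) * Tg a + Ag (g (a + 1) c * ?Z)) (Ag (al (a + 1) c) * Tg a + Ag (al a c * al c (a + 1)))"
 proof (intro sim_add sim_refl lsim_sim)
  have "g (a + 1) c * ?Z = (\<kappa> * lvar a * g (a + 1) c) * (\<kappa> - al a c)" by (simp add: algebra_simps)
  also have "lsim \<dots> ((\<kappa> * lvar a * g (a + 1) c) * al c a)"
   by (rule lsim_lmult[OF _ lsim_sym[OF al_neg[OF ac]]]) (use L in auto)
  also have "(\<kappa> * lvar a * g (a + 1) c) * al c a = (\<kappa> * \<kappa> * lvar a * lvar c) * (g (a + 1) c * g c a)"
   by (simp add: al_def algebra_simps)
  also have "lsim \<dots> ((\<kappa> * \<kappa> * lvar a * lvar c) * (- g c (a + 1) * - g a c))"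
   by (intro lsim_lmult lsim_mult g_anti apart_sym[OF a'c] ac) (use L in auto)
  also have "(\<kappa> * \<kappa> * lvar a * lvar c) * (- g c (a + 1) * - g a c) = al a c * al c (a + 1)"
   by (simp add: al_def algebra_simps)
  finally show "lsim (g (a + 1) c * ?Z) (al a c * al c (a + 1))" .
 qed
 also have "sim \<dots> (Ag (al (a + 1) c) * Tg a + Ag (al a c) * Ag (al c (a + 1)))"
  by (intro sim_add sim_refl Ag_mult al_laurent ac apart_sym[OF a'c])
 finally show ?thesis .
qed

lemma T_al':
 assumes a: "a \<in> lev ns" and ac: "apart ns a c"
 shows "sim (Tg a * Ag (al (a + 1) c)) (Ag (al a c) * Tg a - Ag (al a c) * Ag (al c (a + 1)))"
proof -
 have a'c: "apart ns (a + 1) c" using lev_apart[OF a] ac by blast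
 have c: "c ~= a" "c ~= a + 1" using ac a'c by (auto simp: apart_def)
 note L = g_laurent[OF ac] g_laurent[OF a'c] apart_lvar[OF ac] apart_lvar[OF a'c] al_laurent[OF ac] al_laurent[OF a'c]
 have 1: "sim (Tg a * Ag (lvar (a + 1) - lvar c)) (Ag (lvar a - lvar c) * Tg a + Ag (\<kappa> * (lvar a * - 1)))"
  by (rule cross[OF a]) (use L c lev_subset in "auto simp: lrename_diff")
 have 2: "sim (Tg a * Ag (\<kappa> * lvar (a + 1))) (Ag (\<kappa> * lvar a) * Tg a + Ag (\<kappa> * (lvar a * - \<kappa>)))"
  by (rule cross[OF a]) (use L lev_subset in "auto simp: lrename_mult right_diff_distrib")
 let ?Z = "\<kappa> * (lvar a * - \<kappa>) - \<kappa> * (lvar a * - 1) * al (a + 1) c"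
 have "sim (Tg a * Ag (al (a + 1) c)) (Ag (g a c * (\<kappa> * lvar a)) * Tg a + Ag (g a c * ?Z))"
  by (rule T_quotient[OF 1 2 d_al[OF a'c] sim_cancel[OF ac]]) (use L in auto)
 also have "g a c * (\<kappa> * lvar a) = al a c" by (simp add: al_def algebra_simps)
 also have "sim (Ag (al a c) * Tg a + Ag (g a c * ?Z)) (Ag (al a c) * Tg a + Ag (- (al a c * al c (a + 1))))"
 proof (intro sim_add sim_refl lsim_sim)
  have "g a c * ?Z = - (al a c * (\<kappa> - al (a + 1) c))" by (simp add: al_def[of a c] algebra_simps)
  also have "lsim \<dots> (- (al a c * al c (a + 1)))"
   by (intro lsim_uminus lsim_lmult lsim_sym[OF al_neg[OF a'c]] al_laurent ac)
  finally show "lsim (g a c * ?Z) (- (al a c * al c (a + 1)))" .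
 qed
 also have "sim \<dots> (Ag (al a c) * Tg a + - (Ag (al a c) * Ag (al c (a + 1))))"
  by (intro sim_add sim_refl sim_trans[OF Ag_uminus sim_uminus[OF Ag_mult]])
   (use al_laurent[OF apart_sym[OF a'c]] L in auto)
 finally show ?thesis by simp
qed

lemma T_al_far:
 assumes a: "a \<in> lev ns" and bc: "apart ns b c" and "b ~= a" "b ~= a + 1" "c ~= a" "c ~= a + 1"
 shows "sim (Tg a * Ag (al b c)) (Ag (al b c) * Tg a)"
proof -
 note L = g_laurent[OF bc] apart_lvar[OF bc] al_laurent[OF bc]
 have an: "lvar a \<in> \<A> n" using a lev_subset by fastforce
 have comm: "sim (Tg a * Ag f) (Ag f * Tg a)" if "f \<in> \<A> n" "lrename (sref a) f = f" for f
 proof -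
  have "sim (Tg a * Ag f) (Ag f * Tg a + Ag (\<kappa> * (lvar a * 0)))"
   by (rule cross[OF a]) (use that lev_subset in auto)
  also have "sim \<dots> (Ag f * Tg a + 0)" by (intro sim_add sim_refl) (simp add: Ag_zero)
  finally show ?thesis by simp
 qed
 have "sim (Ag (lvar b - lvar c) * (Tg a * Ag (al b c))) (Tg a * Ag (lvar b - lvar c) * Ag (al b c))"
  unfolding mult.assoc[symmetric] by (intro sim_mult sim_refl sim_sym[OF comm]) (use L assms in "auto simp: lrename_diff")
 also have "sim \<dots> (Tg a * Ag (\<kappa> * lvar b))"
  unfolding mult.assoc by (intro sim_mult sim_refl d_al bc)
 also have "sim \<dots> (Ag (\<kappa> * lvar b) * Tg a)"
  by (rule comm) (use L assms in "auto simp: lrename_mult")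
 finally have "sim (Tg a * Ag (al b c)) (Ag (g b c) * (Ag (\<kappa> * lvar b) * Tg a))" by (rule sim_cancel[OF bc])
 also have "\<dots> = Ag (g b c) * Ag (\<kappa> * lvar b) * Tg a" by (simp add: mult.assoc)
 also have "sim \<dots> (Ag (g b c * (\<kappa> * lvar b)) * Tg a)"
  by (intro sim_mult sim_refl sim_sym[OF Ag_mult]) (use L in auto)
 also have "g b c * (\<kappa> * lvar b) = al b c" by (simp add: al_def algebra_simps)
 finally show ?thesis .
qed

end

context label_model
begin

lemma al_neg_sim: "apart ns a b ==> sim (Ag (al b a)) (K - Ag (al a b))"
proof -
 assume ab: "apart ns a b"
 have "sim (Ag (al b a)) (Ag (\<kappa> - al a b))" by (rule lsim_sim[OF al_neg[OF ab]])
 also have "sim \<dots> (Ag \<kappa> - Ag (al a b))" by (rule Ag_diff) (use al_laurent[OF ab] in auto)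
 also have "sim \<dots> (K - Ag (al a b))" by (intro sim_diff Ag_const sim_refl)
 finally show ?thesis .
qed

lemma fconst_q: "fconst (of_nat q) = 1 + K"
 by (simp add: fconst_diff)

lemma K_comm: "u * K = K * u" "u * (K * v) = K * (u * v)"
 using fconst_commute[of "of_nat q - 1" u] by (simp_all flip: mult.assoc)

lemma Tg_comm: "a \<in> lev ns ==> c \<in> lev ns ==> a + 2 \<le> c \<or> c + 2 \<le> a ==> sim (Tg a * Tg c) (Tg c * Tg a)"
 by (rule sim_cong_mod[OF killed Tg_far])

lemma relation_elements:
 assumes a: "a \<in> lev ns" and ac: "apart ns a c"
 defines "t \<equiv> Tg a" and "P \<equiv> Ag (al a c)" and "P' \<equiv> Ag (al (a + 1) c)"
 shows "t * P - P' * t - P * (K - P') \<in> ann" and "t * P' - P * t + P * (K - P') \<in> ann"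
  and "t * t - (K * t + (1 + K)) \<in> ann" and "P * P' - P' * P \<in> ann"
proof -
 have a'c: "apart ns (a + 1) c" using lev_apart[OF a] ac by blast
 have R: "sim (Ag (al c (a + 1))) (K - P')" unfolding P'_def by (rule al_neg_sim[OF a'c])
 have "sim (t * P) (P' * t + P * (K - P'))"
  unfolding t_def P_def by (rule sim_trans[OF T_al[OF a ac, folded P'_def]]) (intro sim_add sim_mult sim_refl R)
 thus "t * P - P' * t - P * (K - P') \<in> ann" by (simp add: sim_iff diff_diff_eq)
 have "sim (t * P') (P * t - P * (K - P'))"
  unfolding t_def P_def P'_def
  by (rule sim_trans[OF T_al'[OF a ac]]) (intro sim_diff sim_mult sim_refl R[unfolded P'_def])
 thus "t * P' - P * t + P * (K - P') \<in> ann" by (simp add: sim_iff algebra_simps)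
 show "t * t - (K * t + (1 + K)) \<in> ann"
  using Tg_quad_sim[OF a] unfolding t_def fconst_q sim_iff .
 show "P * P' - P' * P \<in> ann"
  using Ag_comm[OF al_laurent[OF ac] al_laurent[OF a'c]] unfolding P_def P'_def sim_iff .
qed

text \<open>The cases where exactly two of three adjacent labels agree: the first two (1-3), the
  last two (4-6), the outer two (7-9). Here T_a does not commute with the coefficients, which is why
  the explicit combinations of \<open>braid_combinations\<close> are called for.\<close>

lemma braid_mixed:
 assumes a: "a \<in> lev ns" and ac: "apart ns a c"
 defines "t \<equiv> Tg a" and "P \<equiv> Ag (al a c)" and "P' \<equiv> Ag (al (a + 1) c)" and "Q \<equiv> Ag (al c a)" and "R \<equiv> Ag (al c (a + 1))"
 shows "sim (t * P' * t) (P' * t * P' + (- 1 - P') * P * (- 1 - R))"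
  and "sim (t * (- 1 - P') * P) (P' * t * (- 1 - P') + (- 1 - P') * P * R)"
  and "sim (t * (- 1 - P') * (- 1 - P)) ((- 1 - P') * (- 1 - P) * t)"
  and "sim (Q * t * Q + (- 1 - Q) * R * (- 1 - P)) (t * Q * t)"
  and "sim (Q * t * (- 1 - Q) + (- 1 - Q) * R * P) (t * (- 1 - Q) * R)"
  and "sim ((- 1 - Q) * (- 1 - R) * t) (t * (- 1 - Q) * (- 1 - R))"
  and "sim (P * R * P + (- 1 - P) * t * (- 1 - Q)) (R * P * R + (- 1 - R) * t * (- 1 - P'))"
  and "sim (P * R * (- 1 - P) + (- 1 - P) * t * Q) (R * (- 1 - P) * t)"
  and "sim (P * (- 1 - R) * t) (R * P * (- 1 - R) + (- 1 - R) * t * P')"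
proof -
 have a'c: "apart ns (a + 1) c" using lev_apart[OF a] ac by blast
 have Q: "sim Q (K - P)" and R: "sim R (K - P')"
  unfolding Q_def R_def P_def P'_def by (intro al_neg_sim ac a'c)+
 note rel = relation_elements[OF a ac, folded t_def P_def P'_def]
 note combo = braid_combinations[of P K P' t, OF K_comm(1) K_comm(1) K_comm(1) K_comm(2) K_comm(2) K_comm(2) refl refl refl refl]
 note A = ann_add ann_diff ann_uminus ann_lmult[OF rel(1)] ann_lmult[OF rel(2)] ann_lmult[OF rel(3)] ann_lmult[OF rel(4)]
  ann_rmult[OF rel(1)] ann_rmult[OF rel(2)] ann_rmult[OF rel(4)] rel
 note S = sim_add sim_diff sim_mult sim_refl Q R
 have via: "sim u v" if "sim u u'" "sim v v'" "u' - v' = w" "w \<in> ann" for u u' v v' w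
  using that sim_iff sim_trans sim_sym by metis
 show "sim (t * P' * t) (P' * t * P' + (- 1 - P') * P * (- 1 - R))"
  by (rule via[OF _ _ combo(1)]) (intro S, intro S, intro A)
 show "sim (t * (- 1 - P') * P) (P' * t * (- 1 - P') + (- 1 - P') * P * R)"
  by (rule via[OF _ _ combo(2)]) (intro S, intro S, intro A)
 show "sim (t * (- 1 - P') * (- 1 - P)) ((- 1 - P') * (- 1 - P) * t)"
  by (rule via[OF _ _ combo(3)]) (intro S, intro S, intro A)
 show "sim (Q * t * Q + (- 1 - Q) * R * (- 1 - P)) (t * Q * t)"
  by (rule via[OF _ _ combo(4)]) (intro S, intro S, intro A)
 show "sim (Q * t * (- 1 - Q) + (- 1 - Q) * R * P) (t * (- 1 - Q) * R)"
  by (rule via[OF _ _ combo(5)]) (intro S, intro S, intro A)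
 show "sim ((- 1 - Q) * (- 1 - R) * t) (t * (- 1 - Q) * (- 1 - R))"
  by (rule via[OF _ _ combo(6)]) (intro S, intro S, intro A)
 show "sim (P * R * P + (- 1 - P) * t * (- 1 - Q)) (R * P * R + (- 1 - R) * t * (- 1 - P'))"
  by (rule via[OF _ _ combo(7)]) (intro S, intro S, intro A)
 show "sim (P * R * (- 1 - P) + (- 1 - P) * t * Q) (R * (- 1 - P) * t)"
  by (rule via[OF _ _ combo(8)]) (intro S, intro S, intro A)
 show "sim (P * (- 1 - R) * t) (R * P * (- 1 - R) + (- 1 - R) * t * P')"
  by (rule via[OF _ _ combo(9)]) (intro S, intro S, intro A)
qed

text \<open>Carries an identity between operators to the commutative algebra of Laurent
  polynomials.\<close>

definition rep :: "hgen free => laurent => bool" where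
 "rep E f \<longleftrightarrow> f \<in> \<A> n \<and> sim E (Ag f)"

lemma rep_al: "apart ns a b ==> rep (Ag (al a b)) (al a b)"
 by (simp add: rep_def al_laurent)

lemma rep_add: "rep E f ==> rep E' f' ==> rep (E + E') (f + f')"
 unfolding rep_def using Ag_add[of f f'] sim_add[of E "Ag f" E' "Ag f'"] sim_trans sim_sym by (metis laurent_add)

lemma rep_mult: "rep E f ==> rep E' f' ==> rep (E * E') (f * f')"
 unfolding rep_def using Ag_mult[of f f'] sim_mult[of E "Ag f" E' "Ag f'"] sim_trans sim_sym by (metis laurent_mult)

lemma rep_neg: "rep E f ==> rep (- 1 - E) (- 1 - f)"
proof -
 assume "rep E f"
 hence f: "f \<in> \<A> n" and E: "sim E (Ag f)" by (auto simp: rep_def)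
 have "sim (- 1 - E) (- Ag 1 - Ag f)" by (intro sim_diff E sim_uminus sim_sym[OF Ag_one])
 also have "sim \<dots> (Ag (- 1) - Ag f)" by (intro sim_diff sim_refl sim_sym[OF Ag_uminus]) simp
 also have "sim \<dots> (Ag (- 1 - f))" by (rule sim_sym[OF Ag_diff]) (use f in auto)
 finally show ?thesis using f by (simp add: rep_def)
qed

lemma sim_via_rep: "rep E f ==> rep E' f' ==> lsim (f - f') 0 ==> sim E E'"
 unfolding rep_def using lsim_zeroD[of f f'] lsim_sim sim_trans sim_sym by metis

lemma lsim_zeroI: "lsim u v ==> lsim (u - v) 0"
 using lsim_diff[of u v v v] lsim_refl[of v] by (auto simp: lsim_def)

lemma lnull_add: "lsim u 0 ==> lsim v 0 ==> lsim (u + v) 0"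
 and lnull_diff: "lsim u 0 ==> lsim v 0 ==> lsim (u - v) 0"
 and lnull_mult: "w \<in> \<A> n ==> lsim u 0 ==> lsim (w * u) 0"
 and lnull_uminus: "lsim u 0 ==> lsim (- u) 0"
 and lnull_zero: "lsim 0 0"
 using lsim_add[of u 0 v 0] lsim_diff[of u 0 v 0] lsim_lmult[of w u 0] lsim_uminus[of u 0] lsim_refl[of 0] by simp_all

text \<open>Three different labels: all coefficients are Laurent polynomials. The first three
  identities come from \<open>al_mult\<close> and the two instances of \<open>al_add\<close>,
  collected in \<open>r\<close>, \<open>u\<close> and \<open>v\<close>; the last three hold by
  commutativity.\<close>

lemma braid_distinct:
 assumes ab: "apart ns a b" and bc: "apart ns b c" and ac: "apart ns a c"
 defines "x \<equiv> Ag (al a b)" and "y \<equiv> Ag (al b c)" and "z \<equiv> Ag (al a c)" and "x' \<equiv> Ag (al b a)" and "y' \<equiv> Ag (al c b)"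
 shows "sim (x * y * x + (- 1 - x) * z * (- 1 - x')) (y * x * y + (- 1 - y) * z * (- 1 - y'))"
  and "sim (x * y * (- 1 - x) + (- 1 - x) * z * x') (y * (- 1 - x) * z)"
  and "sim (x * (- 1 - y) * z) (y * x * (- 1 - y) + (- 1 - y) * z * y')"
  and "sim (x * (- 1 - y) * (- 1 - z)) ((- 1 - y) * (- 1 - z) * x)"
  and "sim ((- 1 - x) * (- 1 - z) * y) (y * (- 1 - x) * (- 1 - z))"
  and "sim ((- 1 - x) * (- 1 - z) * (- 1 - y)) ((- 1 - y) * (- 1 - z) * (- 1 - x))"
proof -
 note L = al_laurent[OF ab] al_laurent[OF bc] al_laurent[OF ac]
 define r where "r = al a b * al b c - al a c * (al a b + al b c - \<kappa>)"
 define u where "u = al a b + al b a - \<kappa>"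
 define v where "v = al b c + al c b - \<kappa>"
 have r: "lsim r 0" and u: "lsim u 0" and v: "lsim v 0"
  using lsim_zeroI[OF al_mult[OF ab bc ac]] lsim_zeroI[OF al_add[OF ab]] lsim_zeroI[OF al_add[OF bc]]
  by (simp_all add: r_def u_def v_def)
 note reps = rep_al[OF ab] rep_al[OF bc] rep_al[OF ac] rep_al[OF apart_sym[OF ab]] rep_al[OF apart_sym[OF bc]]
  rep_add rep_mult rep_neg
 note null = lnull_add lnull_diff lnull_uminus lnull_zero lnull_mult[OF _ r] lnull_mult[OF _ u] lnull_mult[OF _ v]
 have via: "sim E E'" if "rep E f" "rep E' f'" "f - f' = w" "lsim w 0" for E E' f f' w
  using that sim_via_rep by metis
 show "sim (x * y * x + (- 1 - x) * z * (- 1 - x')) (y * x * y + (- 1 - y) * z * (- 1 - y'))"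
  unfolding x_def y_def z_def x'_def y'_def
  \<comment> \<open>\<open>u\<close> and \<open>v\<close> eliminate \<alpha>(b, a) and \<alpha>(c,
    b), and \<open>r\<close> the product \<alpha>(a, b) \<alpha>(b, c). The witness collects the
    cofactors of this elimination.\<close>
  by (rule via[where w = "(al a b - al b c) * r + (al a c * (1 + al a b)) * u - (al a c * (1 + al b c)) * v"],
    (rule reps)+, simp add: r_def u_def v_def algebra_simps, intro null) (use L in auto)
 show "sim (x * y * (- 1 - x) + (- 1 - x) * z * x') (y * (- 1 - x) * z)"
  unfolding x_def y_def z_def x'_def y'_def
  by (rule via[where w = "(- 1 - al a b) * r + ((- 1 - al a b) * al a c) * u"],
    (rule reps)+, simp add: r_def u_def v_def algebra_simps, intro null) (use L in auto)
 show "sim (x * (- 1 - y) * z) (y * x * (- 1 - y) + (- 1 - y) * z * y')"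
  unfolding x_def y_def z_def x'_def y'_def
  by (rule via[where w = "- ((- 1 - al b c) * r) - ((- 1 - al b c) * al a c) * v"],
    (rule reps)+, simp add: r_def u_def v_def algebra_simps, intro null) (use L in auto)
 show "sim (x * (- 1 - y) * (- 1 - z)) ((- 1 - y) * (- 1 - z) * x)"
  unfolding x_def y_def z_def
  by (rule via[where w = 0], (rule reps)+, simp add: algebra_simps, intro null)
 show "sim ((- 1 - x) * (- 1 - z) * y) (y * (- 1 - x) * (- 1 - z))"
  unfolding x_def y_def z_def
  by (rule via[where w = 0], (rule reps)+, simp add: algebra_simps, intro null)
 show "sim ((- 1 - x) * (- 1 - z) * (- 1 - y)) ((- 1 - y) * (- 1 - z) * (- 1 - x))"
  unfolding x_def y_def z_def
  by (rule via[where w = 0], (rule reps)+, simp add: algebra_simps, intro null)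
qed

lemma quad_apart:
 assumes ab: "apart ns a b"
 defines "u \<equiv> Ag (al a b)" and "v \<equiv> Ag (al b a)"
 shows "sim (u * u + (- 1 - u) * (- 1 - v)) (K * u + fconst (of_nat q))"
  and "sim (u * (- 1 - u) + (- 1 - u) * v) (K * (- 1 - u))"
proof -
 have v: "sim v (K - u)" unfolding u_def v_def by (rule al_neg_sim[OF ab])
 have "sim (u * u + (- 1 - u) * (- 1 - v)) (u * u + (- 1 - u) * (- 1 - (K - u)))"
  by (intro sim_add sim_mult sim_diff sim_refl v)
 also have "u * u + (- 1 - u) * (- 1 - (K - u)) = K * u + fconst (of_nat q)"
  using K_comm(1)[of u] by (simp add: fconst_q algebra_simps)
 finally show "sim (u * u + (- 1 - u) * (- 1 - v)) (K * u + fconst (of_nat q))" .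
 have "sim (u * (- 1 - u) + (- 1 - u) * v) (u * (- 1 - u) + (- 1 - u) * (K - u))"
  by (intro sim_add sim_mult sim_refl v)
 also have "u * (- 1 - u) + (- 1 - u) * (K - u) = K * (- 1 - u)"
  using K_comm(1)[of u] by (simp add: algebra_simps)
 finally show "sim (u * (- 1 - u) + (- 1 - u) * v) (K * (- 1 - u))" .
qed

text \<open>T_j \<phi> will have the value \<open>PP l j\<close> \<phi>(l) + \<open>QQ l j\<close>
  \<phi>(l s_j) at l.\<close>

definition PP :: "(nat => nat) => nat => hgen free" where
 "PP l j = (if l j = l (Suc j) then Tg (lpos ns l j) else Ag (al (lpos ns l j) (lpos ns l (Suc j))))"

definition QQ :: "(nat => nat) => nat => hgen free" where
 "QQ l j = (if l j = l (Suc j) then 0 else - 1 - Ag (al (lpos ns l j) (lpos ns l (Suc j))))"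

text \<open>The coefficients of T_i T_j T_i \<phi> at l, in the order l, l s_i, l s_j, l s_j s_i, l
  s_i s_j, l s_i s_j s_i of the arguments of \<phi>. Exchanging i and j therefore exchanges entries
  1 and 2, and entries 3 and 4.\<close>

definition braid_coeff :: "nat => nat => (nat => nat) => hgen free list" where
 "braid_coeff i j l =
  [PP l i * PP l j * PP l i + QQ l i * PP (l \<circ> sref i) j * QQ (l \<circ> sref i) i,
   PP l i * PP l j * QQ l i + QQ l i * PP (l \<circ> sref i) j * PP (l \<circ> sref i) i,
   PP l i * QQ l j * PP (l \<circ> sref j) i,
   PP l i * QQ l j * QQ (l \<circ> sref j) i,
   QQ l i * QQ (l \<circ> sref i) j * PP (l \<circ> sref i \<circ> sref j) i,
   QQ l i * QQ (l \<circ> sref i) j * QQ (l \<circ> sref i \<circ> sref j) i]"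

lemma lpos_sref_app:
 assumes "j \<in> full n" and "l j ~= l (Suc j)"
 shows "lpos ns (l \<circ> sref j) i = lpos ns l (sref j i)"
 using lpos_sref[OF assms(1), of l] assms(2) by (metis Suc_eq_plus1 comp_apply)

text \<open>The coefficients agree one by one, even where several of the six labellings coincide.
  The cases are the possible coincidences among the labels of j, j + 1 and j + 2.\<close>

lemma braid_sims:
 assumes l: "l \<in> labellings ns" and j: "j \<in> full n" and k: "k = Suc j" "k \<in> full n"
 defines "cs \<equiv> braid_coeff j k l" and "ds \<equiv> braid_coeff k j l"
 shows "sim (cs ! 0) (ds ! 0) \<and> sim (cs ! 1) (ds ! 2) \<and> sim (cs ! 2) (ds ! 1) \<and>
  sim (cs ! 3) (ds ! 4) \<and> sim (cs ! 4) (ds ! 3) \<and> sim (cs ! 5) (ds ! 5)"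
proof -
 define a where "a = lpos ns l j"
 define b where "b = lpos ns l k"
 define c where "c = lpos ns l (Suc k)"
 have in1: "j \<in> {1..n}" "k \<in> {1..n}" "Suc k \<in> {1..n}" using j k by auto
 have ab: "apart ns a b \<longleftrightarrow> l j ~= l k" and bc: "apart ns b c \<longleftrightarrow> l k ~= l (Suc k)" and ac: "apart ns a c \<longleftrightarrow> l j ~= l (Suc k)"
  unfolding a_def b_def c_def using lpos_apart[OF l] in1 by auto
 have sab: "b = a + 1 \<and> a \<in> lev ns" if "l j = l k"
  unfolding a_def b_def using lpos_same[OF j, of l] lpos_lev[OF l j] that k by simp
 have sbc: "c = b + 1 \<and> b \<in> lev ns" if "l k = l (Suc k)"
  unfolding c_def b_def using lpos_same[OF k(2), of l] lpos_lev[OF l k(2)] that k by simp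
 have jk: "sref j j = k" "sref j k = j" "sref j (Suc k) = Suc k" "sref k j = j" "sref k k = Suc k" "sref k (Suc k) = k"
  using k by (auto simp: transpose_def)
 have pos: "lpos ns l j = a" "lpos ns l k = b" "lpos ns l (Suc k) = c" by (simp_all add: a_def b_def c_def)
 have Sj: "Suc j = k" using k by simp
 note ev = cs_def ds_def braid_coeff_def PP_def QQ_def Sj jk[unfolded Sj] pos lpos_sref_app[OF j, unfolded Sj] lpos_sref_app[OF k(2)]
 show ?thesis
 proof (cases "l j = l k"; cases "l k = l (Suc k)"; cases "l j = l (Suc k)")
  assume 1: "l j = l k" and 2: "l k = l (Suc k)" and "l j = l (Suc k)"
  have "l \<circ> sref j = l" "l \<circ> sref k = l" using label_sref_same[of l j] label_sref_same[of l k] 1 2 k by auto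
  moreover have "sim (Tg a * Tg b * Tg a) (Tg b * Tg a * Tg b)"
   using sim_cong_mod[OF killed Tg_braid[of a "lev ns"]] sab[OF 1] sbc[OF 2] by simp
  ultimately show ?thesis using 1 2 by (simp add: ev)
 next
  assume 1: "l j = l k" and 2: "l k ~= l (Suc k)" and 3: "l j ~= l (Suc k)"
  have s: "l \<circ> sref j = l" using label_sref_same[of l j] 1 k by auto
  note m = braid_mixed[of a c] 
  have "a \<in> lev ns" "apart ns a c" "b = a + 1" using sab[OF 1] ac 3 by auto
  thus ?thesis using m(1-3) 1 2 3 by (simp add: ev s)
 next
  assume 1: "l j ~= l k" and 2: "l k = l (Suc k)" and 3: "l j ~= l (Suc k)"
  have s: "l \<circ> sref k = l" using label_sref_same[of l k] 2 by auto
  note m = braid_mixed[of b a] 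
  have "b \<in> lev ns" "apart ns b a" "c = b + 1" using sbc[OF 2] ab 1 apart_sym by auto
  thus ?thesis using m(4-6) 1 2 3 by (simp add: ev s)
 next
  assume 1: "l j ~= l k" and 2: "l k ~= l (Suc k)" and 3: "l j = l (Suc k)"
  \<comment> \<open>After s_k the two equal outer labels are adjacent; this yields c = a + 1
    although their positions in l are not adjacent.\<close>
  have s: "lpos ns (l \<circ> sref k) (j + 1) = lpos ns (l \<circ> sref k) j + 1 \<and> lpos ns (l \<circ> sref k) j \<in> lev ns"
   using lpos_same[OF j, of "l \<circ> sref k"] lpos_lev[OF labellings_sref[OF l k(2)] j] 3 by (simp add: jk Sj)
  have "lpos ns (l \<circ> sref k) (j + 1) = c" "lpos ns (l \<circ> sref k) j = a"
   using lpos_sref_app[OF k(2) 2] by (simp_all add: jk pos Sj)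
  hence "a \<in> lev ns" "apart ns a b" "c = a + 1" using s ab 1 by auto
  thus ?thesis using braid_mixed(7-9)[of a b] 1 2 3 by (simp add: ev)
 next
  assume 1: "l j ~= l k" and 2: "l k ~= l (Suc k)" and 3: "l j ~= l (Suc k)"
  thus ?thesis using braid_distinct[of a b c] ab bc ac by (simp add: ev)
 qed auto
qed

lemma quad_sims:
 assumes l: "l \<in> labellings ns" and j: "j \<in> full n"
 shows "sim (PP l j * PP l j + QQ l j * QQ (l \<circ> sref j) j) (K * PP l j + fconst (of_nat q))"
  and "sim (PP l j * QQ l j + QQ l j * PP (l \<circ> sref j) j) (K * QQ l j)"
proof -
 have in1: "j \<in> {1..n}" "Suc j \<in> {1..n}" using j by auto
 have ap: "apart ns (lpos ns l j) (lpos ns l (Suc j)) \<longleftrightarrow> l j ~= l (Suc j)" using lpos_apart[OF l in1] .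
 note q = quad_apart[of "lpos ns l j" "lpos ns l (Suc j)"]
 have "lpos ns l j \<in> lev ns" if "l j = l (Suc j)" using lpos_lev[OF l j] that by simp
 thus "sim (PP l j * PP l j + QQ l j * QQ (l \<circ> sref j) j) (K * PP l j + fconst (of_nat q))"
  "sim (PP l j * QQ l j + QQ l j * PP (l \<circ> sref j) j) (K * QQ l j)"
  using q ap Tg_quad_sim label_sref_same[of l j]
  by (cases "l j = l (Suc j)"; simp add: PP_def QQ_def lpos_sref_app[OF j])+
qed

definition commute :: "hgen free => hgen free => bool" where
 "commute u v \<longleftrightarrow> sim (u * v) (v * u)"

lemma commute_sym: "commute u v ==> commute v u"
 by (simp add: commute_def sim_sym)

lemma commute_neg: "commute u v ==> commute (- 1 - u) v"
 unfolding commute_def using sim_diff[OF sim_refl[of "- v"], of "u * v" "v * u"] by (simp add: algebra_simps)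

lemma commute_zero: "commute 0 v"
 by (simp add: commute_def)

lemma far_commute:
 assumes l: "l \<in> labellings ns" and i: "i \<in> full n" and j: "j \<in> full n" and ij: "i + 2 \<le> j \<or> j + 2 \<le> i"
 shows "commute (PP l i) (PP l j)" "commute (PP l i) (QQ l j)" "commute (QQ l i) (PP l j)" "commute (QQ l i) (QQ l j)"
proof -
 let ?p = "lpos ns l"
 have in1: "i \<in> {1..n}" "Suc i \<in> {1..n}" "j \<in> {1..n}" "Suc j \<in> {1..n}" using i j by auto
 have ne: "?p i ~= ?p j" "?p i ~= ?p (Suc j)" "?p (Suc i) ~= ?p j" "?p (Suc i) ~= ?p (Suc j)"
  using lpos_inj[OF l in1(1,3)] lpos_inj[OF l in1(1,4)] lpos_inj[OF l in1(2,3)] lpos_inj[OF l in1(2,4)] ij by auto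
 have ap: "l i ~= l (Suc i) ==> apart ns (?p i) (?p (Suc i))" "l j ~= l (Suc j) ==> apart ns (?p j) (?p (Suc j))"
  using lpos_apart[OF l] in1 by auto
 have sa: "l i = l (Suc i) ==> ?p (Suc i) = Suc (?p i) \<and> ?p i \<in> lev ns"
  "l j = l (Suc j) ==> ?p (Suc j) = Suc (?p j) \<and> ?p j \<in> lev ns"
  using lpos_same[OF i, of l] lpos_lev[OF l i] lpos_same[OF j, of l] lpos_lev[OF l j] by auto
 have pp: "commute (PP l i) (PP l j)"
 proof (cases "l i = l (Suc i)"; cases "l j = l (Suc j)")
  assume 1: "l i = l (Suc i)" and 2: "l j = l (Suc j)"
  have "?p i + 2 \<le> ?p j \<or> ?p j + 2 \<le> ?p i" using ne sa(1)[OF 1] sa(2)[OF 2] by linarith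
  thus ?thesis using Tg_comm sa(1)[OF 1] sa(2)[OF 2] 1 2 by (simp add: PP_def commute_def)
 next
  assume 1: "l i = l (Suc i)" and 2: "l j ~= l (Suc j)"
  thus ?thesis
   using T_al_far[of "?p i" "?p j" "?p (Suc j)"] sa(1)[OF 1] ap(2)[OF 2] ne by (simp add: PP_def commute_def)
 next
  assume 1: "l i ~= l (Suc i)" and 2: "l j = l (Suc j)"
  thus ?thesis
   using sim_sym[OF T_al_far[of "?p j" "?p i" "?p (Suc i)"]] sa(2)[OF 2] ap(1)[OF 1] ne
   by (simp add: PP_def commute_def)
 next
  assume 1: "l i ~= l (Suc i)" and 2: "l j ~= l (Suc j)"
  thus ?thesis using Ag_comm al_laurent ap by (simp add: PP_def commute_def)
 qed
 have Q: "QQ l i = 0 \<or> QQ l i = - 1 - PP l i" "QQ l j = 0 \<or> QQ l j = - 1 - PP l j"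
  by (simp_all add: QQ_def PP_def)
 show "commute (PP l i) (PP l j)" by (rule pp)
 show "commute (PP l i) (QQ l j)" "commute (QQ l i) (PP l j)" "commute (QQ l i) (QQ l j)"
  using Q pp commute_sym commute_neg commute_zero by metis+
qed

lemma far_value:
 assumes j: "j \<in> full n" and ij: "i + 2 \<le> j \<or> j + 2 \<le> i"
 shows "PP (l \<circ> sref j) i = PP l i" "QQ (l \<circ> sref j) i = QQ l i"
proof -
 have s: "sref j i = i" "sref j (Suc i) = Suc i" using ij by (auto simp: transpose_def)
 have "lpos ns (l \<circ> sref j) i = lpos ns l i" "lpos ns (l \<circ> sref j) (Suc i) = lpos ns l (Suc i)"
  using lpos_sref_app[OF j, of l] label_sref_same[of l j] s by (cases "l j = l (Suc j)"; simp)+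
 thus "PP (l \<circ> sref j) i = PP l i" "QQ (l \<circ> sref j) i = QQ l i"
  using s by (simp_all add: PP_def QQ_def)
qed

end

section \<open>The module of sections over labellings\<close>

definition fun_group :: "'i set => ('s, 'b) module => (unit, 'i => 'b) module" where
 "fun_group I M = \<lparr>carrier = I \<rightarrow>\<^sub>E carrier M,
   monoid.mult = (\<lambda>_ _. undefined), monoid.one = undefined,
   ring.zero = (\<lambda>i\<in>I. \<zero>\<^bsub>M\<^esub>), ring.add = (\<lambda>f g. \<lambda>i\<in>I. f i \<oplus>\<^bsub>M\<^esub> g i),
   module.smult = (\<lambda>_ _. undefined)\<rparr>"

lemma fun_group_simps [simp]:
 "carrier (fun_group I M) = (I \<rightarrow>\<^sub>E carrier M)"
 "\<zero>\<^bsub>fun_group I M\<^esub> = (\<lambda>i\<in>I. \<zero>\<^bsub>M\<^esub>)"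
 "f \<oplus>\<^bsub>fun_group I M\<^esub> g = (\<lambda>i\<in>I. f i \<oplus>\<^bsub>M\<^esub> g i)"
 by (simp_all add: fun_group_def)

lemma fun_group_eqI:
 "f \<in> I \<rightarrow>\<^sub>E A ==> g \<in> I \<rightarrow>\<^sub>E B ==> (!!i. i \<in> I ==> f i = g i) ==> f = g"
 by (rule extensionalityI[of _ I]) (auto simp: PiE_def)

lemma abelian_group_fun_group:
 assumes "abelian_group M" shows "abelian_group (fun_group I M)"
proof -
 let ?F = "fun_group I M"
 interpret abelian_group M by fact
 show ?thesis
 proof (rule abelian_groupI)
  fix f g h assume f: "f \<in> carrier (?F)" and g: "g \<in> carrier (?F)"
  show "f \<oplus>\<^bsub>?F\<^esub> g \<in> carrier (?F)" using f g by auto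
  show "f \<oplus>\<^bsub>?F\<^esub> g = g \<oplus>\<^bsub>?F\<^esub> f"
   using f g by (auto simp: PiE_iff intro!: restrict_ext a_comm)
  assume h: "h \<in> carrier (?F)"
  show "f \<oplus>\<^bsub>?F\<^esub> g \<oplus>\<^bsub>?F\<^esub> h = f \<oplus>\<^bsub>?F\<^esub> (g \<oplus>\<^bsub>?F\<^esub> h)"
   using f g h by (auto simp: PiE_iff intro!: restrict_ext a_assoc)
 next
  fix f assume f: "f \<in> carrier (?F)"
  show "\<zero>\<^bsub>?F\<^esub> \<oplus>\<^bsub>?F\<^esub> f = f"
   by (rule fun_group_eqI[of _ I "carrier M" _ "carrier M"]) (use f in "auto simp: PiE_iff")
  show "\<exists>g\<in>carrier (?F). g \<oplus>\<^bsub>?F\<^esub> f = \<zero>\<^bsub>?F\<^esub>"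
   by (rule bexI[of _ "\<lambda>i\<in>I. \<ominus>\<^bsub>M\<^esub> f i"]) (use f in "auto simp: PiE_iff l_neg intro!: restrict_ext")
 qed auto
qed

context label_model
begin

abbreviation L where "L \<equiv> labellings ns"
abbreviation FG where "FG \<equiv> fun_group L M"

text \<open>At l a Laurent polynomial acts after the substitution given by \<open>lpos ns l\<close>,
  as it would on T_w tensor x with w the representative of l, up to shorter terms. The identity for
  \<open>GT j\<close> with j out of range is a default value.\<close>

definition fop :: "hgen => ((nat => nat) => 'b) => (nat => nat) => 'b" where
 "fop c \<phi> = (case c of
   GA f => \<lambda>l\<in>L. act (Ag (lrename (lpos ns l) f)) (\<phi> l)
  | GT j => if j \<in> full n then \<lambda>l\<in>L. act (PP l j) (\<phi> l) \<oplus> act (QQ l j) (\<phi> (l \<circ> sref j)) else \<phi>)"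

definition fsc :: "complex => ((nat => nat) => 'b) => (nat => nat) => 'b" where
 "fsc c \<phi> = (\<lambda>l\<in>L. act (fconst c) (\<phi> l))"

lemma labellings_sref' [simp]: "l \<in> L ==> j \<in> full n ==> l \<circ> sref j \<in> L"
 by (rule labellings_sref)

lemma fun_val [simp]: "\<phi> \<in> L \<rightarrow>\<^sub>E carrier M ==> l \<in> L ==> \<phi> l \<in> carrier M"
 by (auto simp: PiE_iff)

lemma fop_closed: "\<phi> \<in> L \<rightarrow>\<^sub>E carrier M ==> fop c \<phi> \<in> L \<rightarrow>\<^sub>E carrier M"
 unfolding fop_def
 by (cases c) (auto simp del: in_full intro!: a_closed act_closed fun_val[OF _ labellings_sref'])

lemma fop_GA: "l \<in> L ==> fop (GA f) \<phi> l = act (Ag (lrename (lpos ns l) f)) (\<phi> l)"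
 by (simp add: fop_def)

lemma fop_GT: "j \<in> full n ==> l \<in> L ==> fop (GT j) \<phi> l = act (PP l j) (\<phi> l) \<oplus> act (QQ l j) (\<phi> (l \<circ> sref j))"
 by (simp add: fop_def del: in_full)

lemma act_fconst_comm: "x \<in> carrier M ==> act a (act (fconst c) x) = act (fconst c) (act a x)"
 by (simp add: act_mult[symmetric] fconst_commute)

sublocale F: letter_operators FG fsc fop
proof (intro letter_operators.intro letter_operators_axioms.intro)
 show "abelian_group FG" by (rule abelian_group_fun_group) unfold_locales
next
 fix \<phi> \<psi> c d g assume \<phi>: "\<phi> \<in> carrier FG"
 show "fsc c \<phi> \<in> carrier FG" using \<phi> by (auto simp: fsc_def)
 show "fop g \<phi> \<in> carrier FG" using \<phi> fop_closed by simp
 show "fsc (c + d) \<phi> = fsc c \<phi> \<oplus>\<^bsub>FG\<^esub> fsc d \<phi>"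
  using \<phi> by (auto simp: fsc_def fconst_add act_add intro!: restrict_ext)
 show "fsc (c * d) \<phi> = fsc c (fsc d \<phi>)"
  using \<phi> by (auto simp: fsc_def fconst_mult act_mult intro!: restrict_ext)
 show "fsc 1 \<phi> = \<phi>"
  by (rule fun_group_eqI[of _ L "carrier M" _ "carrier M"]) (use \<phi> in "auto simp: fsc_def")
 show "fop g (fsc c \<phi>) = fsc c (fop g \<phi>)"
 proof (rule fun_group_eqI[of _ L "carrier M" _ "carrier M"])
  have f: "fsc c \<phi> \<in> L \<rightarrow>\<^sub>E carrier M" using \<phi> by (auto simp: fsc_def)
  thus "fop g (fsc c \<phi>) \<in> L \<rightarrow>\<^sub>E carrier M" by (rule fop_closed)
  show "fsc c (fop g \<phi>) \<in> L \<rightarrow>\<^sub>E carrier M" using \<phi> fop_closed[of \<phi> g] by (auto simp: fsc_def)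
  fix l assume l: "l \<in> L"
  show "fop g (fsc c \<phi>) l = fsc c (fop g \<phi>) l"
  proof (cases g)
   case (GA f)
   thus ?thesis using l \<phi> by (simp add: fop_GA fsc_def act_fconst_comm)
  next
   case (GT j)
   show ?thesis
   proof (cases "j \<in> full n")
    case True
    thus ?thesis unfolding GT using l \<phi> labellings_sref'[OF l True]
     by (simp add: fop_GT fsc_def act_fconst_comm act_radd del: in_full labellings_sref')
   next
    case False
    thus ?thesis using GT by (simp add: fop_def del: in_full)
   qed
  qed
 qed
 assume \<psi>: "\<psi> \<in> carrier FG"
 show "fsc c (\<phi> \<oplus>\<^bsub>FG\<^esub> \<psi>) = fsc c \<phi> \<oplus>\<^bsub>FG\<^esub> fsc c \<psi>"
  using \<phi> \<psi> by (auto simp: fsc_def act_radd intro!: restrict_ext)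
 show "fop g (\<phi> \<oplus>\<^bsub>FG\<^esub> \<psi>) = fop g \<phi> \<oplus>\<^bsub>FG\<^esub> fop g \<psi>"
 proof (rule fun_group_eqI[of _ L "carrier M" _ "carrier M"])
  show "fop g (\<phi> \<oplus>\<^bsub>FG\<^esub> \<psi>) \<in> L \<rightarrow>\<^sub>E carrier M" by (rule fop_closed) (use \<phi> \<psi> in auto)
  show "fop g \<phi> \<oplus>\<^bsub>FG\<^esub> fop g \<psi> \<in> L \<rightarrow>\<^sub>E carrier M" using \<phi> \<psi> fop_closed[of \<phi> g] fop_closed[of \<psi> g] by auto
  fix l assume l: "l \<in> L"
  show "fop g (\<phi> \<oplus>\<^bsub>FG\<^esub> \<psi>) l = (fop g \<phi> \<oplus>\<^bsub>FG\<^esub> fop g \<psi>) l"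
  proof (cases g)
   case (GA f)
   thus ?thesis using l \<phi> \<psi> by (simp add: fop_GA act_radd)
  next
   case (GT j)
   show ?thesis
   proof (cases "j \<in> full n")
    case True
    thus ?thesis unfolding GT using l \<phi> \<psi> labellings_sref'[OF l True]
     by (simp add: fop_GT act_radd a_ac del: in_full labellings_sref')
   next
    case False
    thus ?thesis using GT l by (simp add: fop_def del: in_full)
   qed
  qed
 qed
qed

definition fact :: "hgen free => ((nat => nat) => 'b) => (nat => nat) => 'b" where
 "fact = F.letter_act"

sublocale FA: free_action FG fact
 unfolding fact_def by (rule F.free_action_letter_act)

lemma fact_closed [simp]: "\<phi> \<in> L \<rightarrow>\<^sub>E carrier M ==> fact a \<phi> \<in> L \<rightarrow>\<^sub>E carrier M"
 using FA.act_closed[of \<phi> a] by simp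

lemma fact_fgen [simp]: "\<phi> \<in> L \<rightarrow>\<^sub>E carrier M ==> fact (fgen c) \<phi> = fop c \<phi>"
 by (simp add: fact_def)

lemma fact_fconst: "\<phi> \<in> L \<rightarrow>\<^sub>E carrier M ==> fact (fconst c) \<phi> = fsc c \<phi>"
 by (simp add: fact_def)

lemma fact_fconst_val: "\<phi> \<in> L \<rightarrow>\<^sub>E carrier M ==> l \<in> L ==> fact (fconst c) \<phi> l = act (fconst c) (\<phi> l)"
 by (simp add: fact_fconst fsc_def)

lemma fact_GA: "\<phi> \<in> L \<rightarrow>\<^sub>E carrier M ==> l \<in> L ==> fact (Ag f) \<phi> l = act (Ag (lrename (lpos ns l) f)) (\<phi> l)"
 by (simp add: fop_GA)

lemma fact_GT: "\<phi> \<in> L \<rightarrow>\<^sub>E carrier M ==> j \<in> full n ==> l \<in> L ==>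
  fact (Tg j) \<phi> l = act (PP l j) (\<phi> l) \<oplus> act (QQ l j) (\<phi> (l \<circ> sref j))"
 by (simp add: fop_GT del: in_full)

lemma fact_mult: "\<phi> \<in> L \<rightarrow>\<^sub>E carrier M ==> fact (a * b) \<phi> = fact a (fact b \<phi>)"
 using FA.act_mult[of \<phi> a b] by simp

lemma fact_add_val: "\<phi> \<in> L \<rightarrow>\<^sub>E carrier M ==> l \<in> L ==> fact (a + b) \<phi> l = fact a \<phi> l \<oplus> fact b \<phi> l"
 using FA.act_add[of \<phi> a b] by simp

lemma fact_eqI:
 "\<phi> \<in> L \<rightarrow>\<^sub>E carrier M ==> (!!l. l \<in> L ==> fact u \<phi> l = fact v \<phi> l) ==> fact (u - v) \<phi> = \<zero>\<^bsub>FG\<^esub>"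
proof -
 assume \<phi>: "\<phi> \<in> L \<rightarrow>\<^sub>E carrier M" and "!!l. l \<in> L ==> fact u \<phi> l = fact v \<phi> l"
 hence "fact u \<phi> = fact v \<phi>"
  by (intro fun_group_eqI[OF fact_closed fact_closed]) auto
 thus ?thesis using \<phi> FA.act_diff[of \<phi> u v] F.r_neg[of "fact v \<phi>"] by (simp add: F.minus_eq)
qed

lemma fact_GT_GT:
 assumes \<phi>: "\<phi> \<in> L \<rightarrow>\<^sub>E carrier M" and i: "i \<in> full n" and j: "j \<in> full n" and l: "l \<in> L"
 shows "fact (Tg i) (fact (Tg j) \<phi>) l =
  act (PP l i * PP l j) (\<phi> l) \<oplus> (act (PP l i * QQ l j) (\<phi> (l \<circ> sref j)) \<oplus>
  (act (QQ l i * PP (l \<circ> sref i) j) (\<phi> (l \<circ> sref i)) \<oplus>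
   act (QQ l i * QQ (l \<circ> sref i) j) (\<phi> (l \<circ> sref i \<circ> sref j))))"
proof -
 have c: "\<phi> l \<in> carrier M" "\<phi> (l \<circ> sref j) \<in> carrier M" "\<phi> (l \<circ> sref i) \<in> carrier M"
  "\<phi> (l \<circ> sref i \<circ> sref j) \<in> carrier M" using \<phi> i j l by (simp_all del: in_full)
 have v: "fact (Tg j) \<phi> l = act (PP l j) (\<phi> l) \<oplus> act (QQ l j) (\<phi> (l \<circ> sref j))"
  "fact (Tg j) \<phi> (l \<circ> sref i) = act (PP (l \<circ> sref i) j) (\<phi> (l \<circ> sref i)) \<oplus>
   act (QQ (l \<circ> sref i) j) (\<phi> (l \<circ> sref i \<circ> sref j))"
  by (rule fact_GT[OF \<phi> j l], rule fact_GT[OF \<phi> j labellings_sref'[OF l i]])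
 show ?thesis
  unfolding fact_GT[OF fact_closed[OF \<phi>] i l] v
  using c by (simp add: act_radd act_mult a_assoc)
qed

lemma add_eight:
 assumes "A \<in> carrier M" "B \<in> carrier M" "C \<in> carrier M" "D \<in> carrier M"
  "E \<in> carrier M" "F \<in> carrier M" "G \<in> carrier M" "H \<in> carrier M"
 shows "A \<oplus> (B \<oplus> (C \<oplus> D)) \<oplus> (E \<oplus> (F \<oplus> (G \<oplus> H))) =
  A \<oplus> F \<oplus> (B \<oplus> E \<oplus> (C \<oplus> (D \<oplus> (G \<oplus> H))))"
 using assms by (simp add: a_ac)

lemma fact_GT_GT_GT:
 assumes \<phi>: "\<phi> \<in> L \<rightarrow>\<^sub>E carrier M" and i: "i \<in> full n" and j: "j \<in> full n" and l: "l \<in> L"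
 defines "cs \<equiv> braid_coeff i j l"
 shows "fact (Tg i) (fact (Tg j) (fact (Tg i) \<phi>)) l =
  act (cs ! 0) (\<phi> l) \<oplus> (act (cs ! 1) (\<phi> (l \<circ> sref i)) \<oplus> (act (cs ! 2) (\<phi> (l \<circ> sref j)) \<oplus>
  (act (cs ! 3) (\<phi> (l \<circ> sref j \<circ> sref i)) \<oplus> (act (cs ! 4) (\<phi> (l \<circ> sref i \<circ> sref j)) \<oplus>
   act (cs ! 5) (\<phi> (l \<circ> sref i \<circ> sref j \<circ> sref i))))))"
proof -
 have c: "\<phi> l \<in> carrier M" "\<phi> (l \<circ> sref j) \<in> carrier M" "\<phi> (l \<circ> sref i) \<in> carrier M"
  "\<phi> (l \<circ> sref i \<circ> sref j) \<in> carrier M" "\<phi> (l \<circ> sref j \<circ> sref i) \<in> carrier M"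
  "\<phi> (l \<circ> sref i \<circ> sref j \<circ> sref i) \<in> carrier M" using \<phi> i j l by (simp_all del: in_full)
 let ?a = "PP l i" and ?b = "QQ l i" and ?li = "l \<circ> sref i"
 have v: "fact (Tg j) (fact (Tg i) \<phi>) l =
   act (PP l j * PP l i) (\<phi> l) \<oplus> (act (PP l j * QQ l i) (\<phi> (l \<circ> sref i)) \<oplus>
  (act (QQ l j * PP (l \<circ> sref j) i) (\<phi> (l \<circ> sref j)) \<oplus>
   act (QQ l j * QQ (l \<circ> sref j) i) (\<phi> (l \<circ> sref j \<circ> sref i))))"
  "fact (Tg j) (fact (Tg i) \<phi>) ?li =
   act (PP ?li j * PP ?li i) (\<phi> ?li) \<oplus> (act (PP ?li j * QQ ?li i) (\<phi> l) \<oplus>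
  (act (QQ ?li j * PP (?li \<circ> sref j) i) (\<phi> (?li \<circ> sref j)) \<oplus>
   act (QQ ?li j * QQ (?li \<circ> sref j) i) (\<phi> (?li \<circ> sref j \<circ> sref i))))"
  using fact_GT_GT[OF \<phi> j i l] fact_GT_GT[OF \<phi> j i labellings_sref'[OF l i]] unfolding sref_sref by blast+
 show ?thesis
  unfolding fact_GT[OF fact_closed[OF fact_closed[OF \<phi>]] i l] v cs_def braid_coeff_def
  using c by (simp add: act_radd act_mult act_add add_eight)
qed

text \<open>A relation can be tested at one labelling l at a time, where it becomes an identity
  between the coefficients of the values of \<phi> at the labellings reached from l.\<close>

lemma fun_kills: "FA.kills (rels q n (full n))"
 unfolding FA.kills_def
proof (intro ballI)
 fix r \<phi> assume r: "r \<in> rels q n (full n)" and "\<phi> \<in> carrier FG"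
 hence \<phi>: "\<phi> \<in> L \<rightarrow>\<^sub>E carrier M" by simp
 have lp: "lpos ns l ` {1..n} <= {1..n}" if "l \<in> L" for l using lpos_in[OF that] by blast
 note cross_rule = cross
 from r show "fact r \<phi> = \<zero>\<^bsub>FG\<^esub>"
 proof (cases rule: rels_cases)
  case (const c)
  show ?thesis unfolding const
  proof (rule fact_eqI[OF \<phi>])
   fix l assume l: "l \<in> L"
   thus "fact (Ag (lconst c)) \<phi> l = fact (fconst c) \<phi> l"
    using \<phi> simD[OF Ag_const, of "\<phi> l" c] by (simp add: fact_GA fact_fconst_val del: fact_fgen)
  qed
 next
  case (add f f')
  show ?thesis unfolding add(1)
  proof (rule fact_eqI[OF \<phi>])
   fix l assume l: "l \<in> L"
   show "fact (Ag (f + f')) \<phi> l = fact (Ag f + Ag f') \<phi> l"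
    using \<phi> l simD[OF Ag_add[OF lrename_laurent[OF add(2) lp[OF l]] lrename_laurent[OF add(3) lp[OF l]]], of "\<phi> l"]
    by (simp add: fact_GA fact_add_val lrename_add act_add del: fact_fgen)
  qed
 next
  case (mult f f')
  show ?thesis unfolding mult(1)
  proof (rule fact_eqI[OF \<phi>])
   fix l assume l: "l \<in> L"
   show "fact (Ag (f * f')) \<phi> l = fact (Ag f * Ag f') \<phi> l"
    using \<phi> l simD[OF Ag_mult[OF lrename_laurent[OF mult(2) lp[OF l]] lrename_laurent[OF mult(3) lp[OF l]]], of "\<phi> l"]
    by (simp add: fact_GA fact_mult lrename_mult act_mult del: fact_fgen)
  qed
 next
  case (braid j)
  have j: "j \<in> full n" "Suc j \<in> full n" using braid by auto
  show ?thesis unfolding braid(1)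
  proof (rule fact_eqI[OF \<phi>])
   fix l assume l: "l \<in> L"
   let ?i = "sref j" and ?k = "sref (Suc j)"
   have c: "\<phi> l \<in> carrier M" "\<phi> (l \<circ> ?k) \<in> carrier M" "\<phi> (l \<circ> ?i) \<in> carrier M"
    "\<phi> (l \<circ> ?i \<circ> ?k) \<in> carrier M" "\<phi> (l \<circ> ?k \<circ> ?i) \<in> carrier M"
    "\<phi> (l \<circ> ?i \<circ> ?k \<circ> ?i) \<in> carrier M" using \<phi> j l by (simp_all del: in_full)
   have e: "l \<circ> ?k \<circ> ?i \<circ> ?k = l \<circ> ?i \<circ> ?k \<circ> ?i" by (auto simp: fun_eq_iff transpose_def)
   have s: "act (braid_coeff j (Suc j) l ! 0) x = act (braid_coeff (Suc j) j l ! 0) x"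
    "act (braid_coeff j (Suc j) l ! 1) x = act (braid_coeff (Suc j) j l ! 2) x"
    "act (braid_coeff j (Suc j) l ! 2) x = act (braid_coeff (Suc j) j l ! 1) x"
    "act (braid_coeff j (Suc j) l ! 3) x = act (braid_coeff (Suc j) j l ! 4) x"
    "act (braid_coeff j (Suc j) l ! 4) x = act (braid_coeff (Suc j) j l ! 3) x"
    "act (braid_coeff j (Suc j) l ! 5) x = act (braid_coeff (Suc j) j l ! 5) x" if "x \<in> carrier M" for x
    using braid_sims[OF l j(1) refl j(2)] simD that by blast+
   have "fact (Tg j * Tg (Suc j) * Tg j) \<phi> l = fact (Tg j) (fact (Tg (Suc j)) (fact (Tg j) \<phi>)) l"
    using \<phi> by (simp add: fact_mult del: fact_fgen)
   also have "\<dots> = fact (Tg (Suc j)) (fact (Tg j) (fact (Tg (Suc j)) \<phi>)) l"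
    unfolding fact_GT_GT_GT[OF \<phi> j l] fact_GT_GT_GT[OF \<phi> j(2,1) l] e s[OF c(1)] s[OF c(2)] s[OF c(3)] s[OF c(4)] s[OF c(5)] s[OF c(6)]
    using c by (simp only: a_ac act_closed a_closed)
   also have "\<dots> = fact (Tg (Suc j) * Tg j * Tg (Suc j)) \<phi> l"
    using \<phi> by (simp add: fact_mult del: fact_fgen)
   finally show "fact (Tg j * Tg (j + 1) * Tg j) \<phi> l = fact (Tg (j + 1) * Tg j * Tg (j + 1)) \<phi> l" by simp
  qed
 next
  case (far j k)
  show ?thesis unfolding far(1)
  proof (rule fact_eqI[OF \<phi>])
   fix l assume l: "l \<in> L"
   have c: "\<phi> l \<in> carrier M" "\<phi> (l \<circ> sref k) \<in> carrier M" "\<phi> (l \<circ> sref j) \<in> carrier M"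
    "\<phi> (l \<circ> sref j \<circ> sref k) \<in> carrier M" using \<phi> l far(2,3) by (simp_all del: in_full)
   have e: "l \<circ> sref k \<circ> sref j = l \<circ> sref j \<circ> sref k"
    using far(4) by (auto simp: fun_eq_iff transpose_def)
   have f1: "j + 2 \<le> k \<or> k + 2 \<le> j" "k + 2 \<le> j \<or> j + 2 \<le> k" using far(4) by auto
   note comm = far_commute[OF l far(2,3) f1(1), unfolded commute_def, THEN simD]
   note val = far_value[OF far(3) f1(1)] far_value[OF far(2) f1(2)]
   show "fact (Tg j * Tg k) \<phi> l = fact (Tg k * Tg j) \<phi> l"
    unfolding fact_mult[OF \<phi>] fact_GT_GT[OF \<phi> far(2,3) l] fact_GT_GT[OF \<phi> far(3,2) l] e val
    using c by (simp add: comm a_ac)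
  qed
 next
  case (quad j)
  have "(Tg j + 1) * (Tg j - fconst (of_nat q)) = Tg j * Tg j - (K * Tg j + fconst (of_nat q))"
   using K_comm(1)[of "Tg j"] by (simp add: fconst_q algebra_simps)
  moreover have "fact (Tg j * Tg j - (K * Tg j + fconst (of_nat q))) \<phi> = \<zero>\<^bsub>FG\<^esub>"
  proof (rule fact_eqI[OF \<phi>])
   fix l assume l: "l \<in> L"
   have c: "\<phi> l \<in> carrier M" "\<phi> (l \<circ> sref j) \<in> carrier M" using \<phi> l quad(2) by (simp_all del: in_full)
   have "fact (Tg j * Tg j) \<phi> l = act (PP l j * PP l j) (\<phi> l) \<oplus> (act (PP l j * QQ l j) (\<phi> (l \<circ> sref j)) \<oplus>
    (act (QQ l j * PP (l \<circ> sref j) j) (\<phi> (l \<circ> sref j)) \<oplus>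
    act (QQ l j * QQ (l \<circ> sref j) j) (\<phi> l)))"
    unfolding fact_mult[OF \<phi>] fact_GT_GT[OF \<phi> quad(2,2) l] sref_sref ..
   also have "\<dots> = act (PP l j * PP l j + QQ l j * QQ (l \<circ> sref j) j) (\<phi> l) \<oplus>
     act (PP l j * QQ l j + QQ l j * PP (l \<circ> sref j) j) (\<phi> (l \<circ> sref j))"
    using c by (simp add: act_add a_ac)
   also have "\<dots> = act (K * PP l j + fconst (of_nat q)) (\<phi> l) \<oplus> act (K * QQ l j) (\<phi> (l \<circ> sref j))"
    using simD[OF quad_sims(1)[OF l quad(2)] c(1)] simD[OF quad_sims(2)[OF l quad(2)] c(2)] by simp
   also have "\<dots> = fact (K * Tg j + fconst (of_nat q)) \<phi> l"
    using c l \<phi> quad(2)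
    by (simp add: fact_add_val fact_mult fact_fconst_val fact_GT act_add act_mult act_radd a_ac del: fact_fgen in_full)
   finally show "fact (Tg j * Tg j) \<phi> l = fact (K * Tg j + fconst (of_nat q)) \<phi> l" .
  qed
  ultimately show ?thesis unfolding quad(1) by simp
 next
  case (cross j f e)
  let ?f' = "lrename (sref j) f"
  have f': "?f' \<in> \<A> n" using cross lrename_sref_laurent by auto
  have j: "j \<in> {1..n}" "Suc j \<in> {1..n}" using cross(2) by auto
  have "fact (Tg j * Ag f - (Ag ?f' * Tg j + K * Ag (lvar j * e))) \<phi> = \<zero>\<^bsub>FG\<^esub>"
  proof (rule fact_eqI[OF \<phi>])
   fix l assume l: "l \<in> L"
   let ?p = "lpos ns l"
   have c: "\<phi> l \<in> carrier M" "\<phi> (l \<circ> sref j) \<in> carrier M" using \<phi> l cross(2) by (simp_all del: in_full)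
   have ff: "lrename ?p f \<in> \<A> n" "lrename ?p ?f' \<in> \<A> n" "lrename ?p e \<in> \<A> n"
    using lrename_laurent[OF _ lp[OF l]] cross f' by auto
   have pj: "lvar (?p j) \<in> \<A> n" "lvar (?p (Suc j)) \<in> \<A> n"
    using lpos_in[OF l j(1)] lpos_in[OF l j(2)] by auto
   have lhs: "fact (Tg j * Ag f) \<phi> l = act (PP l j * Ag (lrename ?p f)) (\<phi> l) \<oplus>
     act (QQ l j * Ag (lrename (lpos ns (l \<circ> sref j)) f)) (\<phi> (l \<circ> sref j))"
    using c l \<phi> cross(2) by (simp add: fact_mult fact_GT fact_GA act_mult del: fact_fgen in_full)
   have rhs: "fact (Ag ?f' * Tg j + K * Ag (lvar j * e)) \<phi> l =
     act (Ag (lrename ?p ?f') * PP l j + K * Ag (lvar (?p j) * lrename ?p e)) (\<phi> l) \<oplus>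
     act (Ag (lrename ?p ?f') * QQ l j) (\<phi> (l \<circ> sref j))"
    using c l \<phi> cross(2) by (simp add: fact_add_val fact_fconst_val fact_mult fact_GT fact_GA act_mult act_add act_radd
      lrename_mult a_ac del: fact_fgen in_full)
   have ee: "lrename ?p e * (lvar (?p j) - lvar (?p (Suc j))) = lrename ?p f - lrename ?p ?f'"
    using arg_cong[OF cross(5), of "lrename ?p"] by (simp add: lrename_mult lrename_diff)
   show "fact (Tg j * Ag f) \<phi> l = fact (Ag ?f' * Tg j + K * Ag (lvar j * e)) \<phi> l"
   proof (cases "l j = l (Suc j)")
    case True
    have same: "?p (Suc j) = ?p j + 1" "?p j \<in> lev ns"
    proof -
     have T: "l j = l (j + 1)" using True by simp
     show "?p (Suc j) = ?p j + 1" "?p j \<in> lev ns"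
      using lpos_same[OF cross(2) T] lpos_lev[OF l cross(2) T] by simp_all
    qed
    have "lrename (sref (?p j)) (lrename ?p f) = lrename ?p ?f'"
     unfolding lrename_comp
    proof (rule lrename_cong[OF cross(3)])
     fix i assume i: "i \<in> {1..n}"
     show "(sref (?p j) \<circ> ?p) i = (?p \<circ> sref j) i"
     proof -
      consider "i = j" | "i = Suc j" | "i ~= j" "i ~= Suc j" by blast
      thus ?thesis
      proof cases
       case 3
       hence "?p i ~= ?p j" "?p i ~= Suc (?p j)"
        using lpos_inj[OF l i j(1)] lpos_inj[OF l i j(2)] same(1) by auto
       thus ?thesis using 3 by simp
      qed (use same(1) in simp_all)
     qed
    qed
    hence "sim (Tg (?p j) * Ag (lrename ?p f)) (Ag (lrename ?p ?f') * Tg (?p j) + Ag (\<kappa> * (lvar (?p j) * lrename ?p e)))"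
     by (intro cross_rule) (use same ff ee lev_subset in auto)
    also have "sim \<dots> (Ag (lrename ?p ?f') * Tg (?p j) + K * Ag (lvar (?p j) * lrename ?p e))"
     by (intro sim_add sim_refl sim_trans[OF Ag_mult sim_mult[OF Ag_const sim_refl]]) (use pj ff in auto)
    finally have "act (Tg (?p j) * Ag (lrename ?p f)) (\<phi> l) = act (Ag (lrename ?p ?f') * Tg (?p j) + K * Ag (lvar (?p j) * lrename ?p e)) (\<phi> l)"
     using c simD by blast
    thus ?thesis unfolding lhs rhs using True c by (simp add: PP_def QQ_def)
   next
    \<comment> \<open>At l the claim is \<alpha> (f - f') = \<kappa> x_a e for the divided
      difference e, which is the definition of \<alpha>. At l s_j both sides carry the same Laurent
      polynomial, because \<open>lpos\<close> of l s_j is \<open>lpos\<close> of l composed with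
      s_j.\<close>
    case False
    let ?a = "?p j" and ?b = "?p (Suc j)"
    have ab: "apart ns ?a ?b" using lpos_apart[OF l j] False by simp
    note al = al_laurent[OF ab]
    have pe: "lrename (lpos ns (l \<circ> sref j)) f = lrename ?p ?f'"
     unfolding lrename_comp using lpos_sref[OF cross(2), of l] False by simp
    have "sim (Ag (al ?a ?b) * Ag (lrename ?p f)) (Ag (al ?a ?b * lrename ?p f))"
     by (rule sim_sym[OF Ag_mult[OF al ff(1)]])
    also have "sim \<dots> (Ag (lrename ?p ?f' * al ?a ?b + \<kappa> * (lvar ?a * lrename ?p e)))"
    proof (rule lsim_sim)
     have "al ?a ?b * lrename ?p f = lrename ?p ?f' * al ?a ?b + (\<kappa> * (lvar ?a * lrename ?p e)) * ((lvar ?a - lvar ?b) * g ?a ?b)"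
     proof -
      have "al ?a ?b * lrename ?p f = lrename ?p ?f' * al ?a ?b + al ?a ?b * (lrename ?p f - lrename ?p ?f')"
       by (simp add: algebra_simps)
      thus ?thesis unfolding ee[symmetric] by (simp add: al_def algebra_simps)
     qed
     also have "lsim \<dots> (lrename ?p ?f' * al ?a ?b + (\<kappa> * (lvar ?a * lrename ?p e)) * 1)"
      by (intro lsim_add lsim_lmult dg ab lsim_refl) (use ff pj al in auto)
     finally show "lsim (al ?a ?b * lrename ?p f) (lrename ?p ?f' * al ?a ?b + \<kappa> * (lvar ?a * lrename ?p e))"
      by simp
    qed
    also have "sim \<dots> (Ag (lrename ?p ?f') * Ag (al ?a ?b) + K * Ag (lvar ?a * lrename ?p e))"
     by (intro sim_trans[OF Ag_add] sim_add sim_trans[OF Ag_mult sim_mult[OF Ag_const sim_refl]] Ag_mult)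
      (use ff pj al in auto)
    finally have 1: "sim (Ag (al ?a ?b) * Ag (lrename ?p f)) (Ag (lrename ?p ?f') * Ag (al ?a ?b) + K * Ag (lvar ?a * lrename ?p e))" .
    have 2: "sim ((- 1 - Ag (al ?a ?b)) * Ag (lrename ?p ?f')) (Ag (lrename ?p ?f') * (- 1 - Ag (al ?a ?b)))"
     using commute_neg[of "Ag (al ?a ?b)" "Ag (lrename ?p ?f')"] Ag_comm[OF al ff(2)] by (simp add: commute_def)
    show ?thesis unfolding lhs rhs pe
     using simD[OF 1 c(1)] simD[OF 2 c(2)] False by (simp add: PP_def QQ_def)
   qed
  qed
  thus ?thesis unfolding cross(1) by (simp add: diff_diff_eq)
 qed
qed

end

section \<open>Comparison of the induced module with the functions on labellings\<close>

section \<open>Triangularity\<close>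

lemma (in abelian_group) add_cancel:
 "a \<in> carrier G ==> b \<in> carrier G ==> (a \<oplus> b) \<oplus> (\<ominus> b) = a"
 by (simp add: a_assoc r_neg)

lemma fun_group_finsum:
 assumes "abelian_group M" and "finite A" and "!!a. a \<in> A ==> F a \<in> I \<rightarrow>\<^sub>E carrier M" and "i \<in> I"
 shows "(\<Oplus>\<^bsub>fun_group I M\<^esub>a\<in>A. F a) i = (\<Oplus>\<^bsub>M\<^esub>a\<in>A. F a i)"
 using assms(2,3)
proof (induction A rule: finite_induct)
 interpret M: abelian_group M by fact
 interpret G: abelian_group "fun_group I M" by (rule abelian_group_fun_group) fact
 case empty
 thus ?case using assms(4) by simp
next
 interpret M: abelian_group M by fact
 interpret G: abelian_group "fun_group I M" by (rule abelian_group_fun_group) fact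
 case (insert a A)
 have "F a i \<in> carrier M" "(\<lambda>a. F a i) \<in> A \<rightarrow> carrier M"
  using insert.prems assms(4) by (auto simp: PiE_iff)
 thus ?case using insert assms(4) by (simp add: Pi_def)
qed

context label_model
begin

definition delta :: "(nat => nat) => 'b => (nat => nat) => 'b" where
 "delta l x = (\<lambda>m\<in>L. if m = l then x else \<zero>)"

lemma delta_closed [simp]: "x \<in> carrier M ==> delta l x \<in> L \<rightarrow>\<^sub>E carrier M"
 by (auto simp: delta_def)

lemma delta_val: "m \<in> L ==> delta l x m = (if m = l then x else \<zero>)"
 by (simp add: delta_def)

definition len :: "(nat => nat) => nat" where
 "len l = length (canon n (lpos ns l))"

abbreviation TL :: "(nat => nat) => hgen free" where
 "TL l \<equiv> Tprod (canon n (lpos ns l))"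

lemma len_step:
 assumes l: "l \<in> L" and j: "j \<in> full n" and lt: "l j < l (j + 1)"
 shows "len (l \<circ> sref j) = Suc (len l)"
proof -
 have "lpos ns (l \<circ> sref j) = lpos ns l \<circ> sref j" by (rule lpos_sref[OF j]) (use lt in simp)
 thus ?thesis
  unfolding len_def using length_canon_step[OF lpos_permutes[OF l] j lpos_less[OF l j]] lt by simp
qed

lemma len_sref:
 assumes l: "l \<in> L" and j: "j \<in> full n"
 shows "len l \<le> Suc (len (l \<circ> sref j))"
proof (cases "l (j + 1) < l j")
 case True
 have "len (l \<circ> sref j \<circ> sref j) = Suc (len (l \<circ> sref j))"
  by (rule len_step) (use l j True in auto)
 thus ?thesis unfolding sref_sref by simp
next
 case False
 then consider "l j = l (j + 1)" | "l j < l (j + 1)" by linarith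
 thus ?thesis
 proof cases
  case 1
  thus ?thesis using label_sref_same[OF 1] by simp
 next
  case 2
  thus ?thesis using len_step[OF l j] by simp
 qed
qed

lemma TL_base: "TL (base_label ns) = 1"
 by (simp add: lpos_base canon_id)

lemma TL_step:
 assumes l: "l \<in> L" and j: "j \<in> full n" and lt: "l j < l (j + 1)"
 shows "cong_mod (rels q n (full n)) (Tg j * TL l) (TL (l \<circ> sref j))"
proof -
 have "lpos ns (l \<circ> sref j) = lpos ns l \<circ> sref j" by (rule lpos_sref[OF j]) (use lt in simp)
 thus ?thesis
  using canon_up[OF lpos_permutes[OF l] j lpos_less[OF l j] j set_canon[OF lpos_permutes[OF l]]] lt by simp
qed

lemma TL_step_down:
 assumes l: "l \<in> L" and j: "j \<in> full n" and lt: "l (j + 1) < l j"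
 shows "cong_mod (rels q n (full n)) (Tg j * TL l) (K * TL l + fconst (of_nat q) * TL (l \<circ> sref j))"
proof -
 have "lpos ns (l \<circ> sref j) = lpos ns l \<circ> sref j" by (rule lpos_sref[OF j]) (use lt in simp)
 thus ?thesis
  using canon_down[OF lpos_permutes[OF l] j lpos_greater[OF l j lt] j set_canon[OF lpos_permutes[OF l]]] by simp
qed

text \<open>For the representative w of l, equality of the two labels means s_j w = w s_a with a =
  \<open>lpos ns l j\<close>, and lengths add on both sides. The factor T_a thus produced lies in
  the Levi subalgebra.\<close>

lemma TL_same:
 assumes l: "l \<in> L" and j: "j \<in> full n" and eq: "l j = l (j + 1)"
 shows "cong_mod (rels q n (full n)) (Tg j * TL l) (TL l * Tg (lpos ns l j))"
proof -
 let ?p = "lpos ns l"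
 have p: "?p permutes {1..n}" by (rule lpos_permutes[OF l])
 have lt: "?p j < ?p (j + 1)" by (rule lpos_less[OF l j]) (use eq in simp)
 have inn: "?p j \<in> full n" using lpos_lev[OF l j eq] lev_subset by blast
 have sw: "?p \<circ> sref j = sref (?p j) \<circ> ?p"
 proof
  fix i
  have s: "?p (Suc j) = Suc (?p j)" using lpos_same[OF j eq] by simp
  consider "i = j" | "i = Suc j" | "i ~= j" "i ~= Suc j" by blast
  thus "(?p \<circ> sref j) i = (sref (?p j) \<circ> ?p) i"
  proof cases
   case 3
   hence "?p i ~= ?p j" "?p i ~= ?p (Suc j)" using permutes_inj[OF p] by (simp_all add: inj_eq)
   thus ?thesis using 3 s by simp
  qed (use s in simp_all)
 qed
 have "cong_mod (rels q n (full n)) (Tg j * TL l) (Tprod (canon n (?p \<circ> sref j)))"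
  by (rule canon_up[OF p j lt j set_canon[OF p]])
 also have "cong_mod (rels q n (full n)) \<dots> (TL l * Tg (?p j))"
  unfolding sw using length_canon_step[OF p j lt]
  by (intro cong_mod_sym[OF canon_right[OF p inn]]) (simp add: sw)
 finally show ?thesis .
qed

text \<open>-1 - \<alpha>(a, b) = (x_b - q x_a) / (x_a - x_b), so the inverse is formed with
  \<open>h b a\<close>.\<close>

lemma be_inverse:
 assumes ab: "apart ns a b"
 defines "d \<equiv> Ag ((lvar a - lvar b) * h b a)"
 shows "sim ((- 1 - Ag (al a b)) * d) 1" and "sim (d * (- 1 - Ag (al a b))) 1"
proof -
 have ba: "apart ns b a" by (rule apart_sym[OF ab])
 note la = apart_lvar[OF ab] h_laurent[OF ba] al_laurent[OF ab]
 have r1: "rep (- 1 - Ag (al a b)) (- 1 - al a b)" by (intro rep_neg rep_al ab)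
 have r2: "rep d ((lvar a - lvar b) * h b a)" using la by (simp add: rep_def d_def)
 have r3: "rep 1 1" by (simp add: rep_def sim_sym[OF Ag_one])
 have hb: "lsim ((lvar b - lconst (of_nat q) * lvar a) * h b a) 1"
  using h_inverse[OF ba] la sim_trans[OF _ sim_sym[OF Ag_one]] by (auto simp: lsim_def)
 have q1: "lconst (of_nat q) = 1 + \<kappa>" by (simp add: lconst_diff)
 have "(- 1 - al a b) * ((lvar a - lvar b) * h b a) =
  - ((lvar a - lvar b) * h b a) - (\<kappa> * lvar a * h b a) * ((lvar a - lvar b) * g a b)"
  by (simp add: al_def algebra_simps)
 also have "lsim \<dots> (- ((lvar a - lvar b) * h b a) - (\<kappa> * lvar a * h b a) * 1)"
  by (intro lsim_diff lsim_refl lsim_lmult dg ab) (use la in auto)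
 also have "- ((lvar a - lvar b) * h b a) - (\<kappa> * lvar a * h b a) * 1 = (lvar b - lconst (of_nat q) * lvar a) * h b a"
  unfolding q1 by (simp add: algebra_simps)
 also note hb
 finally have e: "lsim ((- 1 - al a b) * ((lvar a - lvar b) * h b a)) 1" .
 show "sim ((- 1 - Ag (al a b)) * d) 1"
  by (rule sim_via_rep[OF rep_mult[OF r1 r2] r3 lsim_zeroI[OF e]])
 show "sim (d * (- 1 - Ag (al a b))) 1"
  by (rule sim_via_rep[OF rep_mult[OF r2 r1] r3]) (use lsim_zeroI[OF e] in "simp add: mult.commute")
qed

text \<open>The image of T_w tensor x under the map out of the induced module, where w is the
  representative of l.\<close>

definition theta :: "(nat => nat) => 'b => (nat => nat) => 'b" where
 "theta l x = fact (TL l) (delta (base_label ns) x)"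

lemma theta_closed [simp]: "x \<in> carrier M ==> theta l x \<in> L \<rightarrow>\<^sub>E carrier M"
 by (simp add: theta_def)

text \<open>A step of \<open>labelling_induct\<close> multiplies the leading coefficient by an
  invertible \<open>QQ\<close>. Nothing else reaches labellings of the same or greater length, since
  s_j changes the length by at most one. Only a left inverse of the leading coefficient is recorded,
  which is what injectivity uses.\<close>

lemma theta_triangular:
 assumes "l \<in> L"
 shows "\<exists>c d. sim (d * c) 1 \<and> (\<forall>x\<in>carrier M. theta l x l = act c x \<and>
  (\<forall>m\<in>L. m ~= l --> len l \<le> len m --> theta l x m = \<zero>))"
 using assms
proof (induction l rule: labelling_induct)
 case base
 have "theta (base_label ns) x = delta (base_label ns) x" if "x \<in> carrier M" for x
  unfolding theta_def TL_base using FA.act_one[of "delta (base_label ns) x"] that by simp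
 thus ?case
  by (intro exI[of _ 1]) (simp add: delta_val base_label_labelling)
next
 case (step l j)
 then obtain c d where cd: "sim (d * c) 1"
  and th: "!!x. x \<in> carrier M ==> theta l x l = act c x"
   "!!x m. x \<in> carrier M ==> m \<in> L ==> m ~= l ==> len l \<le> len m ==> theta l x m = \<zero>" by blast
 let ?l = "l \<circ> sref j"
 have lL: "?l \<in> L" using step by simp
 have lv: "?l j ~= ?l (Suc j)" "l j ~= l (Suc j)" using step by simp_all
 have ap: "apart ns (lpos ns ?l j) (lpos ns ?l (Suc j))"
  using lpos_apart[OF lL, of j "Suc j"] lv step(2) by auto
 obtain d' where d': "sim (d' * QQ ?l j) 1"
  using be_inverse(2)[OF ap] lv by (auto simp: QQ_def)
 have st: "theta ?l x m = act (PP m j) (theta l x m) \<oplus> act (QQ m j) (theta l x (m \<circ> sref j))"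
  if x: "x \<in> carrier M" and m: "m \<in> L" for x m
 proof -
  have "theta ?l x = fact (Tg j * TL l) (delta (base_label ns) x)"
   unfolding theta_def
   using FA.act_cong[OF fun_kills cong_mod_sym[OF TL_step[OF step(1,2,3)]], of "delta (base_label ns) x"] x by simp
  also have "\<dots> = fact (Tg j) (theta l x)" unfolding theta_def by (rule fact_mult) (use x in simp)
  finally show ?thesis using fact_GT[OF theta_closed[OF x] step(2) m] by simp
 qed
 have len: "len ?l = Suc (len l)" by (rule len_step[OF step(1-3)])
 show ?case
 proof (intro exI conjI ballI impI)
  have "sim (d * d' * (QQ ?l j * c)) (d * 1 * c)"
   using sim_mult[OF sim_mult[OF sim_refl[of d] d'] sim_refl[of c]] by (simp add: mult.assoc)
  also have "sim (d * 1 * c) 1" using cd by simp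
  finally show "sim (d * d' * (QQ ?l j * c)) 1" .
  fix x assume x: "x \<in> carrier M"
  have "?l ~= l" using len by auto
  hence "theta l x ?l = \<zero>" by (intro th(2) x lL) (simp_all add: len)
  thus "theta ?l x ?l = act (QQ ?l j * c) x"
   using x step(1) st[OF x lL] unfolding sref_sref by (simp add: th(1) act_mult)
  fix m assume m: "m \<in> L" "m ~= ?l" "len ?l \<le> len m"
  have "m ~= l" using m len by auto
  hence "theta l x m = \<zero>" using m(3) unfolding len by (intro th(2) x m(1)) simp_all
  moreover have "act (QQ m j) (theta l x (m \<circ> sref j)) = \<zero>"
  proof (cases "m j = m (Suc j)")
   case True
   thus ?thesis using fun_val[OF theta_closed[OF x], of "m \<circ> sref j"] m(1) step(2) by (simp add: QQ_def)
  next
   case False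
   have "m \<circ> sref j ~= l" using m(2) sref_sref(2)[of m j] by auto
   moreover have "len l \<le> len (m \<circ> sref j)" using len_sref[OF m(1) step(2)] m(3) unfolding len by simp
   ultimately have "theta l x (m \<circ> sref j) = \<zero>" using m(1) step(2) by (intro th(2) x) simp_all
   thus ?thesis by simp
  qed
  ultimately show "theta ?l x m = \<zero>" using st[OF x m(1)] by simp
 qed
qed

lemma theta_zero: "theta l \<zero> = \<zero>\<^bsub>FG\<^esub>"
proof -
 have "delta (base_label ns) \<zero> = \<zero>\<^bsub>FG\<^esub>" by (auto simp: delta_def intro!: restrict_ext)
 thus ?thesis unfolding theta_def by (simp only: FA.act_rzero)
qed

text \<open>At the labelling of a nonzero term of maximal length all other terms vanish, so the
  leading coefficient kills a nonzero vector, against its left inverse.\<close>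

lemma theta_independent:
 assumes x: "!!l. l \<in> L ==> x l \<in> carrier M" and sum: "(\<Oplus>\<^bsub>FG\<^esub>l\<in>L. theta l (x l)) = \<zero>\<^bsub>FG\<^esub>" and "l \<in> L"
 shows "x l = \<zero>"
proof (rule ccontr)
 assume ne: "x l ~= \<zero>"
 let ?S = "{l \<in> L. x l ~= \<zero>}"
 have "finite (len ` ?S)" "len ` ?S ~= {}" using ne \<open>l \<in> L\<close> by auto
 hence "Max (len ` ?S) \<in> len ` ?S" by (rule Max_in)
 then obtain k where k: "k \<in> L" "x k ~= \<zero>" "len k = Max (len ` ?S)" by auto
 have le: "len m \<le> len k" if "m \<in> L" "x m ~= \<zero>" for m
  unfolding k(3) using that by (intro Max_ge) auto
 have zero: "theta m (x m) k = \<zero>" if m: "m \<in> L" "m ~= k" for m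
 proof (cases "x m = \<zero>")
  case True
  thus ?thesis using k by (simp add: theta_zero)
 next
  case False
  obtain c d where "\<forall>x\<in>carrier M. theta m x m = act c x \<and>
    (\<forall>i\<in>L. i ~= m --> len m \<le> len i --> theta m x i = \<zero>)"
   using theta_triangular[OF m(1)] by auto
  thus ?thesis using x[OF m(1)] k(1) le[OF m(1) False] m(2) by auto
 qed
 obtain c d where cd: "sim (d * c) 1" "theta k (x k) k = act c (x k)"
  using theta_triangular[OF k(1)] x[OF k(1)] by blast
 have "(\<Oplus>\<^bsub>FG\<^esub>l\<in>L. theta l (x l)) k = (\<Oplus>l\<in>L. theta l (x l) k)"
  by (rule fun_group_finsum) (use x k in \<open>auto intro: theta_closed\<close>, unfold_locales)
 also have "\<dots> = (\<Oplus>l\<in>L. if k = l then act c (x k) else \<zero>)"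
  using zero cd(2) x k by (intro finsum_cong') auto
 also have "\<dots> = act c (x k)" using add.finprod_singleton[of k L "\<lambda>_. act c (x k)"] k x by simp
 finally have "act c (x k) = \<zero>" using sum k by simp
 hence "act (d * c) (x k) = \<zero>" using x k by (simp add: act_mult)
 thus False using simD[OF cd(1) x[OF k(1)]] x k by simp
qed

text \<open>At the base labelling \<open>lpos\<close> is the identity, and the swaps of the Levi
  subalgebra fix this labelling. So the functions supported there form a copy of the Levi
  module.\<close>

lemma delta_equivariant:
 assumes a: "a \<in> fsupp (gens n (lev ns))" and x: "x \<in> carrier M"
 shows "delta (base_label ns) (act a x) = fact a (delta (base_label ns) x)"
proof (rule free_action_equivariant[OF _ _ killed _ _ _ _ a x, where N = FG])
 let ?b = "base_label ns"
 show "free_action M act" "free_action FG fact" by unfold_locales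
 show "FA.kills (rels q n (lev ns))" by (rule FA.kills_mono[OF fun_kills rels_mono[OF lev_subset]])
 show "!!x. x \<in> carrier M ==> delta ?b x \<in> carrier FG" by simp
 show "!!x y. x \<in> carrier M ==> y \<in> carrier M ==> delta ?b (x \<oplus> y) = delta ?b x \<oplus>\<^bsub>FG\<^esub> delta ?b y"
  by (auto simp: delta_def intro!: restrict_ext)
 fix c x assume c: "c \<in> gens n (lev ns)" and x: "x \<in> carrier M"
 show "delta ?b (act (fgen c) x) = fact (fgen c) (delta ?b x)"
 proof (rule fun_group_eqI[OF delta_closed fact_closed[OF delta_closed]])
  fix m assume m: "m \<in> L"
  show "delta ?b (act (fgen c) x) m = fact (fgen c) (delta ?b x) m"
  proof (cases c)
   case (GA f)
   hence "lrename id f = f" using c by (intro lrename_ident) auto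
   thus ?thesis unfolding GA fact_GA[OF delta_closed[OF x] m] using m x by (simp add: delta_val lpos_base)
  next
   case (GT j)
   hence j: "j \<in> lev ns" using c by simp
   hence j2: "j \<in> full n" using lev_subset by blast
   have bj: "?b j = ?b (j + 1)" using j j2 by (auto simp: base_label_def lev_block_index)
   have bb: "?b \<circ> sref j = ?b" by (rule label_sref_same[OF bj])
   have v: "fact (Tg j) (delta ?b x) m = act (PP m j) (delta ?b x m) \<oplus> act (QQ m j) (delta ?b x (m \<circ> sref j))"
    by (rule fact_GT[OF delta_closed[OF x] j2 m])
   show ?thesis
   proof (cases "m = ?b")
    case True
    have "PP ?b j = Tg j" "QQ ?b j = 0" using bj by (simp_all add: PP_def QQ_def lpos_base)
    thus ?thesis using v x base_label_labelling[of ns] unfolding GT True bb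
     by (simp add: delta_val del: fact_fgen)
   next
    case False
    hence "m \<circ> sref j ~= ?b" using bb sref_sref(2)[of m j] by metis
    moreover have "m \<circ> sref j \<in> L" using m j2 by simp
    ultimately show ?thesis using v m False x unfolding GT by (simp add: delta_val del: fact_fgen)
   qed
  qed
 qed (use x in auto)
qed

text \<open>The coefficients \<open>QQ\<close> are invertible, so \<open>T\<^sub>j\<close> moves the base labelling to all others.\<close>

lemma fun_generated:
 assumes sub: "\<zero>\<^bsub>FG\<^esub> \<in> U" "!!\<phi> \<psi>. \<phi> \<in> U ==> \<psi> \<in> U ==> \<phi> \<oplus>\<^bsub>FG\<^esub> \<psi> \<in> U"
   "U <= L \<rightarrow>\<^sub>E carrier M"
  and base: "!!x. x \<in> carrier M ==> delta (base_label ns) x \<in> U"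
  and stable: "!!a \<phi>. a \<in> hfree n ==> \<phi> \<in> U ==> fact a \<phi> \<in> U"
 shows "L \<rightarrow>\<^sub>E carrier M <= U"
proof -
 have d: "\<forall>x\<in>carrier M. delta l x \<in> U" if "l \<in> L" for l
  using that
 proof (induction l rule: labelling_induct)
  case base
  thus ?case using assms(4) by blast
 next
  case (step l j)
  let ?l = "l \<circ> sref j"
  have lL: "?l \<in> L" using step by simp
  have lv: "?l j ~= ?l (Suc j)" "l j ~= l (Suc j)" "?l ~= l" using step len_step[OF step(1-3)] by (simp_all, force)
  have ap: "apart ns (lpos ns ?l j) (lpos ns ?l (Suc j))"
   using lpos_apart[OF lL, of j "Suc j"] lv step(2) by auto
  obtain d' where d': "sim (QQ ?l j * d') 1"
   using be_inverse(1)[OF ap] lv by (auto simp: QQ_def)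
  show ?case
  proof
   fix y assume y: "y \<in> carrier M"
   let ?x = "act d' y"
   \<comment> \<open>T_j applied to the function with value d' y at l has the value y at l s_j,
     because d' inverts \<open>QQ\<close>; the part that remains at l is subtracted.\<close>
   have "delta ?l y = fact (Tg j) (delta l ?x) \<oplus>\<^bsub>FG\<^esub> (\<ominus>\<^bsub>FG\<^esub> delta l (act (PP l j) ?x))"
   proof -
    have "fact (Tg j) (delta l ?x) = delta ?l y \<oplus>\<^bsub>FG\<^esub> delta l (act (PP l j) ?x)"
    proof (rule fun_group_eqI[OF fact_closed[OF delta_closed], where B = "carrier M"])
     fix m assume m: "m \<in> L"
     have eq: "m \<circ> sref j = l \<longleftrightarrow> m = ?l" using sref_sref(2) by metis
     have mm: "m \<circ> sref j \<in> L" using m step(2) by simp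
     have "act (QQ ?l j) ?x = y" using simD[OF d' y] y by (simp add: act_mult)
     thus "fact (Tg j) (delta l ?x) m = (delta ?l y \<oplus>\<^bsub>FG\<^esub> delta l (act (PP l j) ?x)) m"
      unfolding fact_GT[OF delta_closed[OF act_closed[OF y]] step(2) m]
      using m mm y lv(3) by (auto simp: delta_val eq)
    qed (use y F.a_closed[of "delta ?l y" "delta l (act (PP l j) ?x)"] in auto)
    thus ?thesis
     using F.add_cancel[of "delta ?l y" "delta l (act (PP l j) ?x)"] y by simp
   qed
   moreover have "fact (Tg j) (delta l ?x) \<in> U" by (rule stable) (use step(2,4) y in auto)
   moreover have "\<ominus>\<^bsub>FG\<^esub> delta l (act (PP l j) ?x) \<in> U"
    using stable[of "- 1" "delta l (act (PP l j) ?x)"] FA.act_uminus[of "delta l (act (PP l j) ?x)" 1]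
     FA.act_one[of "delta l (act (PP l j) ?x)"] step(4) y by simp
   ultimately show "delta ?l y \<in> U" using sub(2) by simp
  qed
 qed
 show ?thesis
 proof
  fix \<phi> assume \<phi>: "\<phi> \<in> L \<rightarrow>\<^sub>E carrier M"
  have fin: "(\<Oplus>\<^bsub>FG\<^esub>l\<in>A. delta l (\<phi> l)) \<in> U" if "finite A" "A <= L" for A
   using that
  proof (induction A rule: finite_induct)
   case empty
   thus ?case using sub(1) by (simp del: fun_group_simps(2))
  next
   case (insert l A)
   have "(\<Oplus>\<^bsub>FG\<^esub>l\<in>insert l A. delta l (\<phi> l)) = delta l (\<phi> l) \<oplus>\<^bsub>FG\<^esub> (\<Oplus>\<^bsub>FG\<^esub>l\<in>A. delta l (\<phi> l))"
    using insert \<phi> by (intro F.finsum_insert) (auto simp: subset_iff)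
   thus ?case using insert sub(2) d \<phi> by (simp del: fun_group_simps(3))
  qed
  have "\<phi> = (\<Oplus>\<^bsub>FG\<^esub>l\<in>L. delta l (\<phi> l))"
  proof (rule fun_group_eqI[OF \<phi>, where B = "carrier M"])
   show "(\<Oplus>\<^bsub>FG\<^esub>l\<in>L. delta l (\<phi> l)) \<in> L \<rightarrow>\<^sub>E carrier M" using fin[of L] sub(3) by auto
   fix m assume m: "m \<in> L"
   have "(\<Oplus>\<^bsub>FG\<^esub>l\<in>L. delta l (\<phi> l)) m = (\<Oplus>l\<in>L. delta l (\<phi> l) m)"
    by (rule fun_group_finsum) (use \<phi> m in \<open>auto intro: delta_closed\<close>, unfold_locales)
   also have "\<dots> = (\<Oplus>l\<in>L. if m = l then \<phi> m else \<zero>)"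
    using \<phi> m by (intro finsum_cong') (auto simp: delta_val)
   also have "\<dots> = \<phi> m" using add.finprod_singleton[of m L "\<lambda>_. \<phi> m"] \<phi> m by simp
   finally show "\<phi> m = (\<Oplus>\<^bsub>FG\<^esub>l\<in>L. delta l (\<phi> l)) m" ..
  qed
  thus "\<phi> \<in> U" using fin[of L] by simp
 qed
qed

end

section \<open>Induced modules\<close>

locale induction_data = A?: ring A + left_module R M
 for A :: "('a, 'r) ring_scheme" and R :: "('a, 's) ring_scheme" and M :: "('a, 'b) module" +
 assumes sub: "carrier R <= carrier A" and ops: "monoid.mult R = monoid.mult A" "\<one>\<^bsub>R\<^esub> = \<one>\<^bsub>A\<^esub>"
begin

abbreviation "FA \<equiv> free_Abelian_group (carrier A \<times> carrier M)"
abbreviation "TR \<equiv> tensor_relations A R M"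
abbreviation "lmf \<equiv> left_mult_formal A"
abbreviation "NA \<equiv> generate FA TR"
abbreviation "Ind \<equiv> induced_module A R M"

lemma FA_diff: "c \<in> carrier FA ==> d \<in> carrier FA ==> c - d \<in> carrier FA"
 using keys_diff[of c d] by auto

lemma FA_add: "c \<in> carrier FA ==> d \<in> carrier FA ==> c + d \<in> carrier FA"
 using keys_add[of c d] by auto

lemma FA_uminus: "c \<in> carrier FA ==> - c \<in> carrier FA"
 by simp

lemma FA_frag: "a \<in> carrier A ==> x \<in> carrier M ==> frag_of (a, x) \<in> carrier FA"
 by simp

lemma sub_carrier: "r \<in> carrier R ==> r \<in> carrier A"
 using sub by blast

lemma relations_cases [consumes 1, case_names ladd radd balanced]:
 assumes "r \<in> TR"
  and "!!a a' x. r = frag_of (a \<oplus>\<^bsub>A\<^esub> a', x) - frag_of (a, x) - frag_of (a', x) ==>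
   a \<in> carrier A ==> a' \<in> carrier A ==> x \<in> carrier M ==> P"
  and "!!a x x'. r = frag_of (a, x \<oplus>\<^bsub>M\<^esub> x') - frag_of (a, x) - frag_of (a, x') ==>
   a \<in> carrier A ==> x \<in> carrier M ==> x' \<in> carrier M ==> P"
  and "!!a s x. r = frag_of (a \<otimes>\<^bsub>A\<^esub> s, x) - frag_of (a, s \<odot>\<^bsub>M\<^esub> x) ==>
   a \<in> carrier A ==> s \<in> carrier R ==> x \<in> carrier M ==> P"
 shows P
 using assms(1) unfolding tensor_relations_def
 by (elim UnE CollectE exE conjE) (rule assms(2-), assumption+)+

lemma relations_ladd: "a \<in> carrier A ==> a' \<in> carrier A ==> x \<in> carrier M ==>
  frag_of (a \<oplus>\<^bsub>A\<^esub> a', x) - frag_of (a, x) - frag_of (a', x) \<in> TR"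
 and relations_radd: "a \<in> carrier A ==> x \<in> carrier M ==> y \<in> carrier M ==>
  frag_of (a, x \<oplus>\<^bsub>M\<^esub> y) - frag_of (a, x) - frag_of (a, y) \<in> TR"
 and relations_balanced: "a \<in> carrier A ==> s \<in> carrier R ==> x \<in> carrier M ==>
  frag_of (a \<otimes>\<^bsub>A\<^esub> s, x) - frag_of (a, s \<odot>\<^bsub>M\<^esub> x) \<in> TR"
 unfolding tensor_relations_def by blast+

lemma relations_in: "TR <= carrier FA"
proof
 fix r assume "r \<in> TR"
 thus "r \<in> carrier FA"
 proof (cases rule: relations_cases)
  case (ladd a a' x)
  thus ?thesis unfolding ladd(1) by (intro FA_diff FA_frag) auto
 next
  case (radd a x x')
  thus ?thesis unfolding radd(1) by (intro FA_diff FA_frag) auto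
 next
  case (balanced a s x)
  thus ?thesis unfolding balanced(1) by (intro FA_diff FA_frag) (auto intro: sub_carrier smult_closed)
 qed
qed

sublocale NA: normal NA FA
proof -
 interpret comm_group FA by (rule abelian_free_Abelian_group)
 show "normal NA FA" by (intro subgroup_imp_normal generate_is_subgroup relations_in)
qed

lemma NA_zero: "0 \<in> NA"
 using subgroup.one_closed[OF NA.subgroup_axioms] by simp

lemma NA_carrier: "c \<in> NA ==> c \<in> carrier FA"
 by (rule subgroup.mem_carrier[OF NA.subgroup_axioms])

lemma NA_uminus: "c \<in> NA ==> - c \<in> NA"
 using subgroup.m_inv_closed[OF NA.subgroup_axioms] NA_carrier inv_free_Abelian_group
 by (metis carrier_free_Abelian_group_iff)

lemma NA_add: "c \<in> NA ==> d \<in> NA ==> c + d \<in> NA"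
 using subgroup.m_closed[OF NA.subgroup_axioms, of c d] by simp

definition cl :: "(('a \<times> 'b) \<Rightarrow>\<^sub>0 int) => (('a \<times> 'b) \<Rightarrow>\<^sub>0 int) set" where
 "cl c = NA #>\<^bsub>FA\<^esub> c"

lemma carrier_Ind: "carrier Ind = cl ` carrier FA"
 by (auto simp: induced_module_def Let_def FactGroup_def RCOSETS_def cl_def)

lemma zero_Ind: "\<zero>\<^bsub>Ind\<^esub> = cl 0"
 using group.coset_join2[OF group_free_Abelian_group, of 0 "carrier A \<times> carrier M" NA] NA.subgroup_axioms NA_zero
 by (simp add: induced_module_def Let_def FactGroup_def cl_def)

lemma Ind_cases:
 assumes "u \<in> carrier Ind"
 obtains c where "c \<in> carrier FA" "u = cl c"
 using assms by (auto simp: carrier_Ind simp del: carrier_free_Abelian_group_iff)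

lemma cl_in: "c \<in> carrier FA ==> cl c \<in> carrier Ind"
 by (auto simp: carrier_Ind)

lemma add_Ind: "c \<in> carrier FA ==> d \<in> carrier FA ==> cl c \<oplus>\<^bsub>Ind\<^esub> cl d = cl (c + d)"
 using NA.rcos_sum[of c d] by (simp add: induced_module_def Let_def FactGroup_def cl_def)

lemma cl_eq_iff:
 assumes "c \<in> carrier FA" and "d \<in> carrier FA" shows "cl c = cl d \<longleftrightarrow> c - d \<in> NA"
proof -
 have "cl c = cl d \<longleftrightarrow> c \<in> NA #>\<^bsub>FA\<^esub> d"
  using group.repr_independence[OF group_free_Abelian_group _ assms(2) NA.subgroup_axioms]
   group.rcos_self[OF group_free_Abelian_group assms(1) NA.subgroup_axioms]
  unfolding cl_def by metis
 also have "\<dots> \<longleftrightarrow> (\<exists>h\<in>NA. c = h + d)" by (simp add: r_coset_def)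
 also have "\<dots> \<longleftrightarrow> c - d \<in> NA"
 proof
  assume "\<exists>h\<in>NA. c = h + d"
  then obtain h where "h \<in> NA" "c = h + d" by blast
  moreover from this(2) have "c - d = h" by simp
  ultimately show "c - d \<in> NA" by (simp only:)
 next
  assume "c - d \<in> NA"
  thus "\<exists>h\<in>NA. c = h + d" by (rule bexI[rotated]) simp
 qed
 finally show ?thesis .
qed

lemma relation_cl: "c - d \<in> TR ==> c \<in> carrier FA ==> d \<in> carrier FA ==> cl c = cl d"
 by (rule iffD2[OF cl_eq_iff generate.incl])

lemma lmf_add: "lmf h (c + d) = lmf h c + lmf h d"
 and lmf_diff: "lmf h (c - d) = lmf h c - lmf h d"
 and lmf_of [simp]: "lmf h (frag_of (a, x)) = frag_of (h \<otimes>\<^bsub>A\<^esub> a, x)"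
 and lmf_zero [simp]: "lmf h 0 = 0"
 and lmf_uminus: "lmf h (- c) = - lmf h c"
 by (simp_all add: left_mult_formal_def frag_extend_add frag_extend_diff frag_extend_minus)

lemma lmf_in:
 assumes h: "h \<in> carrier A" and c: "c \<in> carrier FA"
 shows "lmf h c \<in> carrier FA"
proof -
 have "Poly_Mapping.keys c <= carrier A \<times> carrier M" using c by simp
 thus ?thesis
 proof (induction c rule: frag_induction)
  case (one z)
  thus ?case using h FA_frag by (cases z) (auto simp del: carrier_free_Abelian_group_iff)
 next
  case (diff a b)
  thus ?case unfolding lmf_diff by (intro FA_diff)
 qed simp
qed

lemma lmf_relation:
 assumes h: "h \<in> carrier A" and r: "r \<in> TR"
 shows "lmf h r \<in> TR"
 using r
proof (cases rule: relations_cases)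
 case (ladd a a' x)
 have "lmf h r = frag_of (h \<otimes>\<^bsub>A\<^esub> a \<oplus>\<^bsub>A\<^esub> h \<otimes>\<^bsub>A\<^esub> a', x) - frag_of (h \<otimes>\<^bsub>A\<^esub> a, x) - frag_of (h \<otimes>\<^bsub>A\<^esub> a', x)"
  using ladd h by (simp add: lmf_diff A.r_distr)
 thus ?thesis using relations_ladd[of "h \<otimes>\<^bsub>A\<^esub> a" "h \<otimes>\<^bsub>A\<^esub> a'" x] ladd h by simp
next
 case (radd a x x')
 thus ?thesis using relations_radd[of "h \<otimes>\<^bsub>A\<^esub> a" x x'] h by (simp add: lmf_diff)
next
 case (balanced a s x)
 have "lmf h r = frag_of (h \<otimes>\<^bsub>A\<^esub> a \<otimes>\<^bsub>A\<^esub> s, x) - frag_of (h \<otimes>\<^bsub>A\<^esub> a, s \<odot>\<^bsub>M\<^esub> x)"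
  using balanced h sub_carrier by (simp add: lmf_diff A.m_assoc)
 thus ?thesis using relations_balanced[of "h \<otimes>\<^bsub>A\<^esub> a" s x] balanced h by simp
qed

lemma NA_induct [consumes 1, case_names zero incl uminus add]:
 assumes "c \<in> NA" and "P 0" and "!!r. r \<in> TR ==> P r"
  and "!!r. r \<in> TR ==> P (- r)" and "!!c d. c \<in> NA ==> d \<in> NA ==> P c ==> P d ==> P (c + d)"
 shows "P c"
 using assms(1)
proof (induction rule: generate.induct)
 case one
 thus ?case using assms(2) by simp
next
 case (inv h)
 hence "Poly_Mapping.keys h <= carrier A \<times> carrier M" using subsetD[OF relations_in inv] by simp
 thus ?case using inv assms(4) by simp
qed (use assms in auto)

lemma lmf_NA:
 assumes h: "h \<in> carrier A" shows "c \<in> NA ==> lmf h c \<in> NA"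
proof (induction c rule: NA_induct)
 case zero
 thus ?case using NA_zero by simp
next
 case (incl r)
 thus ?case using lmf_relation[OF h] by (auto intro: generate.incl)
next
 case (uminus r)
 thus ?case using lmf_relation[OF h] NA_uminus by (auto simp: lmf_uminus intro: generate.incl)
next
 case (add c d)
 thus ?case using NA_add by (simp add: lmf_add)
qed

text \<open>\<open>lmf h\<close> maps relations to relations, hence each coset into a coset; adding
  the subgroup once more fills that coset.\<close>

lemma smult_Ind:
 assumes h: "h \<in> carrier A" and c: "c \<in> carrier FA"
 shows "h \<odot>\<^bsub>Ind\<^esub> cl c = cl (lmf h c)"
proof -
 have "h \<odot>\<^bsub>Ind\<^esub> cl c = NA <#>\<^bsub>FA\<^esub> (lmf h ` (NA #>\<^bsub>FA\<^esub> c))"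
  by (simp add: induced_module_def Let_def cl_def)
 also have "\<dots> = cl (lmf h c)"
 proof (intro equalityI subsetI)
  fix z assume "z \<in> NA <#>\<^bsub>FA\<^esub> (lmf h ` (NA #>\<^bsub>FA\<^esub> c))"
  then obtain x y where "x \<in> NA" "y \<in> NA" "z = x + lmf h (y + c)"
   by (auto simp: set_mult_def r_coset_def)
  thus "z \<in> cl (lmf h c)"
   using NA_add[OF _ lmf_NA[OF h]] unfolding cl_def r_coset_def
   by (auto simp: lmf_add intro!: bexI[of _ "x + lmf h y"])
 next
  fix z assume "z \<in> cl (lmf h c)"
  then obtain x where x: "x \<in> NA" "z = x + lmf h c" by (auto simp: cl_def r_coset_def)
  have "c \<in> NA #>\<^bsub>FA\<^esub> c" using NA_zero by (force simp: r_coset_def)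
  thus "z \<in> NA <#>\<^bsub>FA\<^esub> (lmf h ` (NA #>\<^bsub>FA\<^esub> c))"
   using x by (auto simp: set_mult_def)
 qed
 finally show ?thesis .
qed

lemma lmf_lmf: 
 assumes "h \<in> carrier A" "k \<in> carrier A" "c \<in> carrier FA"
 shows "lmf (h \<otimes>\<^bsub>A\<^esub> k) c = lmf h (lmf k c)"
proof -
 have "Poly_Mapping.keys c <= carrier A \<times> carrier M" using assms by simp
 thus ?thesis
  by (induction c rule: frag_induction) (use assms in "auto simp: A.m_assoc lmf_diff")
qed

lemma lmf_one: "c \<in> carrier FA ==> lmf \<one>\<^bsub>A\<^esub> c = c"
proof -
 assume "c \<in> carrier FA"
 hence "Poly_Mapping.keys c <= carrier A \<times> carrier M" by simp
 thus ?thesis by (induction c rule: frag_induction) (auto simp: lmf_diff)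
qed

text \<open>On formal sums \<open>lmf\<close> is not additive in its first argument; it becomes so
  modulo the relations of additivity in the left factor.\<close>

lemma cl_add_formal:
 assumes "h \<in> carrier A" "k \<in> carrier A" "c \<in> carrier FA"
 shows "cl (lmf (h \<oplus>\<^bsub>A\<^esub> k) c) = cl (lmf h c + lmf k c)"
proof -
 have hk: "h \<oplus>\<^bsub>A\<^esub> k \<in> carrier A" using assms by simp
 let ?D = "\<lambda>c. lmf (h \<oplus>\<^bsub>A\<^esub> k) c - (lmf h c + lmf k c)"
 have "Poly_Mapping.keys c <= carrier A \<times> carrier M" using assms by simp
 hence "?D c \<in> NA"
 proof (induction c rule: frag_induction)
  case zero
  thus ?case using NA_zero by simp
 next
  case (one z)
  obtain a x where z: "z = (a, x)" by (cases z)
  have "?D (frag_of z) = frag_of (h \<otimes>\<^bsub>A\<^esub> a \<oplus>\<^bsub>A\<^esub> k \<otimes>\<^bsub>A\<^esub> a, x) - frag_of (h \<otimes>\<^bsub>A\<^esub> a, x) - frag_of (k \<otimes>\<^bsub>A\<^esub> a, x)"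
   using one assms z by (simp add: A.l_distr diff_diff_eq)
  moreover have "\<dots> \<in> TR"
   by (rule relations_ladd) (use one assms z in simp_all)
  ultimately show ?case using generate.incl by metis
 next
  case (diff a b)
  have "?D (a - b) = ?D a + - ?D b" by (simp add: lmf_diff)
  thus ?case using diff NA_add NA_uminus by metis
 qed
 moreover have "lmf h c + lmf k c \<in> carrier FA"
  by (rule FA_add[OF lmf_in[OF assms(1,3)] lmf_in[OF assms(2,3)]])
 ultimately show ?thesis using cl_eq_iff lmf_in[OF hk assms(3)] by blast
qed

lemma left_module_Ind: "left_module A Ind"
proof (intro left_module.intro left_module_axioms.intro)
 show "ring A" by (rule A.ring_axioms)
 show "abelian_group Ind"
 proof (rule abelian_groupI)
  fix u assume "u \<in> carrier Ind"
  then obtain c where c: "c \<in> carrier FA" "u = cl c" by (blast elim: Ind_cases)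
  show "\<zero>\<^bsub>Ind\<^esub> \<oplus>\<^bsub>Ind\<^esub> u = u"
   using add_Ind[of 0 c] c by (simp add: zero_Ind)
  show "\<exists>v\<in>carrier Ind. v \<oplus>\<^bsub>Ind\<^esub> u = \<zero>\<^bsub>Ind\<^esub>"
   by (rule bexI[of _ "cl (- c)"]) (use c add_Ind[of "- c" c] cl_in[of "- c"] in "simp_all add: zero_Ind")
  fix v assume "v \<in> carrier Ind"
  then obtain d where d: "d \<in> carrier FA" "v = cl d" by (blast elim: Ind_cases)
  show "u \<oplus>\<^bsub>Ind\<^esub> v \<in> carrier Ind" unfolding c d add_Ind[OF c(1) d(1)] by (intro cl_in FA_add c d)
  show "u \<oplus>\<^bsub>Ind\<^esub> v = v \<oplus>\<^bsub>Ind\<^esub> u"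
   unfolding c d add_Ind[OF c(1) d(1)] add_Ind[OF d(1) c(1)] by (simp add: add.commute)
  fix w assume "w \<in> carrier Ind"
  then obtain e where e: "e \<in> carrier FA" "w = cl e" by (blast elim: Ind_cases)
  show "u \<oplus>\<^bsub>Ind\<^esub> v \<oplus>\<^bsub>Ind\<^esub> w = u \<oplus>\<^bsub>Ind\<^esub> (v \<oplus>\<^bsub>Ind\<^esub> w)"
   unfolding c d e add_Ind[OF c(1) d(1)] add_Ind[OF d(1) e(1)]
    add_Ind[OF FA_add[OF c(1) d(1)] e(1)] add_Ind[OF c(1) FA_add[OF d(1) e(1)]] by (simp add: add.assoc)
 next
  show "\<zero>\<^bsub>Ind\<^esub> \<in> carrier Ind" unfolding zero_Ind by (rule cl_in) simp
 qed
next
 fix h u assume h: "h \<in> carrier A" and "u \<in> carrier Ind"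
 then obtain c where c: "c \<in> carrier FA" "u = cl c" by (blast elim: Ind_cases)
 show "h \<odot>\<^bsub>Ind\<^esub> u \<in> carrier Ind" unfolding c smult_Ind[OF h c(1)] by (intro cl_in lmf_in h c)
 { fix k assume k: "k \<in> carrier A"
  show "(h \<oplus>\<^bsub>A\<^esub> k) \<odot>\<^bsub>Ind\<^esub> u = h \<odot>\<^bsub>Ind\<^esub> u \<oplus>\<^bsub>Ind\<^esub> k \<odot>\<^bsub>Ind\<^esub> u"
   unfolding c smult_Ind[OF h c(1)] smult_Ind[OF k c(1)] smult_Ind[OF A.a_closed[OF h k] c(1)]
    add_Ind[OF lmf_in[OF h c(1)] lmf_in[OF k c(1)]] by (rule cl_add_formal[OF h k c(1)])
  show "(h \<otimes>\<^bsub>A\<^esub> k) \<odot>\<^bsub>Ind\<^esub> u = h \<odot>\<^bsub>Ind\<^esub> (k \<odot>\<^bsub>Ind\<^esub> u)"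
   unfolding c smult_Ind[OF k c(1)] smult_Ind[OF A.m_closed[OF h k] c(1)] smult_Ind[OF h lmf_in[OF k c(1)]]
   by (simp only: lmf_lmf[OF h k c(1)]) }
 fix v assume "v \<in> carrier Ind"
 then obtain d where d: "d \<in> carrier FA" "v = cl d" by (blast elim: Ind_cases)
 show "h \<odot>\<^bsub>Ind\<^esub> (u \<oplus>\<^bsub>Ind\<^esub> v) = h \<odot>\<^bsub>Ind\<^esub> u \<oplus>\<^bsub>Ind\<^esub> h \<odot>\<^bsub>Ind\<^esub> v"
  unfolding c d add_Ind[OF c(1) d(1)] smult_Ind[OF h c(1)] smult_Ind[OF h d(1)]
   smult_Ind[OF h FA_add[OF c(1) d(1)]] add_Ind[OF lmf_in[OF h c(1)] lmf_in[OF h d(1)]]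
  by (simp only: lmf_add)
next
 fix u assume "u \<in> carrier Ind"
 then obtain c where c: "c \<in> carrier FA" "u = cl c" by (blast elim: Ind_cases)
 show "\<one>\<^bsub>A\<^esub> \<odot>\<^bsub>Ind\<^esub> u = u" unfolding c smult_Ind[OF A.one_closed c(1)] by (simp only: lmf_one[OF c(1)])
qed

definition tens :: "'a => 'b => (('a \<times> 'b) \<Rightarrow>\<^sub>0 int) set" where
 "tens a x = cl (frag_of (a, x))"

lemma tens_in [simp]: "a \<in> carrier A ==> x \<in> carrier M ==> tens a x \<in> carrier Ind"
 unfolding tens_def by (rule cl_in) simp

lemma tens_smult: "h \<in> carrier A ==> a \<in> carrier A ==> x \<in> carrier M ==> h \<odot>\<^bsub>Ind\<^esub> tens a x = tens (h \<otimes>\<^bsub>A\<^esub> a) x"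
 unfolding tens_def by (subst smult_Ind) simp_all

lemma tens_radd:
 assumes "a \<in> carrier A" "x \<in> carrier M" "y \<in> carrier M"
 shows "tens a (x \<oplus>\<^bsub>M\<^esub> y) = tens a x \<oplus>\<^bsub>Ind\<^esub> tens a y"
proof -
 have "frag_of (a, x \<oplus>\<^bsub>M\<^esub> y) - (frag_of (a, x) + frag_of (a, y)) \<in> TR"
  using relations_radd[OF assms] by (simp add: diff_diff_eq)
 moreover have "frag_of (a, x) + frag_of (a, y) \<in> carrier FA" by (rule FA_add) (use assms in simp_all)
 ultimately have "cl (frag_of (a, x \<oplus>\<^bsub>M\<^esub> y)) = cl (frag_of (a, x) + frag_of (a, y))"
  using assms by (intro relation_cl) simp_all
 thus ?thesis unfolding tens_def using assms by (subst add_Ind) simp_all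
qed

lemma tens_balanced:
 assumes "a \<in> carrier A" "r \<in> carrier R" "x \<in> carrier M"
 shows "tens (a \<otimes>\<^bsub>A\<^esub> r) x = tens a (r \<odot>\<^bsub>M\<^esub> x)"
 unfolding tens_def
proof (rule relation_cl)
 show "frag_of (a \<otimes>\<^bsub>A\<^esub> r, x) - frag_of (a, r \<odot>\<^bsub>M\<^esub> x) \<in> TR"
  by (rule relations_balanced[OF assms])
qed (use assms sub_carrier[OF assms(2)] smult_closed in simp_all)

lemma Ind_induct [consumes 1, case_names zero tens minus]:
 assumes "u \<in> carrier Ind" and "P \<zero>\<^bsub>Ind\<^esub>"
  and "!!a x. a \<in> carrier A ==> x \<in> carrier M ==> P (tens a x)"
  and "!!u v. u \<in> carrier Ind ==> v \<in> carrier Ind ==> P u ==> P v ==> P (u \<ominus>\<^bsub>Ind\<^esub> v)"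
 shows "P u"
proof -
 interpret I: left_module A Ind by (rule left_module_Ind)
 obtain c where c: "c \<in> carrier FA" "u = cl c"
  using assms(1) by (blast elim: Ind_cases)
 have "Poly_Mapping.keys c <= carrier A \<times> carrier M" using c(1) by simp
 hence "P (cl c)"
 proof (rule free_Abelian_group_induct[where P = "\<lambda>c. P (cl c)"])
  show "P (cl 0)" using assms(2) by (simp add: zero_Ind)
 next
  fix c d :: "('a \<times> 'b) \<Rightarrow>\<^sub>0 int"
  assume "Poly_Mapping.keys c <= carrier A \<times> carrier M" "Poly_Mapping.keys d <= carrier A \<times> carrier M"
   and P: "P (cl c)" "P (cl d)"
  hence cd: "c \<in> carrier FA" "d \<in> carrier FA" by simp_all
  have nd: "\<ominus>\<^bsub>Ind\<^esub> cl d = cl (- d)"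
   by (rule I.M.minus_equality)
    (use add_Ind[OF FA_uminus[OF cd(2)] cd(2)] cl_in[OF FA_uminus[OF cd(2)]] cl_in[OF cd(2)] in "simp_all add: zero_Ind")
  have "cl (c - d) = cl c \<ominus>\<^bsub>Ind\<^esub> cl d"
   using add_Ind[OF cd(1) FA_uminus[OF cd(2)]] by (simp add: I.M.minus_eq nd)
  thus "P (cl (c - d))" using P assms(4)[OF cl_in[OF cd(1)] cl_in[OF cd(2)]] by simp
 next
  fix z assume "z \<in> carrier A \<times> carrier M"
  thus "P (cl (frag_of z))" using assms(3)[of "fst z" "snd z"] by (auto simp: tens_def)
 qed
 thus ?thesis using c by simp
qed

text \<open>The universal property of the tensor product: sending (a, x) to a f(x) defines a
  homomorphism on the free abelian group, it vanishes on the tensor relations, and it descends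
  through chosen representatives.\<close>

lemma Ind_universal:
 fixes P :: "('a, 'c) module"
 assumes "left_module A P" and f: "!!x. x \<in> carrier M ==> f x \<in> carrier P"
  and f_add: "!!x y. x \<in> carrier M ==> y \<in> carrier M ==> f (x \<oplus>\<^bsub>M\<^esub> y) = f x \<oplus>\<^bsub>P\<^esub> f y"
  and f_lin: "!!r x. r \<in> carrier R ==> x \<in> carrier M ==> f (r \<odot>\<^bsub>M\<^esub> x) = r \<odot>\<^bsub>P\<^esub> f x"
 obtains \<Phi> where "!!u. u \<in> carrier Ind ==> \<Phi> u \<in> carrier P"
  "!!u v. u \<in> carrier Ind ==> v \<in> carrier Ind ==> \<Phi> (u \<oplus>\<^bsub>Ind\<^esub> v) = \<Phi> u \<oplus>\<^bsub>P\<^esub> \<Phi> v"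
  "!!h u. h \<in> carrier A ==> u \<in> carrier Ind ==> \<Phi> (h \<odot>\<^bsub>Ind\<^esub> u) = h \<odot>\<^bsub>P\<^esub> \<Phi> u"
  "!!a x. a \<in> carrier A ==> x \<in> carrier M ==> \<Phi> (tens a x) = a \<odot>\<^bsub>P\<^esub> f x"
proof -
 interpret P: left_module A P by fact
 interpret I: left_module A Ind by (rule left_module_Ind)
 obtain k where k: "k \<in> hom FA (add_monoid P)"
  and k_of: "!!z. z \<in> carrier A \<times> carrier M ==> k (frag_of z) = fst z \<odot>\<^bsub>P\<^esub> f (snd z)"
 proof (rule comm_group.free_Abelian_group_universal[OF P.M.a_comm_group, of "\<lambda>z. fst z \<odot>\<^bsub>P\<^esub> f (snd z)" "carrier A \<times> carrier M"])
  show "(\<lambda>z. fst z \<odot>\<^bsub>P\<^esub> f (snd z)) ` (carrier A \<times> carrier M) <= carrier (add_monoid P)"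
   using f P.smult_closed by auto
 qed blast
 have kc: "k c \<in> carrier P" if "c \<in> carrier FA" for c using k that by (auto simp: hom_def)
 have ka: "k (c + d) = k c \<oplus>\<^bsub>P\<^esub> k d" if "c \<in> carrier FA" "d \<in> carrier FA" for c d
  using hom_mult[OF k that] by simp
 have k0: "k 0 = \<zero>\<^bsub>P\<^esub>" using ka[of 0 0] kc[of 0] by (simp add: P.M.add.l_cancel_one')
 have ku: "k (- c) = \<ominus>\<^bsub>P\<^esub> k c" if "c \<in> carrier FA" for c
  using ka[of "- c" c] kc[of c] kc[of "- c"] that k0 by (intro P.M.minus_equality[symmetric]) simp_all
 have kd: "k (c - d) = k c \<ominus>\<^bsub>P\<^esub> k d" if "c \<in> carrier FA" "d \<in> carrier FA" for c d
  using ka[of c "- d"] ku[of d] that by (simp add: P.M.minus_eq)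
 have rel0: "k r = \<zero>\<^bsub>P\<^esub>" if r: "r \<in> TR" for r
 proof -
  have zz: "x \<ominus>\<^bsub>P\<^esub> y \<ominus>\<^bsub>P\<^esub> z = \<zero>\<^bsub>P\<^esub>" if "x = y \<oplus>\<^bsub>P\<^esub> z" "y \<in> carrier P" "z \<in> carrier P" for x y z
  proof -
   have "x \<ominus>\<^bsub>P\<^esub> y = z"
    using that P.M.add_cancel[of z y] by (simp add: P.M.minus_eq P.M.a_comm)
   thus ?thesis using that by (simp add: P.M.minus_eq P.M.r_neg)
  qed
  have Rin: "s \<in> carrier A" if "s \<in> carrier R" for s using that sub by blast
  have inn: "Poly_Mapping.keys (x - y) <= S" if "Poly_Mapping.keys x <= S" "Poly_Mapping.keys y <= S"
   for x y :: "('a \<times> 'b) \<Rightarrow>\<^sub>0 int" and S using that keys_diff[of x y] by blast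
  from r show ?thesis
  proof (rule relations_cases)
   fix a a' x assume e: "r = frag_of (a \<oplus>\<^bsub>A\<^esub> a', x) - frag_of (a, x) - frag_of (a', x)"
    and in1: "a \<in> carrier A" "a' \<in> carrier A" "x \<in> carrier M"
   have "k r = k (frag_of (a \<oplus>\<^bsub>A\<^esub> a', x)) \<ominus>\<^bsub>P\<^esub> k (frag_of (a, x)) \<ominus>\<^bsub>P\<^esub> k (frag_of (a', x))"
    unfolding e using in1 by (subst kd, simp_all add: inn, subst kd, simp_all)
   also have "\<dots> = \<zero>\<^bsub>P\<^esub>"
    by (rule zz) (use in1 f P.smult_closed in "simp_all add: k_of P.smult_l_distr")
   finally show ?thesis .
  next
   fix a x x' assume e: "r = frag_of (a, x \<oplus>\<^bsub>M\<^esub> x') - frag_of (a, x) - frag_of (a, x')"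
    and in1: "a \<in> carrier A" "x \<in> carrier M" "x' \<in> carrier M"
   have "k r = k (frag_of (a, x \<oplus>\<^bsub>M\<^esub> x')) \<ominus>\<^bsub>P\<^esub> k (frag_of (a, x)) \<ominus>\<^bsub>P\<^esub> k (frag_of (a, x'))"
    unfolding e using in1 by (subst kd, simp_all add: inn, subst kd, simp_all)
   also have "\<dots> = \<zero>\<^bsub>P\<^esub>"
    by (rule zz) (use in1 f P.smult_closed in "simp_all add: k_of f_add P.smult_r_distr")
   finally show ?thesis .
  next
   fix a s x assume e: "r = frag_of (a \<otimes>\<^bsub>A\<^esub> s, x) - frag_of (a, s \<odot>\<^bsub>M\<^esub> x)"
    and in1: "a \<in> carrier A" "s \<in> carrier R" "x \<in> carrier M"
   have "k r = k (frag_of (a \<otimes>\<^bsub>A\<^esub> s, x)) \<ominus>\<^bsub>P\<^esub> k (frag_of (a, s \<odot>\<^bsub>M\<^esub> x))"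
    unfolding e using in1 Rin[OF in1(2)] smult_closed by (subst kd) simp_all
   also have "\<dots> = \<zero>\<^bsub>P\<^esub>"
    using in1 Rin[OF in1(2)] f smult_closed P.smult_closed
    by (simp add: k_of f_lin P.smult_assoc1 P.M.r_neg P.M.minus_eq)
   finally show ?thesis .
  qed
 qed
 have N0: "k c = \<zero>\<^bsub>P\<^esub>" if "c \<in> NA" for c
  using that
 proof (induction c rule: NA_induct)
  case (uminus r)
  thus ?case using relations_in rel0[of r] ku[of r] by (auto simp del: carrier_free_Abelian_group_iff)
 next
  case (add c d)
  thus ?case using NA.subset ka[of c d] by (auto simp del: carrier_free_Abelian_group_iff)
 qed (simp_all add: k0 rel0)
 define \<Phi> where "\<Phi> u = k (SOME c. c \<in> carrier FA \<and> cl c = u)" for u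
 have \<Phi>: "\<Phi> (cl c) = k c" if c: "c \<in> carrier FA" for c
 proof -
  let ?d = "SOME d. d \<in> carrier FA \<and> cl d = cl c"
  have d: "?d \<in> carrier FA \<and> cl ?d = cl c" by (rule someI[of _ c]) (use c in simp)
  have "k (?d - c) = \<zero>\<^bsub>P\<^esub>"
   by (rule N0[OF iffD1[OF cl_eq_iff[OF conjunct1[OF d] c] conjunct2[OF d]]])
  hence "k ?d \<ominus>\<^bsub>P\<^esub> k c = \<zero>\<^bsub>P\<^esub>" using kd[OF conjunct1[OF d] c] by (simp only:)
  hence "k ?d = k c"
   using P.M.add_cancel[OF kc[OF conjunct1[OF d]] P.M.a_inv_closed[OF kc[OF c]]] kc[OF c]
   by (simp only: P.M.minus_eq P.M.l_zero P.M.minus_minus)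
  thus ?thesis by (simp add: \<Phi>_def)
 qed
 show ?thesis
 proof (rule that[of \<Phi>])
  fix u assume "u \<in> carrier Ind"
  then obtain c where c: "c \<in> carrier FA" "u = cl c" by (blast elim: Ind_cases)
  show "\<Phi> u \<in> carrier P" unfolding c \<Phi>[OF c(1)] by (rule kc[OF c(1)])
  { fix v assume "v \<in> carrier Ind"
   then obtain d where d: "d \<in> carrier FA" "v = cl d" by (blast elim: Ind_cases)
   show "\<Phi> (u \<oplus>\<^bsub>Ind\<^esub> v) = \<Phi> u \<oplus>\<^bsub>P\<^esub> \<Phi> v"
    unfolding c d add_Ind[OF c(1) d(1)] \<Phi>[OF c(1)] \<Phi>[OF d(1)] \<Phi>[OF FA_add[OF c(1) d(1)]] by (rule ka[OF c(1) d(1)]) }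
  fix h assume h: "h \<in> carrier A"
  have "k (lmf h c) = h \<odot>\<^bsub>P\<^esub> k c"
  proof -
   have "Poly_Mapping.keys c <= carrier A \<times> carrier M" using c(1) by simp
   hence "Poly_Mapping.keys c <= carrier A \<times> carrier M \<and> k (lmf h c) = h \<odot>\<^bsub>P\<^esub> k c"
   proof (induction c rule: frag_induction)
    case zero
    thus ?case using h by (simp add: k0 P.smult_rzero)
   next
    case (one z)
    thus ?case using h f P.smult_closed by (cases z) (auto simp: k_of P.smult_assoc1)
   next
    case (diff a b)
    have ab: "a \<in> carrier FA" "b \<in> carrier FA" using diff by auto
    have "k (lmf h (a - b)) = k (lmf h a) \<ominus>\<^bsub>P\<^esub> k (lmf h b)"
     unfolding lmf_diff by (rule kd) (intro lmf_in h ab)+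
    also have "\<dots> = h \<odot>\<^bsub>P\<^esub> (k a \<ominus>\<^bsub>P\<^esub> k b)"
     using diff h kc[OF ab(1)] kc[OF ab(2)] by (simp add: P.M.minus_eq P.smult_r_distr P.smult_rminus)
    also have "\<dots> = h \<odot>\<^bsub>P\<^esub> k (a - b)" by (simp only: kd[OF ab])
    finally show ?case using diff keys_diff[of a b] by blast
   qed
   thus ?thesis ..
  qed
  thus "\<Phi> (h \<odot>\<^bsub>Ind\<^esub> u) = h \<odot>\<^bsub>P\<^esub> \<Phi> u"
   unfolding c smult_Ind[OF h c(1)] \<Phi>[OF c(1)] \<Phi>[OF lmf_in[OF h c(1)]] .
 next
  fix a x assume "a \<in> carrier A" "x \<in> carrier M"
  thus "\<Phi> (tens a x) = a \<odot>\<^bsub>P\<^esub> f x" unfolding tens_def by (subst \<Phi>) (simp_all add: k_of)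
 qed
qed

end

section \<open>Induced modules as modules of sections\<close>

text \<open>\<open>E\<close> is any \<H>_n-module with a map \<open>e\<close> compatible with the
  Levi action; it will be the induced module with x going to 1 tensor x. That \<open>U\<close> is a
  submodule follows from the relations alone.\<close>

locale spanned = label_model M act q ns g h + E: free_action E actE
 for M :: "('s, 'b) module" and act and q :: nat and ns :: "nat list" and g h
  and E :: "('t, 'e) module" and actE +
 fixes e :: "'b => 'e"
 assumes E_kills: "E.kills (rels q (sum_list ns) (full (sum_list ns)))"
  and e_closed [simp]: "x \<in> carrier M ==> e x \<in> carrier E"
  and e_add: "x \<in> carrier M ==> y \<in> carrier M ==> e (x \<oplus>\<^bsub>M\<^esub> y) = e x \<oplus>\<^bsub>E\<^esub> e y"
  and e_act: "a \<in> fsupp (gens (sum_list ns) (lev ns)) ==> x \<in> carrier M ==> e (act a x) = actE a (e x)"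
begin

definition U :: "'e set" where
 "U = {\<Oplus>\<^bsub>E\<^esub>l\<in>L. actE (TL l) (e (x l)) | x. \<forall>l\<in>L. x l \<in> carrier M}"

lemma e_zero: "e \<zero>\<^bsub>M\<^esub> = \<zero>\<^bsub>E\<^esub>"
 using e_add[of "\<zero>\<^bsub>M\<^esub>" "\<zero>\<^bsub>M\<^esub>"] e_closed[of "\<zero>\<^bsub>M\<^esub>"] by (simp add: E.add.l_cancel_one')

lemma U_closed: "u \<in> U ==> u \<in> carrier E"
 unfolding U_def by (auto intro!: E.finsum_closed)

lemma U_add: "u \<in> U ==> v \<in> U ==> u \<oplus>\<^bsub>E\<^esub> v \<in> U"
proof -
 assume "u \<in> U" "v \<in> U"
 then obtain x y where x: "\<forall>l\<in>L. x l \<in> carrier M" "u = (\<Oplus>\<^bsub>E\<^esub>l\<in>L. actE (TL l) (e (x l)))"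
  and y: "\<forall>l\<in>L. y l \<in> carrier M" "v = (\<Oplus>\<^bsub>E\<^esub>l\<in>L. actE (TL l) (e (y l)))"
  unfolding U_def by blast
 have "u \<oplus>\<^bsub>E\<^esub> v = (\<Oplus>\<^bsub>E\<^esub>l\<in>L. actE (TL l) (e (x l)) \<oplus>\<^bsub>E\<^esub> actE (TL l) (e (y l)))"
  unfolding x(2) y(2) by (rule E.finsum_addf[symmetric]) (use x(1) y(1) in auto)
 also have "\<dots> = (\<Oplus>\<^bsub>E\<^esub>l\<in>L. actE (TL l) (e (x l \<oplus>\<^bsub>M\<^esub> y l)))"
  using x(1) y(1) by (intro E.finsum_cong') (auto simp: e_add E.act_radd)
 finally show ?thesis unfolding U_def using x(1) y(1) by (intro CollectI exI[of _ "\<lambda>l. x l \<oplus>\<^bsub>M\<^esub> y l"]) auto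
qed

lemma U_single: "l \<in> L ==> x \<in> carrier M ==> actE (TL l) (e x) \<in> U"
proof -
 assume l: "l \<in> L" and x: "x \<in> carrier M"
 have "(\<Oplus>\<^bsub>E\<^esub>m\<in>L. actE (TL m) (e (if l = m then x else \<zero>\<^bsub>M\<^esub>))) =
   (\<Oplus>\<^bsub>E\<^esub>m\<in>L. if l = m then actE (TL m) (e x) else \<zero>\<^bsub>E\<^esub>)"
  using x by (intro E.finsum_cong') (auto simp: e_zero)
 also have "\<dots> = actE (TL l) (e x)"
  using E.add.finprod_singleton[of l L "\<lambda>m. actE (TL m) (e x)"] l x by simp
 finally show ?thesis unfolding U_def using x
  by (intro CollectI exI[of _ "\<lambda>m. if l = m then x else \<zero>\<^bsub>M\<^esub>"]) auto
qed

lemma U_zero: "\<zero>\<^bsub>E\<^esub> \<in> U"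
proof -
 have "actE (TL (base_label ns)) (e \<zero>\<^bsub>M\<^esub>) \<in> U" by (rule U_single[OF base_label_labelling]) simp
 thus ?thesis by (simp only: e_zero E.act_rzero)
qed

lemma U_finsum: "finite A ==> (!!a. a \<in> A ==> F a \<in> U) ==> (\<Oplus>\<^bsub>E\<^esub>a\<in>A. F a) \<in> U"
proof (induction A rule: finite_induct)
 case empty
 thus ?case using U_zero by simp
next
 case (insert a A)
 hence "F a \<in> carrier E" "F \<in> A \<rightarrow> carrier E" using U_closed by auto
 thus ?case using insert U_add by (simp add: E.finsum_insert)
qed

lemma U_base: "x \<in> carrier M ==> e x \<in> U"
 using U_single[OF base_label_labelling, of x] E.act_one[OF e_closed[of x]] unfolding TL_base by simp

lemma act_const_fsupp: "e (act (fconst c) x) = actE (fconst c) (e x)" if "x \<in> carrier M"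
 by (rule e_act) (use that in auto)

lemma E_const_comm: "u \<in> carrier E ==> actE (fconst c) (actE a u) = actE a (actE (fconst c) u)"
 by (simp add: E.act_mult[symmetric] fconst_commute)

lemma U_linear:
 assumes "!!l x. l \<in> L ==> x \<in> carrier M ==> actE a (actE (TL l) (e x)) \<in> U" and "u \<in> U"
 shows "actE a u \<in> U"
proof -
 from assms(2) obtain x where x: "\<forall>l\<in>L. x l \<in> carrier M" "u = (\<Oplus>\<^bsub>E\<^esub>l\<in>L. actE (TL l) (e (x l)))"
  unfolding U_def by blast
 have "actE a u = (\<Oplus>\<^bsub>E\<^esub>l\<in>L. actE a (actE (TL l) (e (x l))))"
  unfolding x(2) by (rule E.act_rsum) (use x(1) in auto)
 also have "\<dots> \<in> U" by (rule U_finsum) (use x(1) assms(1) in auto)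
 finally show ?thesis .
qed

lemma U_const: "u \<in> U ==> actE (fconst c) u \<in> U"
proof (rule U_linear)
 fix l x assume "l \<in> L" "x \<in> carrier M"
 thus "actE (fconst c) (actE (TL l) (e x)) \<in> U"
  using U_single[of l "act (fconst c) x"] by (simp add: E_const_comm act_const_fsupp)
qed

text \<open>According to the labels at j and j + 1, T_j lengthens T_w, shortens it with a quadratic
  correction, or passes to its right into the Levi subalgebra, where \<open>e\<close> absorbs
  it.\<close>

lemma U_Tg: "j \<in> full n ==> u \<in> U ==> actE (Tg j) u \<in> U"
proof (rule U_linear)
 fix l x assume j: "j \<in> full n" and l: "l \<in> L" and x: "x \<in> carrier M"
 note cong = E.act_cong[OF E_kills _ e_closed[OF x]]
 have eq: "actE (Tg j) (actE (TL l) (e x)) = actE (Tg j * TL l) (e x)" using x by (simp add: E.act_mult)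
 consider "l j < l (j + 1)" | "l (j + 1) < l j" | "l j = l (j + 1)" by linarith
 thus "actE (Tg j) (actE (TL l) (e x)) \<in> U"
 proof cases
  case 1
  show ?thesis unfolding eq cong[OF TL_step[OF l j 1]] by (rule U_single[OF labellings_sref[OF l j] x])
 next
  case 2
  have "actE (K * TL l + fconst (of_nat q) * TL (l \<circ> sref j)) (e x) =
    actE K (actE (TL l) (e x)) \<oplus>\<^bsub>E\<^esub> actE (fconst (of_nat q)) (actE (TL (l \<circ> sref j)) (e x))"
   using x by (simp add: E.act_add E.act_mult)
  thus ?thesis unfolding eq cong[OF TL_step_down[OF l j 2]]
   using U_add[OF U_const[OF U_single[OF l x]] U_const[OF U_single[OF labellings_sref[OF l j] x]]] by simp
 next
  case 3
  let ?a = "lpos ns l j"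
  have a: "?a \<in> lev ns" by (rule lpos_lev[OF l j 3])
  have "actE (TL l * Tg ?a) (e x) = actE (TL l) (e (act (Tg ?a) x))"
   using x a by (simp add: E.act_mult e_act)
  thus ?thesis unfolding eq cong[OF TL_same[OF l j 3]]
   using U_single[OF l, of "act (Tg ?a) x"] x by simp
 qed
qed

text \<open>The Laurent polynomial moves to the right through the word. Every crossing leaves a
  correction with one letter less and another polynomial, whence the induction for arbitrary
  f.\<close>

lemma U_Ag_word:
 assumes "set js <= full n" and "f \<in> \<A> n" and x: "x \<in> carrier M"
 shows "actE (Ag f * Tprod js) (e x) \<in> U"
 using assms(1,2)
proof (induction js arbitrary: f)
 case Nil
 hence "actE (Ag f * Tprod []) (e x) = e (act (Ag f) x)" using x by (simp add: e_act)
 thus ?case using U_base x by simp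
next
 case (Cons j js)
 interpret EH: hecke_action E actE q n "full n"
  by (intro hecke_action.intro hecke_action_axioms.intro E_kills E.free_action_axioms)
 have j: "j \<in> full n" "1 \<le> j" "j < n" using Cons by auto
 let ?f = "lrename (sref j) f"
 have f': "?f \<in> \<A> n" by (rule lrename_sref_laurent) (use j Cons in auto)
 have ff: "lrename (sref j) ?f = f" unfolding lrename_comp by (rule lrename_ident[OF Cons.prems(2)]) simp
 obtain d where d: "d \<in> \<A> n" "d * (lvar j - lvar (j + 1)) = ?f - lrename (sref j) ?f"
  using divided_difference[OF f' j(2,3)] by blast
 let ?d = "\<kappa> * (lvar j * d)"
 have dl: "?d \<in> \<A> n" using d j by auto
 have "E.sim (Tg j * Ag ?f) (Ag f * Tg j + Ag ?d)"
  by (rule EH.cross[OF j(1) f' d(1) ff]) (use d ff in simp_all)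
 hence "E.sim (Tg j * Ag ?f - Ag ?d) (Ag f * Tg j + Ag ?d - Ag ?d)"
  by (intro E.sim_diff E.sim_refl)
 hence s: "E.sim (Ag f * Tg j) (Tg j * Ag ?f - Ag ?d)" by (simp add: E.sim_sym)
 have c: "actE (Tprod js) (e x) \<in> carrier E" using x by simp
 have js: "set js <= full n" using Cons by simp
 have "actE (Ag f * Tprod (j # js)) (e x) = actE (Ag f * Tg j) (actE (Tprod js) (e x))"
  using x by (simp add: E.act_mult)
 also have "\<dots> = actE (Tg j * Ag ?f - Ag ?d) (actE (Tprod js) (e x))" by (rule E.simD[OF s c])
 also have "\<dots> = actE (Tg j) (actE (Ag ?f * Tprod js) (e x)) \<oplus>\<^bsub>E\<^esub> actE (- 1) (actE (Ag ?d * Tprod js) (e x))"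
  using x by (simp add: E.act_diff E.act_mult E.act_uminus E.minus_eq)
 also have "\<dots> \<in> U"
  using U_add[OF U_Tg[OF j(1) Cons.IH[OF js f']] U_const[OF Cons.IH[OF js dl], of "- 1"]]
  by (simp add: fconst_uminus)
 finally show ?case .
qed

lemma U_stable: "a \<in> hfree n ==> u \<in> U ==> actE a u \<in> U"
proof (induction a rule: free_induct)
 case (const c)
 thus ?case by (simp add: U_const)
next
 case (add a b)
 thus ?case using U_add U_closed by (simp add: E.act_add)
next
 case (gen c a)
 have v: "actE a u \<in> U" using gen by simp
 have eq: "actE (fgen c * a) u = actE (fgen c) (actE a u)" by (rule E.act_mult[OF U_closed[OF gen(4)]])
 show ?case
 proof (cases c)
  case (GT j)
  thus ?thesis unfolding eq using U_Tg[OF _ v] gen(1) by simp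
 next
  case (GA f)
  hence f: "f \<in> \<A> n" using gen(1) by simp
  have "actE (Ag f) (actE a u) \<in> U"
  proof (rule U_linear[OF _ v])
   fix l x assume l: "l \<in> L" and x: "x \<in> carrier M"
   show "actE (Ag f) (actE (TL l) (e x)) \<in> U"
    using U_Ag_word[OF set_canon[OF lpos_permutes[OF l]] f x] x by (simp add: E.act_mult)
  qed
  thus ?thesis using eq GA by simp
 qed
qed

end

text \<open>Bundles the assumptions of \<open>label_model\<close> on \<open>g\<close> and
  \<open>h\<close> into one condition on a given set of vectors.\<close>

definition invertible_apart :: "nat => nat list => (hgen free => 'b => 'b) => 'b set => (nat => nat => laurent) => (nat => nat => laurent) => bool" where
 "invertible_apart q ns act C g h \<longleftrightarrow> (\<forall>a b. apart ns a b -->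
   g a b \<in> \<A> (sum_list ns) \<and> h a b \<in> \<A> (sum_list ns) \<and>
   (\<forall>x\<in>C. act (Ag ((lvar a - lvar b) * g a b)) x = x \<and>
    act (Ag ((lvar a - lconst (of_nat q) * lvar b) * h a b)) x = x))"

locale levi_model =
 fixes q :: nat and ns :: "nat list" and \<sigma> :: "(hecke_elt, 'b) module" and g h
 assumes levi_module: "left_module (levi q ns) \<sigma>"
  and invertible: "invertible_apart q ns (mact q (sum_list ns) (lev ns) \<sigma>) (carrier \<sigma>) g h"

sublocale levi_model \<subseteq> label_model \<sigma> "mact q (sum_list ns) (lev ns) \<sigma>" q ns g h
proof -
 interpret free_action \<sigma> "mact q (sum_list ns) (lev ns) \<sigma>" by (rule free_action_levi[OF levi_module])
 show "label_model \<sigma> (mact q (sum_list ns) (lev ns) \<sigma>) q ns g h"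
 proof
  show "kills (rels q (sum_list ns) (lev ns))" by (rule kills_levi[OF levi_module])
 qed (use invertible in "auto simp: invertible_apart_def sim_def")
qed

context levi_model
begin

definition FM :: "(hecke_elt, (nat => nat) => 'b) module" where
 "FM = act_module q n FG fact"

lemma left_module_FM: "left_module (hecke q n) FM"
 unfolding FM_def by (rule left_module_act_module[OF FA.free_action_axioms fun_kills])

lemma FM_smult: "a \<in> hfree n ==> \<phi> \<in> L \<rightarrow>\<^sub>E carrier \<sigma> ==> hcls q n a \<odot>\<^bsub>FM\<^esub> \<phi> = fact a \<phi>"
 unfolding FM_def by (rule act_module_smult[OF FA.free_action_axioms fun_kills]) simp_all

lemma FM_simps [simp]: "carrier FM = (L \<rightarrow>\<^sub>E carrier \<sigma>)" "\<zero>\<^bsub>FM\<^esub> = \<zero>\<^bsub>FG\<^esub>" "add FM = add FG"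
 unfolding FM_def by simp_all

lemma induction_data_levi: "induction_data (hecke q n) (levi q ns) \<sigma>"
 by (intro induction_data.intro induction_data_axioms.intro ring_hecke levi_module levi_subset_hecke) simp_all

text \<open>The map extends the embedding at the base labelling. The induced module is spanned by
  the T_w tensor x, and their images \<open>theta\<close> are independent, so the map is injective;
  it is onto by \<open>fun_generated\<close>.\<close>

theorem induced_iso_sections: "left_modules_isomorphic (hecke q n) (induced_module (hecke q n) (levi q ns) \<sigma>) FM"
proof -
 interpret I: induction_data "hecke q n" "levi q ns" \<sigma> by (rule induction_data_levi)
 interpret S: left_module "levi q ns" \<sigma> by (rule levi_module)
 interpret FMm: left_module "hecke q n" FM by (rule left_module_FM)
 interpret IM: left_module "hecke q n" I.Ind by (rule I.left_module_Ind)
 let ?act = "mact q n (lev ns) \<sigma>" and ?b = "base_label ns"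
 let ?actE = "mact q n (full n) I.Ind"
 let ?e = "I.tens \<one>\<^bsub>hecke q n\<^esub>"
 have lev_elt: "\<exists>a\<in>fsupp (gens n (lev ns)). r = hcls q n a" if "r \<in> carrier (levi q ns)" for r
  using that by (auto simp: carrier_levi)
 have hc: "hcls q n a \<in> carrier (levi q ns)" if "a \<in> fsupp (gens n (lev ns))" for a
  using that by (auto simp: carrier_levi)
 obtain \<Phi> where \<Phi>: "!!u. u \<in> carrier I.Ind ==> \<Phi> u \<in> carrier FM"
  "!!u v. u \<in> carrier I.Ind ==> v \<in> carrier I.Ind ==> \<Phi> (u \<oplus>\<^bsub>I.Ind\<^esub> v) = \<Phi> u \<oplus>\<^bsub>FM\<^esub> \<Phi> v"
  "!!h u. h \<in> carrier (hecke q n) ==> u \<in> carrier I.Ind ==> \<Phi> (h \<odot>\<^bsub>I.Ind\<^esub> u) = h \<odot>\<^bsub>FM\<^esub> \<Phi> u"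
  "!!a x. a \<in> carrier (hecke q n) ==> x \<in> carrier \<sigma> ==> \<Phi> (I.tens a x) = a \<odot>\<^bsub>FM\<^esub> delta ?b x"
 proof (rule I.Ind_universal[OF left_module_FM, of "delta ?b"])
  fix x y assume xy: "x \<in> carrier \<sigma>" "y \<in> carrier \<sigma>"
  thus "delta ?b (x \<oplus>\<^bsub>\<sigma>\<^esub> y) = delta ?b x \<oplus>\<^bsub>FM\<^esub> delta ?b y"
   by (auto simp: delta_def intro!: restrict_ext)
  show "delta ?b x \<in> carrier FM" using xy by simp
  fix r assume "r \<in> carrier (levi q ns)"
  then obtain a where a: "a \<in> fsupp (gens n (lev ns))" "r = hcls q n a" using lev_elt by blast
  have "delta ?b (r \<odot>\<^bsub>\<sigma>\<^esub> x) = delta ?b (?act a x)" using a by (simp add: mact_eq)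
  also have "\<dots> = fact a (delta ?b x)" by (rule delta_equivariant[OF a(1) xy(1)])
  also have "\<dots> = r \<odot>\<^bsub>FM\<^esub> delta ?b x"
   unfolding a(2) by (rule FM_smult[symmetric]) (use a fsupp_lev_hfree xy in auto)
  finally show "delta ?b (r \<odot>\<^bsub>\<sigma>\<^esub> x) = r \<odot>\<^bsub>FM\<^esub> delta ?b x" .
 qed blast
 interpret SP: spanned \<sigma> ?act q ns g h I.Ind ?actE ?e
 proof (intro spanned.intro spanned_axioms.intro)
  show "label_model \<sigma> ?act q ns g h" by unfold_locales
  show "free_action I.Ind ?actE" by (rule free_action_hecke[OF I.left_module_Ind])
  show "free_action.kills I.Ind ?actE (rels q n (full n))" by (rule kills_hecke[OF I.left_module_Ind])
  fix x assume x: "x \<in> carrier \<sigma>"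
  show "?e x \<in> carrier I.Ind" using x by simp
  { fix y assume y: "y \<in> carrier \<sigma>"
   show "?e (x \<oplus>\<^bsub>\<sigma>\<^esub> y) = ?e x \<oplus>\<^bsub>I.Ind\<^esub> ?e y" using x y by (intro I.tens_radd) simp_all }
  fix a assume a: "a \<in> fsupp (gens n (lev ns))"
  have ah: "a \<in> hfree n" by (rule fsupp_lev_hfree[OF a])
  have "?e (?act a x) = I.tens (\<one>\<^bsub>hecke q n\<^esub> \<otimes>\<^bsub>hecke q n\<^esub> hcls q n a) x"
   unfolding mact_eq[OF a] using hc[OF a] x by (intro I.tens_balanced[symmetric]) simp_all
  also have "\<dots> = I.tens (hcls q n a) x" using ah by simp
  also have "\<dots> = ?actE a (?e x)"
   unfolding mact_eq[OF ah] using ah x by (subst I.tens_smult) simp_all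
  finally show "?e (?act a x) = ?actE a (?e x)" .
 qed
 have span: "u \<in> SP.U" if "u \<in> carrier I.Ind" for u
  using that
 proof (induction u rule: I.Ind_induct)
  case zero
  show ?case by (rule SP.U_zero)
 next
  case (tens a x)
  obtain c where c: "c \<in> hfree n" "a = hcls q n c" using hcls_surj[OF tens(1)] by blast
  have "I.tens a x = ?actE c (?e x)"
   unfolding mact_eq[OF c(1)] using c tens by (subst I.tens_smult) simp_all
  thus ?case using SP.U_stable[OF c(1) SP.U_base[OF tens(2)]] by simp
 next
  case (minus u v)
  have "u \<ominus>\<^bsub>I.Ind\<^esub> v = u \<oplus>\<^bsub>I.Ind\<^esub> ?actE (fconst (- 1)) v"
   using minus by (simp add: IM.M.minus_eq fconst_uminus SP.E.act_uminus)
  thus ?case using SP.U_add[OF minus(3) SP.U_const[OF minus(4)]] by simp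
 qed
 have \<Phi>e: "\<Phi> (?actE (TL l) (?e x)) = theta l x" if l: "l \<in> L" and x: "x \<in> carrier \<sigma>" for l x
 proof -
  have T: "TL l \<in> hfree n" by (rule Tprod_fsupp[OF set_canon[OF lpos_permutes[OF l]]])
  have "\<Phi> (?actE (TL l) (?e x)) = hcls q n (TL l) \<odot>\<^bsub>FM\<^esub> \<Phi> (?e x)"
   unfolding mact_eq[OF T] using T x by (intro \<Phi>(3)) simp_all
  also have "\<Phi> (?e x) = delta ?b x"
   using \<Phi>(4)[of "\<one>\<^bsub>hecke q n\<^esub>" x] FMm.smult_one[of "delta ?b x"] x by simp
  also have "hcls q n (TL l) \<odot>\<^bsub>FM\<^esub> delta ?b x = theta l x"
   unfolding theta_def using x by (intro FM_smult T) simp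
  finally show ?thesis .
 qed
 have \<Phi>sum: "\<Phi> (\<Oplus>\<^bsub>I.Ind\<^esub>a\<in>A. F a) = (\<Oplus>\<^bsub>FG\<^esub>a\<in>A. \<Phi> (F a))" if "finite A" "!!a. a \<in> A ==> F a \<in> carrier I.Ind" for A and F :: "(nat => nat) => _"
  using that
 proof (induction A rule: finite_induct)
  case empty
  have z: "\<Phi> \<zero>\<^bsub>I.Ind\<^esub> \<oplus>\<^bsub>FM\<^esub> \<Phi> \<zero>\<^bsub>I.Ind\<^esub> = \<Phi> \<zero>\<^bsub>I.Ind\<^esub>" using \<Phi>(2)[of "\<zero>\<^bsub>I.Ind\<^esub>" "\<zero>\<^bsub>I.Ind\<^esub>"] by simp
  have "\<Phi> \<zero>\<^bsub>I.Ind\<^esub> = \<zero>\<^bsub>FM\<^esub>"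
   using FMm.M.add.l_cancel_one[OF \<Phi>(1)[OF IM.M.zero_closed] \<Phi>(1)[OF IM.M.zero_closed]] z by blast
  thus ?case by (simp only: IM.M.finsum_empty F.finsum_empty FM_simps)
 next
  case (insert a A)
  have "\<Phi> (F a \<oplus>\<^bsub>I.Ind\<^esub> (\<Oplus>\<^bsub>I.Ind\<^esub>a\<in>A. F a)) = \<Phi> (F a) \<oplus>\<^bsub>FG\<^esub> (\<Oplus>\<^bsub>FG\<^esub>a\<in>A. \<Phi> (F a))"
   using insert \<Phi>(2)[of "F a" "\<Oplus>\<^bsub>I.Ind\<^esub>a\<in>A. F a"] by (simp del: fun_group_simps(3))
  moreover have "(\<lambda>a. \<Phi> (F a)) \<in> A \<rightarrow> carrier FG" "\<Phi> (F a) \<in> carrier FG" using insert.prems \<Phi>(1) by auto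
  ultimately show ?case using insert by (simp add: IM.M.finsum_insert F.finsum_insert Pi_def del: fun_group_simps)
 qed
 have inj: "u = \<zero>\<^bsub>I.Ind\<^esub>" if u: "u \<in> carrier I.Ind" and z: "\<Phi> u = \<zero>\<^bsub>FG\<^esub>" for u
 proof -
  obtain x where x: "\<forall>l\<in>L. x l \<in> carrier \<sigma>" "u = (\<Oplus>\<^bsub>I.Ind\<^esub>l\<in>L. ?actE (TL l) (?e (x l)))"
   using span[OF u] unfolding SP.U_def by blast
  have "\<Phi> u = (\<Oplus>\<^bsub>FG\<^esub>l\<in>L. \<Phi> (?actE (TL l) (?e (x l))))"
   unfolding x(2) by (rule \<Phi>sum) (use x(1) in auto)
  also have "\<dots> = (\<Oplus>\<^bsub>FG\<^esub>l\<in>L. theta l (x l))"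
   by (rule F.finsum_cong') (use x(1) \<Phi>e theta_closed in auto)
  finally have "x l = \<zero>\<^bsub>\<sigma>\<^esub>" if "l \<in> L" for l
   using theta_independent[of x l] x(1) z that by metis
  hence "u = (\<Oplus>\<^bsub>I.Ind\<^esub>l\<in>L. \<zero>\<^bsub>I.Ind\<^esub>)"
   unfolding x(2) by (intro IM.M.finsum_cong') (auto simp: SP.e_zero)
  thus ?thesis by simp
 qed
 have "inj_on \<Phi> (carrier I.Ind)"
 proof (rule inj_onI)
  fix u v assume u: "u \<in> carrier I.Ind" and v: "v \<in> carrier I.Ind" and eq: "\<Phi> u = \<Phi> v"
  let ?w = "\<ominus>\<^bsub>I.Ind\<^esub> v"
  have w: "?w \<in> carrier I.Ind" using v by simp
  have "\<Phi> (u \<oplus>\<^bsub>I.Ind\<^esub> ?w) = \<Phi> (v \<oplus>\<^bsub>I.Ind\<^esub> ?w)" using \<Phi>(2)[OF u w] \<Phi>(2)[OF v w] eq by simp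
  also have "v \<oplus>\<^bsub>I.Ind\<^esub> ?w = \<zero>\<^bsub>I.Ind\<^esub>" using v by (rule IM.M.r_neg)
  also have "\<Phi> \<zero>\<^bsub>I.Ind\<^esub> = \<zero>\<^bsub>FG\<^esub>" using \<Phi>sum[of "{}" undefined] by simp
  finally have "u \<oplus>\<^bsub>I.Ind\<^esub> ?w = \<zero>\<^bsub>I.Ind\<^esub>" using inj u w by simp
  hence "\<ominus>\<^bsub>I.Ind\<^esub> ?w = u" by (rule IM.M.minus_equality[OF _ w u])
  thus "u = v" using v by simp
 qed
 moreover have "\<Phi> ` carrier I.Ind = carrier FM"
 proof
  show "\<Phi> ` carrier I.Ind <= carrier FM" using \<Phi>(1) by blast
  have "L \<rightarrow>\<^sub>E carrier \<sigma> <= \<Phi> ` carrier I.Ind"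
  proof (rule fun_generated)
   show "\<zero>\<^bsub>FG\<^esub> \<in> \<Phi> ` carrier I.Ind" using \<Phi>sum[of "{}" undefined] IM.M.zero_closed by (metis F.finsum_empty IM.M.finsum_empty finite.emptyI imageI empty_iff)
   show "\<Phi> ` carrier I.Ind <= L \<rightarrow>\<^sub>E carrier \<sigma>" using \<Phi>(1) by auto
   fix x assume x: "x \<in> carrier \<sigma>"
   have "\<Phi> (?e x) = delta ?b x"
    using \<Phi>(4)[of "\<one>\<^bsub>hecke q n\<^esub>" x] FMm.smult_one[of "delta ?b x"] x by simp
   thus "delta ?b x \<in> \<Phi> ` carrier I.Ind" using x by (metis I.tens_in I.A.one_closed imageI)
  next
   fix \<phi> \<psi> assume "\<phi> \<in> \<Phi> ` carrier I.Ind" "\<psi> \<in> \<Phi> ` carrier I.Ind"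
   then obtain u v where uv: "u \<in> carrier I.Ind" "v \<in> carrier I.Ind" "\<phi> = \<Phi> u" "\<psi> = \<Phi> v" by blast
   hence "\<phi> \<oplus>\<^bsub>FG\<^esub> \<psi> = \<Phi> (u \<oplus>\<^bsub>I.Ind\<^esub> v)" using \<Phi>(2)[OF uv(1,2)] by simp
   thus "\<phi> \<oplus>\<^bsub>FG\<^esub> \<psi> \<in> \<Phi> ` carrier I.Ind" using uv by (metis IM.M.a_closed imageI)
  next
   fix a \<phi> assume a: "a \<in> hfree n" and "\<phi> \<in> \<Phi> ` carrier I.Ind"
   then obtain u where u: "u \<in> carrier I.Ind" "\<phi> = \<Phi> u" by blast
   have \<phi>: "\<phi> \<in> L \<rightarrow>\<^sub>E carrier \<sigma>" using u \<Phi>(1) by simp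
   have "fact a \<phi> = hcls q n a \<odot>\<^bsub>FM\<^esub> \<phi>" by (rule FM_smult[OF a \<phi>, symmetric])
   also have "\<dots> = \<Phi> (hcls q n a \<odot>\<^bsub>I.Ind\<^esub> u)" unfolding u(2) by (rule \<Phi>(3)[symmetric]) (use u a in auto)
   finally show "fact a \<phi> \<in> \<Phi> ` carrier I.Ind" using IM.smult_closed[of "hcls q n a" u] u a by (auto intro: image_eqI)
  qed
  thus "carrier FM <= \<Phi> ` carrier I.Ind" by simp
 qed
 ultimately have "\<Phi> \<in> left_module_iso (hecke q n) I.Ind FM"
  using \<Phi>(2,3) by (auto simp: left_module_iso_def bij_betw_def)
 thus ?thesis
  using I.left_module_Ind left_module_FM by (auto simp: left_modules_isomorphic_def)
qed

end

section \<open>Linear independence of the T_w and presentations of Levi subalgebras\<close>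

section \<open>A basis of the affine Hecke algebra\<close>

abbreviation lchar :: "(nat => complex) => expo => complex" where
 "lchar t a \<equiv> (\<Prod>k\<in>Poly_Mapping.keys a. t k powi Poly_Mapping.lookup a k)"

lemma lchar_superset:
 "finite S ==> Poly_Mapping.keys a <= S ==> lchar t a = (\<Prod>k\<in>S. t k powi Poly_Mapping.lookup a k)"
 by (rule prod.mono_neutral_left) (auto simp: in_keys_iff)

lemma lchar_add:
 assumes "!!k. t k ~= 0"
 shows "lchar t (a + b) = lchar t a * lchar t b"
proof -
 let ?S = "Poly_Mapping.keys a \<union> Poly_Mapping.keys b"
 have S: "finite ?S" "Poly_Mapping.keys (a + b) <= ?S" using Poly_Mapping.keys_add[of a b] by auto
 show ?thesis
  unfolding lchar_superset[OF S] lchar_superset[OF S(1), of a, simplified] lchar_superset[OF S(1), of b, simplified]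
  by (simp add: lookup_add power_int_add assms prod.distrib)
qed

lemma leval_superset:
 assumes "finite S" and "Poly_Mapping.keys f <= S"
 shows "leval t f = (\<Sum>a\<in>S. Poly_Mapping.lookup f a * lchar t a)"
 unfolding leval_def by (rule sum.mono_neutral_left) (use assms in "auto simp: in_keys_iff")

lemma leval_add: "leval t (f + g) = leval t f + leval t g"
proof -
 let ?S = "Poly_Mapping.keys f \<union> Poly_Mapping.keys g"
 have S: "finite ?S" "Poly_Mapping.keys (f + g) <= ?S" using Poly_Mapping.keys_add[of f g] by auto
 show ?thesis
  unfolding leval_superset[OF S] leval_superset[OF S(1), of f, simplified] leval_superset[OF S(1), of g, simplified]
  by (simp add: lookup_add distrib_right sum.distrib)
qed

lemma leval_single: "leval t (Poly_Mapping.single a c) = c * lchar t a"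
 by (simp add: leval_def)

lemma leval_lconst [simp]: "leval t (lconst c) = c"
 unfolding lconst_def leval_single by simp

lemma leval_lvar [simp]: "leval t (lvar k) = t k"
 unfolding lvar_def leval_single by simp

lemma leval_uminus: "leval t (- f) = - leval t f"
 using leval_add[of t f "- f"] leval_lconst[of t 0] by (simp add: eq_neg_iff_add_eq_0 add.commute)

lemma leval_diff: "leval t (f - g) = leval t f - leval t g"
 using leval_add[of t f "- g"] by (simp add: leval_uminus)

lemma leval_mult:
 assumes t: "!!k. t k ~= 0"
 shows "leval t (f * g) = leval t f * leval t g"
proof (induction f rule: poly_mapping_induct)
 case (single a c)
 show ?case
 proof (induction g rule: poly_mapping_induct)
  case (single b d)
  show ?case by (simp add: mult_single leval_single lchar_add[OF t])
 qed (simp add: distrib_left leval_add)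
qed (simp add: distrib_right leval_add)

text \<open>The sum is the value at N of a nonzero integer polynomial with coefficients d_k, which
  has finitely many roots; D is finite as well.\<close>

lemma separating_exponents:
 fixes D :: "expo set"
 assumes "finite D" and "0 \<notin> D"
 shows "\<exists>N\<ge>2::nat. \<forall>d\<in>D. (\<Sum>k\<in>Poly_Mapping.keys d. Poly_Mapping.lookup d k * int N ^ k) ~= 0"
proof -
 define P where "P d = (\<Sum>k\<in>Poly_Mapping.keys d. Polynomial.monom (Poly_Mapping.lookup d k) k)" for d :: expo
 have co: "Polynomial.coeff (P d) k = Poly_Mapping.lookup d k" for d k
  by (simp add: P_def coeff_sum in_keys_iff)
 have "P d ~= 0" if "d ~= 0" for d using that co[of d] by (auto simp: poly_mapping_eq_iff fun_eq_iff)
 hence P0: "P d ~= 0" if "d \<in> D" for d using that assms(2) by metis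
 have "finite (\<Union>d\<in>D. {x. poly (P d) x = 0})" by (intro finite_UN_I assms(1) poly_roots_finite P0)
 hence "finite (int -` (\<Union>d\<in>D. {x. poly (P d) x = 0}))" (is "finite ?B") by (rule finite_vimageI) (simp add: inj_on_def)
 hence "infinite ({2..} - ?B)" by (rule Diff_infinite_finite) (rule infinite_Ici)
 hence "{2..} - ?B ~= {}" by (metis finite.emptyI)
 then obtain N where "N \<in> {2..} - ?B" by blast
 hence "N \<ge> 2" "\<forall>d\<in>D. poly (P d) (int N) ~= 0" by auto
 moreover have "poly (P d) (int N) = (\<Sum>k\<in>Poly_Mapping.keys d. Poly_Mapping.lookup d k * int N ^ k)" for d
  by (simp add: P_def poly_sum poly_monom)
 ultimately show ?thesis by (intro exI[of _ N]) simp
qed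

text \<open>A nonzero Laurent polynomial does not vanish at \<open>(z\<^bsup>N\<^esup>, z\<^bsup>N\<^sup>2\<^esup>, \<dots>)\<close> for suitable \<open>N\<close> and \<open>z\<close>.\<close>

lemma generic_point:
 assumes "f ~= 0"
 shows "\<exists>t. (\<forall>k. t k ~= 0) \<and> (\<forall>a b. a ~= b --> t a ~= t b \<and> t a ~= of_nat q * t b) \<and> leval t f ~= 0"
proof -
 let ?A = "Poly_Mapping.keys f"
 let ?D = "(\<lambda>(a, b). a - b) ` {(a, b) \<in> ?A \<times> ?A. a ~= b}"
 have "finite {(a, b) \<in> ?A \<times> ?A. a ~= b}" by (rule finite_subset[of _ "?A \<times> ?A"]) auto
 hence "finite ?D" by (rule finite_imageI)
 moreover have "0 \<notin> ?D" by auto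
 ultimately have "\<exists>N\<ge>2::nat. \<forall>d\<in>?D. (\<Sum>k\<in>Poly_Mapping.keys d. Poly_Mapping.lookup d k * int N ^ k) ~= 0"
  by (rule separating_exponents)
 then obtain N :: nat where N: "N \<ge> 2"
  "!!d. d \<in> ?D ==> (\<Sum>k\<in>Poly_Mapping.keys d. Poly_Mapping.lookup d k * int N ^ k) ~= 0"
  by blast
 define w :: "expo => int" where "w a = (\<Sum>k\<in>Poly_Mapping.keys a. Poly_Mapping.lookup a k * int N ^ k)" for a
 have w_superset: "w a = (\<Sum>k\<in>S. Poly_Mapping.lookup a k * int N ^ k)" if "finite S" "Poly_Mapping.keys a <= S" for a S
  unfolding w_def by (rule sum.mono_neutral_left) (use that in "auto simp: in_keys_iff")
 have w_diff: "w (a - b) = w a - w b" for a b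
 proof -
  let ?S = "Poly_Mapping.keys a \<union> Poly_Mapping.keys b"
  have S: "finite ?S" "Poly_Mapping.keys (a - b) <= ?S" using Poly_Mapping.keys_diff[of a b] by auto
  show ?thesis
   unfolding w_superset[OF S] w_superset[OF S(1), of a, simplified] w_superset[OF S(1), of b, simplified]
   by (simp add: lookup_minus left_diff_distrib sum_subtractf)
 qed
 have w_inj: "a = b" if ab: "a \<in> ?A" "b \<in> ?A" "w a = w b" for a b
 proof (rule ccontr)
  assume "a ~= b"
  hence "a - b \<in> ?D" using ab by force
  hence "w (a - b) ~= 0" unfolding w_def by (rule N(2))
  thus False using ab by (simp add: w_diff)
 qed
 \<comment> \<open>The shift by m makes all exponents nonnegative, so that f at the point becomes,
   up to a power of z, an ordinary polynomial in z.\<close>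
 define m where "m = nat (\<Sum>a\<in>?A. \<bar>w a\<bar>)"
 have m: "w a + int m \<ge> 0" if "a \<in> ?A" for a
 proof -
  have "\<bar>w a\<bar> \<le> (\<Sum>a\<in>?A. \<bar>w a\<bar>)" by (rule member_le_sum) (use that in auto)
  thus ?thesis by (simp add: m_def)
 qed
 define P where "P = (\<Sum>a\<in>?A. Polynomial.monom (Poly_Mapping.lookup f a) (nat (w a + int m)))"
 obtain a where a: "a \<in> ?A" using assms by fastforce
 have "Polynomial.coeff P (nat (w a + int m)) = (\<Sum>b\<in>?A. if b = a then Poly_Mapping.lookup f b else 0)"
  unfolding P_def coeff_sum by (rule sum.cong) (use a m w_inj in "auto simp: nat_eq_iff")
 also have "\<dots> ~= 0" using a by (simp add: in_keys_iff)
 finally have "P ~= 0" by auto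
 hence "finite {x. poly P x = 0}" by (rule poly_roots_finite)
 hence "finite (complex_of_real -` {x. poly P x = 0})" (is "finite ?B") by (rule finite_vimageI) (simp add: inj_on_def)
 \<comment> \<open>Because z > q + 1, consecutive powers of z differ by a factor greater than both 1
   and q. This keeps the coordinates different from one another and from q times one
   another.\<close>
 hence "infinite ({real q + 1<..} - ?B)" by (rule Diff_infinite_finite) (rule infinite_Ioi)
 hence "{real q + 1<..} - ?B ~= {}" by (metis finite.emptyI)
 then obtain z where "z \<in> {real q + 1<..} - ?B" by blast
 hence z: "z > real q + 1" "poly P (of_real z) ~= 0" by auto
 define t where "t k = complex_of_real (z ^ (N ^ k))" for k
 have z0: "z > 1" using z by linarith
 have t0: "t k ~= 0" for k using z0 by (simp add: t_def)
 have lt: "real q * z ^ (N ^ b) < z ^ (N ^ a) \<and> z ^ (N ^ b) < z ^ (N ^ a)" if "b < a" for a b :: nat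
 proof -
  have "N ^ b < N ^ a" using N(1) that by simp
  hence "z ^ Suc (N ^ b) \<le> z ^ (N ^ a)" using z0 by (intro power_increasing) auto
  moreover have "real q * z ^ (N ^ b) < z * z ^ (N ^ b)" "1 * z ^ (N ^ b) < z * z ^ (N ^ b)"
   using z z0 by (auto intro!: mult_strict_right_mono)
  ultimately show ?thesis by simp
 qed
 have ge: "z ^ (N ^ b) < real q * z ^ (N ^ a)" if "b < a" "q ~= 0" for a b
 proof -
  have "1 * z ^ (N ^ a) \<le> real q * z ^ (N ^ a)" using that z0 by (intro mult_right_mono) auto
  thus ?thesis using lt[OF that(1)] by linarith
 qed
 have t1: "t a ~= t b \<and> t a ~= of_nat q * t b" if "a ~= b" for a b
 proof -
  have "z ^ (N ^ a) ~= z ^ (N ^ b)" using lt[of a b] lt[of b a] that by (cases "a < b") auto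
  moreover have "z ^ (N ^ a) ~= real q * z ^ (N ^ b)"
  proof (cases "q = 0 \<or> b < a")
   case True
   thus ?thesis using lt[of b a] z0 by auto
  next
   case False
   thus ?thesis using ge[of a b] that by auto
  qed
  moreover have "(of_nat q :: complex) = of_real (real q)" by simp
  ultimately show ?thesis
   unfolding t_def by (simp only: of_real_mult[symmetric] of_real_eq_iff) simp
 qed
 have ch: "lchar t a = of_real z powi w a" for a
 proof -
  have "t k powi Poly_Mapping.lookup a k = of_real z powi (Poly_Mapping.lookup a k * int N ^ k)" for k
  proof -
   have "t k = of_real z powi (int N ^ k)" by (simp add: t_def flip: of_nat_power)
   hence "t k powi Poly_Mapping.lookup a k = of_real z powi (int N ^ k * Poly_Mapping.lookup a k)"
    by (simp only: power_int_mult)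
   thus ?thesis by (simp only: mult.commute)
  qed
  moreover have "(\<Prod>k\<in>A. of_real z powi e k) = (of_real z :: complex) powi sum e A" if "finite A" for A :: "nat set" and e
   using that by (induction A rule: finite_induct) (use z0 in "simp_all add: power_int_add")
  ultimately show ?thesis by (simp add: w_def)
 qed
 have "of_real z ^ m * leval t f = poly P (of_real z)"
 proof -
  have "of_real z ^ m * (c * of_real z powi w a) = c * of_real z ^ nat (w a + int m)" if "a \<in> ?A" for a and c :: complex
  proof -
   have "(of_real z :: complex) ^ nat (w a + int m) = of_real z powi (w a + int m)"
    using m[OF that] by (simp add: power_int_def)
   also have "\<dots> = of_real z powi w a * of_real z ^ m" using z0 by (subst power_int_add) auto
   finally show ?thesis by simp
  qed
  hence "(\<Sum>a\<in>?A. of_real z ^ m * (Poly_Mapping.lookup f a * of_real z powi w a)) =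
    (\<Sum>a\<in>?A. Poly_Mapping.lookup f a * of_real z ^ nat (w a + int m))"
   by (intro sum.cong refl)
  thus ?thesis
   unfolding leval_def ch P_def by (simp add: poly_sum poly_monom sum_distrib_left)
 qed
 hence "leval t f ~= 0" using z by auto
 thus ?thesis using t0 t1 by (intro exI[of _ t]) blast
qed

definition complex_group :: "(unit, complex) module" where
 "complex_group = \<lparr>carrier = UNIV, monoid.mult = (\<lambda>_ _. undefined), monoid.one = undefined,
   ring.zero = 0, ring.add = (+), module.smult = (\<lambda>_ _. undefined)\<rparr>"

lemma complex_group_simps [simp]: "carrier complex_group = UNIV" "\<zero>\<^bsub>complex_group\<^esub> = 0"
 "x \<oplus>\<^bsub>complex_group\<^esub> y = x + y"
 by (simp_all add: complex_group_def)

lemma abelian_group_complex_group: "abelian_group complex_group"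
 by (rule abelian_groupI) (auto intro: exI[of _ "- x" for x])

lemma complex_group_minus [simp]: "x \<ominus>\<^bsub>complex_group\<^esub> y = x - y"
proof -
 interpret abelian_group complex_group by (rule abelian_group_complex_group)
 have "\<ominus>\<^bsub>complex_group\<^esub> y = - y" by (rule minus_equality) simp_all
 thus ?thesis by (simp add: a_minus_def)
qed

text \<open>The one-dimensional \<A>-module at the point t. It is used with blocks of size 1, where
  the Levi subalgebra contains no T_j; the identity on \<open>GT j\<close> is a default
  value.\<close>

definition eval_op :: "(nat => complex) => hgen => complex => complex" where
 "eval_op t c x = (case c of GA f => leval t f * x | GT j => x)"

lemma letter_operators_eval: "letter_operators complex_group (*) (eval_op t)"
 by (intro letter_operators.intro abelian_group_complex_group letter_operators_axioms.intro)
  (auto simp: eval_op_def algebra_simps split: hgen.split)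

lemma offset_replicate: "k \<le> n ==> offset (replicate n (Suc 0)) k = k"
 by (simp add: offset_def sum_list_replicate)

lemma block_index_replicate: "j \<in> {1..n} ==> block_index (replicate n (Suc 0)) j = j - 1"
 by (rule block_index_eq) (auto simp: block_def offset_replicate)

lemma lev_replicate: "lev (replicate n (Suc 0)) = {}"
 by (auto simp: lev_block_index block_index_replicate sum_list_replicate)

text \<open>With all blocks of size 1 the labellings are the permutations, with values lowered by 1
  because blocks are numbered from 0.\<close>

lemma lpos_replicate:
 assumes "p permutes {1..n}"
 shows "\<exists>l\<in>labellings (replicate n (Suc 0)). lpos (replicate n (Suc 0)) l = p"
proof -
 define l where "l = (\<lambda>j\<in>{1..n}. p j - 1)"
 have p: "p j \<in> {1..n}" if "j \<in> {1..n}" for j using permutes_in_image[OF assms, of j] that by simp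
 have one: "i = j" if "i \<in> {1..n}" "j \<in> {1..n}" "l i = l j" for i j
 proof -
  have "p i - 1 = p j - 1" using that by (simp add: l_def)
  hence "p i = p j" using p[OF that(1)] p[OF that(2)] by (simp add: eq_diff_iff)
  thus ?thesis using permutes_inj[OF assms] by (simp only: inj_eq)
 qed
 have "card {j \<in> {1..n}. l j = k} = 1" if k: "k < n" for k
 proof -
  have "Suc k \<in> p ` {1..n}" using permutes_image[OF assms] k by simp
  then obtain j where j: "j \<in> {1..n}" "p j = Suc k" by (metis imageE)
  hence "l j = k" by (simp add: l_def)
  hence "{j \<in> {1..n}. l j = k} = {j}" using one j(1) by blast
  thus ?thesis by simp
 qed
 hence L: "l \<in> labellings (replicate n (Suc 0))"
 proof -
  have "l \<in> {1..n} \<rightarrow>\<^sub>E {..<n}"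
  proof (rule PiE_I)
   fix j assume "j \<in> {1..n}"
   thus "l j \<in> {..<n}" using p[of j] by (auto simp: l_def)
  qed (auto simp: l_def)
  moreover assume "!!k. k < n ==> card {j \<in> {1..n}. l j = k} = 1"
  ultimately show ?thesis by (simp add: labellings_def sum_list_replicate)
 qed
 have "lpos (replicate n (Suc 0)) l j = p j" for j
 proof (cases "j \<in> {1..n}")
  case True
  hence "!!i. i \<in> {1..j} ==> i \<in> {1..n}" by simp
  hence "{i \<in> {1..j}. l i = l j} = {j}" using one[OF _ True] True by force
  moreover have "l j \<le> n" "Suc (l j) = p j" using p[OF True] True by (auto simp: l_def)
  ultimately show ?thesis using True by (simp add: lpos_def sum_list_replicate offset_replicate)
 next
  case False
  thus ?thesis using permutes_not_in[OF assms False] by (auto simp: lpos_def sum_list_replicate)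
 qed
 thus ?thesis using L by blast
qed

text \<open>Evaluate on the principal series at a generic point.\<close>

lemma basis_independent:
 assumes F: "!!p. p permutes {1..n} ==> F p \<in> \<A> n"
  and zero: "(\<Sum>p | p permutes {1..n}. Tprod (canon n p) * Ag (F p)) \<in> tideal (rels q n (full n))"
  and p: "p permutes {1..n}"
 shows "F p = 0"
proof (rule ccontr)
 assume "F p ~= 0"
 then obtain t where t: "!!k. t k ~= 0" "!!a b. a ~= b ==> t a ~= t b \<and> t a ~= of_nat q * t b"
  "leval t (F p) ~= 0"
  using generic_point[of "F p" q] by blast
 let ?ns = "replicate n (Suc 0)"
 interpret E: letter_operators complex_group "(*)" "eval_op t" by (rule letter_operators_eval)
 interpret EA: free_action complex_group E.letter_act by (rule E.free_action_letter_act)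
 have n: "sum_list ?ns = n" by (simp add: sum_list_replicate)
 have kills: "EA.kills (rels q (sum_list ?ns) (lev ?ns))"
  unfolding EA.kills_def n lev_replicate
  by (auto elim!: rels_cases simp: EA.act_diff EA.act_add EA.act_mult eval_op_def leval_add leval_mult[OF t(1)] distrib_right)
 have ap: "t a ~= t b" "t a ~= of_nat q * t b" if "apart ?ns a b" for a b
  using that t(2)[of a b] by (auto simp: apart_def)
 \<comment> \<open>At the point t the differences are nonzero numbers, so constants invert
   them.\<close>
 let ?g = "\<lambda>a b. lconst (1 / (t a - t b))" and ?h = "\<lambda>a b. lconst (1 / (t a - of_nat q * t b))"
 interpret label_model complex_group E.letter_act q ?ns ?g ?h
  by unfold_locales (use kills ap in "auto simp: EA.sim_def eval_op_def leval_mult[OF t(1)] leval_diff")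
 let ?b = "base_label ?ns" and ?P = "{p. p permutes {1..n}}"
 have fP: "finite ?P" by (simp add: finite_permutations)
 have d: "delta ?b x \<in> L \<rightarrow>\<^sub>E carrier complex_group" for x by (rule delta_closed) simp
 have c: "fact a (delta ?b x) \<in> L \<rightarrow>\<^sub>E carrier complex_group" for a x by (rule fact_closed[OF d])
 \<comment> \<open>The Laurent polynomial belongs to the Levi part and multiplies the base vector by
   its value at t; T then produces the vector \<open>theta\<close> of the labelling with
   \<open>lpos\<close> equal to p.\<close>
 have summand: "fact (Tprod (canon n p) * Ag (F p)) (delta ?b 1) = fact (Tprod (canon n p)) (delta ?b (leval t (F p)))"
  if "p \<in> ?P" for p
 proof -
  have "delta ?b (E.letter_act (Ag (F p)) 1) = fact (Ag (F p)) (delta ?b 1)"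
   by (rule delta_equivariant) (use F that n in auto)
  thus ?thesis by (simp add: fact_mult[OF d] eval_op_def)
 qed
 have bij: "bij_betw (lpos ?ns) L ?P"
 proof (rule bij_betw_imageI)
  show "inj_on (lpos ?ns) L"
  proof (rule inj_onI)
   fix l m assume lm: "l \<in> L" "m \<in> L" "lpos ?ns l = lpos ?ns m"
   have "l j = m j" for j
   proof (cases "j \<in> {1..sum_list ?ns}")
    case True
    thus ?thesis using block_index_lpos[OF lm(1) True] block_index_lpos[OF lm(2) True] lm(3) by simp
   next
    case False
    thus ?thesis using lm(1,2) by (auto simp: labellings_def PiE_def extensional_def)
   qed
   thus "l = m" by blast
  qed
  show "lpos ?ns ` L = ?P" using lpos_permutes[of _ ?ns] lpos_replicate[of _ n] n by fastforce
 qed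
 have "\<zero>\<^bsub>FG\<^esub> = fact (\<Sum>p\<in>?P. Tprod (canon n p) * Ag (F p)) (delta ?b 1)"
  by (rule FA.kills_tideal[OF zero, symmetric]) (use fun_kills n d in simp_all)
 also have "\<dots> = (\<Oplus>\<^bsub>FG\<^esub>p\<in>?P. fact (Tprod (canon n p) * Ag (F p)) (delta ?b 1))"
  by (rule FA.act_sum[OF fP]) (use d in simp)
 also have "\<dots> = (\<Oplus>\<^bsub>FG\<^esub>p\<in>?P. fact (Tprod (canon n p)) (delta ?b (leval t (F p))))"
  using summand c by (intro F.finsum_cong') (simp_all add: Pi_def del: fun_group_simps(2,3))
 also have "\<dots> = (\<Oplus>\<^bsub>FG\<^esub>l\<in>L. theta l (leval t (F (lpos ?ns l))))"
  unfolding bij_betw_imp_surj_on[OF bij, symmetric] theta_def n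
  by (rule F.add.finprod_reindex) (use bij c in "simp_all add: bij_betw_def Pi_def")
 finally have s: "(\<Oplus>\<^bsub>FG\<^esub>l\<in>L. theta l (leval t (F (lpos ?ns l)))) = \<zero>\<^bsub>FG\<^esub>" by simp
 obtain l where l: "l \<in> L" "lpos ?ns l = p" using lpos_replicate[OF p] by blast
 thus False using theta_independent[OF _ s l(1)] t(3) by simp
qed

text \<open>Plays the part of the parabolic subgroup generated by the s_j with j in
  \<open>J\<close>, in the form in which the canonical words give it.\<close>

definition psupp :: "nat => nat set => (nat => nat) set" where
 "psupp n J = {p. p permutes {1..n} \<and> set (canon n p) <= J}"

lemma finite_psupp [simp]: "finite (psupp n J)"
 by (rule finite_subset[of _ "{p. p permutes {1..n}}"]) (auto simp: psupp_def finite_permutations)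

lemma psupp_sref: "p \<in> psupp n J ==> j \<in> J ==> J <= full n ==> p \<circ> sref j \<in> psupp n J"
 unfolding psupp_def using perm_sref[of p n j] set_canon_step[of p n j J] by blast

context
 fixes q n :: nat and J :: "nat set"
 assumes J: "J <= full n"
begin

private abbreviation eqv (infix "\<sim>\<^sub>J" 50) where "a \<sim>\<^sub>J b \<equiv> cong_mod (rels q n J) a b"

definition spanned_elts :: "hgen free set" where
 "spanned_elts = {a. \<exists>F. (\<forall>p. F p \<in> \<A> n) \<and> a \<sim>\<^sub>J (\<Sum>p\<in>psupp n J. Tprod (canon n p) * Ag (F p))}"

lemma Ag_rels:
 "Ag (lconst c) \<sim>\<^sub>J fconst c"
 "f \<in> \<A> n ==> g \<in> \<A> n ==> Ag (f + g) \<sim>\<^sub>J Ag f + Ag g"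
 "f \<in> \<A> n ==> g \<in> \<A> n ==> Ag (f * g) \<sim>\<^sub>J Ag f * Ag g"
 unfolding cong_mod_def by (intro tideal_incl rels_const rels_add rels_mult; assumption)+

lemma Ag_zero_cong: "Ag 0 \<sim>\<^sub>J 0"
 using Ag_rels(1)[of 0] by simp

lemma span_cong: "a \<sim>\<^sub>J b ==> b \<in> spanned_elts ==> a \<in> spanned_elts"
 unfolding spanned_elts_def using cong_mod_trans by blast

lemma span_zero: "0 \<in> spanned_elts"
proof -
 have "0 \<sim>\<^sub>J (\<Sum>p\<in>psupp n J. Tprod (canon n p) * Ag 0)"
  using cong_mod_sum[of "psupp n J" "rels q n J" "\<lambda>p. Tprod (canon n p) * 0" "\<lambda>p. Tprod (canon n p) * Ag 0"]
   cong_mod_mult_left[OF cong_mod_sym[OF Ag_zero_cong]] by simp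
 thus ?thesis unfolding spanned_elts_def by (intro CollectI exI[of _ "\<lambda>_. 0"]) simp
qed

lemma span_add: "a \<in> spanned_elts ==> b \<in> spanned_elts ==> a + b \<in> spanned_elts"
proof -
 assume "a \<in> spanned_elts" "b \<in> spanned_elts"
 then obtain F G where F: "\<forall>p. F p \<in> \<A> n" "a \<sim>\<^sub>J (\<Sum>p\<in>psupp n J. Tprod (canon n p) * Ag (F p))"
  and G: "\<forall>p. G p \<in> \<A> n" "b \<sim>\<^sub>J (\<Sum>p\<in>psupp n J. Tprod (canon n p) * Ag (G p))"
  unfolding spanned_elts_def by blast
 have "a + b \<sim>\<^sub>J (\<Sum>p\<in>psupp n J. Tprod (canon n p) * Ag (F p)) + (\<Sum>p\<in>psupp n J. Tprod (canon n p) * Ag (G p))"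
  by (rule cong_mod_add[OF F(2) G(2)])
 also have "\<dots> = (\<Sum>p\<in>psupp n J. Tprod (canon n p) * (Ag (F p) + Ag (G p)))"
  by (simp add: distrib_left sum.distrib)
 finally have "a + b \<sim>\<^sub>J (\<Sum>p\<in>psupp n J. Tprod (canon n p) * (Ag (F p) + Ag (G p)))" .
 also have "\<dots> \<sim>\<^sub>J (\<Sum>p\<in>psupp n J. Tprod (canon n p) * Ag (F p + G p))"
  by (intro cong_mod_sum cong_mod_mult_left cong_mod_sym[OF Ag_rels(2)]) (use F(1) G(1) in auto)
 finally show ?thesis unfolding spanned_elts_def using F(1) G(1) by (intro CollectI exI[of _ "\<lambda>p. F p + G p"]) simp
qed

lemma span_single: "p \<in> psupp n J ==> f \<in> \<A> n ==> Tprod (canon n p) * Ag f \<in> spanned_elts"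
proof -
 assume p: "p \<in> psupp n J" and f: "f \<in> \<A> n"
 let ?F = "\<lambda>r. if r = p then f else 0"
 have "(\<Sum>r\<in>psupp n J. Tprod (canon n r) * (if r = p then Ag f else 0)) = Tprod (canon n p) * Ag f"
  using p by (simp add: if_distrib cong: if_cong)
 moreover have "(\<Sum>r\<in>psupp n J. Tprod (canon n r) * (if r = p then Ag f else 0)) \<sim>\<^sub>J (\<Sum>r\<in>psupp n J. Tprod (canon n r) * Ag (?F r))"
  by (intro cong_mod_sum cong_mod_mult_left) (simp add: cong_mod_sym[OF Ag_zero_cong])
 ultimately show ?thesis unfolding spanned_elts_def using f by (intro CollectI exI[of _ ?F]) simp
qed

lemma span_linear:
 assumes "!!p f. p \<in> psupp n J ==> f \<in> \<A> n ==> a * (Tprod (canon n p) * Ag f) \<in> spanned_elts"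
  and "b \<in> spanned_elts"
 shows "a * b \<in> spanned_elts"
proof -
 from assms(2) obtain F where F: "\<forall>p. F p \<in> \<A> n" "b \<sim>\<^sub>J (\<Sum>p\<in>psupp n J. Tprod (canon n p) * Ag (F p))"
  unfolding spanned_elts_def by blast
 have s: "finite A ==> (!!x. x \<in> A ==> G x \<in> spanned_elts) ==> sum G A \<in> spanned_elts" for A :: "(nat => nat) set" and G
  by (induction A rule: finite_induct) (auto simp: span_zero span_add)
 have "a * b \<sim>\<^sub>J (\<Sum>p\<in>psupp n J. a * (Tprod (canon n p) * Ag (F p)))"
  using cong_mod_mult_left[OF F(2), of a] by (simp add: sum_distrib_left)
 thus ?thesis by (rule span_cong) (rule s, simp, use F(1) assms(1) in blast)
qed

lemma span_const: "b \<in> spanned_elts ==> fconst c * b \<in> spanned_elts"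
proof (rule span_linear)
 fix p f assume p: "p \<in> psupp n J" and f: "f \<in> \<A> n"
 have "Ag (lconst c * f) \<sim>\<^sub>J Ag (lconst c) * Ag f" by (rule Ag_rels(3)) (use f in auto)
 also have "\<dots> \<sim>\<^sub>J fconst c * Ag f" by (rule cong_mod_mult_right[OF Ag_rels(1)])
 finally have "Tprod (canon n p) * (fconst c * Ag f) \<sim>\<^sub>J Tprod (canon n p) * Ag (lconst c * f)"
  by (intro cong_mod_mult_left cong_mod_sym[of _ "Ag (lconst c * f)"])
 moreover have "fconst c * (Tprod (canon n p) * Ag f) = Tprod (canon n p) * (fconst c * Ag f)"
  by (simp only: fconst_commute[of c "Tprod (canon n p)"] mult.assoc flip: mult.assoc[of "fconst c"])
 ultimately have "fconst c * (Tprod (canon n p) * Ag f) \<sim>\<^sub>J Tprod (canon n p) * Ag (lconst c * f)" by simp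
 thus "fconst c * (Tprod (canon n p) * Ag f) \<in> spanned_elts"
  by (rule span_cong) (use span_single[OF p, of "lconst c * f"] f in simp)
qed

lemma span_Tg: "j \<in> J ==> b \<in> spanned_elts ==> Tg j * b \<in> spanned_elts"
proof (rule span_linear)
 fix p f assume j: "j \<in> J" and p: "p \<in> psupp n J" and f: "f \<in> \<A> n"
 have j': "j \<in> full n" using j J by blast
 have pp: "p permutes {1..n}" "set (canon n p) <= J" using p by (auto simp: psupp_def)
 have ps: "p \<circ> sref j \<in> psupp n J" by (rule psupp_sref[OF p j J])
 have "p j ~= p (j + 1)" using permutes_inj[OF pp(1)] by (metis injD n_not_Suc_n Suc_eq_plus1)
 then consider "p j < p (j + 1)" | "p (j + 1) < p j" by linarith
 thus "Tg j * (Tprod (canon n p) * Ag f) \<in> spanned_elts"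
 proof cases
  case 1
  have "Tg j * (Tprod (canon n p) * Ag f) \<sim>\<^sub>J Tprod (canon n (p \<circ> sref j)) * Ag f"
   using cong_mod_mult_right[OF canon_up[OF pp(1) j' 1 j pp(2)]] by (simp add: mult.assoc)
  thus ?thesis by (rule span_cong) (rule span_single[OF ps f])
 next
  case 2
  have "Tg j * (Tprod (canon n p) * Ag f) \<sim>\<^sub>J
   fconst (of_nat q - 1) * (Tprod (canon n p) * Ag f) + fconst (of_nat q) * (Tprod (canon n (p \<circ> sref j)) * Ag f)"
   using cong_mod_mult_right[OF canon_down[where q = q and N = n, OF pp(1) j' 2 j pp(2)], of "Ag f"]
   by (simp add: mult.assoc distrib_right)
  thus ?thesis
   by (rule span_cong) (intro span_add span_const span_single[OF ps f] span_single[OF p f])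
 qed
qed

text \<open>The same passage from left to right as in \<open>U_Ag_word\<close>, now modulo the
  relations for \<open>J\<close> only.\<close>

lemma span_word: "set js <= J ==> f \<in> \<A> n ==> g \<in> \<A> n ==> Ag f * (Tprod js * Ag g) \<in> spanned_elts"
proof (induction js arbitrary: f)
 case Nil
 have "id \<in> psupp n J" by (simp add: psupp_def canon_id permutes_id)
 from span_single[OF this, of "f * g"] have "Ag (f * g) \<in> spanned_elts" using Nil by (simp add: canon_id)
 thus ?case using span_cong[OF cong_mod_sym[OF Ag_rels(3)]] Nil by simp
next
 case (Cons j js)
 have j: "j \<in> J" "1 \<le> j" "j < n" using Cons J by auto
 let ?f = "lrename (sref j) f"
 have f': "?f \<in> \<A> n" by (rule lrename_sref_laurent) (use j Cons in auto)
 have ff: "lrename (sref j) ?f = f" unfolding lrename_comp by (rule lrename_ident[OF Cons.prems(2)]) simp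
 obtain d where d: "d \<in> \<A> n" "d * (lvar j - lvar (j + 1)) = ?f - lrename (sref j) ?f"
  using divided_difference[OF f' j(2,3)] by blast
 have dl: "lvar j * d \<in> \<A> n" using d j by auto
 have "Tg j * Ag ?f - Ag f * Tg j - fconst (of_nat q - 1) * Ag (lvar j * d) \<in> tideal (rels q n J)"
  using tideal_incl[OF rels_cross[OF j(1) f' d]] unfolding ff .
 hence "Ag f * Tg j \<sim>\<^sub>J Tg j * Ag ?f - fconst (of_nat q - 1) * Ag (lvar j * d)"
  unfolding cong_mod_def by (drule_tac tideal_uminus) (simp add: algebra_simps)
 from cong_mod_mult_right[OF this, of "Tprod js * Ag g"]
 have "Ag f * (Tprod (j # js) * Ag g) \<sim>\<^sub>J Tg j * (Ag ?f * (Tprod js * Ag g))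
   + fconst (1 - of_nat q) * (Ag (lvar j * d) * (Tprod js * Ag g))"
  by (simp add: mult.assoc algebra_simps fconst_diff)
 thus ?case
  by (rule span_cong) (use Cons f' dl j in "auto intro!: span_add span_Tg span_const")
qed

lemma basis_spans: "a \<in> fsupp (gens n J) ==> a \<in> spanned_elts"
proof (induction a rule: free_induct)
 case (const c)
 have "id \<in> psupp n J" by (simp add: psupp_def canon_id permutes_id)
 from span_single[OF this, of "lconst c"] have "Ag (lconst c) \<in> spanned_elts" by (simp add: canon_id)
 thus ?case by (rule span_cong[OF cong_mod_sym[OF Ag_rels(1)]])
next
 case (add a b)
 thus ?case by (simp add: span_add)
next
 case (gen c a)
 show ?case
 proof (cases c)
  case (GT j)
  thus ?thesis using gen span_Tg by simp
 next
  case (GA f)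
  hence f: "f \<in> \<A> n" using gen(1) by simp
  have "Ag f * a \<in> spanned_elts"
  proof (rule span_linear[OF _ gen(3)])
   fix p g assume "p \<in> psupp n J" and g: "g \<in> \<A> n"
   thus "Ag f * (Tprod (canon n p) * Ag g) \<in> spanned_elts"
    by (intro span_word f g) (simp add: psupp_def)
  qed
  thus ?thesis using GA by simp
 qed
qed

text \<open>The relations for \<open>J\<close> bring a to the normal form \<open>\<Sum>\<close> T_p
  F_p. As a vanishes in \<H>_n, all F_p are 0 by \<open>basis_independent\<close>, so a is congruent
  to 0 modulo the relations for \<open>J\<close> already.\<close>

lemma parabolic_presentation:
 assumes a: "a \<in> fsupp (gens n J)" and z: "a \<in> tideal (rels q n (full n))"
 shows "a \<in> tideal (rels q n J)"
proof -
 obtain F where F: "\<forall>p. F p \<in> \<A> n" "a \<sim>\<^sub>J (\<Sum>p\<in>psupp n J. Tprod (canon n p) * Ag (F p))" (is "_ \<sim>\<^sub>J ?s")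
  using basis_spans[OF a] unfolding spanned_elts_def by blast
 let ?G = "\<lambda>p. if p \<in> psupp n J then F p else 0"
 have "a - ?s \<in> tideal (rels q n (full n))"
  using F(2) tideal_mono[OF _ rels_mono[OF J]] unfolding cong_mod_def by blast
 from tideal_diff[OF z this] have s: "?s \<in> tideal (rels q n (full n))" by simp
 have "(\<Sum>p | p permutes {1..n}. Tprod (canon n p) * (if p \<in> psupp n J then Ag (F p) else 0)) = ?s"
  by (rule sum.mono_neutral_cong_right) (auto simp: psupp_def finite_permutations)
 moreover have "cong_mod (rels q n (full n))
   (\<Sum>p | p permutes {1..n}. Tprod (canon n p) * Ag (?G p))
   (\<Sum>p | p permutes {1..n}. Tprod (canon n p) * (if p \<in> psupp n J then Ag (F p) else 0))"
  by (intro cong_mod_sum cong_mod_mult_left)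
   (use cong_mod_mono[OF Ag_zero_cong rels_mono[OF J]] in auto)
 ultimately have "(\<Sum>p | p permutes {1..n}. Tprod (canon n p) * Ag (?G p)) - ?s \<in> tideal (rels q n (full n))"
  by (simp add: cong_mod_def)
 from tideal.add[OF this s] have "(\<Sum>p | p permutes {1..n}. Tprod (canon n p) * Ag (?G p)) \<in> tideal (rels q n (full n))"
  by simp
 hence G: "?G p = 0" if "p permutes {1..n}" for p using basis_independent[of n ?G q p] F(1) that by simp
 have "F p = 0" if p: "p \<in> psupp n J" for p using G[of p] p by (simp add: psupp_def)
 hence "?s \<sim>\<^sub>J (\<Sum>p\<in>psupp n J. Tprod (canon n p) * 0)"
  by (intro cong_mod_sum cong_mod_mult_left) (simp add: Ag_zero_cong)
 thus ?thesis using cong_mod_trans[OF F(2)] by (fastforce simp: cong_mod_def)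
qed

end

section \<open>Embeddings of Levi subalgebras, sign projectors, and the modules they cut out\<close>

section \<open>Embeddings of Levi subalgebras\<close>

definition subst :: "(nat => nat) => hgen free => hgen free" where
 "subst p = pm_push (\<lambda>w. Word (map (\<lambda>c. case c of GT j => GT (p j) | GA f => GA (lrename p f)) (letters w)))"

lemma subst_add: "subst p (a + b) = subst p a + subst p b"
 and subst_diff: "subst p (a - b) = subst p a - subst p b"
 and subst_zero [simp]: "subst p 0 = 0"
 by (simp_all add: subst_def pm_push_add pm_push_diff)

lemma subst_mult: "subst p (a * b) = subst p a * subst p b"
 unfolding subst_def by (rule pm_push_mult) (simp add: plus_word_def)

lemma subst_Tg [simp]: "subst p (Tg j) = Tg (p j)"
 and subst_Ag [simp]: "subst p (Ag f) = Ag (lrename p f)"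
 and subst_fconst [simp]: "subst p (fconst c) = fconst c"
 by (simp_all add: subst_def fgen_def fconst_def zero_word_def)

lemma subst_one [simp]: "subst p 1 = 1"
 using subst_fconst[of p 1] by simp

lemma subst_fsupp:
 assumes "a \<in> fsupp (gens k J)" and "p ` {1..k} <= {1..n}" and "!!j. j \<in> J ==> p j \<in> J'"
 shows "subst p a \<in> fsupp (gens n J')"
 using assms(1)
proof (induction a rule: free_induct)
 case (gen c a)
 show ?case
 proof (cases c)
  case (GA f)
  hence "lrename p f \<in> \<A> n" using gen(1) lrename_laurent[OF _ assms(2)] by simp
  thus ?thesis using gen GA by (simp add: subst_mult)
 qed (use gen assms(3) in "simp add: subst_mult")
qed (simp_all add: subst_add)

text \<open>j belongs to \<open>lev ms\<close> when j and j + 1 lie in one block, so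
  \<open>step\<close> says that p is a translation on each block. Injectivity keeps images of
  different blocks apart, as the commutation relations demand.\<close>

locale translation =
 fixes ms :: "nat list" and n :: nat and p :: "nat => nat"
 assumes maps: "p ` {1..sum_list ms} <= {1..n}" and inj: "inj_on p {1..sum_list ms}"
  and step: "j \<in> lev ms ==> p (j + 1) = p j + 1"
begin

abbreviation "k \<equiv> sum_list ms"

lemma maps': "a \<in> {1..k} ==> p a \<in> {1..n}"
 using maps by blast

lemma lev_range: "j \<in> lev ms ==> j \<in> {1..k} \<and> j + 1 \<in> {1..k}"
 using lev_subset by fastforce

lemma lev_full: "j \<in> lev ms ==> p j \<in> full n"
 using maps'[of j] maps'[of "j + 1"] lev_range[of j] step[of j] by simp

lemma p_sref: "j \<in> lev ms ==> a \<in> {1..k} ==> p (sref j a) = sref (p j) (p a)"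
proof -
 assume j: "j \<in> lev ms" and a: "a \<in> {1..k}"
 note r = lev_range[OF j]
 consider "a = j" | "a = j + 1" | "a ~= j" "a ~= j + 1" by blast
 thus ?thesis
 proof cases
  case 3
  have "p a ~= p j" "p a ~= p (j + 1)" using inj_onD[OF inj _ a] r 3 by metis+
  thus ?thesis using 3 step[OF j] by (simp add: transpose_def)
 qed (use step[OF j] in "simp_all add: transpose_def")
qed

lemma p_far: "i \<in> lev ms ==> j \<in> lev ms ==> i + 2 \<le> j ==> p i + 2 \<le> p j \<or> p j + 2 \<le> p i"
proof -
 assume i: "i \<in> lev ms" and j: "j \<in> lev ms" and ij: "i + 2 \<le> j"
 note r = lev_range[OF i] lev_range[OF j]
 have "p i ~= p j" "p (i + 1) ~= p j" "p i ~= p (j + 1)" using inj_onD[OF inj, of i j]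
   inj_onD[OF inj, of "i + 1" j] inj_onD[OF inj, of i "j + 1"] r ij by auto
 thus ?thesis using step[OF i] step[OF j] by linarith
qed

lemma subst_tideal:
 assumes "a \<in> tideal (rels q k (lev ms))" and J: "J <= full n" "!!j. j \<in> lev ms ==> p j \<in> J"
 shows "subst p a \<in> tideal (rels q n J)"
proof (rule tideal_hom[OF assms(1)])
 fix r assume "r \<in> rels q k (lev ms)"
 thus "subst p r \<in> tideal (rels q n J)"
 proof (cases rule: rels_cases)
  case (const c)
  thus ?thesis using tideal_incl[OF rels_const] by (simp add: subst_diff)
 next
  case (add f g)
  hence "lrename p f \<in> \<A> n" "lrename p g \<in> \<A> n" using lrename_laurent[OF _ maps] by blast+
  thus ?thesis using tideal_incl[OF rels_add] add by (simp add: subst_diff subst_add lrename_add)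
 next
  case (mult f g)
  hence "lrename p f \<in> \<A> n" "lrename p g \<in> \<A> n" using lrename_laurent[OF _ maps] by blast+
  thus ?thesis using tideal_incl[OF rels_mult] mult by (simp add: subst_diff subst_mult lrename_mult)
 next
  case (braid j)
  hence "p j \<in> J" "p j + 1 \<in> J" using J(2)[of j] J(2)[of "j + 1"] step[of j] by auto
  thus ?thesis using tideal_incl[OF rels_braid, of "p j" J q n] step[OF braid(2)] unfolding braid
   by (simp add: subst_diff subst_mult)
 next
  case (far i j)
  have "cong_mod (rels q n J) (Tg (p i) * Tg (p j)) (Tg (p j) * Tg (p i))"
   by (rule Tg_far) (use far J(2) p_far in auto)
  thus ?thesis using far by (simp add: cong_mod_def subst_diff subst_mult)
 next
  case (quad j)
  thus ?thesis using tideal_incl[OF rels_quad[OF J(2)[of j], of q n]]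
   by (simp add: subst_diff subst_mult subst_add)
 next
  case (cross j f g)
  have f: "lrename p f \<in> \<A> n" and g: "lrename p g \<in> \<A> n"
   using cross lrename_laurent[OF _ maps] by blast+
  have s: "lrename p (lrename (sref j) f) = lrename (sref (p j)) (lrename p f)"
   unfolding lrename_comp by (rule lrename_cong[OF cross(3)]) (use p_sref[OF cross(2)] in simp)
  have "lrename p g * (lvar (p j) - lvar (p j + 1)) = lrename p (g * (lvar j - lvar (j + 1)))"
   using step[OF cross(2)] by (simp add: lrename_mult lrename_diff)
  also have "\<dots> = lrename p f - lrename (sref (p j)) (lrename p f)"
   unfolding cross(5) by (simp add: lrename_diff s)
  finally show ?thesis
   using tideal_incl[OF rels_cross[OF J(2)[OF cross(2)] f g]] unfolding cross(1)
   by (simp add: subst_diff subst_mult lrename_mult s)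
 qed
qed (simp_all add: subst_add subst_mult)

lemma subst_hfree: "a \<in> fsupp (gens k (lev ms)) ==> subst p a \<in> hfree n"
 by (rule subst_fsupp[OF _ maps]) (use lev_full in auto)

text \<open>Equality in \<H>_k is congruence modulo all relations, including those of generators to
  which p does not apply. \<open>parabolic_presentation\<close> reduces it to the relations of the
  Levi subalgebra, and these are preserved by \<open>subst\<close>.\<close>

lemma subst_well_defined:
 assumes a: "a \<in> fsupp (gens k (lev ms))" and b: "b \<in> fsupp (gens k (lev ms))" and eq: "hcls q k a = hcls q k b"
 shows "hcls q n (subst p a) = hcls q n (subst p b)"
proof -
 have "a - b \<in> tideal (rels q k (full k))"
  using eq hcls_eq_iff[of a k b q] a b fsupp_lev_hfree by (auto simp: cong_mod_def)
 hence "a - b \<in> tideal (rels q k (lev ms))"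
  by (intro parabolic_presentation[OF lev_subset]) (use a b in auto)
 hence "subst p a - subst p b \<in> tideal (rels q n (full n))" using subst_tideal[OF _ order_refl lev_full] by (metis subst_diff)
 thus ?thesis using hcls_eq_iff[OF subst_hfree[OF a] subst_hfree[OF b]] by (simp add: cong_mod_def)
qed

text \<open>A homomorphism with the required values is constructed, which gives meaning to the
  Hilbert choice in \<open>levi_embedding\<close>.\<close>

lemma is_levi_embedding_levi_embedding: "is_levi_embedding q ms n p (levi_embedding q ms n p)"
proof -
 define \<phi> where "\<phi> h = hcls q n (subst p (SOME a. a \<in> fsupp (gens k (lev ms)) \<and> hcls q k a = h))" for h
 have \<phi>: "\<phi> (hcls q k a) = hcls q n (subst p a)" if a: "a \<in> fsupp (gens k (lev ms))" for a
 proof -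
  let ?b = "SOME b. b \<in> fsupp (gens k (lev ms)) \<and> hcls q k b = hcls q k a"
  have b: "?b \<in> fsupp (gens k (lev ms)) \<and> hcls q k ?b = hcls q k a"
   by (rule someI[of _ a]) (use a in simp)
  show ?thesis unfolding \<phi>_def by (rule subst_well_defined) (use a b in auto)
 qed
 have "\<phi> \<in> ring_hom (levi q ms) (hecke q n)"
 proof (rule ring_hom_memI)
  fix x assume "x \<in> carrier (levi q ms)"
  then obtain a where a: "a \<in> fsupp (gens k (lev ms))" "x = hcls q k a" by (auto simp: carrier_levi)
  thus "\<phi> x \<in> carrier (hecke q n)" using subst_hfree by (simp add: \<phi>)
  fix y assume "y \<in> carrier (levi q ms)"
  then obtain b where b: "b \<in> fsupp (gens k (lev ms))" "y = hcls q k b" by (auto simp: carrier_levi)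
  show "\<phi> (x \<otimes>\<^bsub>levi q ms\<^esub> y) = \<phi> x \<otimes>\<^bsub>hecke q n\<^esub> \<phi> y"
   using a b subst_hfree \<phi>[of "a * b"] fsupp_lev_hfree by (simp add: \<phi> hcls_mult subst_mult)
  show "\<phi> (x \<oplus>\<^bsub>levi q ms\<^esub> y) = \<phi> x \<oplus>\<^bsub>hecke q n\<^esub> \<phi> y"
   using a b subst_hfree \<phi>[of "a + b"] fsupp_lev_hfree by (simp add: \<phi> hcls_add subst_add)
 next
  show "\<phi> \<one>\<^bsub>levi q ms\<^esub> = \<one>\<^bsub>hecke q n\<^esub>" using \<phi>[of 1] by (simp add: hcls_one)
 qed
 hence "is_levi_embedding q ms n p \<phi>"
  unfolding is_levi_embedding_def Let_def hecke_gen_eq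
  using \<phi>[of "Ag _"] \<phi>[of "Tg _"] by (auto simp: lev_def)
 thus ?thesis unfolding levi_embedding_def by (rule someI[of "is_levi_embedding q ms n p"])
qed

lemma levi_embedding_hom: "levi_embedding q ms n p \<in> ring_hom (levi q ms) (hecke q n)"
 using is_levi_embedding_levi_embedding by (simp add: is_levi_embedding_def Let_def)

lemma levi_embedding_hcls:
 assumes "a \<in> fsupp (gens k (lev ms))"
 shows "levi_embedding q ms n p (hcls q k a) = hcls q n (subst p a)"
proof -
 let ?\<phi> = "levi_embedding q ms n p"
 note hom = levi_embedding_hom[of q]
 have emb: "!!f. f \<in> \<A> k ==> ?\<phi> (hcls q k (Ag f)) = hcls q n (Ag (lrename p f))"
  "!!j. j \<in> lev ms ==> ?\<phi> (hcls q k (Tg j)) = hcls q n (Tg (p j))"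
  using is_levi_embedding_levi_embedding[of q] by (auto simp: is_levi_embedding_def Let_def hecke_gen_eq lev_def)
 have hc: "hcls q k a \<in> carrier (levi q ms)" if "a \<in> fsupp (gens k (lev ms))" for a
  using that by (simp add: carrier_levi)
 note h = fsupp_lev_hfree[of _ ms]
 show ?thesis
  using assms
 proof (induction a rule: free_induct)
  case (const c)
  have "hcls q m (Ag (lconst c)) = hcls q m (fconst c)" for m
   using hcls_eq_iff[of "Ag (lconst c)" m "fconst c" q] Ag_rels(1)[of "full m" m q c] by simp
  thus ?case using emb(1)[of "lconst c"] by simp
 next
  case (add a b)
  have "?\<phi> (hcls q k (a + b)) = ?\<phi> (hcls q k a) \<oplus>\<^bsub>hecke q n\<^esub> ?\<phi> (hcls q k b)"
   using ring_hom_add[OF hom hc[OF add(1)] hc[OF add(2)]] by (simp only: levi_simps hcls_add[OF h[OF add(1)] h[OF add(2)]])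
  thus ?case by (simp only: add.IH subst_add hcls_add[OF subst_hfree[OF add(1)] subst_hfree[OF add(2)]])
 next
  case (gen c a)
  have c: "fgen c \<in> fsupp (gens k (lev ms))" using gen by simp
  have e: "?\<phi> (hcls q k (fgen c)) = hcls q n (subst p (fgen c))"
   using gen(1) emb by (cases c) auto
  have "?\<phi> (hcls q k (fgen c * a)) = ?\<phi> (hcls q k (fgen c)) \<otimes>\<^bsub>hecke q n\<^esub> ?\<phi> (hcls q k a)"
   using ring_hom_mult[OF hom hc[OF c] hc[OF gen(2)]] by (simp only: levi_simps hcls_mult[OF h[OF c] h[OF gen(2)]])
  thus ?case by (simp only: gen.IH e subst_mult hcls_mult[OF subst_hfree[OF c] subst_hfree[OF gen(2)]])
 qed
qed

end

section \<open>Sign projectors\<close>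

definition sgn_vec :: "('s, 'b) module => (hgen free => 'b => 'b) => nat set => 'b set" where
 "sgn_vec M act S = {x \<in> carrier M. \<forall>j\<in>S. act (Tg j) x = \<ominus>\<^bsub>M\<^esub> x}"

definition sgn_sum :: "nat => nat => hgen free" where
 "sgn_sum q n = (\<Sum>p | p permutes {1..n}. fconst ((- 1 / of_nat q) ^ length (canon n p)) * Tprod (canon n p))"

definition sgn_norm :: "nat => nat => complex" where
 "sgn_norm q n = inverse (\<Sum>p | p permutes {1..n}. (1 / of_nat q) ^ length (canon n p))"

definition sgn_elt :: "nat => nat => hgen free" where
 "sgn_elt q n = fconst (sgn_norm q n) * sgn_sum q n"

lemma sgn_elt_fsupp: "sgn_elt q n \<in> fsupp (gens n (full n))"
 unfolding sgn_elt_def sgn_sum_def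
 by (intro fsupp_mult fsupp_sum fsupp_fconst Tprod_fsupp set_canon) simp

lemma hcls_Ag_lconst: "hcls q n (Ag (lconst c)) = hcls q n (fconst c)"
 using hcls_eq_iff[of "Ag (lconst c)" n "fconst c" q] Ag_rels(1)[of "full n" n q c] by simp

lemma foldr_hT: "set js <= full n ==> foldr (\<lambda>j h. hT q n j \<otimes>\<^bsub>hecke q n\<^esub> h) js \<one>\<^bsub>hecke q n\<^esub> = hcls q n (Tprod js)"
proof (induction js)
 case Nil
 thus ?case by (simp add: hcls_one)
next
 case (Cons j js)
 have "Tprod js \<in> hfree n" by (rule Tprod_fsupp) (use Cons in simp)
 thus ?case using Cons by (simp add: hcls_mult hecke_gen_eq)
qed

lemma hTw_eq:
 assumes w: "w permutes {1..n}"
 shows "hTw q n w = hcls q n (Tprod (canon n (pinv w)))"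
proof -
 let ?js = "SOME js. reduced_word n w js"
 obtain js where js: "set js <= full n" "pword js = pinv w" "length js = length (canon n (pinv w))"
  using reduced_word_exists[OF permutes_inv[OF w]] by blast
 have "sref_word js = w"
 proof -
  have "pinv (sref_word js) = pinv w" using js(2) by (simp add: inv_sref_word)
  moreover have "bij (sref_word js)" by (rule o_bij[OF sref_word_pword(2) sref_word_pword(1)])
  ultimately show ?thesis using permutes_bij[OF w] by (metis inv_inv_eq)
 qed
 hence "reduced_word n w js" using js perm_length_eq[OF w] by (simp add: reduced_word_def full_def)
 hence "reduced_word n w ?js" by (rule someI)
 hence s: "set ?js <= full n" "sref_word ?js = w" "length ?js = length (canon n (pinv w))"
  using perm_length_eq[OF w] by (auto simp: reduced_word_def full_def)
 have pw: "pword ?js = pinv w" using inv_sref_word[of ?js] s(2) by simp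
 have "cong_mod (rels q n (full n)) (Tprod ?js) (Tprod (canon n (pinv w)))"
  using Tprod_reduced[OF s(1)] s(3) unfolding pw .
 hence "hcls q n (Tprod ?js) = hcls q n (Tprod (canon n (pinv w)))"
  using hcls_eq_iff[OF Tprod_fsupp[OF s(1)] Tprod_fsupp[OF set_canon[OF permutes_inv[OF w]]]] by blast
 thus ?thesis unfolding hTw_def foldr_hT[OF s(1)] .
qed

text \<open>T_w belongs to the canonical word of the inverse of w, so the sums over the symmetric
  group are reindexed by inversion.\<close>

lemma sign_projector_eq: "sign_projector q n = hcls q n (sgn_elt q n)"
proof -
 interpret H: ring "hecke q n" by (rule ring_hecke)
 let ?P = "{w. w permutes {1..n}}"
 let ?F = "\<lambda>p. fconst ((- 1 / of_nat q) ^ length (canon n p)) * Tprod (canon n p)"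
 have T: "Tprod (canon n (pinv w)) \<in> hfree n" if "w \<in> ?P" for w
  using that by (intro Tprod_fsupp set_canon permutes_inv) simp
 have s: "hscalar q n ((- 1 / of_nat q) ^ perm_length n w) \<otimes>\<^bsub>hecke q n\<^esub> hTw q n w = hcls q n (?F (pinv w))" if "w \<in> ?P" for w
  using that T[OF that] by (simp add: hTw_eq perm_length_eq hecke_gen_eq hcls_Ag_lconst hcls_mult)
 have "(\<Oplus>\<^bsub>hecke q n\<^esub>w\<in>?P. hscalar q n ((- 1 / of_nat q) ^ perm_length n w) \<otimes>\<^bsub>hecke q n\<^esub> hTw q n w)
   = (\<Oplus>\<^bsub>hecke q n\<^esub>w\<in>?P. hcls q n (?F (pinv w)))"
  by (rule H.finsum_cong') (use s T in "auto intro!: hcls_closed")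
 also have "\<dots> = hcls q n (\<Sum>w\<in>?P. ?F (pinv w))"
  by (rule hcls_sum[symmetric]) (use T in "auto simp: finite_permutations")
 also have "(\<Sum>w\<in>?P. ?F (pinv w)) = sgn_sum q n"
  unfolding sgn_sum_def by (rule sum_permutations_inverse[symmetric])
 finally have sum: "(\<Oplus>\<^bsub>hecke q n\<^esub>w\<in>?P. hscalar q n ((- 1 / of_nat q) ^ perm_length n w) \<otimes>\<^bsub>hecke q n\<^esub> hTw q n w) = hcls q n (sgn_sum q n)" .
 have "(\<Sum>w\<in>?P. (1 / of_nat q) ^ perm_length n w) = (\<Sum>w\<in>?P. (1 / of_nat q :: complex) ^ length (canon n (pinv w)))"
  by (rule sum.cong) (simp_all add: perm_length_eq)
 also have "\<dots> = (\<Sum>p\<in>?P. (1 / of_nat q) ^ length (canon n p))"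
  by (rule sum_permutations_inverse[symmetric])
 finally have norm: "inverse (\<Sum>w\<in>?P. (1 / of_nat q) ^ perm_length n w) = sgn_norm q n" by (simp add: sgn_norm_def)
 have "sgn_sum q n \<in> hfree n"
  unfolding sgn_sum_def by (intro fsupp_mult fsupp_sum fsupp_fconst Tprod_fsupp set_canon) simp
 thus ?thesis
  unfolding sign_projector_def sum norm sgn_elt_def by (simp add: hecke_gen_eq hcls_Ag_lconst hcls_mult)
qed

text \<open>The terms of \<open>p\<close> and \<open>p \<circ> sref j\<close> span an invariant subspace on which \<open>T\<^sub>j\<close> acts by \<open>-1\<close>.\<close>

lemma Tg_sgn_sum:
 assumes q: "q > 0" and j: "j \<in> full n"
 shows "cong_mod (rels q n (full n)) (Tg j * sgn_sum q n) (- sgn_sum q n)"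
proof -
 let ?P = "{p. p permutes {1..n}}" and ?R = "rels q n (full n)"
 define F where "F p = fconst ((- 1 / of_nat q) ^ length (canon n p)) * Tprod (canon n p)" for p
 define G where "G p = F p + F (p \<circ> sref j)" for p
 have up: "cong_mod ?R (Tg j * G p) (- G p)" if p: "p permutes {1..n}" and lt: "p j < p (j + 1)" for p
 proof -
  let ?r = "p \<circ> sref j" and ?a = "(- 1 / of_nat q) ^ length (canon n p) :: complex"
  let ?T = "Tprod (canon n p)" and ?U = "Tprod (canon n ?r)"
  have r: "?r permutes {1..n}" by (rule perm_sref[OF p j])
  have len: "length (canon n ?r) = Suc (length (canon n p))" by (rule length_canon_step[OF p j lt])
  have 1: "cong_mod ?R (Tg j * ?T) ?U" by (rule canon_up[OF p j lt j set_canon[OF p]])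
  have 2: "cong_mod ?R (Tg j * ?U) (fconst (of_nat q - 1) * ?U + fconst (of_nat q) * ?T)"
   using canon_down[OF r j _ j set_canon[OF r], of q n] lt by (simp add: sref_sref)
  have G: "G p = fconst ?a * ?T + fconst (- ?a / of_nat q) * ?U"
   unfolding G_def F_def len by simp
  have "Tg j * G p = fconst ?a * (Tg j * ?T) + fconst (- ?a / of_nat q) * (Tg j * ?U)"
   unfolding G by (simp only: distrib_left flip: mult.assoc fconst_commute[of _ "Tg j"])
  moreover have "cong_mod ?R \<dots> (fconst ?a * ?U + fconst (- ?a / of_nat q) * (fconst (of_nat q - 1) * ?U + fconst (of_nat q) * ?T))"
   by (intro cong_mod_add cong_mod_mult_left 1 2)
  moreover have "fconst ?a * ?U + fconst (- ?a / of_nat q) * (fconst (of_nat q - 1) * ?U + fconst (of_nat q) * ?T)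
    = fconst (?a + (- ?a / of_nat q) * (of_nat q - 1)) * ?U + fconst ((- ?a / of_nat q) * of_nat q) * ?T"
   by (simp only: fconst_add fconst_mult distrib_left distrib_right mult.assoc add.assoc)
  moreover have "?a + (- ?a / of_nat q) * (of_nat q - 1) = - (- ?a / of_nat q)" "(- ?a / of_nat q) * of_nat q = - ?a"
   using q by (simp_all add: field_simps)
  ultimately show ?thesis unfolding G by (simp add: fconst_uminus)
 qed
 have all: "cong_mod ?R (Tg j * G p) (- G p)" if p: "p permutes {1..n}" for p
 proof (cases "p j < p (j + 1)")
  case True
  thus ?thesis by (rule up[OF p])
 next
  case False
  have "p j ~= p (j + 1)" using permutes_inj[OF p] by (metis injD n_not_Suc_n Suc_eq_plus1)
  hence "(p \<circ> sref j) j < (p \<circ> sref j) (j + 1)" using False by simp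
  from up[OF perm_sref[OF p j] this] show ?thesis by (simp only: G_def sref_sref add.commute[of "F p"])
 qed
 have "(\<Sum>p\<in>?P. F (p \<circ> sref j)) = (\<Sum>p\<in>?P. F p)"
  by (rule sum.reindex_bij_witness[of _ "\<lambda>p. p \<circ> sref j" "\<lambda>p. p \<circ> sref j"])
   (use perm_sref[OF _ j] sref_sref in auto)
 \<comment> \<open>Pairing p with p s_j counts every term twice; the factor 1/2 below undoes
   this.\<close>
 hence two: "(\<Sum>p\<in>?P. G p) = sgn_sum q n + sgn_sum q n"
  unfolding G_def sum.distrib by (simp add: sgn_sum_def F_def)
 have "cong_mod ?R (\<Sum>p\<in>?P. Tg j * G p) (\<Sum>p\<in>?P. - G p)"
  by (rule cong_mod_sum) (use all in simp)
 hence "cong_mod ?R (Tg j * (\<Sum>p\<in>?P. G p)) (- (\<Sum>p\<in>?P. G p))" by (simp add: sum_distrib_left sum_negf)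
 from cong_mod_mult_left[OF this, of "fconst (1 / 2)"]
 have 1: "cong_mod ?R (fconst (1/2) * (Tg j * (sgn_sum q n + sgn_sum q n))) (fconst (1/2) * (- (sgn_sum q n + sgn_sum q n)))"
  unfolding two .
 have half: "fconst (1/2) * (s + s) = s" for s :: "hgen free"
 proof -
  have "fconst (1/2) * (s + s) = fconst (1/2 + 1/2) * s" by (simp only: fconst_add distrib_left distrib_right)
  thus ?thesis by simp
 qed
 have "fconst (1/2) * (Tg j * (sgn_sum q n + sgn_sum q n)) = Tg j * (fconst (1/2) * (sgn_sum q n + sgn_sum q n))"
  by (simp only: fconst_commute[of _ "Tg j"] flip: mult.assoc)
 thus ?thesis using 1 by (simp only: half mult_minus_right)
qed

lemma sgn_norm_nonzero:
 assumes "q > 0"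
 shows "sgn_norm q n * (\<Sum>p | p permutes {1..n}. (1 / of_nat q) ^ length (canon n p)) = 1"
proof -
 have "0 < (\<Sum>p | p permutes {1..n}. (1 / real q) ^ length (canon n p))"
  by (rule sum_pos) (use assms permutes_id in "auto simp: finite_permutations intro: exI[of _ id]")
 moreover have "(\<Sum>p | p permutes {1..n}. (1 / of_nat q) ^ length (canon n p)) =
   complex_of_real (\<Sum>p | p permutes {1..n}. (1 / real q) ^ length (canon n p))" by simp
 ultimately have "(\<Sum>p | p permutes {1..n}. (1 / of_nat q :: complex) ^ length (canon n p)) ~= 0"
  by (metis of_real_eq_0_iff less_irrefl)
 thus ?thesis by (simp add: sgn_norm_def)
qed

context free_action
begin

lemma sgn_vec_Tprod:
 assumes x: "x \<in> sgn_vec M act S"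
 shows "set js <= S ==> act (Tprod js) x = act (fconst ((- 1) ^ length js)) x"
proof (induction js)
 case Nil
 thus ?case by simp
next
 case (Cons j js)
 have xc: "x \<in> carrier M" using x by (simp add: sgn_vec_def)
 have "act (Tg j) x = act (fconst (- 1)) x" using x Cons xc by (simp add: sgn_vec_def fconst_uminus act_uminus)
 hence "act (fconst ((- 1) ^ length js)) (act (Tg j) x) = act (fconst ((- 1) ^ length js)) (act (fconst (- 1)) x)" by simp
 hence "act (fconst ((- 1) ^ length js) * Tg j) x = act (fconst ((- 1) ^ length (j # js))) x"
  using xc by (simp add: mult.commute flip: act_mult fconst_mult)
 thus ?case using Cons xc by (simp add: act_mult fconst_commute)
qed

text \<open>On a sign vector T_w is (-1) to the power l(w). The coefficients (-1/q)^l(w) thereby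
  turn into (1/q)^l(w), whose sum the normalisation cancels.\<close>

lemma sgn_elt_fixes:
 assumes q: "q > 0" and x: "x \<in> sgn_vec M act (full n)"
 shows "act (sgn_elt q n) x = x"
proof -
 let ?P = "{p. p permutes {1..n}}"
 have xc: "x \<in> carrier M" using x by (simp add: sgn_vec_def)
 have fin: "finite ?P" by (simp add: finite_permutations)
 have "act (fconst ((- 1 / of_nat q) ^ length (canon n p)) * Tprod (canon n p)) x
   = act (fconst ((1 / of_nat q) ^ length (canon n p))) x" if "p \<in> ?P" for p
 proof -
  have e: "(- 1 / of_nat q) ^ m * (- 1) ^ m = (1 / of_nat q :: complex) ^ m" for m
   by (simp flip: power_mult_distrib)
  have "act (fconst ((- 1 / of_nat q) ^ length (canon n p)) * Tprod (canon n p)) x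
    = act (fconst ((- 1 / of_nat q) ^ length (canon n p)) * fconst ((- 1) ^ length (canon n p))) x"
   using sgn_vec_Tprod[OF x set_canon, of p] that xc by (simp only: act_mult mem_Collect_eq)
  thus ?thesis by (simp only: fconst_mult[symmetric] e)
 qed
 hence "(\<Oplus>p\<in>?P. act (fconst ((- 1 / of_nat q) ^ length (canon n p)) * Tprod (canon n p)) x)
   = (\<Oplus>p\<in>?P. act (fconst ((1 / of_nat q) ^ length (canon n p))) x)"
  by (intro finsum_cong') (use xc in auto)
 hence "act (sgn_sum q n) x = act (\<Sum>p\<in>?P. fconst ((1 / of_nat q) ^ length (canon n p))) x"
  unfolding sgn_sum_def by (simp only: act_sum[OF fin xc])
 also have "(\<Sum>p\<in>A. fconst (f p)) = fconst (sum f A)" if "finite A" for A :: "(nat => nat) set" and f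
  using that by (induction A rule: finite_induct) (simp_all add: fconst_add)
 from this[OF fin] have "(\<Sum>p\<in>?P. fconst ((1 / of_nat q) ^ length (canon n p))) = fconst (\<Sum>p\<in>?P. (1 / of_nat q) ^ length (canon n p))" .
 finally have "act (sgn_elt q n) x = act (fconst (sgn_norm q n) * fconst (\<Sum>p\<in>?P. (1 / of_nat q) ^ length (canon n p))) x"
  unfolding sgn_elt_def using xc by (simp add: act_mult)
 also have "\<dots> = x" using xc by (simp only: fconst_mult[symmetric] sgn_norm_nonzero[OF q] fconst_one act_one)
 finally show ?thesis .
qed

lemma sgn_elt_in:
 assumes q: "q > 0" and k: "kills (rels q n (full n))" and x: "x \<in> carrier M"
 shows "act (sgn_elt q n) x \<in> sgn_vec M act (full n)"
proof -
 have "act (Tg j) (act (sgn_elt q n) x) = \<ominus> act (sgn_elt q n) x" if j: "j \<in> full n" for j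
 proof -
  have "cong_mod (rels q n (full n)) (fconst (sgn_norm q n) * (Tg j * sgn_sum q n)) (fconst (sgn_norm q n) * (- sgn_sum q n))"
   by (rule cong_mod_mult_left[OF Tg_sgn_sum[OF q j]])
  moreover have "fconst (sgn_norm q n) * (Tg j * sgn_sum q n) = Tg j * sgn_elt q n"
   unfolding sgn_elt_def by (simp only: fconst_commute[of _ "Tg j"] flip: mult.assoc)
  ultimately have "cong_mod (rels q n (full n)) (Tg j * sgn_elt q n) (- sgn_elt q n)"
   by (simp add: sgn_elt_def)
  from act_cong[OF k this x] show ?thesis using x by (simp add: act_mult act_uminus)
 qed
 thus ?thesis using x by (simp add: sgn_vec_def)
qed

lemma free_action_subst: "free_action M (\<lambda>a. act (subst p a))"
 by unfold_locales (simp_all add: subst_add subst_mult act_add act_radd act_mult)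

end

lemma (in translation) subst_kills:
 assumes "free_action M act" and "free_action.kills M act (rels q n J)" and "J <= full n"
  and "!!j. j \<in> lev ms ==> p j \<in> J"
 shows "free_action.kills M (\<lambda>a. act (subst p a)) (rels q k (lev ms))"
proof -
 interpret A: free_action M act by (rule assms(1))
 interpret B: free_action M "\<lambda>a. act (subst p a)" by (rule A.free_action_subst)
 show ?thesis unfolding B.kills_def
  using A.kills_tideal[OF subst_tideal[OF tideal_incl assms(3,4)] assms(2)] by blast
qed

text \<open>T_j at positions outside the image of p is far from every renamed T, and s_j fixes all
  renamed variables, so the crossing relation has no correction term.\<close>

lemma (in translation) subst_commute:
 assumes J: "J <= full n" "!!j. j \<in> lev ms ==> p j \<in> J"
  and j: "j \<in> J" "j \<notin> p ` {1..k}" "j + 1 \<notin> p ` {1..k}"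
  and a: "a \<in> fsupp (gens k (lev ms))"
 shows "cong_mod (rels q n J) (Tg j * subst p a) (subst p a * Tg j)"
 using a
proof (induction a rule: free_induct)
 case (const c)
 thus ?case by (simp add: fconst_commute)
next
 case (add a b)
 from cong_mod_add[OF add.IH] show ?case by (simp add: subst_add distrib_left distrib_right)
next
 case (gen c a)
 have "cong_mod (rels q n J) (Tg j * subst p (fgen c)) (subst p (fgen c) * Tg j)"
 proof (cases c)
  case (GT i)
  hence i: "i \<in> lev ms" using gen(1) by simp
  have "p i \<in> p ` {1..k}" "p i + 1 \<in> p ` {1..k}" using lev_range[OF i] step[OF i] by (metis imageI)+
  hence "j ~= p i" "j ~= p i + 1" "j + 1 ~= p i" using j by metis+
  hence "cong_mod (rels q n J) (Tg j * Tg (p i)) (Tg (p i) * Tg j)"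
   by (intro Tg_far j(1) J(2) i) linarith
  thus ?thesis using GT by simp
 next
  case (GA f)
  hence f: "f \<in> \<A> k" using gen(1) by simp
  have f': "lrename p f \<in> \<A> n" by (rule lrename_laurent[OF f maps])
  have inv: "lrename (sref j) (lrename p f) = lrename p f"
   unfolding lrename_comp
  proof (rule lrename_cong[OF f])
   fix a assume "a \<in> {1..k}"
   hence "p a \<in> p ` {1..k}" by (rule imageI)
   hence "p a ~= j" "p a ~= j + 1" using j(2,3) by metis+
   thus "(sref j \<circ> p) a = p a" by (simp add: transpose_def)
  qed
  have "Tg j * Ag (lrename p f) - Ag (lrename p f) * Tg j - fconst (of_nat q - 1) * Ag 0 \<in> tideal (rels q n J)"
   using tideal_incl[OF rels_cross[OF j(1) f', of 0 q]] inv by simp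
  hence "cong_mod (rels q n J) (Tg j * Ag (lrename p f)) (Ag (lrename p f) * Tg j + fconst (of_nat q - 1) * Ag 0)"
   by (simp add: cong_mod_def diff_diff_eq)
  also have "cong_mod (rels q n J) \<dots> (Ag (lrename p f) * Tg j + fconst (of_nat q - 1) * 0)"
   by (intro cong_mod_add cong_mod_refl cong_mod_mult_left Ag_zero_cong J)
  finally show ?thesis using GA by simp
 qed
 from cong_mod_mult_right[OF this, of "subst p a"] cong_mod_mult_left[OF gen.IH, of "subst p (fgen c)"]
 show ?case unfolding subst_mult mult.assoc by (rule cong_mod_trans)
qed

definition sgn_factor :: "nat => nat list => nat => hgen free" where
 "sgn_factor q ks k = subst (\<lambda>j. j + offset ks k) (sgn_elt q (ks ! k))"

definition sgn_levi :: "nat => nat list => hgen free" where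
 "sgn_levi q ks = prod_list (map (sgn_factor q ks) [0..<length ks])"

lemma shift_block: "k < length ks ==> (\<lambda>j. j + offset ks k) ` {1..ks ! k} = block ks k"
 unfolding block_def by (simp add: add.commute)

lemma shift_lev: "k < length ks ==> j \<in> full (ks ! k) ==> j + offset ks k \<in> lev ks"
proof -
 assume k: "k < length ks" and j: "j \<in> full (ks ! k)"
 hence b: "j + offset ks k \<in> block ks k" "j + offset ks k + 1 \<in> block ks k" by (auto simp: block_def)
 hence "j + offset ks k \<in> full (sum_list ks)" using block_subset[OF k] by fastforce
 thus ?thesis unfolding lev_eq using b k by blast
qed

lemma lev_shift:
 assumes "j \<in> lev ks"
 obtains k i where "k < length ks" "i \<in> full (ks ! k)" "j = i + offset ks k"
proof -
 obtain k where k: "k < length ks" "j \<in> block ks k" "j + 1 \<in> block ks k" using assms unfolding lev_eq by blast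
 hence "j - offset ks k \<in> full (ks ! k)" "j = (j - offset ks k) + offset ks k" by (auto simp: block_def)
 thus ?thesis using that k(1) by blast
qed

lemma translation_shift:
 assumes "k < length ks"
 shows "translation [ks ! k] (sum_list ks) (\<lambda>j. j + offset ks k)"
proof
 show "(\<lambda>j. j + offset ks k) ` {1..sum_list [ks ! k]} <= {1..sum_list ks}"
  using shift_block[OF assms] block_subset[OF assms] by simp
qed (auto simp: inj_on_def)

lemma sgn_factor_fsupp: "k < length ks ==> sgn_factor q ks k \<in> fsupp (gens (sum_list ks) (lev ks))"
 unfolding sgn_factor_def
 by (rule subst_fsupp[OF sgn_elt_fsupp]) (use shift_block block_subset shift_lev in "simp_all del: in_full")

lemma sgn_levi_fsupp: "sgn_levi q ks \<in> fsupp (gens (sum_list ks) (lev ks))"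
 unfolding sgn_levi_def by (rule fsupp_prod_list) (use sgn_factor_fsupp in simp)

lemma sign_projector_levi_eq: "sign_projector_levi q ks = hcls q (sum_list ks) (sgn_levi q ks)"
proof -
 have factor: "emb_factor q ks k (sign_projector q (ks ! k)) = hcls q (sum_list ks) (sgn_factor q ks k)" if k: "k < length ks" for k
 proof -
  interpret translation "[ks ! k]" "sum_list ks" "\<lambda>j. j + offset ks k" by (rule translation_shift[OF k])
  show ?thesis
   unfolding emb_factor_def sign_projector_eq sgn_factor_def
   using levi_embedding_hcls[of "sgn_elt q (ks ! k)" q] sgn_elt_fsupp[of q "ks ! k"] by (simp add: lev_singleton)
 qed
 have "foldr (\<lambda>k h. emb_factor q ks k (sign_projector q (ks ! k)) \<otimes>\<^bsub>hecke q (sum_list ks)\<^esub> h) xs \<one>\<^bsub>hecke q (sum_list ks)\<^esub>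
   = hcls q (sum_list ks) (prod_list (map (sgn_factor q ks) xs))" if "set xs <= {..<length ks}" for xs
  using that
 proof (induction xs)
  case Nil
  thus ?case by (simp add: hcls_one)
 next
  case (Cons k xs)
  have "prod_list (map (sgn_factor q ks) xs) \<in> hfree (sum_list ks)"
   by (intro fsupp_lev_hfree fsupp_prod_list sgn_factor_fsupp) (use Cons in auto)
  moreover have "sgn_factor q ks k \<in> hfree (sum_list ks)" by (intro fsupp_lev_hfree sgn_factor_fsupp) (use Cons in auto)
  ultimately show ?case using Cons factor[of k] by (simp add: hcls_mult)
 qed
 from this[of "[0..<length ks]"] show ?thesis
  unfolding sign_projector_levi_def sgn_levi_def Let_def by (simp only: set_upt atLeast0LessThan order_refl)
qed

context free_action
begin

lemma sgn_factor_image: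
 assumes q: "q > 0" and k: "k < length ks" and kills: "kills (rels q (sum_list ks) (lev ks))"
 shows "x \<in> sgn_vec M act (lev ks) ==> act (sgn_factor q ks k) x = x"
  and "x \<in> carrier M ==> i \<in> full (ks ! k) ==> act (Tg (i + offset ks k)) (act (sgn_factor q ks k) x) = \<ominus> act (sgn_factor q ks k) x"
proof -
 interpret T: translation "[ks ! k]" "sum_list ks" "\<lambda>j. j + offset ks k" by (rule translation_shift[OF k])
 let ?act = "\<lambda>a. act (subst (\<lambda>j. j + offset ks k) a)"
 interpret B: free_action M ?act by (rule free_action_subst)
 have Bk: "B.kills (rels q (ks ! k) (full (ks ! k)))"
  using T.subst_kills[OF free_action_axioms kills lev_subset] shift_lev[OF k] by (simp add: lev_singleton del: in_full)
 { assume x: "x \<in> sgn_vec M act (lev ks)"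
  hence "x \<in> sgn_vec M ?act (full (ks ! k))" using shift_lev[OF k] by (simp add: sgn_vec_def del: in_full)
  from B.sgn_elt_fixes[OF q this] show "act (sgn_factor q ks k) x = x" by (simp add: sgn_factor_def) }
 assume "x \<in> carrier M" "i \<in> full (ks ! k)"
 thus "act (Tg (i + offset ks k)) (act (sgn_factor q ks k) x) = \<ominus> act (sgn_factor q ks k) x"
  using B.sgn_elt_in[OF q Bk, of x] by (simp add: sgn_vec_def sgn_factor_def del: in_full)
qed

lemma sgn_factor_commute:
 assumes k: "k < length ks" and l: "l < length ks" "k ~= l" and i: "i \<in> full (ks ! k)"
 shows "cong_mod (rels q (sum_list ks) (lev ks)) (Tg (i + offset ks k) * sgn_factor q ks l) (sgn_factor q ks l * Tg (i + offset ks k))"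
proof -
 interpret T: translation "[ks ! l]" "sum_list ks" "\<lambda>j. j + offset ks l" by (rule translation_shift[OF l(1)])
 have b: "i + offset ks k \<in> block ks k" "i + offset ks k + 1 \<in> block ks k" using i by (auto simp: block_def)
 have nb: "a \<notin> block ks l" if "a \<in> block ks k" for a using block_unique[OF k l(1) that] l(2) by blast
 show ?thesis
  unfolding sgn_factor_def
 proof (rule T.subst_commute[OF lev_subset])
  show "!!j. j \<in> lev [ks ! l] ==> j + offset ks l \<in> lev ks" using shift_lev[OF l(1)] by (simp add: lev_singleton del: in_full)
  show "i + offset ks k \<in> lev ks" by (rule shift_lev[OF k i])
  show "i + offset ks k \<notin> (\<lambda>j. j + offset ks l) ` {1..sum_list [ks ! l]}"
   "i + offset ks k + 1 \<notin> (\<lambda>j. j + offset ks l) ` {1..sum_list [ks ! l]}"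
   using nb[OF b(1)] nb[OF b(2)] shift_block[OF l(1)] by simp_all
  show "sgn_elt q (ks ! l) \<in> fsupp (gens (sum_list [ks ! l]) (lev [ks ! l]))"
   using sgn_elt_fsupp by (simp add: lev_singleton)
 qed
qed

text \<open>Each factor fixes the sign vectors. Conversely a T_j of block k commutes with the
  factors of the other blocks until it meets the k-th factor, which turns it into -1.\<close>

lemma sgn_levi_image:
 assumes q: "q > 0" and kills: "kills (rels q (sum_list ks) (lev ks))"
 shows "act (sgn_levi q ks) ` carrier M = sgn_vec M act (lev ks)"
proof -
 let ?p = "\<lambda>xs. prod_list (map (sgn_factor q ks) xs)"
 have fixes_: "act (?p xs) x = x" if "x \<in> sgn_vec M act (lev ks)" "set xs <= {..<length ks}" for x xs
  using that(2)
 proof (induction xs)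
  case Nil
  thus ?case using that(1) by (simp add: sgn_vec_def)
 next
  case (Cons k xs)
  have "x \<in> carrier M" using that(1) by (simp add: sgn_vec_def)
  thus ?case using Cons sgn_factor_image(1)[OF q _ kills that(1), of k] by (simp add: act_mult)
 qed
 have sgn: "act (Tg (i + offset ks k)) (act (?p xs) x) = \<ominus> act (?p xs) x"
  if x: "x \<in> carrier M" and k: "k < length ks" and i: "i \<in> full (ks ! k)" and "k \<in> set xs" "set xs <= {..<length ks}" for x xs i k
  using that(4,5)
 proof (induction xs)
  case Nil
  thus ?case by simp
 next
  case (Cons l xs)
  let ?T = "Tg (i + offset ks k)"
  have e: "act (?p (l # xs)) x = act (sgn_factor q ks l) (act (?p xs) x)" using x by (simp add: act_mult)
  show ?case
  proof (cases "k = l")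
   case True
   thus ?thesis unfolding e using sgn_factor_image(2)[OF q k kills _ i] x by simp
  next
   case False
   have l: "l < length ks" using Cons by simp
   have "act ?T (act (sgn_factor q ks l) (act (?p xs) x)) = act (?T * sgn_factor q ks l) (act (?p xs) x)" using x by (simp add: act_mult)
   also have "\<dots> = act (sgn_factor q ks l * ?T) (act (?p xs) x)"
    by (rule act_cong[OF kills sgn_factor_commute[OF k l False i]]) (use x in simp)
   also have "\<dots> = act (sgn_factor q ks l) (\<ominus> act (?p xs) x)" using Cons False x by (simp add: act_mult)
   also have "\<dots> = \<ominus> act (sgn_factor q ks l) (act (?p xs) x)" using x by (simp add: act_rminus)
   finally show ?thesis unfolding e .
  qed
 qed
 show ?thesis
 proof
  show "act (sgn_levi q ks) ` carrier M <= sgn_vec M act (lev ks)"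
  proof
   fix y assume "y \<in> act (sgn_levi q ks) ` carrier M"
   then obtain x where x: "x \<in> carrier M" "y = act (sgn_levi q ks) x" by blast
   have "act (Tg j) y = \<ominus> y" if "j \<in> lev ks" for j
   proof -
    obtain k i where "k < length ks" "i \<in> full (ks ! k)" "j = i + offset ks k" using lev_shift[OF \<open>j \<in> lev ks\<close>] .
    thus ?thesis using sgn[OF x(1), of k i "[0..<length ks]"] x(2) by (simp add: sgn_levi_def atLeast0LessThan)
   qed
   thus "y \<in> sgn_vec M act (lev ks)" using x by (simp add: sgn_vec_def)
  qed
  show "sgn_vec M act (lev ks) <= act (sgn_levi q ks) ` carrier M"
  proof
   fix x assume x: "x \<in> sgn_vec M act (lev ks)"
   hence "act (sgn_levi q ks) x = x" using fixes_[OF x, of "[0..<length ks]"] by (simp add: sgn_levi_def atLeast0LessThan)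
   thus "x \<in> act (sgn_levi q ks) ` carrier M" using x by (metis (no_types, lifting) sgn_vec_def mem_Collect_eq imageI)
  qed
 qed
qed

lemma sgn_elt_image:
 assumes "q > 0" and "kills (rels q n (full n))"
 shows "act (sgn_elt q n) ` carrier M = sgn_vec M act (full n)"
proof
 show "act (sgn_elt q n) ` carrier M <= sgn_vec M act (full n)" using sgn_elt_in[OF assms] by blast
 show "sgn_vec M act (full n) <= act (sgn_elt q n) ` carrier M"
 proof
  fix x assume x: "x \<in> sgn_vec M act (full n)"
  hence "x \<in> carrier M" by (simp add: sgn_vec_def)
  thus "x \<in> act (sgn_elt q n) ` carrier M" using sgn_elt_fixes[OF assms(1) x] by (metis imageI)
 qed
qed

end

lemma levi_singleton: "levi q [n] = hecke q n"
proof -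
 have "levi q [n] = (hecke q n)\<lparr>carrier := carrier (levi q [n])\<rparr>" by (simp add: levi_def Let_def)
 thus ?thesis using carrier_levi_singleton[of q n] by simp
qed

section \<open>Modules of sign vectors\<close>

text \<open>A common frame for both kinds of derivatives: \<open>p\<close> embeds the Levi
  subalgebra that continues to act, \<open>p'\<close> the one whose sign projector \<open>E\<close>
  cuts. \<open>E_image\<close> speaks of all actions because it is applied to the action pulled back
  along \<open>subst p'\<close>.\<close>

locale sign_cut = P: translation ms "sum_list ns" p + P': translation ms' "sum_list ns" p'
 for ms ns p ms' p' +
 fixes q :: nat and \<sigma> :: "(hecke_elt, 'b) module" (structure) and E :: "hgen free"
 assumes module_ns: "left_module (levi q ns) \<sigma>"
  and lands: "j \<in> lev ms ==> p j \<in> lev ns" and lands': "j \<in> lev ms' ==> p' j \<in> lev ns"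
  and disjoint: "p ` {1..sum_list ms} \<inter> p' ` {1..sum_list ms'} = {}"
  and E_fsupp: "E \<in> fsupp (gens (sum_list ms') (lev ms'))"
  and E_image: "!!act. free_action \<sigma> act ==> free_action.kills \<sigma> act (rels q (sum_list ms') (lev ms')) ==>
   act E ` carrier \<sigma> = sgn_vec \<sigma> act (lev ms')"
begin

abbreviation N where "N \<equiv> sum_list ns"
abbreviation act where "act \<equiv> mact q N (lev ns) \<sigma>"

definition cut :: "(hecke_elt, 'b) module" where
 "cut = cut_module (hcls q N (subst p' E)) (levi_embedding q ms N p) \<sigma>"

sublocale A: free_action \<sigma> act
 by (rule free_action_levi[OF module_ns])

lemma A_kills: "A.kills (rels q N (lev ns))"
 by (rule kills_levi[OF module_ns])

lemma subst_in: "a \<in> fsupp (gens (sum_list ms) (lev ms)) ==> subst p a \<in> fsupp (gens N (lev ns))"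
 by (rule subst_fsupp[OF _ P.maps lands])

lemma subst_in': "a \<in> fsupp (gens (sum_list ms') (lev ms')) ==> subst p' a \<in> fsupp (gens N (lev ns))"
 by (rule subst_fsupp[OF _ P'.maps lands'])

lemma hom: "levi_embedding q ms N p \<in> ring_hom (levi q ms) (levi q ns)"
proof (rule ring_hom_memI)
 note h = P.levi_embedding_hom[of q]
 fix x y assume x: "x \<in> carrier (levi q ms)" and y: "y \<in> carrier (levi q ms)"
 show "levi_embedding q ms N p x \<in> carrier (levi q ns)"
  using x P.levi_embedding_hcls subst_in by (auto simp: carrier_levi)
 show "levi_embedding q ms N p (x \<otimes>\<^bsub>levi q ms\<^esub> y) = levi_embedding q ms N p x \<otimes>\<^bsub>levi q ns\<^esub> levi_embedding q ms N p y"
  using ring_hom_mult[OF h x y] by simp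
 show "levi_embedding q ms N p (x \<oplus>\<^bsub>levi q ms\<^esub> y) = levi_embedding q ms N p x \<oplus>\<^bsub>levi q ns\<^esub> levi_embedding q ms N p y"
  using ring_hom_add[OF h x y] by simp
next
 show "levi_embedding q ms N p \<one>\<^bsub>levi q ms\<^esub> = \<one>\<^bsub>levi q ns\<^esub>"
  using ring_hom_one[OF P.levi_embedding_hom[of q]] by simp
qed

lemma carrier_cut: "carrier cut = sgn_vec \<sigma> act (p' ` lev ms')"
proof -
 have "carrier cut = (\<lambda>x. act (subst p' E) x) ` carrier \<sigma>"
  by (simp add: cut_def mact_eq[OF subst_in'[OF E_fsupp]])
 also have "\<dots> = sgn_vec \<sigma> (\<lambda>a. act (subst p' a)) (lev ms')"
  by (rule E_image[OF A.free_action_subst P'.subst_kills[OF A.free_action_axioms A_kills lev_subset lands']])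
 finally show ?thesis by (auto simp: sgn_vec_def)
qed

lemma cut_simps [simp]: "\<zero>\<^bsub>cut\<^esub> = \<zero>" "add cut = add \<sigma>"
 by (simp_all add: cut_def)

lemma cut_carrier: "x \<in> carrier cut ==> x \<in> carrier \<sigma>"
 by (simp add: carrier_cut sgn_vec_def)

lemma cut_smult:
 "a \<in> fsupp (gens (sum_list ms) (lev ms)) ==> hcls q (sum_list ms) a \<odot>\<^bsub>cut\<^esub> x = act (subst p a) x"
 by (simp add: cut_def P.levi_embedding_hcls mact_eq[OF subst_in])

lemma cut_mact:
 "a \<in> fsupp (gens (sum_list ms) (lev ms)) ==> mact q (sum_list ms) (lev ms) cut a x = act (subst p a) x"
 by (simp add: mact_eq cut_smult)

lemma cut_stable:
 assumes a: "a \<in> fsupp (gens (sum_list ms) (lev ms))" and x: "x \<in> carrier cut"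
 shows "act (subst p a) x \<in> carrier cut"
proof -
 have xc: "x \<in> carrier \<sigma>" by (rule cut_carrier[OF x])
 have "act (Tg (p' j)) (act (subst p a) x) = \<ominus> act (subst p a) x" if j: "j \<in> lev ms'" for j
 proof -
  note r = P'.lev_range[OF j]
  have "p' j \<in> p' ` {1..sum_list ms'}" "p' j + 1 \<in> p' ` {1..sum_list ms'}" using r P'.step[OF j] by (metis imageI)+
  hence nj: "p' j \<notin> p ` {1..sum_list ms}" "p' j + 1 \<notin> p ` {1..sum_list ms}" using disjoint by blast+
  have "act (Tg (p' j)) (act (subst p a) x) = act (Tg (p' j) * subst p a) x" using xc by (simp add: A.act_mult)
  also have "\<dots> = act (subst p a * Tg (p' j)) x"
   by (rule A.act_cong[OF A_kills P.subst_commute[OF lev_subset lands lands'[OF j] nj a] xc])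
  also have "\<dots> = act (subst p a) (\<ominus> x)" using x j xc by (simp add: A.act_mult carrier_cut sgn_vec_def)
  also have "\<dots> = \<ominus> act (subst p a) x" by (rule A.act_rminus[OF xc])
  finally show ?thesis .
 qed
 thus ?thesis using xc by (simp add: carrier_cut sgn_vec_def)
qed

lemma left_module_cut: "left_module (levi q ms) cut"
 unfolding cut_def
proof (rule left_module_cut_module[OF module_ns ring_levi _ hom])
 show "hcls q N (subst p' E) \<in> carrier (levi q ns)" using subst_in'[OF E_fsupp] by (simp add: carrier_levi)
 fix h x assume h: "h \<in> carrier (levi q ms)"
  and x: "x \<in> carrier (cut_module (hcls q N (subst p' E)) (levi_embedding q ms N p) \<sigma>)"
 then obtain a where a: "a \<in> fsupp (gens (sum_list ms) (lev ms))" "h = hcls q (sum_list ms) a" by (auto simp: carrier_levi)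
 show "levi_embedding q ms N p h \<odot> x \<in> carrier (cut_module (hcls q N (subst p' E)) (levi_embedding q ms N p) \<sigma>)"
  using cut_stable[OF a(1), of x] cut_smult[OF a(1), of x] x a(2) by (simp add: cut_def)
qed

end

section \<open>Splitting each block in two\<close>

locale block_split =
 fixes ns ks :: "nat list"
 assumes length_ks: "length ks = length ns" and ks_le: "k < length ns ==> ks ! k \<le> ns ! k"
begin

abbreviation "nd \<equiv> tuple_diff ns ks"

lemma length_nd [simp]: "length nd = length ns"
 by (simp add: length_ks)

lemma nd_nth: "k < length ns ==> nd ! k = ns ! k - ks ! k"
 by (simp add: length_ks)

lemma offset_split: "k \<le> length ns ==> offset nd k + offset ks k = offset ns k"
proof (induction k)
 case (Suc k)
 thus ?case using ks_le[of k] length_ks by (simp add: offset_Suc nd_nth del: nth_map)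
qed simp

lemma sum_split: "sum_list nd + sum_list ks = sum_list ns"
 using offset_split[of "length ns"] offset_length[of nd] offset_length[of ks] offset_length[of ns]
 by (simp only: length_nd length_ks order_refl)

lemma pos_left_eq: "k < length ns ==> a \<in> block nd k ==> pos_left ns ks a = offset ns k + (a - offset nd k)"
 using block_index_eq[of k nd a] by (simp only: pos_left_def Let_def length_nd)

lemma pos_right_eq: "k < length ns ==> a \<in> block ks k ==> pos_right ns ks a = offset ns k + (ns ! k - ks ! k) + (a - offset ks k)"
 using block_index_eq[of k ks a] by (simp only: pos_right_def Let_def length_ks)

lemma pos_left_bounds:
 assumes "k < length ns" and "a \<in> block nd k"
 shows "offset ns k < pos_left ns ks a" and "pos_left ns ks a \<le> offset ns k + (ns ! k - ks ! k)"
  and "pos_left ns ks a \<in> block ns k"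
 using assms pos_left_eq[OF assms] nd_nth[OF assms(1)] by (auto simp: block_def simp del: nth_map)

lemma pos_right_bounds:
 assumes "k < length ns" and "a \<in> block ks k"
 shows "offset ns k + (ns ! k - ks ! k) < pos_right ns ks a" and "pos_right ns ks a \<in> block ns k"
 using assms pos_right_eq[OF assms] ks_le[OF assms(1)] by (auto simp: block_def)

lemma block_index_pos_left: "a \<in> {1..sum_list nd} ==> block_index ns (pos_left ns ks a) = block_index nd a"
 using block_index_in[of a nd] pos_left_bounds(3)[of "block_index nd a" a]
  block_index_eq[of "block_index nd a" ns "pos_left ns ks a"] by (simp only: length_nd)

lemma pos_left_in: "a \<in> {1..sum_list nd} ==> pos_left ns ks a \<in> {1..sum_list ns}"
 using block_index_in[of a nd] pos_left_bounds(3)[of "block_index nd a" a] block_subset[of "block_index nd a" ns]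
 by (metis length_nd subsetD)

lemma pos_right_in: "a \<in> {1..sum_list ks} ==> pos_right ns ks a \<in> {1..sum_list ns}"
 using block_index_in[of a ks] pos_right_bounds(2)[of "block_index ks a" a] block_subset[of "block_index ks a" ns]
 by (metis length_ks subsetD)

lemma pos_left_step:
 assumes "j \<in> lev nd"
 shows "pos_left ns ks (j + 1) = pos_left ns ks j + 1" and "pos_left ns ks j \<in> lev ns"
proof -
 obtain k where k: "k < length ns" "j \<in> block nd k" "j + 1 \<in> block nd k"
  using assms unfolding lev_eq by (simp only: mem_Collect_eq length_nd) blast
 have "offset nd k < j" using k(2) by (simp add: block_def)
 thus s: "pos_left ns ks (j + 1) = pos_left ns ks j + 1"
  using pos_left_eq[OF k(1,2)] pos_left_eq[OF k(1,3)] by simp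
 have b: "pos_left ns ks j \<in> block ns k" "pos_left ns ks j + 1 \<in> block ns k"
  using pos_left_bounds(3)[OF k(1,2)] pos_left_bounds(3)[OF k(1,3)] s by simp_all
 hence "pos_left ns ks j \<in> full (sum_list ns)" using block_subset[OF k(1)] by fastforce
 thus "pos_left ns ks j \<in> lev ns" unfolding lev_eq using b k(1) by blast
qed

lemma pos_right_step:
 assumes "j \<in> lev ks"
 shows "pos_right ns ks (j + 1) = pos_right ns ks j + 1" and "pos_right ns ks j \<in> lev ns"
proof -
 obtain k where k: "k < length ns" "j \<in> block ks k" "j + 1 \<in> block ks k"
  using assms unfolding lev_eq by (simp only: mem_Collect_eq length_ks) blast
 have "offset ks k < j" using k(2) by (simp add: block_def)
 thus s: "pos_right ns ks (j + 1) = pos_right ns ks j + 1"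
  using pos_right_eq[OF k(1,2)] pos_right_eq[OF k(1,3)] by simp
 have b: "pos_right ns ks j \<in> block ns k" "pos_right ns ks j + 1 \<in> block ns k"
  using pos_right_bounds(2)[OF k(1,2)] pos_right_bounds(2)[OF k(1,3)] s by simp_all
 hence "pos_right ns ks j \<in> full (sum_list ns)" using block_subset[OF k(1)] by fastforce
 thus "pos_right ns ks j \<in> lev ns" unfolding lev_eq using b k(1) by blast
qed

lemma translation_left: "translation nd (sum_list ns) (pos_left ns ks)"
proof
 show "pos_left ns ks ` {1..sum_list nd} <= {1..sum_list ns}" using pos_left_in by blast
 show "inj_on (pos_left ns ks) {1..sum_list nd}"
 proof (rule inj_onI)
  fix a b assume ab: "a \<in> {1..sum_list nd}" "b \<in> {1..sum_list nd}" "pos_left ns ks a = pos_left ns ks b"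
  let ?k = "block_index nd a"
  have k: "?k < length ns" "a \<in> block nd ?k" using block_index_in[OF ab(1)] by (simp_all only: length_nd)
  have "block_index nd b = ?k" using block_index_pos_left[OF ab(1)] block_index_pos_left[OF ab(2)] ab(3) by simp
  hence b: "b \<in> block nd ?k" using block_index_in(2)[OF ab(2)] by simp
  hence "offset nd ?k < a" "offset nd ?k < b" using k(2) by (simp_all add: block_def)
  thus "a = b" using pos_left_eq[OF k] pos_left_eq[OF k(1) b] ab(3) by linarith
 qed
qed (rule pos_left_step(1))

lemma translation_right: "translation ks (sum_list ns) (pos_right ns ks)"
proof
 show "pos_right ns ks ` {1..sum_list ks} <= {1..sum_list ns}" using pos_right_in by blast
 show "inj_on (pos_right ns ks) {1..sum_list ks}"
 proof (rule inj_onI)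
  fix a b assume ab: "a \<in> {1..sum_list ks}" "b \<in> {1..sum_list ks}" "pos_right ns ks a = pos_right ns ks b"
  let ?k = "block_index ks a" and ?l = "block_index ks b"
  have k: "?k < length ns" "a \<in> block ks ?k" using block_index_in[OF ab(1)] by (simp_all only: length_ks)
  have l: "?l < length ns" "b \<in> block ks ?l" using block_index_in[OF ab(2)] by (simp_all only: length_ks)
  have "?k = ?l" using block_unique[OF k(1) l(1) pos_right_bounds(2)[OF k]] pos_right_bounds(2)[OF l] ab(3) by simp
  hence b: "b \<in> block ks ?k" using l by simp
  hence "offset ks ?k < a" "offset ks ?k < b" using k(2) by (simp_all add: block_def)
  thus "a = b" using pos_right_eq[OF k] pos_right_eq[OF k(1) b] ab(3) by linarith
 qed
qed (rule pos_right_step(1))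

lemma pos_disjoint: "pos_left ns ks ` {1..sum_list nd} \<inter> pos_right ns ks ` {1..sum_list ks} = {}"
proof (rule equals0I)
 fix c assume "c \<in> pos_left ns ks ` {1..sum_list nd} \<inter> pos_right ns ks ` {1..sum_list ks}"
 then obtain a b where ab: "a \<in> {1..sum_list nd}" "b \<in> {1..sum_list ks}" "c = pos_left ns ks a" "c = pos_right ns ks b" by blast
 obtain k where k: "k < length ns" "a \<in> block nd k" using block_cover[OF ab(1)] by (simp only: length_nd) blast
 obtain l where l: "l < length ns" "b \<in> block ks l" using block_cover[OF ab(2)] by (simp only: length_ks) blast
 have "k = l" using block_unique[OF k(1) l(1), of c] pos_left_bounds(3)[OF k] pos_right_bounds(2)[OF l] ab by simp
 thus False using pos_left_bounds(2)[OF k] pos_right_bounds(1)[OF l] ab by simp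
qed

lemma sign_cut_levi:
 assumes "left_module (levi q ns) \<sigma>" and "q > 0"
 shows "sign_cut nd ns (pos_left ns ks) ks (pos_right ns ks) q \<sigma> (sgn_levi q ks)"
 by (intro sign_cut.intro sign_cut_axioms.intro translation_left translation_right assms(1)
   pos_left_step(2) pos_right_step(2) pos_disjoint sgn_levi_fsupp free_action.sgn_levi_image assms(2))

lemma BZ_levi_eq: "BZ_levi q ns ks \<sigma> =
  cut_module (hcls q (sum_list ns) (subst (pos_right ns ks) (sgn_levi q ks)))
   (levi_embedding q nd (sum_list ns) (pos_left ns ks)) \<sigma>"
 unfolding BZ_levi_def emb_right_levi_def emb_left_levi_def sign_projector_levi_eq
 by (simp only: translation.levi_embedding_hcls[OF translation_right sgn_levi_fsupp])

end

lemma translation_id: "i \<le> n ==> translation [n - i] n (\<lambda>j. j)"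
 by unfold_locales (auto simp: inj_on_def)

lemma translation_tail: "i \<le> n ==> translation [i] n (\<lambda>j. j + (n - i))"
 by unfold_locales (auto simp: inj_on_def)

lemma sign_cut_hecke:
 assumes "left_module (hecke q n) \<pi>" and "q > 0" and i: "i \<le> n"
 shows "sign_cut [n - i] [n] (\<lambda>j. j) [i] (\<lambda>j. j + (n - i)) q \<pi> (sgn_elt q i)"
proof (intro sign_cut.intro sign_cut_axioms.intro)
 show "translation [n - i] (sum_list [n]) (\<lambda>j. j)" "translation [i] (sum_list [n]) (\<lambda>j. j + (n - i))"
  using translation_id[OF i] translation_tail[OF i] by simp_all
 show "left_module (levi q [n]) \<pi>" using assms(1) by (simp add: levi_singleton)
 show "(\<lambda>j. j) ` {1..sum_list [n - i]} \<inter> (\<lambda>j. j + (n - i)) ` {1..sum_list [i]} = {}" by auto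
 show "sgn_elt q i \<in> fsupp (gens (sum_list [i]) (lev [i]))" using sgn_elt_fsupp by (simp add: lev_singleton)
 fix act assume "free_action \<pi> act" "free_action.kills \<pi> act (rels q (sum_list [i]) (lev [i]))"
 thus "act (sgn_elt q i) ` carrier \<pi> = sgn_vec \<pi> act (lev [i])"
  using free_action.sgn_elt_image[OF _ assms(2)] by (simp add: lev_singleton)
qed (use i in "auto simp: lev_singleton")

lemma BZ_eq:
 assumes "i \<le> n"
 shows "BZ q n i \<pi> = cut_module (hcls q (sum_list [n]) (subst (\<lambda>j. j + (n - i)) (sgn_elt q i)))
   (levi_embedding q [n - i] (sum_list [n]) (\<lambda>j. j)) \<pi>"
proof -
 have "sgn_elt q i \<in> fsupp (gens (sum_list [i]) (lev [i]))" using sgn_elt_fsupp by (simp add: lev_singleton)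
 from translation.levi_embedding_hcls[OF translation_tail[OF assms] this, of q] show ?thesis
  unfolding BZ_def emb_right_def emb_left_def sign_projector_eq by simp
qed

lemma
 assumes \<pi>: "left_module (hecke q n) \<pi>" and q: "q > 0" and i: "i \<le> n"
 shows left_module_BZ: "left_module (hecke q (n - i)) (BZ q n i \<pi>)"
  and carrier_BZ: "carrier (BZ q n i \<pi>) = sgn_vec \<pi> (mact q n (full n) \<pi>) {j \<in> full n. n - i < j}"
  and BZ_smult: "a \<in> hfree (n - i) ==> hcls q (n - i) a \<odot>\<^bsub>BZ q n i \<pi>\<^esub> x = mact q n (full n) \<pi> (subst (\<lambda>j. j) a) x"
proof -
 interpret S: sign_cut "[n - i]" "[n]" "\<lambda>j. j" "[i]" "\<lambda>j. j + (n - i)" q \<pi> "sgn_elt q i"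
  by (rule sign_cut_hecke[OF assms])
 have eq: "BZ q n i \<pi> = S.cut" unfolding S.cut_def by (rule BZ_eq[OF i])
 show "left_module (hecke q (n - i)) (BZ q n i \<pi>)" unfolding eq using S.left_module_cut by (simp add: levi_singleton)
 have "(\<lambda>j. j + (n - i)) ` full i = {j \<in> full n. n - i < j}"
 proof (intro equalityI subsetI)
  fix j assume "j \<in> {j \<in> full n. n - i < j}"
  thus "j \<in> (\<lambda>j. j + (n - i)) ` full i" by (intro image_eqI[of _ _ "j - (n - i)"]) auto
 qed (use i in auto)
 thus "carrier (BZ q n i \<pi>) = sgn_vec \<pi> (mact q n (full n) \<pi>) {j \<in> full n. n - i < j}"
  unfolding eq S.carrier_cut by (simp add: lev_singleton)
 show "hcls q (n - i) a \<odot>\<^bsub>BZ q n i \<pi>\<^esub> x = mact q n (full n) \<pi> (subst (\<lambda>j. j) a) x" if "a \<in> hfree (n - i)"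
  unfolding eq using S.cut_smult[of a x] that by (simp add: lev_singleton)
qed

lemma BZ_simps [simp]: "\<zero>\<^bsub>BZ q n i \<pi>\<^esub> = \<zero>\<^bsub>\<pi>\<^esub>" "add (BZ q n i \<pi>) = add \<pi>"
 by (simp_all add: BZ_def)

lemma BZ_isomorphic:
 assumes iso: "left_modules_isomorphic (hecke q n) \<pi> \<pi>'" and q: "q > 0" and i: "i \<le> n"
 shows "left_modules_isomorphic (hecke q (n - i)) (BZ q n i \<pi>) (BZ q n i \<pi>')"
proof -
 have \<pi>: "left_module (hecke q n) \<pi>" and \<pi>': "left_module (hecke q n) \<pi>'"
  using iso by (auto simp: left_modules_isomorphic_def)
 interpret P: left_module "hecke q n" \<pi> by (rule \<pi>)
 obtain \<phi> where \<phi>: "bij_betw \<phi> (carrier \<pi>) (carrier \<pi>')"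
  "!!x y. x \<in> carrier \<pi> ==> y \<in> carrier \<pi> ==> \<phi> (x \<oplus>\<^bsub>\<pi>\<^esub> y) = \<phi> x \<oplus>\<^bsub>\<pi>'\<^esub> \<phi> y"
  "!!a x. a \<in> carrier (hecke q n) ==> x \<in> carrier \<pi> ==> \<phi> (a \<odot>\<^bsub>\<pi>\<^esub> x) = a \<odot>\<^bsub>\<pi>'\<^esub> \<phi> x"
  using iso by (auto simp: left_modules_isomorphic_def left_module_iso_def)
 interpret S: sign_cut "[n - i]" "[n]" "\<lambda>j. j" "[i]" "\<lambda>j. j + (n - i)" q \<pi> "sgn_elt q i"
  by (rule sign_cut_hecke[OF \<pi> q i])
 let ?e = "hcls q n (subst (\<lambda>j. j + (n - i)) (sgn_elt q i))" and ?f = "levi_embedding q [n - i] n (\<lambda>j. j)"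
 have eq: "BZ q n i \<rho> = cut_module ?e ?f \<rho>" for \<rho> :: "(hecke_elt, 'z) module" using BZ_eq[OF i, of q \<rho>] by simp
 have e: "?e \<in> carrier (hecke q n)"
  using S.subst_in'[OF S.E_fsupp] by (simp add: lev_singleton)
 have f: "?f h \<in> carrier (hecke q n)" if "h \<in> carrier (hecke q (n - i))" for h
  using ring_hom_closed[OF S.hom, of h] that by (simp add: levi_singleton)
 have sub: "carrier (cut_module ?e ?f \<pi>) <= carrier \<pi>" using P.smult_closed[OF e] by auto
 have "\<phi> ` carrier (cut_module ?e ?f \<pi>) = (\<lambda>y. ?e \<odot>\<^bsub>\<pi>'\<^esub> y) ` (\<phi> ` carrier \<pi>)"
  using \<phi>(3)[OF e] by (auto simp: image_image)
 hence "bij_betw \<phi> (carrier (cut_module ?e ?f \<pi>)) (carrier (cut_module ?e ?f \<pi>'))"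
  using \<phi>(1) inj_on_subset[OF _ sub, of \<phi>] by (simp add: bij_betw_def)
 moreover have "\<forall>x\<in>carrier (cut_module ?e ?f \<pi>). \<forall>y\<in>carrier (cut_module ?e ?f \<pi>). \<phi> (x \<oplus>\<^bsub>\<pi>\<^esub> y) = \<phi> x \<oplus>\<^bsub>\<pi>'\<^esub> \<phi> y"
  using \<phi>(2) sub by blast
 moreover have "\<forall>a\<in>carrier (hecke q (n - i)). \<forall>x\<in>carrier (cut_module ?e ?f \<pi>). \<phi> (?f a \<odot>\<^bsub>\<pi>\<^esub> x) = ?f a \<odot>\<^bsub>\<pi>'\<^esub> \<phi> x"
  using \<phi>(3)[OF f] sub by blast
 ultimately have "\<phi> \<in> left_module_iso (hecke q (n - i)) (BZ q n i \<pi>) (BZ q n i \<pi>')"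
  unfolding eq left_module_iso_def by simp
 thus ?thesis
  using left_module_BZ[OF \<pi> q i] left_module_BZ[OF \<pi>' q i] by (auto simp: left_modules_isomorphic_def)
qed

section \<open>Inverses of differences of variables from different blocks\<close>

section \<open>Inverting differences of variables\<close>

text \<open>The elementary symmetric polynomial of degree r in the family v.\<close>

definition esym :: "'i set => ('i => 'a::comm_ring_1) => nat => 'a" where
 "esym S v r = (\<Sum>T | T <= S \<and> card T = r. \<Prod>s\<in>T. v s)"

lemma prod_diff_subsets:
 fixes v :: "'i => 'a::comm_ring_1"
 assumes "finite S"
 shows "(\<Prod>s\<in>S. z - v s) = (\<Sum>T\<in>Pow S. (- 1) ^ card T * z ^ (card S - card T) * (\<Prod>s\<in>T. v s))"
proof -
 have "(\<Prod>s\<in>S. - v s + z) = (\<Sum>T\<in>Pow S. (\<Prod>s\<in>T. - v s) * (\<Prod>s\<in>S - T. z))"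
  by (rule prod_add[OF assms])
 also have "\<dots> = (\<Sum>T\<in>Pow S. (- 1) ^ card T * z ^ (card S - card T) * (\<Prod>s\<in>T. v s))"
 proof (rule sum.cong[OF refl])
  fix T assume "T \<in> Pow S"
  hence "card (S - T) = card S - card T" using assms by (intro card_Diff_subset) (auto intro: finite_subset)
  thus "(\<Prod>s\<in>T. - v s) * (\<Prod>s\<in>S - T. z) = (- 1) ^ card T * z ^ (card S - card T) * (\<Prod>s\<in>T. v s)"
   by (simp add: prod_uminus ac_simps)
 qed
 finally show ?thesis by simp
qed

lemma prod_diff_esym:
 fixes v :: "'i => 'a::comm_ring_1"
 assumes "finite S"
 shows "(\<Prod>s\<in>S. z - v s) = (\<Sum>r\<le>card S. (- 1) ^ r * z ^ (card S - r) * esym S v r)"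
proof -
 let ?f = "\<lambda>T. (- 1) ^ card T * z ^ (card S - card T) * (\<Prod>s\<in>T. v s)"
 have "(\<Sum>r\<in>{..card S}. sum ?f {T \<in> Pow S. card T = r}) = sum ?f (Pow S)"
  by (rule sum.group) (use assms card_mono in auto)
 moreover have "sum ?f {T \<in> Pow S. card T = r} = (- 1) ^ r * z ^ (card S - r) * esym S v r" for r
  by (simp add: esym_def sum_distrib_left)
 ultimately show ?thesis by (simp only: prod_diff_subsets[OF assms])
qed

lemma esym_hom:
 assumes h: "h 0 = 0" "h 1 = 1" "!!a b. h (a + b) = h a + h b" "!!a b. h (a * b) = h a * h b"
 shows "h (esym S v r) = esym S (\<lambda>s. h (v s)) r"
proof -
 have "h (prod f A) = (\<Prod>x\<in>A. h (f x))" for f and A :: "'c set"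
  by (induction A rule: infinite_finite_induct) (simp_all add: h)
 moreover have "h (sum f A) = (\<Sum>x\<in>A. h (f x))" for f and A :: "'c set set"
  by (induction A rule: infinite_finite_induct) (simp_all add: h)
 ultimately show ?thesis by (simp add: esym_def)
qed

lemma esym_reindex:
 assumes "finite S" and p: "bij_betw p S S"
 shows "esym S (\<lambda>s. v (p s)) r = esym S v r"
proof -
 let ?A = "{T. T <= S \<and> card T = r}"
 have inj: "inj_on p T" if "T <= S" for T using p that by (meson bij_betw_def inj_on_subset)
 have "(\<lambda>T. p ` T) ` ?A <= ?A"
 proof
  fix U assume "U \<in> (\<lambda>T. p ` T) ` ?A"
  then obtain T where T: "T <= S" "card T = r" "U = p ` T" by blast
  moreover have "p ` T <= p ` S" using T(1) by (rule image_mono)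
  ultimately show "U \<in> ?A" using card_image[OF inj[OF T(1)]] bij_betw_imp_surj_on[OF p] by simp
 qed
 moreover have ij: "inj_on (\<lambda>T. p ` T) ?A"
 proof (rule inj_onI)
  fix T U assume "T \<in> ?A" "U \<in> ?A" and eq: "p ` T = p ` U"
  hence "T <= S" "U <= S" by simp_all
  thus "T = U" using inj_on_image_eq_iff[OF inj[OF order_refl]] eq by metis
 qed
 moreover have "finite ?A" by (rule finite_subset[of _ "Pow S"]) (use assms(1) in auto)
 ultimately have "(\<lambda>T. p ` T) ` ?A = ?A" using endo_inj_surj[of ?A "\<lambda>T. p ` T"] by simp
 hence "esym S v r = (\<Sum>T\<in>(\<lambda>T. p ` T) ` ?A. \<Prod>s\<in>T. v s)" by (simp add: esym_def)
 also have "\<dots> = (\<Sum>T\<in>?A. \<Prod>s\<in>p ` T. v s)" by (simp add: sum.reindex[OF ij])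
 also have "\<dots> = esym S (\<lambda>s. v (p s)) r"
  unfolding esym_def by (rule sum.cong) (use inj in "auto simp: prod.reindex")
 finally show ?thesis by simp
qed

lemma leval_cong:
 assumes "f \<in> \<A> n" and "!!k. k \<in> {1..n} ==> s k = t k"
 shows "leval s f = leval t f"
proof -
 have "lchar s a = lchar t a" if "a \<in> Poly_Mapping.keys f" for a
  by (rule prod.cong) (use assms that in "auto simp: laurent_polys_def subset_iff")
 thus ?thesis by (simp add: leval_def)
qed

lemma lconst_esym: "lconst (esym S v r) = esym S (\<lambda>s. lconst (v s)) r"
 by (rule esym_hom) (simp_all add: lconst_add lconst_mult)

lemma laurent_esym: "(!!s. s \<in> S ==> v s \<in> \<A> n) ==> esym S v r \<in> \<A> n"
 unfolding esym_def by (rule laurent_sum, rule laurent_prod) auto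

text \<open>Satisfied by polynomial operations with constant coefficients. An inverse of this kind
  is carried along by any renaming of variables, so it serves for \<sigma> and for the modules cut
  out of \<sigma>.\<close>

definition natural_op :: "(laurent => laurent) => bool" where
 "natural_op F \<longleftrightarrow> (\<forall>p y. lrename p (F y) = F (lrename p y)) \<and> (\<forall>n y. y \<in> \<A> n --> F y \<in> \<A> n)"

lemma natural_op_intros:
 "natural_op (\<lambda>y. lconst c)" "natural_op (\<lambda>y. y)"
 "natural_op F ==> natural_op G ==> natural_op (\<lambda>y. F y + G y)"
 "natural_op F ==> natural_op G ==> natural_op (\<lambda>y. F y * G y)"
 by (simp_all add: natural_op_def lrename_add lrename_mult)

text \<open>If such an expression acts by zero, then - \<open>G y\<close> / \<open>C\<close> inverts
  y.\<close>

definition unit_form :: "(laurent => laurent) => bool" where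
 "unit_form F \<longleftrightarrow> (\<exists>C G. C ~= 0 \<and> natural_op G \<and> (\<forall>y. F y = lconst C + y * G y))"

lemma unit_form_mult:
 assumes "unit_form F" and "unit_form F'"
 shows "unit_form (\<lambda>y. F y * F' y)"
proof -
 obtain C G where 1: "C ~= 0" "natural_op G" "!!y. F y = lconst C + y * G y" using assms(1) unfolding unit_form_def by blast
 obtain C' G' where 2: "C' ~= 0" "natural_op G'" "!!y. F' y = lconst C' + y * G' y" using assms(2) unfolding unit_form_def by blast
 have "natural_op (\<lambda>y. (lconst C * G' y + lconst C' * G y) + y * (G y * G' y))"
  by (intro natural_op_intros 1 2)
 moreover have "!!y. F y * F' y = lconst (C * C') + y * ((lconst C * G' y + lconst C' * G y) + y * (G y * G' y))"
  unfolding 1(3) 2(3) lconst_mult by (simp add: algebra_simps)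
 moreover have "C * C' ~= 0" using 1(1) 2(1) by simp
 ultimately show ?thesis unfolding unit_form_def by blast
qed

lemma unit_form_one: "unit_form (\<lambda>y. 1)"
 unfolding unit_form_def using natural_op_intros(1)[of 0] by (intro exI[of _ 1] exI[of _ "\<lambda>y. lconst 0"]) simp

lemma unit_form_factor: "c ~= 0 ==> unit_form (\<lambda>y. y - lconst c)"
 unfolding unit_form_def using natural_op_intros(1)[of 1]
 by (intro exI[of _ "- c"] exI[of _ "\<lambda>y. lconst 1"]) (simp add: lconst_uminus)

lemma unit_form_prod:
 assumes "finite S" and "!!s. s \<in> S ==> c s ~= 0"
 shows "unit_form (\<lambda>y. \<Prod>s\<in>S. y - lconst (c s))"
 using assms
proof (induction S rule: finite_induct)
 case (insert a S)
 thus ?case using unit_form_mult[OF unit_form_factor[of "c a"], of "\<lambda>y. \<Prod>s\<in>S. y - lconst (c s)"] by simp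
qed (simp add: unit_form_one)

lemma unit_form_power: "unit_form F ==> unit_form (\<lambda>y. F y ^ N)"
 by (induction N) (simp_all add: unit_form_one unit_form_mult)

context hecke_action
begin

definition killed_by :: "laurent => bool" where
 "killed_by f \<longleftrightarrow> f \<in> \<A> n \<and> sim (Ag f) 0"

lemma killed_by_zero: "killed_by 0"
 by (simp add: killed_by_def Ag_zero)

lemma killed_by_add: "killed_by f ==> killed_by g ==> killed_by (f + g)"
 unfolding killed_by_def using sim_trans[OF Ag_add sim_add[of _ 0 _ 0]] by simp

lemma killed_by_mult: "f \<in> \<A> n ==> killed_by g ==> killed_by (f * g)"
 unfolding killed_by_def using sim_trans[OF Ag_mult sim_mult[OF sim_refl, of _ 0]] by simp

lemma killed_by_sum: "(!!x. x \<in> A ==> killed_by (F x)) ==> killed_by (sum F A)"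
 by (induction A rule: infinite_finite_induct) (simp_all add: killed_by_zero killed_by_add)

end

lemma orbit_ideal_power_mult:
 assumes "f \<in> orbit_ideal ns t [^]\<^bsub>ideals_set (invariants ns)\<^esub> (N::nat)" and "g \<in> orbit_ideal ns t"
 shows "f * g \<in> orbit_ideal ns t [^]\<^bsub>ideals_set (invariants ns)\<^esub> Suc N"
 using ideal_prod.prod[OF assms, of "invariants ns"]
 by (simp add: nat_pow_def ideals_set_def invariants_def)

text \<open>Expanding the power gives products of N elements of the orbit ideal with arbitrary, not
  necessarily invariant, cofactors. The induction splits off one factor at a time and lets f collect
  the elements of the ideal.\<close>

lemma (in hecke_action) killed_power:
 assumes kill: "!!f. f \<in> orbit_ideal ns t [^]\<^bsub>ideals_set (invariants ns)\<^esub> (N::nat) ==> killed_by f"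
  and m: "!!s. s \<in> S ==> m s \<in> \<A> n" and d: "!!s. s \<in> S ==> d s \<in> orbit_ideal ns t"
 shows "killed_by ((\<Sum>s\<in>S. m s * d s) ^ N)"
proof -
 let ?r = "\<Sum>s\<in>S. m s * d s"
 have powers: "f \<in> orbit_ideal ns t [^]\<^bsub>ideals_set (invariants ns)\<^esub> (N - i) ==> i \<le> N ==> killed_by (f * ?r ^ i)" for f i
 proof (induction i arbitrary: f)
  case 0
  thus ?case using kill by simp
 next
  case (Suc i)
  have "killed_by (m s * ((f * d s) * ?r ^ i))" if s: "s \<in> S" for s
  proof (rule killed_by_mult[OF m[OF s]], rule Suc.IH)
   have "Suc (N - Suc i) = N - i" using Suc.prems by simp
   thus "f * d s \<in> orbit_ideal ns t [^]\<^bsub>ideals_set (invariants ns)\<^esub> (N - i)"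
    using orbit_ideal_power_mult[OF Suc.prems(1) d[OF s]] by simp
  qed (use Suc.prems in simp)
  hence "killed_by (\<Sum>s\<in>S. m s * ((f * d s) * ?r ^ i))" by (rule killed_by_sum)
  also have "(\<Sum>s\<in>S. m s * ((f * d s) * ?r ^ i)) = f * ?r ^ Suc i"
   by (simp add: sum_distrib_left sum_distrib_right ac_simps)
  finally show ?case .
 qed
 have "1 \<in> orbit_ideal ns t [^]\<^bsub>ideals_set (invariants ns)\<^esub> (0::nat)"
  by (simp add: nat_pow_def ideals_set_def invariants_def)
 thus ?thesis using powers[of 1 N] by simp
qed

lemma parabolic_block: "w \<in> parabolic ns ==> k < length ns ==> bij_betw w (block ns k) (block ns k)"
 unfolding parabolic_def bij_betw_def using permutes_inj inj_on_subset by blast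

text \<open>
 The product of \<open>z - (x\<^sub>a - c x\<^sub>b)\<close> over \<open>a\<close>, \<open>b\<close> in two given blocks has invariant coefficients and
 vanishes at each of the differences. Replacing the coefficients by their values at the orbit
 changes it by an element of the extension of the orbit ideal.
\<close>

lemma (in hecke_action) difference_inverse:
 assumes n: "n = sum_list ns" and k: "k < length ns" "k' < length ns" and ab: "a \<in> block ns k" "b \<in> block ns k'"
  and t0: "!!i. i \<in> {1..n} ==> t i ~= 0"
  and ne: "!!i j. i \<in> block ns k ==> j \<in> block ns k' ==> t i ~= c * t j"
  and kill: "!!f. f \<in> orbit_ideal ns t [^]\<^bsub>ideals_set (invariants ns)\<^esub> (N::nat) ==> killed_by f"
 shows "\<exists>F. natural_op F \<and> sim (Ag ((lvar a - lconst c * lvar b) * F (lvar a - lconst c * lvar b))) 1"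
proof -
 let ?S = "block ns k \<times> block ns k'"
 define v where "v = (\<lambda>(i, j). lvar i - lconst c * lvar j)"
 define \<tau> where "\<tau> = (\<lambda>(i, j). t i - c * t j)"
 define y where "y = v (a, b)"
 have fS: "finite ?S" by (simp add: block_def)
 have bl: "i \<in> {1..n}" if "i \<in> block ns l" "l < length ns" for i l using block_subset[OF that(2)] that(1) n by blast
 have vl: "v s \<in> \<A> n" if "s \<in> ?S" for s using that bl k unfolding v_def by auto
 have yl: "y \<in> \<A> n" unfolding y_def by (rule vl) (use ab in simp)
 define d where "d r = esym ?S v r - lconst (esym ?S \<tau> r)" for r
 have dl: "d r \<in> \<A> n" for r unfolding d_def by (intro laurent_diff laurent_esym vl laurent_lconst)
 have d_orbit: "d r \<in> orbit_ideal ns t" for r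
 proof -
  have wS: "bij_betw (\<lambda>(i, j). (w i, w j)) ?S ?S" if "w \<in> parabolic ns" for w
   using bij_betw_map_prod[OF parabolic_block[OF that k(1)] parabolic_block[OF that k(2)]]
   by (simp add: map_prod_def)
  have inv: "lrename w (d r) = d r" if w: "w \<in> parabolic ns" for w
  proof -
   have "lrename w (esym ?S v r) = esym ?S (\<lambda>s. lrename w (v s)) r"
    by (rule esym_hom) (simp_all add: lrename_add lrename_mult)
   also have "(\<lambda>s. lrename w (v s)) = (\<lambda>s. v (case s of (i, j) => (w i, w j)))"
    by (auto simp: v_def lrename_diff lrename_mult fun_eq_iff)
   also have "esym ?S \<dots> r = esym ?S v r" by (rule esym_reindex[OF fS wS[OF w]])
   finally show ?thesis by (simp add: d_def lrename_diff)
  qed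
  have ev: "leval (t \<circ> w) (d r) = 0" if w: "w \<in> parabolic ns" for w
  proof -
   \<comment> \<open>Multiplicativity of \<open>leval\<close> requires a point without zero
     coordinates at all indices; outside {1..n} the value 1 is inserted.\<close>
   define s where "s i = (if i \<in> {1..n} then t (w i) else 1)" for i
   have wp: "w permutes {1..n}" using w by (simp add: parabolic_def n)
   have s0: "s i ~= 0" for i using t0 permutes_in_image[OF wp, of i] by (simp add: s_def)
   have "leval (t \<circ> w) (d r) = leval s (d r)" by (rule leval_cong[OF dl]) (simp add: s_def)
   also have "\<dots> = leval s (esym ?S v r) - esym ?S \<tau> r" by (simp add: d_def leval_diff)
   also have "leval s (esym ?S v r) = esym ?S (\<lambda>z. leval s (v z)) r"
    by (rule esym_hom) (use leval_lconst[of s 0] leval_lconst[of s 1] in "simp_all add: leval_add leval_mult[OF s0]")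
   also have "\<dots> = esym ?S (\<lambda>z. \<tau> (case z of (i, j) => (w i, w j))) r"
    unfolding esym_def
   proof (intro sum.cong prod.cong refl)
    fix T z assume "T \<in> {T. T <= ?S \<and> card T = r}" "z \<in> T"
    then obtain i j where z: "z = (i, j)" "i \<in> block ns k" "j \<in> block ns k'" by blast
    have "i \<in> {1..n}" "j \<in> {1..n}" using bl z k by blast+
    thus "leval s (v z) = \<tau> (case z of (i, j) => (w i, w j))"
     by (simp add: z(1) v_def \<tau>_def leval_diff leval_mult[OF s0] s_def)
   qed
   also have "\<dots> = esym ?S \<tau> r" by (rule esym_reindex[OF fS wS[OF w]])
   finally show ?thesis by (simp add: comp_def)
  qed
  show ?thesis using inv ev dl n by (simp add: orbit_ideal_def invariants_def comp_def)
 qed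
 \<comment> \<open>The coefficients of the \<open>d r\<close> when the product over the
   \<open>v s\<close> is subtracted from the product over their values; the former product is 0,
   since y is one of the \<open>v s\<close>.\<close>
 define m where "m r = - ((- 1) ^ r * y ^ (card ?S - r))" for r
 have ml: "m r \<in> \<A> n" for r unfolding m_def using yl by (intro laurent_uminus laurent_mult laurent_power) auto
 have "(\<Prod>s\<in>?S. y - v s) = 0" using fS ab by (intro prod_zero) (auto simp: y_def intro!: bexI[of _ "(a, b)"])
 hence "(\<Prod>s\<in>?S. y - lconst (\<tau> s)) = (\<Prod>s\<in>?S. y - lconst (\<tau> s)) - (\<Prod>s\<in>?S. y - v s)" by simp
 also have "\<dots> = (\<Sum>r\<le>card ?S. m r * d r)"
  unfolding prod_diff_esym[OF fS] sum_subtractf[symmetric] m_def d_def lconst_esym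
  by (rule sum.cong) (simp_all add: algebra_simps)
 finally have r: "(\<Prod>s\<in>?S. y - lconst (\<tau> s)) = (\<Sum>r\<le>card ?S. m r * d r)" .
 have dead: "killed_by ((\<Prod>s\<in>?S. y - lconst (\<tau> s)) ^ N)"
  unfolding r by (rule killed_power[OF kill]) (use ml d_orbit in auto)
 have "unit_form (\<lambda>y. (\<Prod>s\<in>?S. y - lconst (\<tau> s)) ^ N)"
  by (intro unit_form_power unit_form_prod fS) (use ne in "auto simp: \<tau>_def")
 then obtain C G where C: "C ~= 0" "natural_op G" "!!y. (\<Prod>s\<in>?S. y - lconst (\<tau> s)) ^ N = lconst C + y * G y"
  unfolding unit_form_def by blast
 \<comment> \<open>The polynomial \<open>lconst C + y * G y\<close> acts by zero, and this equation
   is solved for the inverse of y.\<close>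
 let ?F = "\<lambda>y. lconst (- inverse C) * G y"
 have F: "natural_op ?F" by (intro natural_op_intros C)
 have "lconst (- inverse C) * lconst C = - 1" using C(1) by (simp flip: lconst_mult add: lconst_uminus)
 hence "y * ?F y = 1 + lconst (- inverse C) * (\<Prod>s\<in>?S. y - lconst (\<tau> s)) ^ N"
  unfolding C(3) by (simp add: distrib_left ac_simps)
 moreover have "killed_by (lconst (- inverse C) * (\<Prod>s\<in>?S. y - lconst (\<tau> s)) ^ N)" by (rule killed_by_mult[OF _ dead]) simp
 hence "sim (Ag (1 + lconst (- inverse C) * (\<Prod>s\<in>?S. y - lconst (\<tau> s)) ^ N)) (1 + 0)"
  unfolding killed_by_def using sim_trans[OF Ag_add[OF laurent_one] sim_add[OF Ag_one]] by blast
 ultimately show ?thesis using F by (intro exI[of _ ?F]) (simp add: y_def v_def)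
qed

text \<open>If t i = m t j, absolute values give v i = m v j, and cancelling them leaves u i = u
  j.\<close>

lemma polar_distinct:
 fixes v :: "nat => real" and t u :: "nat => complex"
 assumes "0 < v i" "cmod (u i) = 1" "t i = of_real (v i) * u i" "0 < v j" "cmod (u j) = 1" "t j = of_real (v j) * u j"
  and "u i ~= u j" and "m > 0"
 shows "t i ~= of_nat m * t j"
proof
 assume eq: "t i = of_nat m * t j"
 hence "cmod (t i) = real m * cmod (t j)" by (simp add: norm_mult)
 hence "v i = real m * v j" using assms by (simp add: norm_mult)
 hence "of_real (real m * v j) * u i = of_real (real m * v j) * u j" using eq assms(3,6) by simp
 thus False using assms by simp
qed

text \<open>Applied with m = 1 for the denominators of the coefficients and with m = q for the
  numerators of 1 + \<alpha>.\<close>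

theorem separated_blocks_invertible:
 fixes t u :: "nat => complex" and v :: "nat => real" and \<sigma> :: "(hecke_elt, 'b) module"
 assumes polar: "\<forall>k\<in>{1..sum_list ns}. 0 < v k \<and> cmod (u k) = 1 \<and> t k = of_real (v k) * u k"
  and blocks: "\<forall>k<length ns. \<forall>k'<length ns. \<forall>a\<in>block ns k. \<forall>b\<in>block ns k'. u a = u b \<longleftrightarrow> k = k'"
  and \<sigma>: "left_module (levi q ns) \<sigma>" and ann: "annihilated_by_power q ns t \<sigma>" and m: "m > 0" and ab: "apart ns a b"
 shows "\<exists>F. natural_op F \<and> (\<forall>x\<in>carrier \<sigma>. mact q (sum_list ns) (lev ns) \<sigma>
   (Ag ((lvar a - lconst (of_nat m) * lvar b) * F (lvar a - lconst (of_nat m) * lvar b))) x = x)"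
proof -
 let ?n = "sum_list ns"
 interpret free_action \<sigma> "mact q ?n (lev ns) \<sigma>" by (rule free_action_levi[OF \<sigma>])
 interpret hecke_action \<sigma> "mact q ?n (lev ns) \<sigma>" q ?n "lev ns"
  by unfold_locales (rule kills_levi[OF \<sigma>])
 obtain N :: nat where N: "\<forall>f\<in>orbit_ideal ns t [^]\<^bsub>ideals_set (invariants ns)\<^esub> N.
   \<forall>x\<in>carrier \<sigma>. hA q ?n f \<odot>\<^bsub>\<sigma>\<^esub> x = \<zero>\<^bsub>\<sigma>\<^esub>"
  using ann unfolding annihilated_by_power_def by blast
 have lau: "f \<in> \<A> ?n" if "f \<in> orbit_ideal ns t [^]\<^bsub>ideals_set (invariants ns)\<^esub> M" for f and M :: nat
 proof (cases M)
  case 0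
  thus ?thesis using that by (simp add: nat_pow_def ideals_set_def invariants_def)
 next
  case (Suc M')
  have "f \<in> \<A> ?n" if "f \<in> ideal_prod (invariants ns) I (orbit_ideal ns t)" "I <= \<A> ?n" for f I
   using that by induction (auto simp: orbit_ideal_def invariants_def)
  moreover have "orbit_ideal ns t [^]\<^bsub>ideals_set (invariants ns)\<^esub> M <= \<A> ?n" for M :: nat
  proof (induction M)
   case 0
   thus ?case by (auto simp: nat_pow_def ideals_set_def invariants_def)
  next
   case (Suc M)
   thus ?case using calculation by (auto simp: nat_pow_def ideals_set_def)
  qed
  ultimately show ?thesis using that by blast
 qed
 have kill: "killed_by f" if "f \<in> orbit_ideal ns t [^]\<^bsub>ideals_set (invariants ns)\<^esub> N" for f
  using N that lau[OF that] unfolding killed_by_def sim_def by (simp add: mact_eq[of "Ag f"] hecke_gen_eq)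
 let ?k = "block_index ns a" and ?l = "block_index ns b"
 have k: "?k < length ns" "a \<in> block ns ?k" and l: "?l < length ns" "b \<in> block ns ?l" and kl: "?k ~= ?l"
  using ab block_index_in[of a ns] block_index_in[of b ns] by (auto simp: apart_def)
 have in_n: "i \<in> {1..?n}" if "i \<in> block ns j" "j < length ns" for i j using block_subset[OF that(2)] that(1) by blast
 have "\<exists>F. natural_op F \<and> sim (Ag ((lvar a - lconst (of_nat m) * lvar b) * F (lvar a - lconst (of_nat m) * lvar b))) 1"
 proof (rule difference_inverse[OF refl k(1) l(1) k(2) l(2) _ _ kill])
  fix i assume "i \<in> {1..?n}"
  thus "t i ~= 0" using polar by (metis less_irrefl mult_eq_0_iff norm_zero of_real_eq_0_iff zero_neq_one)
 next
  fix i j assume i: "i \<in> block ns ?k" and j: "j \<in> block ns ?l"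
  have "u i ~= u j" using blocks k(1) l(1) i j kl by blast
  thus "t i ~= of_nat m * t j"
   using polar in_n[OF i k(1)] in_n[OF j l(1)] m by (intro polar_distinct[of v i u t j]) auto
 qed
 thus ?thesis by (auto simp: sim_def)
qed

section \<open>Decomposition of the sign vectors by the content of the tail\<close>

section \<open>Finite direct sums\<close>

lemma direct_sum_simps:
 "finite I ==> carrier (direct_sum I M) = (\<Pi>\<^sub>E i\<in>I. carrier (M i))"
 "\<zero>\<^bsub>direct_sum I M\<^esub> = (\<lambda>i\<in>I. \<zero>\<^bsub>M i\<^esub>)"
 "f \<oplus>\<^bsub>direct_sum I M\<^esub> g = (\<lambda>i\<in>I. f i \<oplus>\<^bsub>M i\<^esub> g i)"
 "a \<odot>\<^bsub>direct_sum I M\<^esub> f = (\<lambda>i\<in>I. a \<odot>\<^bsub>M i\<^esub> f i)"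
 by (auto simp: direct_sum_def)

lemma left_module_direct_sum:
 assumes fin: "finite I" and R: "ring R" and M: "!!i. i \<in> I ==> left_module R (M i)"
 shows "left_module R (direct_sum I M)"
proof -
 let ?S = "direct_sum I M"
 note simps = direct_sum_simps(1)[OF fin] direct_sum_simps(2-4)
 have val: "f i \<in> carrier (M i)" if "f \<in> (\<Pi>\<^sub>E i\<in>I. carrier (M i))" "i \<in> I" for f i using that by blast
 have ab: "abelian_group (M i)" if "i \<in> I" for i using M[OF that] by (simp add: left_module_def)
 have am: "abelian_monoid (M i)" if "i \<in> I" for i by (rule abelian_group.axioms(1)[OF ab[OF that]])
 have "abelian_group (?S)"
 proof (rule abelian_groupI)
  fix f g h
  assume f: "f \<in> carrier (?S)" and g: "g \<in> carrier (?S)" and h: "h \<in> carrier (?S)"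
  have fv: "f i \<in> carrier (M i)" and gv: "g i \<in> carrier (M i)" and hv: "h i \<in> carrier (M i)" if "i \<in> I" for i
   using f g h that unfolding simps by blast+
  show "f \<oplus>\<^bsub>?S\<^esub> g \<in> carrier (?S)"
   unfolding simps using abelian_monoid.a_closed[OF am fv gv] by simp
  show "f \<oplus>\<^bsub>?S\<^esub> g \<oplus>\<^bsub>?S\<^esub> h = f \<oplus>\<^bsub>?S\<^esub> (g \<oplus>\<^bsub>?S\<^esub> h)"
   unfolding simps by (rule restrict_ext) (simp add: abelian_monoid.a_assoc[OF am fv gv hv])
  show "f \<oplus>\<^bsub>?S\<^esub> g = g \<oplus>\<^bsub>?S\<^esub> f"
   unfolding simps by (rule restrict_ext) (rule abelian_monoid.a_comm[OF am fv gv])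
 next
  show "\<zero>\<^bsub>?S\<^esub> \<in> carrier (?S)"
   unfolding simps using abelian_monoid.zero_closed[OF am] by simp
  fix f assume f: "f \<in> carrier (?S)"
  hence fE: "f \<in> (\<Pi>\<^sub>E i\<in>I. carrier (M i))" unfolding simps .
  have "\<zero>\<^bsub>?S\<^esub> \<oplus>\<^bsub>?S\<^esub> f = restrict f I"
   unfolding simps by (rule restrict_ext) (simp add: abelian_monoid.l_zero[OF am val[OF fE]])
  thus "\<zero>\<^bsub>?S\<^esub> \<oplus>\<^bsub>?S\<^esub> f = f" by (simp only: PiE_restrict[OF fE])
  show "\<exists>g\<in>carrier (?S). g \<oplus>\<^bsub>?S\<^esub> f = \<zero>\<^bsub>?S\<^esub>"
  proof (rule bexI[of _ "\<lambda>i\<in>I. \<ominus>\<^bsub>M i\<^esub> f i"])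
   show "(\<lambda>i\<in>I. \<ominus>\<^bsub>M i\<^esub> f i) \<oplus>\<^bsub>?S\<^esub> f = \<zero>\<^bsub>?S\<^esub>"
    unfolding simps by (rule restrict_ext) (simp add: abelian_group.l_neg[OF ab val[OF fE]])
   show "(\<lambda>i\<in>I. \<ominus>\<^bsub>M i\<^esub> f i) \<in> carrier (?S)"
    unfolding simps using abelian_group.a_inv_closed[OF ab val[OF fE]] by simp
  qed
 qed
 thus ?thesis
 proof (intro left_module.intro R left_module_axioms.intro)
  fix a b f g
  assume a: "a \<in> carrier R" and b: "b \<in> carrier R" and f: "f \<in> carrier (?S)" and g: "g \<in> carrier (?S)"
  have fv: "f i \<in> carrier (M i)" and gv: "g i \<in> carrier (M i)" if "i \<in> I" for i
   using f g that unfolding simps by blast+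
  show "a \<odot>\<^bsub>?S\<^esub> f \<in> carrier (?S)"
   unfolding simps using left_module.smult_closed[OF M a fv] by simp
  show "(a \<oplus>\<^bsub>R\<^esub> b) \<odot>\<^bsub>?S\<^esub> f = a \<odot>\<^bsub>?S\<^esub> f \<oplus>\<^bsub>?S\<^esub> b \<odot>\<^bsub>?S\<^esub> f"
   unfolding simps by (rule restrict_ext) (simp add: left_module.smult_l_distr[OF M a b fv])
  show "a \<odot>\<^bsub>?S\<^esub> (f \<oplus>\<^bsub>?S\<^esub> g) = a \<odot>\<^bsub>?S\<^esub> f \<oplus>\<^bsub>?S\<^esub> a \<odot>\<^bsub>?S\<^esub> g"
   unfolding simps by (rule restrict_ext) (simp add: left_module.smult_r_distr[OF M a fv gv])
  show "(a \<otimes>\<^bsub>R\<^esub> b) \<odot>\<^bsub>?S\<^esub> f = a \<odot>\<^bsub>?S\<^esub> (b \<odot>\<^bsub>?S\<^esub> f)"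
   unfolding simps by (rule restrict_ext) (simp add: left_module.smult_assoc1[OF M a b fv])
 next
  fix f assume f: "f \<in> carrier (?S)"
  hence fE: "f \<in> (\<Pi>\<^sub>E i\<in>I. carrier (M i))" unfolding simps .
  show "\<one>\<^bsub>R\<^esub> \<odot>\<^bsub>?S\<^esub> f = f"
  proof -
   have "\<one>\<^bsub>R\<^esub> \<odot>\<^bsub>?S\<^esub> f = restrict f I"
    unfolding simps by (rule restrict_ext) (rule left_module.smult_one[OF M val[OF fE]])
   thus ?thesis by (simp only: PiE_restrict[OF fE])
  qed
 qed
qed

lemma direct_sum_isomorphic:
 assumes fin: "finite I" and R: "ring R" and iso: "!!i. i \<in> I ==> left_modules_isomorphic R (M i) (N i)"
 shows "left_modules_isomorphic R (direct_sum I M) (direct_sum I N)"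
proof -
 note simps = direct_sum_simps(1)[OF fin] direct_sum_simps(2-4)
 have "\<forall>i\<in>I. \<exists>\<phi>. \<phi> \<in> left_module_iso R (M i) (N i)" using iso by (auto simp: left_modules_isomorphic_def)
 then obtain \<phi> where \<phi>: "!!i. i \<in> I ==> \<phi> i \<in> left_module_iso R (M i) (N i)" by metis
 have bij: "bij_betw (\<phi> i) (carrier (M i)) (carrier (N i))"
  and add: "x \<in> carrier (M i) ==> y \<in> carrier (M i) ==> \<phi> i (x \<oplus>\<^bsub>M i\<^esub> y) = \<phi> i x \<oplus>\<^bsub>N i\<^esub> \<phi> i y"
  and smult: "a \<in> carrier R ==> x \<in> carrier (M i) ==> \<phi> i (a \<odot>\<^bsub>M i\<^esub> x) = a \<odot>\<^bsub>N i\<^esub> \<phi> i x" if "i \<in> I" for i x y a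
  using \<phi>[OF that] by (auto simp: left_module_iso_def)
 let ?\<Phi> = "\<lambda>f. \<lambda>i\<in>I. \<phi> i (f i)"
 have val: "f i \<in> carrier (M i)" if "f \<in> (\<Pi>\<^sub>E i\<in>I. carrier (M i))" "i \<in> I" for f i using that by blast
 have "bij_betw ?\<Phi> (\<Pi>\<^sub>E i\<in>I. carrier (M i)) (\<Pi>\<^sub>E i\<in>I. carrier (N i))"
 proof (rule bij_betw_byWitness[where f' = "\<lambda>g. \<lambda>i\<in>I. the_inv_into (carrier (M i)) (\<phi> i) (g i)"])
  show "\<forall>f\<in>\<Pi>\<^sub>E i\<in>I. carrier (M i). (\<lambda>i\<in>I. the_inv_into (carrier (M i)) (\<phi> i) (?\<Phi> f i)) = f"
  proof
   fix f assume f: "f \<in> (\<Pi>\<^sub>E i\<in>I. carrier (M i))"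
   have "(\<lambda>i\<in>I. the_inv_into (carrier (M i)) (\<phi> i) (?\<Phi> f i)) = restrict f I"
    by (rule restrict_ext) (simp add: the_inv_into_f_f[OF bij_betw_imp_inj_on[OF bij] val[OF f]])
   thus "(\<lambda>i\<in>I. the_inv_into (carrier (M i)) (\<phi> i) (?\<Phi> f i)) = f" by (simp only: PiE_restrict[OF f])
  qed
  show "\<forall>g\<in>\<Pi>\<^sub>E i\<in>I. carrier (N i). ?\<Phi> (\<lambda>i\<in>I. the_inv_into (carrier (M i)) (\<phi> i) (g i)) = g"
  proof
   fix g assume g: "g \<in> (\<Pi>\<^sub>E i\<in>I. carrier (N i))"
   have "?\<Phi> (\<lambda>i\<in>I. the_inv_into (carrier (M i)) (\<phi> i) (g i)) = restrict g I"
   proof (rule restrict_ext)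
    fix i assume i: "i \<in> I"
    show "\<phi> i ((\<lambda>i\<in>I. the_inv_into (carrier (M i)) (\<phi> i) (g i)) i) = g i"
     using f_the_inv_into_f_bij_betw[OF bij[OF i], of "g i"] PiE_mem[OF g i] i by simp
   qed
   thus "?\<Phi> (\<lambda>i\<in>I. the_inv_into (carrier (M i)) (\<phi> i) (g i)) = g" by (simp only: PiE_restrict[OF g])
  qed
  show "?\<Phi> ` (\<Pi>\<^sub>E i\<in>I. carrier (M i)) <= (\<Pi>\<^sub>E i\<in>I. carrier (N i))"
   using bij_betw_apply[OF bij val] by auto
  show "(\<lambda>g. \<lambda>i\<in>I. the_inv_into (carrier (M i)) (\<phi> i) (g i)) ` (\<Pi>\<^sub>E i\<in>I. carrier (N i)) <= (\<Pi>\<^sub>E i\<in>I. carrier (M i))"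
   using bij_betw_apply[OF bij_betw_the_inv_into[OF bij]] by (fastforce simp: PiE_iff)
 qed
 moreover have "\<forall>f\<in>\<Pi>\<^sub>E i\<in>I. carrier (M i). \<forall>g\<in>\<Pi>\<^sub>E i\<in>I. carrier (M i).
   ?\<Phi> (\<lambda>i\<in>I. f i \<oplus>\<^bsub>M i\<^esub> g i) = (\<lambda>i\<in>I. ?\<Phi> f i \<oplus>\<^bsub>N i\<^esub> ?\<Phi> g i)"
  by (intro ballI restrict_ext) (simp add: add[OF _ val val])
 moreover have "\<forall>a\<in>carrier R. \<forall>f\<in>\<Pi>\<^sub>E i\<in>I. carrier (M i). ?\<Phi> (\<lambda>i\<in>I. a \<odot>\<^bsub>M i\<^esub> f i) = (\<lambda>i\<in>I. a \<odot>\<^bsub>N i\<^esub> ?\<Phi> f i)"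
  by (intro ballI restrict_ext) (simp add: smult[OF _ _ val])
 ultimately have "?\<Phi> \<in> left_module_iso R (direct_sum I M) (direct_sum I N)"
  unfolding left_module_iso_def simps by blast
 thus ?thesis
  using left_module_direct_sum[OF fin R, of M] left_module_direct_sum[OF fin R, of N] iso
  by (auto simp: left_modules_isomorphic_def)
qed

lemma finite_sub_tuples: "finite (sub_tuples ns i)"
proof (rule finite_subset)
 show "sub_tuples ns i <= {ks. set ks <= {..i} \<and> length ks = length ns}"
  by (auto simp: sub_tuples_def dest: member_le_sum_list)
 show "finite {ks. set ks <= {..i} \<and> length ks = length ns}" by (rule finite_lists_length_eq) simp
qed

section \<open>Concatenating labellings\<close>

definition glue :: "nat => nat => (nat => nat) => (nat => nat) => nat => nat" where
 "glue m n \<alpha> \<mu> = (\<lambda>j\<in>{1..n}. if j \<le> m then \<alpha> j else \<mu> (j - m))"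

lemma glue_head: "j \<in> {1..m} ==> m \<le> n ==> glue m n \<alpha> \<mu> j = \<alpha> j"
 by (simp add: glue_def)

lemma glue_tail: "j \<in> {1..n - m} ==> glue m n \<alpha> \<mu> (j + m) = \<mu> j"
 by (auto simp: glue_def)

lemma glue_count:
 assumes "m \<le> n" and "j \<le> n - m"
 shows "card {i \<in> {1..j + m}. glue m n \<alpha> \<mu> i = k} = card {i \<in> {1..m}. \<alpha> i = k} + card {i \<in> {1..j}. \<mu> i = k}"
proof -
 let ?A = "{i \<in> {1..m}. \<alpha> i = k}" and ?B = "{i \<in> {1..j}. \<mu> i = k}"
 have "{i \<in> {1..j + m}. glue m n \<alpha> \<mu> i = k} = ?A \<union> (\<lambda>i. i + m) ` ?B"
 proof (intro equalityI subsetI)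
  fix i assume i: "i \<in> {i \<in> {1..j + m}. glue m n \<alpha> \<mu> i = k}"
  show "i \<in> ?A \<union> (\<lambda>i. i + m) ` ?B"
  proof (cases "i \<le> m")
   case True
   thus ?thesis using i glue_head[of i m n] assms by auto
  next
   case False
   hence "i - m \<in> {1..n - m}" using i assms by auto
   hence "i - m \<in> ?B" using i False glue_tail[of "i - m" n m \<alpha> \<mu>] by auto
   hence "(i - m) + m \<in> (\<lambda>i. i + m) ` ?B" by (rule imageI)
   thus ?thesis using False by simp
  qed
 next
  fix i assume "i \<in> ?A \<union> (\<lambda>i. i + m) ` ?B"
  thus "i \<in> {i \<in> {1..j + m}. glue m n \<alpha> \<mu> i = k}"
  proof
   assume "i \<in> ?A"
   thus ?thesis using glue_head[of i m n \<alpha> \<mu>] assms by auto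
  next
   assume "i \<in> (\<lambda>i. i + m) ` ?B"
   then obtain i' where "i' \<in> ?B" "i = i' + m" by blast
   thus ?thesis using glue_tail[of i' n m \<alpha> \<mu>] assms by auto
  qed
 qed
 moreover have "card (?A \<union> (\<lambda>i. i + m) ` ?B) = card ?A + card ((\<lambda>i. i + m) ` ?B)"
  by (rule card_Un_disjoint) auto
 moreover have "card ((\<lambda>i. i + m) ` ?B) = card ?B" by (rule card_image) simp
 ultimately show ?thesis by simp
qed

lemma glue_sref_head:
 assumes j: "j \<in> full m" and mn: "m \<le> n"
 shows "glue m n (\<alpha> \<circ> sref j) \<mu> = glue m n \<alpha> \<mu> \<circ> sref j"
proof
 fix i
 consider "i = j" | "i = Suc j" | "i ~= j" "i ~= Suc j" by blast
 thus "glue m n (\<alpha> \<circ> sref j) \<mu> i = (glue m n \<alpha> \<mu> \<circ> sref j) i"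
  by cases (use j mn in "auto simp: glue_def")
qed

lemma glue_sref_tail:
 assumes j: "j \<in> full (n - m)"
 shows "glue m n \<alpha> (\<mu> \<circ> sref j) = glue m n \<alpha> \<mu> \<circ> sref (j + m)"
proof
 fix i
 consider "i = j + m" | "i = Suc (j + m)" | "i ~= j + m" "i ~= Suc (j + m)" by blast
 thus "glue m n \<alpha> (\<mu> \<circ> sref j) i = (glue m n \<alpha> \<mu> \<circ> sref (j + m)) i"
 proof cases
  case 3
  hence "sref (j + m) i = i" "m < i ==> sref j (i - m) = i - m" by (auto simp: transpose_def)
  thus ?thesis by (simp add: glue_def)
 qed (use j in "auto simp: glue_def")
qed

context block_split
begin

lemma glue_labelling:
 assumes l: "\<alpha> \<in> labellings nd" and m: "\<mu> \<in> labellings ks"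
 shows "glue (sum_list nd) (sum_list ns) \<alpha> \<mu> \<in> labellings ns"
proof -
 let ?m = "sum_list nd" and ?n = "sum_list ns"
 have mn: "?m \<le> ?n" "?n - ?m = sum_list ks" using sum_split by simp_all
 have "glue ?m ?n \<alpha> \<mu> \<in> {1..?n} \<rightarrow>\<^sub>E {..<length ns}"
 proof (rule PiE_I)
  fix j assume j: "j \<in> {1..?n}"
  show "glue ?m ?n \<alpha> \<mu> j \<in> {..<length ns}"
  proof (cases "j \<le> ?m")
   case True
   thus ?thesis using j labellings_less[OF l, of j] glue_head[of j ?m ?n] mn length_nd by simp
  next
   case False
   hence "j - ?m \<in> {1..sum_list ks}" using j mn by auto
   thus ?thesis using False j labellings_less[OF m, of "j - ?m"] length_ks by (simp add: glue_def)
  qed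
 qed (auto simp: glue_def)
 moreover have "card {j \<in> {1..?n}. glue ?m ?n \<alpha> \<mu> j = k} = ns ! k" if k: "k < length ns" for k
 proof -
  have "card {j \<in> {1..?m}. \<alpha> j = k} = ns ! k - ks ! k"
   using l k unfolding labellings_def by (simp only: mem_Collect_eq length_nd nd_nth)
  moreover have "card {j \<in> {1..sum_list ks}. \<mu> j = k} = ks ! k"
   using m k unfolding labellings_def by (simp only: mem_Collect_eq length_ks)
  moreover have "sum_list ks + ?m = ?n" using sum_split by simp
  ultimately show ?thesis
   using glue_count[OF mn(1), of "sum_list ks" \<alpha> \<mu> k] mn(2) ks_le[OF k] by simp
 qed
 ultimately show ?thesis by (simp add: labellings_def)
qed

text \<open>The tail does not affect the ranks in the head, and \<open>pos_left\<close> puts each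
  block of the first composition at the start of the corresponding block of
  \<open>ns\<close>.\<close>

lemma lpos_glue_head:
 assumes l: "\<alpha> \<in> labellings nd" and j: "j \<in> {1..sum_list nd}"
 shows "lpos ns (glue (sum_list nd) (sum_list ns) \<alpha> \<mu>) j = pos_left ns ks (lpos nd \<alpha> j)"
proof -
 let ?m = "sum_list nd" and ?n = "sum_list ns"
 have mn: "?m \<le> ?n" using sum_split by simp
 have k: "\<alpha> j < length ns" using labellings_less[OF l j] by (simp only: length_nd)
 have "{i \<in> {1..j}. glue ?m ?n \<alpha> \<mu> i = \<alpha> j} = {i \<in> {1..j}. \<alpha> i = \<alpha> j}"
  using glue_head[of _ ?m ?n \<alpha> \<mu>] j mn by auto
 hence "lpos ns (glue ?m ?n \<alpha> \<mu>) j = offset ns (\<alpha> j) + card {i \<in> {1..j}. \<alpha> i = \<alpha> j}"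
  using j mn glue_head[OF j mn, of \<alpha> \<mu>] by (simp add: lpos_def)
 moreover have "pos_left ns ks (lpos nd \<alpha> j) = offset ns (\<alpha> j) + (lpos nd \<alpha> j - offset nd (\<alpha> j))"
  by (rule pos_left_eq[OF k lpos_block[OF l j]])
 ultimately show ?thesis using j by (simp add: lpos_def)
qed

text \<open>Label k occurs \<open>ns ! k - ks ! k\<close> times in the head. These occurrences
  precede the ones in the tail and account for the places that \<open>pos_right\<close>
  skips.\<close>

lemma lpos_glue_tail:
 assumes l: "\<alpha> \<in> labellings nd" and m: "\<mu> \<in> labellings ks" and j: "j \<in> {1..sum_list ks}"
 shows "lpos ns (glue (sum_list nd) (sum_list ns) \<alpha> \<mu>) (j + sum_list nd) = pos_right ns ks (lpos ks \<mu> j)"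
proof -
 let ?m = "sum_list nd" and ?n = "sum_list ns"
 have mn: "?m \<le> ?n" "?n - ?m = sum_list ks" using sum_split by simp_all
 have k: "\<mu> j < length ns" using labellings_less[OF m j] by (simp only: length_ks)
 have g: "glue ?m ?n \<alpha> \<mu> (j + ?m) = \<mu> j" using glue_tail[of j ?n ?m] j mn(2) by simp
 have "card {i \<in> {1..sum_list nd}. \<alpha> i = \<mu> j} = ns ! \<mu> j - ks ! \<mu> j"
  using l k unfolding labellings_def by (simp only: mem_Collect_eq length_nd nd_nth)
 hence "card {i \<in> {1..j + ?m}. glue ?m ?n \<alpha> \<mu> i = \<mu> j} = (ns ! \<mu> j - ks ! \<mu> j) + card {i \<in> {1..j}. \<mu> i = \<mu> j}"
  using glue_count[of ?m ?n j \<alpha> \<mu> "\<mu> j"] mn j by simp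
 moreover have "j + ?m \<in> {1..?n}" using j sum_split by simp
 ultimately have "lpos ns (glue ?m ?n \<alpha> \<mu>) (j + ?m) = offset ns (\<mu> j) + ((ns ! \<mu> j - ks ! \<mu> j) + card {i \<in> {1..j}. \<mu> i = \<mu> j})"
  unfolding lpos_def g by (simp only: if_True)
 moreover have "pos_right ns ks (lpos ks \<mu> j) = offset ns (\<mu> j) + (ns ! \<mu> j - ks ! \<mu> j) + (lpos ks \<mu> j - offset ks (\<mu> j))"
  by (rule pos_right_eq[OF k lpos_block[OF m j]])
 ultimately show ?thesis using j by (simp add: lpos_def)
qed

end

text \<open>The index of the direct summand to which a labelling contributes.\<close>

definition tail_content :: "nat => nat list => (nat => nat) => nat list" where
 "tail_content m ns l = map (\<lambda>k. card {j \<in> {1..sum_list ns - m}. l (j + m) = k}) [0..<length ns]"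

lemma sub_tuples_block_split: "ks \<in> sub_tuples ns i ==> block_split ns ks"
 by unfold_locales (simp_all add: sub_tuples_def)

lemma sub_tuples_sum:
 assumes "ks \<in> sub_tuples ns i"
 shows "sum_list ks = i" and "sum_list (tuple_diff ns ks) = sum_list ns - i"
proof -
 show k: "sum_list ks = i" using assms by (simp add: sub_tuples_def)
 show "sum_list (tuple_diff ns ks) = sum_list ns - i"
  using block_split.sum_split[OF sub_tuples_block_split[OF assms]] k by linarith
qed

lemma glue_cases:
 assumes l: "l \<in> labellings ns" and i: "i \<le> sum_list ns"
 obtains ks \<alpha> \<mu> where "ks \<in> sub_tuples ns i" "\<alpha> \<in> labellings (tuple_diff ns ks)" "\<mu> \<in> labellings ks"
  "l = glue (sum_list ns - i) (sum_list ns) \<alpha> \<mu>"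
proof -
 let ?n = "sum_list ns"
 let ?m = "?n - i"
 define \<alpha> where "\<alpha> = restrict l {1..?m}"
 define \<mu> where "\<mu> = (\<lambda>j\<in>{1..i}. l (j + ?m))"
 define ks where "ks = map (\<lambda>k. card {j \<in> {1..i}. \<mu> j = k}) [0..<length ns]"
 have mn: "?m \<le> ?n" "?n - ?m = i" using i by simp_all
 have lr: "l j < length ns" if "j \<in> {1..?n}" for j by (rule labellings_less[OF l that])
 have eq: "l = glue ?m ?n \<alpha> \<mu>"
 proof
  fix j
  show "l j = glue ?m ?n \<alpha> \<mu> j"
  proof (cases "j \<in> {1..?n}")
   case True
   thus ?thesis using mn by (auto simp: glue_def \<alpha>_def \<mu>_def)
  next
   case False
   thus ?thesis using l by (auto simp: glue_def labellings_def PiE_def extensional_def)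
  qed
 qed
 have count: "card {j \<in> {1..?m}. \<alpha> j = k} + card {j \<in> {1..i}. \<mu> j = k} = ns ! k" if k: "k < length ns" for k
  using glue_count[of ?m ?n i \<alpha> \<mu> k] l k mn i unfolding labellings_def eq[symmetric] by simp
 have \<mu>r: "\<mu> j < length ns" if "j \<in> {1..i}" for j
 proof -
  have "j + ?m \<in> {1..?n}" using that i by auto
  from lr[OF this] show ?thesis using that by (simp add: \<mu>_def)
 qed
 have \<alpha>r: "\<alpha> j < length ns" if "j \<in> {1..?m}" for j using lr[of j] that by (auto simp: \<alpha>_def)
 have "sum_list ks = (\<Sum>k<length ns. card {j \<in> {1..i}. \<mu> j = k})"
  by (simp add: ks_def sum_list_sum_nth atLeast0LessThan)
 also have "\<dots> = card {1..i}"
 proof -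
  have "(\<Sum>k\<in>{..<length ns}. sum (\<lambda>_. 1) {j \<in> {1..i}. \<mu> j = k}) = sum (\<lambda>_. 1::nat) {1..i}"
   by (rule sum.group) (use \<mu>r in auto)
  thus ?thesis by simp
 qed
 finally have ksum: "sum_list ks = i" by simp
 have ksn: "ks ! k = card {j \<in> {1..i}. \<mu> j = k}" if "k < length ns" for k using that by (simp add: ks_def)
 have klen: "length ks = length ns" by (simp add: ks_def)
 have "ks ! k \<le> ns ! k" if "k < length ns" for k
  using count[OF that] ksn[OF that] by linarith
 hence ks: "ks \<in> sub_tuples ns i" using ksum klen by (simp add: sub_tuples_def)
 interpret B: block_split ns ks by (rule sub_tuples_block_split[OF ks])
 have m: "sum_list (tuple_diff ns ks) = ?m" by (rule sub_tuples_sum(2)[OF ks])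
 have "\<alpha> \<in> labellings (tuple_diff ns ks)"
  unfolding labellings_def m B.length_nd
 proof (intro CollectI conjI allI impI)
  show "\<alpha> \<in> {1..?m} \<rightarrow>\<^sub>E {..<length ns}" using \<alpha>r by (intro PiE_I) (auto simp: \<alpha>_def)
  fix k assume "k < length ns"
  thus "card {j \<in> {1..?m}. \<alpha> j = k} = tuple_diff ns ks ! k" using count[of k] B.nd_nth[of k] ksn[of k] by simp
 qed
 moreover have "\<mu> \<in> labellings ks"
  unfolding labellings_def ksum klen
 proof (intro CollectI conjI allI impI)
  show "\<mu> \<in> {1..i} \<rightarrow>\<^sub>E {..<length ns}" using \<mu>r by (intro PiE_I) (auto simp: \<mu>_def)
 qed (simp add: ksn)
 ultimately show ?thesis using that ks eq by blast
qed

lemma glue_content: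
 assumes ks: "ks \<in> sub_tuples ns i" and l: "\<alpha> \<in> labellings (tuple_diff ns ks)" and m: "\<mu> \<in> labellings ks"
 shows "tail_content (sum_list ns - i) ns (glue (sum_list ns - i) (sum_list ns) \<alpha> \<mu>) = ks"
  and "restrict (glue (sum_list ns - i) (sum_list ns) \<alpha> \<mu>) {1..sum_list ns - i} = \<alpha>"
proof -
 let ?n = "sum_list ns"
 let ?m = "?n - i"
 interpret B: block_split ns ks by (rule sub_tuples_block_split[OF ks])
 have s: "sum_list ks = i" "sum_list (tuple_diff ns ks) = ?m" using sub_tuples_sum[OF ks] by simp_all
 have mn: "?n - ?m = i" using B.sum_split s by linarith
 show "tail_content ?m ns (glue ?m ?n \<alpha> \<mu>) = ks"
 proof (rule nth_equalityI)
  fix k assume "k < length (tail_content ?m ns (glue ?m ?n \<alpha> \<mu>))"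
  hence k: "k < length ns" by (simp add: tail_content_def)
  have "{j \<in> {1..i}. glue ?m ?n \<alpha> \<mu> (j + ?m) = k} = {j \<in> {1..i}. \<mu> j = k}"
   using glue_tail[of _ ?n ?m \<alpha> \<mu>] mn by auto
  thus "tail_content ?m ns (glue ?m ?n \<alpha> \<mu>) ! k = ks ! k"
   using m k B.length_ks s(1) unfolding tail_content_def mn labellings_def by simp
 qed (simp add: tail_content_def B.length_ks)
 have "restrict (glue ?m ?n \<alpha> \<mu>) {1..?m} = restrict \<alpha> {1..?m}"
  by (rule restrict_ext) (simp add: glue_head)
 moreover have "\<alpha> \<in> {1..?m} \<rightarrow>\<^sub>E {..<length (tuple_diff ns ks)}" using l unfolding labellings_def s(2) by blast
 hence "restrict \<alpha> {1..?m} = \<alpha>" by (rule PiE_restrict)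
 ultimately show "restrict (glue ?m ?n \<alpha> \<mu>) {1..?m} = \<alpha>" by (simp only:)
qed

section \<open>Sign vectors in the module of sections\<close>

lemma subst_uminus: "subst p (- a) = - subst p a"
 by (simp add: subst_def pm_push_uminus)

text \<open>The inverses are given as operations on the difference that they invert, so that they
  can be transported along \<open>pos_left\<close>.\<close>

locale separated =
 fixes q :: nat and ns :: "nat list" and \<sigma> :: "(hecke_elt, 'b) module" (structure)
  and Fg Fh :: "nat => nat => laurent => laurent"
 assumes q_pos: "q > 0" and levi_mod: "left_module (levi q ns) \<sigma>"
  and natural: "apart ns a b ==> natural_op (Fg a b)" "apart ns a b ==> natural_op (Fh a b)"
  and inverse_g: "apart ns a b ==> x \<in> carrier \<sigma> ==>
   mact q (sum_list ns) (lev ns) \<sigma> (Ag ((lvar a - lvar b) * Fg a b (lvar a - lvar b))) x = x"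
  and inverse_h: "apart ns a b ==> x \<in> carrier \<sigma> ==>
   mact q (sum_list ns) (lev ns) \<sigma> (Ag ((lvar a - lconst (of_nat q) * lvar b) * Fh a b (lvar a - lconst (of_nat q) * lvar b))) x = x"

sublocale separated \<subseteq> W: levi_model q ns \<sigma> "\<lambda>a b. Fg a b (lvar a - lvar b)"
  "\<lambda>a b. Fh a b (lvar a - lconst (of_nat q) * lvar b)"
proof (rule levi_model.intro)
 show "left_module (levi q ns) \<sigma>" by (rule levi_mod)
 show "invertible_apart q ns (mact q (sum_list ns) (lev ns) \<sigma>) (carrier \<sigma>) (\<lambda>a b. Fg a b (lvar a - lvar b))
   (\<lambda>a b. Fh a b (lvar a - lconst (of_nat q) * lvar b))"
  unfolding invertible_apart_def
 proof (intro allI impI conjI ballI)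
  fix a b assume ab: "apart ns a b"
  hence "lvar a \<in> \<A> (sum_list ns)" "lvar b \<in> \<A> (sum_list ns)" by (simp_all add: apart_def)
  thus "Fg a b (lvar a - lvar b) \<in> \<A> (sum_list ns)"
   "Fh a b (lvar a - lconst (of_nat q) * lvar b) \<in> \<A> (sum_list ns)"
   using natural[OF ab] unfolding natural_op_def by auto
 qed (use inverse_g inverse_h in auto)
qed

context separated
begin

abbreviation act where "act \<equiv> mact q (sum_list ns) (lev ns) \<sigma>"

text \<open>For different labels the factor 1 + \<alpha> is cancelled by \<open>be_inverse\<close>,
  and two equal values remain. For equal labels l s_j = l, so only the condition on the single value
  \<phi>(l) is left.\<close>

lemma sign_local:
 assumes \<phi>: "\<phi> \<in> W.L \<rightarrow>\<^sub>E carrier \<sigma>" and j: "j \<in> full W.n" and l: "l \<in> W.L"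
 shows "W.fact (Tg j) \<phi> l \<oplus> \<phi> l = \<zero> \<longleftrightarrow>
  (l j = l (j + 1) --> act (Tg (lpos ns l j)) (\<phi> l) = \<ominus> \<phi> l) \<and> \<phi> (l \<circ> sref j) = \<phi> l"
proof -
 have x: "\<phi> l \<in> carrier \<sigma>" and y: "\<phi> (l \<circ> sref j) \<in> carrier \<sigma>" using \<phi> l j W.labellings_sref' by auto
 show ?thesis
 proof (cases "l j = l (j + 1)")
  case True
  have ls: "l \<circ> sref j = l" by (rule label_sref_same[OF True])
  have "W.fact (Tg j) \<phi> l = act (Tg (lpos ns l j)) (\<phi> l)"
   using True x y by (simp add: W.fact_GT[OF \<phi> j l] W.PP_def W.QQ_def)
  moreover have "act (Tg (lpos ns l j)) (\<phi> l) \<oplus> \<phi> l = \<zero> \<longleftrightarrow> act (Tg (lpos ns l j)) (\<phi> l) = \<ominus> \<phi> l"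
   using x W.minus_equality[of "act (Tg (lpos ns l j)) (\<phi> l)" "\<phi> l"] W.l_neg[OF x] W.act_closed[OF x] by auto
  ultimately show ?thesis using True ls by simp
 next
  case False
  let ?al = "Ag (W.al (lpos ns l j) (lpos ns l (Suc j)))"
  have jn: "j \<in> {1..W.n}" "Suc j \<in> {1..W.n}" using j by auto
  have ap: "apart ns (lpos ns l j) (lpos ns l (Suc j))" using lpos_apart[OF l jn] False by simp
  have f: "W.fact (Tg j) \<phi> l = act ?al (\<phi> l) \<oplus> act (- 1 - ?al) (\<phi> (l \<circ> sref j))"
   using False by (simp add: W.fact_GT[OF \<phi> j l] W.PP_def W.QQ_def)
  have z: "act ?al (\<phi> l) \<oplus> act (- 1 - ?al) (\<phi> l) \<oplus> \<phi> l = \<zero>"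
  proof -
   have "act (?al + (- 1 - ?al) + 1) (\<phi> l) = \<zero>" using x by simp
   thus ?thesis using x by (simp only: W.act_add W.act_one W.act_closed)
  qed
  obtain d where d: "W.sim (d * (- 1 - ?al)) 1" using W.be_inverse(2)[OF ap] by blast
  have "\<phi> (l \<circ> sref j) = \<phi> l" if "W.fact (Tg j) \<phi> l \<oplus> \<phi> l = \<zero>"
  proof -
   have "act ?al (\<phi> l) \<oplus> act (- 1 - ?al) (\<phi> (l \<circ> sref j)) \<oplus> \<phi> l =
     act ?al (\<phi> l) \<oplus> act (- 1 - ?al) (\<phi> l) \<oplus> \<phi> l"
    using that f z by simp
   hence "act (- 1 - ?al) (\<phi> (l \<circ> sref j)) = act (- 1 - ?al) (\<phi> l)"
    using x y by (simp add: W.act_closed W.a_assoc)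
   hence "act d (act (- 1 - ?al) (\<phi> (l \<circ> sref j))) = act d (act (- 1 - ?al) (\<phi> l))" by simp
   thus ?thesis using W.simD[OF d x] W.simD[OF d y] x y by (simp only: W.act_mult W.act_one)
  qed
  moreover have "W.fact (Tg j) \<phi> l \<oplus> \<phi> l = \<zero>" if "\<phi> (l \<circ> sref j) = \<phi> l"
   unfolding f that by (rule z)
  ultimately show ?thesis using False by blast
 qed
qed

lemma mem_BZ_FM:
 assumes i: "i \<le> W.n"
 shows "\<phi> \<in> carrier (BZ q W.n i W.FM) \<longleftrightarrow> \<phi> \<in> W.L \<rightarrow>\<^sub>E carrier \<sigma> \<and>
  (\<forall>j\<in>full W.n. W.n - i < j --> (\<forall>l\<in>W.L.
   (l j = l (j + 1) --> act (Tg (lpos ns l j)) (\<phi> l) = \<ominus> \<phi> l) \<and> \<phi> (l \<circ> sref j) = \<phi> l))"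
proof -
 interpret FMm: left_module "hecke q W.n" W.FM by (rule W.left_module_FM)
 have "mact q W.n (full W.n) W.FM (Tg j) \<phi> = \<ominus>\<^bsub>W.FM\<^esub> \<phi> \<longleftrightarrow>
   (\<forall>l\<in>W.L. (l j = l (j + 1) --> act (Tg (lpos ns l j)) (\<phi> l) = \<ominus> \<phi> l) \<and> \<phi> (l \<circ> sref j) = \<phi> l)"
  if \<phi>: "\<phi> \<in> W.L \<rightarrow>\<^sub>E carrier \<sigma>" and j: "j \<in> full W.n" for j
 proof -
  have Tj: "Tg j \<in> hfree W.n" using j by simp
  have m: "mact q W.n (full W.n) W.FM (Tg j) \<phi> = W.fact (Tg j) \<phi>"
   unfolding mact_eq[OF Tj] by (rule W.FM_smult[OF Tj \<phi>])
  have c: "W.fact (Tg j) \<phi> \<in> carrier W.FM" "\<phi> \<in> carrier W.FM"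
   by (simp_all only: W.FM_simps W.fact_closed[OF \<phi>] \<phi>)
  have "W.fact (Tg j) \<phi> = \<ominus>\<^bsub>W.FM\<^esub> \<phi> \<longleftrightarrow> W.fact (Tg j) \<phi> \<oplus>\<^bsub>W.FM\<^esub> \<phi> = \<zero>\<^bsub>W.FM\<^esub>"
  proof
   assume eq: "W.fact (Tg j) \<phi> = \<ominus>\<^bsub>W.FM\<^esub> \<phi>"
   show "W.fact (Tg j) \<phi> \<oplus>\<^bsub>W.FM\<^esub> \<phi> = \<zero>\<^bsub>W.FM\<^esub>" unfolding eq by (rule FMm.M.l_neg[OF c(2)])
  next
   assume eq: "W.fact (Tg j) \<phi> \<oplus>\<^bsub>W.FM\<^esub> \<phi> = \<zero>\<^bsub>W.FM\<^esub>"
   show "W.fact (Tg j) \<phi> = \<ominus>\<^bsub>W.FM\<^esub> \<phi>" by (rule FMm.M.minus_equality[OF eq c(2,1), symmetric])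
  qed
  also have "\<dots> \<longleftrightarrow> (\<forall>l\<in>W.L. W.fact (Tg j) \<phi> l \<oplus> \<phi> l = \<zero>)"
  proof
   assume eq: "W.fact (Tg j) \<phi> \<oplus>\<^bsub>W.FM\<^esub> \<phi> = \<zero>\<^bsub>W.FM\<^esub>"
   show "\<forall>l\<in>W.L. W.fact (Tg j) \<phi> l \<oplus> \<phi> l = \<zero>"
   proof
    fix l assume l: "l \<in> W.L"
    have "(W.fact (Tg j) \<phi> \<oplus>\<^bsub>W.FM\<^esub> \<phi>) l = \<zero>\<^bsub>W.FM\<^esub> l" by (simp only: eq)
    thus "W.fact (Tg j) \<phi> l \<oplus> \<phi> l = \<zero>" using l by simp
   qed
  qed (auto intro!: restrict_ext)
  finally show ?thesis unfolding m using sign_local[OF \<phi> j] by blast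
 qed
 thus ?thesis
  unfolding carrier_BZ[OF W.left_module_FM q_pos i] sgn_vec_def by auto
qed

end

section \<open>Restriction to the labellings with a given tail\<close>

locale split_sections = separated q ns \<sigma> Fg Fh + block_split ns ks
 for q ns and \<sigma> :: "(hecke_elt, 'b) module" (structure) and Fg Fh ks

sublocale split_sections \<subseteq> C: sign_cut nd ns "pos_left ns ks" ks "pos_right ns ks" q \<sigma> "sgn_levi q ks"
 by (rule sign_cut_levi[OF levi_mod q_pos])

context split_sections
begin

abbreviation "pl \<equiv> pos_left ns ks"
abbreviation "m \<equiv> sum_list nd"
abbreviation "N \<equiv> sum_list ns"
abbreviation "cat \<alpha> \<equiv> glue m N \<alpha> (base_label ks)"

lemma apart_pl: "apart nd a b ==> apart ns (pl a) (pl b)"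
 using pos_left_in block_index_pos_left unfolding apart_def by simp

text \<open>Here naturality pays off: renaming by \<open>pl\<close> turns the proposed inverse over
  fewer variables into the inverse known on \<sigma>.\<close>

lemma levi_model_cut:
 "levi_model q nd C.cut (\<lambda>a b. Fg (pl a) (pl b) (lvar a - lvar b))
   (\<lambda>a b. Fh (pl a) (pl b) (lvar a - lconst (of_nat q) * lvar b))"
proof (rule levi_model.intro)
 show "left_module (levi q nd) C.cut" by (rule C.left_module_cut)
 show "invertible_apart q nd (mact q m (lev nd) C.cut) (carrier C.cut) (\<lambda>a b. Fg (pl a) (pl b) (lvar a - lvar b))
   (\<lambda>a b. Fh (pl a) (pl b) (lvar a - lconst (of_nat q) * lvar b))"
  unfolding invertible_apart_def
 proof (intro allI impI conjI ballI)
  fix a b assume ab: "apart nd a b"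
  note ap = apart_pl[OF ab] and nat = natural[OF apart_pl[OF ab], unfolded natural_op_def]
  have l: "lvar a - lvar b \<in> \<A> m" "lvar a - lconst (of_nat q) * lvar b \<in> \<A> m"
   using ab by (auto simp: apart_def)
  thus G: "Fg (pl a) (pl b) (lvar a - lvar b) \<in> \<A> m"
   and H: "Fh (pl a) (pl b) (lvar a - lconst (of_nat q) * lvar b) \<in> \<A> m"
   using nat by blast+
  fix x assume x: "x \<in> carrier C.cut"
  have xs: "x \<in> carrier \<sigma>" by (rule C.cut_carrier[OF x])
  have "mact q m (lev nd) C.cut (Ag ((lvar a - lvar b) * Fg (pl a) (pl b) (lvar a - lvar b))) x =
    act (subst pl (Ag ((lvar a - lvar b) * Fg (pl a) (pl b) (lvar a - lvar b)))) x"
   by (rule C.cut_mact) (use l G in auto)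
  also have "\<dots> = x"
   using inverse_g[OF ap xs] nat by (simp add: lrename_mult lrename_diff)
  finally show "mact q m (lev nd) C.cut (Ag ((lvar a - lvar b) * Fg (pl a) (pl b) (lvar a - lvar b))) x = x" .
  have "mact q m (lev nd) C.cut (Ag ((lvar a - lconst (of_nat q) * lvar b) * Fh (pl a) (pl b) (lvar a - lconst (of_nat q) * lvar b))) x =
    act (subst pl (Ag ((lvar a - lconst (of_nat q) * lvar b) * Fh (pl a) (pl b) (lvar a - lconst (of_nat q) * lvar b)))) x"
   by (rule C.cut_mact) (use l H in auto)
  also have "\<dots> = x"
   using inverse_h[OF ap xs] nat by (simp add: lrename_mult lrename_diff)
  finally show "mact q m (lev nd) C.cut (Ag ((lvar a - lconst (of_nat q) * lvar b) * Fh (pl a) (pl b) (lvar a - lconst (of_nat q) * lvar b))) x = x" .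
 qed
qed

end

sublocale split_sections \<subseteq> V: levi_model q nd C.cut "\<lambda>a b. Fg (pl a) (pl b) (lvar a - lvar b)"
  "\<lambda>a b. Fh (pl a) (pl b) (lvar a - lconst (of_nat q) * lvar b)"
 by (rule levi_model_cut)

context split_sections
begin

abbreviation actV where "actV \<equiv> mact q m (lev nd) C.cut"

definition restr :: "((nat => nat) => 'b) => (nat => nat) => 'b" where
 "restr \<phi> = (\<lambda>\<alpha>\<in>V.L. \<phi> (cat \<alpha>))"

lemma mN: "m \<le> N" "N - m = sum_list ks" "sum_list ks \<le> N" "N - sum_list ks = m"
 using sum_split by simp_all

lemma cat_in: "\<alpha> \<in> V.L ==> cat \<alpha> \<in> W.L"
 by (rule glue_labelling[OF _ base_label_labelling])

text \<open>In a sorted tail equal labels are adjacent and \<open>lpos\<close> of the tail is the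
  identity. So every T_j of the Levi subalgebra for \<open>ks\<close> is met at position j + m,
  where the sign condition on \<phi> becomes one on its value.\<close>

lemma restr_closed:
 assumes \<phi>: "\<phi> \<in> carrier (BZ q N (sum_list ks) W.FM)"
 shows "restr \<phi> \<in> V.L \<rightarrow>\<^sub>E carrier C.cut"
proof -
 note \<phi>' = \<phi>[unfolded mem_BZ_FM[OF mN(3)]]
 have "\<phi> (cat \<alpha>) \<in> carrier C.cut" if \<alpha>: "\<alpha> \<in> V.L" for \<alpha>
 proof -
  have "act (Tg (pos_right ns ks j)) (\<phi> (cat \<alpha>)) = \<ominus> \<phi> (cat \<alpha>)" if j: "j \<in> lev ks" for j
  proof -
   have jf: "j \<in> full (sum_list ks)" "j \<in> {1..sum_list ks}" "j + 1 \<in> {1..sum_list ks}"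
    using j lev_subset[of ks] by fastforce+
   have "base_label ks j = base_label ks (j + 1)" using j jf by (simp add: lev_block_index base_label_def)
   hence same: "cat \<alpha> (j + m) = cat \<alpha> (j + m + 1)"
    using glue_tail[of j N m \<alpha> "base_label ks"] glue_tail[of "j + 1" N m \<alpha> "base_label ks"] jf mN by simp
   have pos: "lpos ns (cat \<alpha>) (j + m) = pos_right ns ks j"
    using lpos_glue_tail[OF \<alpha> base_label_labelling jf(2)] by (simp add: lpos_base)
   have "j + m \<in> full N" "N - sum_list ks < j + m" using jf(1) sum_split by auto
   thus ?thesis using \<phi>' cat_in[OF \<alpha>] same pos by metis
  qed
  moreover have "\<phi> (cat \<alpha>) \<in> carrier \<sigma>" using \<phi>' cat_in[OF \<alpha>] by blast
  ultimately show ?thesis by (simp add: C.carrier_cut sgn_vec_def)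
 qed
 thus ?thesis by (simp add: restr_def)
qed

lemma coefficients:
 assumes \<alpha>: "\<alpha> \<in> V.L" and j: "j \<in> full m" and x: "x \<in> carrier C.cut"
 shows "actV (V.PP \<alpha> j) x = act (W.PP (cat \<alpha>) j) x" and "actV (V.QQ \<alpha> j) x = act (W.QQ (cat \<alpha>) j) x"
proof -
 have jm: "j \<in> {1..m}" "Suc j \<in> {1..m}" using j by auto
 have lab: "cat \<alpha> j = \<alpha> j" "cat \<alpha> (Suc j) = \<alpha> (Suc j)" using glue_head[of _ m N] jm mN by simp_all
 have pos: "lpos ns (cat \<alpha>) j = pl (lpos nd \<alpha> j)" "lpos ns (cat \<alpha>) (Suc j) = pl (lpos nd \<alpha> (Suc j))"
  using lpos_glue_head[OF \<alpha>] jm by blast+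
 have "actV (V.PP \<alpha> j) x = act (W.PP (cat \<alpha>) j) x \<and> actV (V.QQ \<alpha> j) x = act (W.QQ (cat \<alpha>) j) x"
 proof (cases "\<alpha> j = \<alpha> (Suc j)")
  case True
  have "lpos nd \<alpha> j \<in> lev nd" using lpos_lev[OF \<alpha> j] True by simp
  thus ?thesis using True lab pos x
   by (simp add: V.PP_def V.QQ_def W.PP_def W.QQ_def C.cut_mact C.cut_carrier)
 next
  case False
  let ?a = "lpos nd \<alpha> j" and ?b = "lpos nd \<alpha> (Suc j)"
  have ap: "apart nd ?a ?b" using lpos_apart[OF \<alpha> jm] False by simp
  have al: "V.al ?a ?b \<in> \<A> m" by (rule V.al_laurent[OF ap])
  \<comment> \<open>Naturality once more: renaming by \<open>pl\<close> carries the coefficient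
    \<alpha> of the cut module to that of \<sigma>.\<close>
  have "lrename pl (V.al ?a ?b) = W.al (pl ?a) (pl ?b)"
   using natural[OF apart_pl[OF ap], unfolded natural_op_def]
   by (simp add: V.al_def W.al_def lrename_mult lrename_diff)
  thus ?thesis using False lab pos al
   by (simp add: V.PP_def V.QQ_def W.PP_def W.QQ_def C.cut_mact subst_diff subst_uminus)
 qed
 thus "actV (V.PP \<alpha> j) x = act (W.PP (cat \<alpha>) j) x" "actV (V.QQ \<alpha> j) x = act (W.QQ (cat \<alpha>) j) x" by auto
qed

text \<open>Letters of the smaller Hecke algebra touch only the first m positions, where
  \<open>cat \<alpha>\<close> agrees with \<alpha>; the sorted tail is carried along.\<close>

lemma restr_letter:
 assumes \<phi>: "\<phi> \<in> carrier (BZ q N (sum_list ks) W.FM)" and c: "c \<in> gens m (full m)"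
 shows "restr (W.fact (fgen c) \<phi>) = V.fact (fgen c) (restr \<phi>)"
proof (rule fun_group_eqI)
 have \<phi>c: "\<phi> \<in> W.L \<rightarrow>\<^sub>E carrier \<sigma>" using \<phi> unfolding mem_BZ_FM[OF mN(3)] by blast
 note r = restr_closed[OF \<phi>]
 show "restr (W.fact (fgen c) \<phi>) \<in> V.L \<rightarrow>\<^sub>E UNIV" by (simp add: restr_def)
 show "V.fact (fgen c) (restr \<phi>) \<in> V.L \<rightarrow>\<^sub>E carrier C.cut" by (rule V.fact_closed[OF r])
 fix \<alpha> assume \<alpha>: "\<alpha> \<in> V.L"
 have l: "cat \<alpha> \<in> W.L" by (rule cat_in[OF \<alpha>])
 have x: "\<phi> (cat \<alpha>) = restr \<phi> \<alpha>" "restr \<phi> \<alpha> \<in> carrier C.cut" using \<alpha> r by (auto simp: restr_def)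
 have lhs: "restr (W.fact (fgen c) \<phi>) \<alpha> = W.fact (fgen c) \<phi> (cat \<alpha>)" using \<alpha> by (simp add: restr_def)
 show "restr (W.fact (fgen c) \<phi>) \<alpha> = V.fact (fgen c) (restr \<phi>) \<alpha>"
 proof (cases c)
  case (GA f)
  hence f: "f \<in> \<A> m" using c by simp
  have f': "lrename (lpos nd \<alpha>) f \<in> \<A> m"
   by (rule lrename_laurent[OF f]) (use lpos_in[OF \<alpha>] in auto)
  have "lrename (lpos ns (cat \<alpha>)) f = lrename pl (lrename (lpos nd \<alpha>) f)"
   unfolding lrename_comp by (rule lrename_cong[OF f]) (use lpos_glue_head[OF \<alpha>] in simp)
  thus ?thesis
   unfolding lhs[unfolded GA] GA W.fact_GA[OF \<phi>c l] V.fact_GA[OF r \<alpha>] x(1) using f' by (simp add: C.cut_mact)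
 next
  case (GT j)
  hence j: "j \<in> full m" using c by simp
  have jN: "j \<in> full N" using j mN by auto
  have \<alpha>': "\<alpha> \<circ> sref j \<in> V.L" by (rule labellings_sref[OF \<alpha> j])
  have y1: "\<phi> (cat \<alpha> \<circ> sref j) = restr \<phi> (\<alpha> \<circ> sref j)"
   using \<alpha>' glue_sref_head[OF j mN(1), of \<alpha> "base_label ks"] by (simp add: restr_def)
  have y2: "restr \<phi> (\<alpha> \<circ> sref j) \<in> carrier C.cut" by (rule PiE_mem[OF r \<alpha>'])
  show ?thesis
   unfolding lhs[unfolded GT] GT W.fact_GT[OF \<phi>c jN l] V.fact_GT[OF r j \<alpha>] x(1) y1
    coefficients(1)[OF \<alpha> j x(2)] coefficients(2)[OF \<alpha> j y2] by simp
 qed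
qed

lemma restr_smult:
 assumes \<phi>: "\<phi> \<in> carrier (BZ q N (sum_list ks) W.FM)" and h: "h \<in> carrier (hecke q m)"
 shows "restr (h \<odot>\<^bsub>BZ q N (sum_list ks) W.FM\<^esub> \<phi>) = h \<odot>\<^bsub>V.FM\<^esub> restr \<phi>"
proof -
 let ?B = "BZ q N (sum_list ks) W.FM"
 have B: "left_module (hecke q m) ?B"
  using left_module_BZ[OF W.left_module_FM q_pos mN(3)] unfolding mN(4) .
 obtain a where a: "a \<in> hfree m" "h = hcls q m a" using hcls_surj[OF h] by blast
 have "restr (mact q m (full m) ?B a \<phi>) = mact q m (full m) V.FM a (restr \<phi>)"
 proof (rule free_action_equivariant[where M = ?B and N = V.FM and \<phi> = restr,
    OF free_action_hecke[OF B] free_action_hecke[OF V.left_module_FM] kills_hecke[OF B] kills_hecke[OF V.left_module_FM] _ _ _ a(1) \<phi>])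
  fix \<psi> assume \<psi>: "\<psi> \<in> carrier ?B"
  show "restr \<psi> \<in> carrier V.FM" using restr_closed[OF \<psi>] by simp
  fix \<chi> assume "\<chi> \<in> carrier ?B"
  show "restr (\<psi> \<oplus>\<^bsub>?B\<^esub> \<chi>) = restr \<psi> \<oplus>\<^bsub>V.FM\<^esub> restr \<chi>"
   using cat_in by (auto simp: restr_def intro!: restrict_ext)
 next
  fix c \<psi> assume c: "c \<in> gens m (full m)" and \<psi>: "\<psi> \<in> carrier ?B"
  have \<psi>c: "\<psi> \<in> W.L \<rightarrow>\<^sub>E carrier \<sigma>" using \<psi> unfolding mem_BZ_FM[OF mN(3)] by blast
  have cm: "fgen c \<in> hfree m" using c by simp
  have cN: "fgen c \<in> hfree N" using c mN(1) laurent_mono[of _ m N] by (cases c) auto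
  have s: "subst (\<lambda>j. j) (fgen c) = fgen c" using c lrename_ident[of _ m] by (cases c) auto
  have "mact q m (full m) ?B (fgen c) \<psi> = mact q N (full N) W.FM (fgen c) \<psi>"
   using BZ_smult[OF W.left_module_FM q_pos mN(3), of "fgen c" \<psi>] cm
   unfolding mN(4) s by (simp add: mact_eq del: fsupp_fgen)
  also have "\<dots> = W.fact (fgen c) \<psi>" unfolding mact_eq[OF cN] by (rule W.FM_smult[OF cN \<psi>c])
  finally have "restr (mact q m (full m) ?B (fgen c) \<psi>) = V.fact (fgen c) (restr \<psi>)"
   using restr_letter[OF \<psi> c] by simp
  also have "\<dots> = mact q m (full m) V.FM (fgen c) (restr \<psi>)"
   unfolding mact_eq[OF cm] by (rule V.FM_smult[OF cm restr_closed[OF \<psi>], symmetric])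
  finally show "restr (mact q m (full m) ?B (fgen c) \<psi>) = mact q m (full m) V.FM (fgen c) (restr \<psi>)" .
 qed
 thus ?thesis by (simp only: a(2) mact_eq[OF a(1)])
qed

lemma BZ_levi_cut: "BZ_levi q ns ks \<sigma> = C.cut"
 unfolding BZ_levi_eq C.cut_def ..

text \<open>Every tail arises from the sorted one by swaps inside the tail, and these leave the
  values of a sign vector unchanged.\<close>

lemma tail_invariant:
 assumes \<phi>: "\<phi> \<in> carrier (BZ q N (sum_list ks) W.FM)" and \<alpha>: "\<alpha> \<in> V.L" and \<mu>: "\<mu> \<in> labellings ks"
 shows "\<phi> (glue m N \<alpha> \<mu>) = restr \<phi> \<alpha>"
 using \<mu>
proof (induction \<mu> rule: labelling_induct)
 case base
 thus ?case using \<alpha> by (simp add: restr_def)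
next
 case (step \<mu> j)
 have j: "j \<in> full (N - m)" using step(2) mN by simp
 have "j + m \<in> full N" "N - sum_list ks < j + m" using step(2) sum_split by auto
 hence "\<phi> (glue m N \<alpha> \<mu> \<circ> sref (j + m)) = \<phi> (glue m N \<alpha> \<mu>)"
  using \<phi>[unfolded mem_BZ_FM[OF mN(3)]] glue_labelling[OF \<alpha> step(1)] by blast
 thus ?case using step.IH by (simp only: glue_sref_tail[OF j])
qed

end

context separated
begin

lemma split: "ks \<in> sub_tuples ns i ==> split_sections q ns \<sigma> Fg Fh ks"
 by (intro split_sections.intro separated_axioms sub_tuples_block_split)

text \<open>The module \<open>V.FM\<close> with its parameters written out, so that it is available
  as a family in \<open>ks\<close>.\<close>

definition sections_at :: "nat list => (hecke_elt, (nat => nat) => 'b) module" where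
 "sections_at ks = levi_model.FM q (tuple_diff ns ks) (BZ_levi q ns ks \<sigma>)
   (\<lambda>a b. Fg (pos_left ns ks a) (pos_left ns ks b) (lvar a - lvar b))"

theorem BZ_sections:
 assumes i: "i \<le> W.n"
 shows "left_modules_isomorphic (hecke q (W.n - i)) (BZ q W.n i W.FM) (direct_sum (sub_tuples ns i) sections_at)"
proof -
 let ?I = "sub_tuples ns i" and ?B = "BZ q W.n i W.FM" and ?m = "W.n - i"
 let ?L = "\<lambda>ks. labellings (tuple_diff ns ks)"
 define \<Psi> where "\<Psi> \<phi> = (\<lambda>ks\<in>?I. \<lambda>\<alpha>\<in>?L ks. \<phi> (glue ?m W.n \<alpha> (base_label ks)))" for \<phi> :: "(nat => nat) => 'b"
 note simps = direct_sum_simps(1)[OF finite_sub_tuples] direct_sum_simps(2-4)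
 have sm: "sum_list ks = i" "sum_list (tuple_diff ns ks) = ?m" if "ks \<in> ?I" for ks
  using sub_tuples_sum[OF that] by simp_all
 \<comment> \<open>The facts about a single \<open>ks\<close> are exported from its interpretation,
   to be used for all summands together.\<close>
 have at: "carrier (sections_at ks) = (?L ks \<rightarrow>\<^sub>E carrier (BZ_levi q ns ks \<sigma>))"
  "x \<oplus>\<^bsub>sections_at ks\<^esub> y = (\<lambda>\<alpha>\<in>?L ks. x \<alpha> \<oplus> y \<alpha>)"
  "left_module (hecke q ?m) (sections_at ks)"
  "\<phi> \<in> carrier ?B ==> \<Psi> \<phi> ks \<in> carrier (sections_at ks)"
  "\<phi> \<in> carrier ?B ==> h \<in> carrier (hecke q ?m) ==> \<Psi> (h \<odot>\<^bsub>?B\<^esub> \<phi>) ks = h \<odot>\<^bsub>sections_at ks\<^esub> \<Psi> \<phi> ks"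
  "\<phi> \<in> carrier ?B ==> \<alpha> \<in> ?L ks ==> \<mu> \<in> labellings ks ==> \<phi> (glue ?m W.n \<alpha> \<mu>) = \<Psi> \<phi> ks \<alpha>"
  if ks: "ks \<in> ?I" for ks x y \<phi> h \<alpha> \<mu>
 proof -
  interpret S: split_sections q ns \<sigma> Fg Fh ks by (rule split[OF ks])
  have eq: "sections_at ks = S.V.FM" by (simp add: sections_at_def S.BZ_levi_cut)
  have P: "\<Psi> \<phi> ks = S.restr \<phi>" for \<phi> using ks by (simp add: \<Psi>_def S.restr_def sm)
  show "carrier (sections_at ks) = (?L ks \<rightarrow>\<^sub>E carrier (BZ_levi q ns ks \<sigma>))"
   "x \<oplus>\<^bsub>sections_at ks\<^esub> y = (\<lambda>\<alpha>\<in>?L ks. x \<alpha> \<oplus> y \<alpha>)"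
   unfolding eq S.BZ_levi_cut by simp_all
  show "left_module (hecke q ?m) (sections_at ks)" using S.V.left_module_FM unfolding eq sm[OF ks] .
  show "\<phi> \<in> carrier ?B ==> \<Psi> \<phi> ks \<in> carrier (sections_at ks)"
   using S.restr_closed[of \<phi>] unfolding eq P sm[OF ks] by simp
  show "\<phi> \<in> carrier ?B ==> h \<in> carrier (hecke q ?m) ==> \<Psi> (h \<odot>\<^bsub>?B\<^esub> \<phi>) ks = h \<odot>\<^bsub>sections_at ks\<^esub> \<Psi> \<phi> ks"
   using S.restr_smult[of \<phi> h] unfolding eq P sm[OF ks] by simp
  show "\<phi> \<in> carrier ?B ==> \<alpha> \<in> ?L ks ==> \<mu> \<in> labellings ks ==> \<phi> (glue ?m W.n \<alpha> \<mu>) = \<Psi> \<phi> ks \<alpha>"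
   using S.tail_invariant[of \<phi> \<alpha> \<mu>] unfolding P sm[OF ks] by simp
 qed
 have closed: "\<Psi> \<phi> \<in> (\<Pi>\<^sub>E ks\<in>?I. carrier (sections_at ks))" if "\<phi> \<in> carrier ?B" for \<phi>
 proof (rule PiE_I)
  fix ks assume "ks \<in> ?I"
  thus "\<Psi> \<phi> ks \<in> carrier (sections_at ks)" by (rule at(4)[OF _ that])
 qed (simp add: \<Psi>_def)
 have inj: "\<phi> = \<psi>" if \<phi>: "\<phi> \<in> carrier ?B" and \<psi>: "\<psi> \<in> carrier ?B" and eq: "\<Psi> \<phi> = \<Psi> \<psi>" for \<phi> \<psi>
 proof (rule fun_group_eqI)
  show "\<phi> \<in> W.L \<rightarrow>\<^sub>E carrier \<sigma>" "\<psi> \<in> W.L \<rightarrow>\<^sub>E carrier \<sigma>" using \<phi> \<psi> unfolding mem_BZ_FM[OF i] by blast+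
  fix l assume "l \<in> W.L"
  then obtain ks \<alpha> \<mu> where l: "ks \<in> ?I" "\<alpha> \<in> ?L ks" "\<mu> \<in> labellings ks" "l = glue ?m W.n \<alpha> \<mu>"
   using glue_cases[OF _ i] by metis
  show "\<phi> l = \<psi> l" unfolding l(4) at(6)[OF l(1) \<phi> l(2,3)] at(6)[OF l(1) \<psi> l(2,3)] eq ..
 qed
 have surj: "\<exists>\<phi>\<in>carrier ?B. \<Psi> \<phi> = F" if F: "F \<in> (\<Pi>\<^sub>E ks\<in>?I. carrier (sections_at ks))" for F
 proof -
  \<comment> \<open>The value depends on the tail only through its content; this makes \<phi>
    invariant under rearrangements of the tail.\<close>
  define \<phi> where "\<phi> = (\<lambda>l\<in>W.L. F (tail_content ?m ns l) (restrict l {1..?m}))"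
  have F': "F ks \<in> ?L ks \<rightarrow>\<^sub>E carrier (BZ_levi q ns ks \<sigma>)" if "ks \<in> ?I" for ks
   using PiE_mem[OF F that] unfolding at(1)[OF that] .
  have \<phi>_glue: "\<phi> (glue ?m W.n \<alpha> \<mu>) = F ks \<alpha>"
   and glue_L: "glue ?m W.n \<alpha> \<mu> \<in> W.L"
   if ks: "ks \<in> ?I" and \<alpha>: "\<alpha> \<in> ?L ks" and \<mu>: "\<mu> \<in> labellings ks" for ks \<alpha> \<mu>
  proof -
   show L: "glue ?m W.n \<alpha> \<mu> \<in> W.L"
    using block_split.glue_labelling[OF sub_tuples_block_split[OF ks] \<alpha> \<mu>] unfolding sm[OF ks] .
   show "\<phi> (glue ?m W.n \<alpha> \<mu>) = F ks \<alpha>"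
    using L glue_content[OF ks \<alpha> \<mu>] by (simp add: \<phi>_def)
  qed
  have "\<phi> \<in> carrier ?B"
   unfolding mem_BZ_FM[OF i]
  proof (intro conjI ballI impI)
   show "\<phi> \<in> W.L \<rightarrow>\<^sub>E carrier \<sigma>"
   proof (rule PiE_I)
    fix l assume "l \<in> W.L"
    then obtain ks \<alpha> \<mu> where l: "ks \<in> ?I" "\<alpha> \<in> ?L ks" "\<mu> \<in> labellings ks" "l = glue ?m W.n \<alpha> \<mu>"
     using glue_cases[OF _ i] by metis
    interpret S: split_sections q ns \<sigma> Fg Fh ks by (rule split[OF l(1)])
    show "\<phi> l \<in> carrier \<sigma>"
     unfolding l(4) \<phi>_glue[OF l(1-3)] using PiE_mem[OF F'[OF l(1)] l(2)] S.C.cut_carrier S.BZ_levi_cut by simp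
   qed (simp add: \<phi>_def)
   fix j l assume j: "j \<in> full W.n" and jm: "?m < j" and "l \<in> W.L"
   then obtain ks \<alpha> \<mu> where l: "ks \<in> ?I" "\<alpha> \<in> ?L ks" "\<mu> \<in> labellings ks" "l = glue ?m W.n \<alpha> \<mu>"
    using glue_cases[OF _ i] by metis
   interpret S: split_sections q ns \<sigma> Fg Fh ks by (rule split[OF l(1)])
   let ?j = "j - ?m"
   have mi: "W.n - ?m = i" using i by simp
   have jj: "?j \<in> full i" "j = ?j + ?m" using j jm i by auto
   have j1: "?j \<in> {1..i}" "?j + 1 \<in> {1..i}" using jj(1) by auto
   have jks: "?j \<in> full (sum_list ks)" using jj(1) by (simp only: sm[OF l(1)])
   have "l \<circ> sref j = glue ?m W.n \<alpha> (\<mu> \<circ> sref ?j)"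
    using glue_sref_tail[of ?j W.n ?m \<alpha> \<mu>] jj mi unfolding l(4) by metis
   thus "\<phi> (l \<circ> sref j) = \<phi> l"
    using \<phi>_glue[OF l(1,2) labellings_sref[OF l(3) jks]] \<phi>_glue[OF l(1-3)] l(4) by simp
   assume same: "l j = l (j + 1)"
   \<comment> \<open>Equal neighbouring labels in the tail single out a T of the Levi subalgebra for
     \<open>ks\<close>, for which the value of \<phi> is a sign vector by construction.\<close>
   have "l j = \<mu> ?j" "l (j + 1) = \<mu> (?j + 1)"
    using glue_tail[of ?j W.n ?m \<alpha> \<mu>] glue_tail[of "?j + 1" W.n ?m \<alpha> \<mu>] j1 mi jj(2) l(4)
    by (simp_all only: mi) (metis add.commute add.left_commute)+
   hence lv: "lpos ks \<mu> ?j \<in> lev ks" using lpos_lev[OF l(3) jks] same by simp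
   have "lpos ns l (?j + ?m) = pos_right ns ks (lpos ks \<mu> ?j)"
    using S.lpos_glue_tail[OF l(2,3), of ?j] j1 unfolding sm[OF l(1)] l(4) by blast
   hence "lpos ns l j = pos_right ns ks (lpos ks \<mu> ?j)" using jj(2) by simp
   moreover have "\<phi> l \<in> carrier S.C.cut"
    unfolding l(4) \<phi>_glue[OF l(1-3)] using PiE_mem[OF F'[OF l(1)] l(2)] S.BZ_levi_cut by simp
   ultimately show "act (Tg (lpos ns l j)) (\<phi> l) = \<ominus> \<phi> l"
    using lv by (simp add: S.C.carrier_cut sgn_vec_def)
  qed
  moreover have "\<Psi> \<phi> = F"
  proof (rule PiE_ext[OF _ F])
   show "\<Psi> \<phi> \<in> (\<Pi>\<^sub>E ks\<in>?I. carrier (sections_at ks))" by (rule closed[OF calculation])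
   fix ks assume ks: "ks \<in> ?I"
   show "\<Psi> \<phi> ks = F ks"
   proof (rule fun_group_eqI[OF _ F'[OF ks]])
    show "\<Psi> \<phi> ks \<in> ?L ks \<rightarrow>\<^sub>E UNIV" using ks by (simp add: \<Psi>_def)
    fix \<alpha> assume \<alpha>: "\<alpha> \<in> ?L ks"
    show "\<Psi> \<phi> ks \<alpha> = F ks \<alpha>"
     using at(6)[OF ks calculation \<alpha> base_label_labelling] \<phi>_glue[OF ks \<alpha> base_label_labelling] by simp
   qed
  qed
  ultimately show ?thesis by blast
 qed
 have "bij_betw \<Psi> (carrier ?B) (carrier (direct_sum ?I sections_at))"
  unfolding simps
 proof (rule bij_betwI')
  show "!!\<phi> \<psi>. \<phi> \<in> carrier ?B ==> \<psi> \<in> carrier ?B ==> \<Psi> \<phi> = \<Psi> \<psi> \<longleftrightarrow> \<phi> = \<psi>" using inj by blast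
  show "!!\<phi>. \<phi> \<in> carrier ?B ==> \<Psi> \<phi> \<in> (\<Pi>\<^sub>E ks\<in>?I. carrier (sections_at ks))" by (rule closed)
  show "!!F. F \<in> (\<Pi>\<^sub>E ks\<in>?I. carrier (sections_at ks)) ==> \<exists>\<phi>\<in>carrier ?B. F = \<Psi> \<phi>" using surj by blast
 qed
 moreover have "\<Psi> (\<phi> \<oplus>\<^bsub>?B\<^esub> \<psi>) = \<Psi> \<phi> \<oplus>\<^bsub>direct_sum ?I sections_at\<^esub> \<Psi> \<psi>" for \<phi> \<psi>
 proof -
  have "(\<lambda>\<alpha>\<in>?L ks. (\<phi> \<oplus>\<^bsub>?B\<^esub> \<psi>) (glue ?m W.n \<alpha> (base_label ks))) = \<Psi> \<phi> ks \<oplus>\<^bsub>sections_at ks\<^esub> \<Psi> \<psi> ks" if ks: "ks \<in> ?I" for ks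
   unfolding at(2)[OF ks]
  proof (rule restrict_ext)
   fix \<alpha> assume \<alpha>: "\<alpha> \<in> ?L ks"
   have "glue ?m W.n \<alpha> (base_label ks) \<in> W.L"
    using block_split.glue_labelling[OF sub_tuples_block_split[OF ks] \<alpha> base_label_labelling] unfolding sm[OF ks] .
   thus "(\<phi> \<oplus>\<^bsub>?B\<^esub> \<psi>) (glue ?m W.n \<alpha> (base_label ks)) = \<Psi> \<phi> ks \<alpha> \<oplus> \<Psi> \<psi> ks \<alpha>"
    using ks \<alpha> by (simp add: \<Psi>_def)
  qed
  thus ?thesis unfolding simps \<Psi>_def[of "\<phi> \<oplus>\<^bsub>?B\<^esub> \<psi>"] by (intro restrict_ext) simp
 qed
 moreover have "\<Psi> (h \<odot>\<^bsub>?B\<^esub> \<phi>) = h \<odot>\<^bsub>direct_sum ?I sections_at\<^esub> \<Psi> \<phi>"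
  if h: "h \<in> carrier (hecke q ?m)" and \<phi>: "\<phi> \<in> carrier ?B" for h \<phi>
 proof -
  have "\<Psi> (h \<odot>\<^bsub>?B\<^esub> \<phi>) = restrict (\<Psi> (h \<odot>\<^bsub>?B\<^esub> \<phi>)) ?I" by (simp add: \<Psi>_def)
  also have "\<dots> = h \<odot>\<^bsub>direct_sum ?I sections_at\<^esub> \<Psi> \<phi>"
   unfolding simps by (rule restrict_ext) (rule at(5)[OF _ \<phi> h])
  finally show ?thesis .
 qed
 ultimately have "\<Psi> \<in> left_module_iso (hecke q ?m) ?B (direct_sum ?I sections_at)"
  by (simp add: left_module_iso_def)
 thus ?thesis
  using left_module_BZ[OF W.left_module_FM q_pos i] left_module_direct_sum[OF finite_sub_tuples ring_hecke at(3)]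
  by (auto simp: left_modules_isomorphic_def)
qed

theorem BZ_induced:
 assumes i: "i \<le> W.n" and \<pi>: "left_modules_isomorphic (hecke q W.n) \<pi> (induced_module (hecke q W.n) (levi q ns) \<sigma>)"
 shows "left_modules_isomorphic (hecke q (W.n - i)) (BZ q W.n i \<pi>)
  (direct_sum (sub_tuples ns i)
   (\<lambda>ks. induced_module (hecke q (W.n - i)) (levi q (tuple_diff ns ks)) (BZ_levi q ns ks \<sigma>)))"
proof -
 have "left_modules_isomorphic (hecke q W.n) \<pi> W.FM"
  by (rule left_modules_isomorphic_trans[OF \<pi> W.induced_iso_sections])
 hence "left_modules_isomorphic (hecke q (W.n - i)) (BZ q W.n i \<pi>) (BZ q W.n i W.FM)"
  by (rule BZ_isomorphic[OF _ q_pos i])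
 hence "left_modules_isomorphic (hecke q (W.n - i)) (BZ q W.n i \<pi>) (direct_sum (sub_tuples ns i) sections_at)"
  by (rule left_modules_isomorphic_trans[OF _ BZ_sections[OF i]])
 moreover have "left_modules_isomorphic (hecke q (W.n - i)) (direct_sum (sub_tuples ns i) sections_at)
  (direct_sum (sub_tuples ns i)
   (\<lambda>ks. induced_module (hecke q (W.n - i)) (levi q (tuple_diff ns ks)) (BZ_levi q ns ks \<sigma>)))"
 proof (rule direct_sum_isomorphic[OF finite_sub_tuples ring_hecke])
  fix ks assume ks: "ks \<in> sub_tuples ns i"
  interpret S: split_sections q ns \<sigma> Fg Fh ks by (rule split[OF ks])
  have eq: "sections_at ks = S.V.FM" by (simp add: sections_at_def S.BZ_levi_cut)
  show "left_modules_isomorphic (hecke q (W.n - i)) (sections_at ks)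
    (induced_module (hecke q (W.n - i)) (levi q (tuple_diff ns ks)) (BZ_levi q ns ks \<sigma>))"
   using left_modules_isomorphic_sym[OF S.V.induced_iso_sections]
   unfolding eq S.BZ_levi_cut sub_tuples_sum(2)[OF ks] .
 qed
 ultimately show ?thesis by (rule left_modules_isomorphic_trans)
qed

end

theorem theorem5p3:
  fixes q n i :: nat
    and ns :: "nat list"
    and t u :: "nat \<Rightarrow> complex" and v :: "nat \<Rightarrow> real"
    and \<pi> :: "(hecke_elt, 'b) module" and \<sigma> :: "(hecke_elt, 'c) module"
  assumes "primepow q"
    and "\<forall>k\<in>{1..n}. 0 < v k \<and> cmod (u k) = 1 \<and> t k = of_real (v k) * u k"
    and "sum_list ns = n"
    and "\<forall>k<length ns. 0 < ns ! k"
    and "\<forall>k<length ns. \<forall>k'<length ns. \<forall>a\<in>block ns k. \<forall>b\<in>block ns k'. u a = u b \<longleftrightarrow> k = k'"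
    and "left_module (hecke q n) \<pi>"
    and "finite_dimensional q n \<pi>"
    and "annihilated_by_power q [n] t \<pi>"
    and "left_module (levi q ns) \<sigma>"
    and "finite_dimensional q n \<sigma>"
    and "annihilated_by_power q ns t \<sigma>"
    and "left_modules_isomorphic (hecke q n) \<pi> (induced_module (hecke q n) (levi q ns) \<sigma>)"
    and "i \<le> n"
  shows "left_modules_isomorphic (hecke q (n - i))
           (BZ q n i \<pi>)
           (direct_sum (sub_tuples ns i)
              (\<lambda>ks. induced_module (hecke q (n - i)) (levi q (tuple_diff ns ks))
                      (BZ_levi q ns ks \<sigma>)))"
proof -
 have n: "sum_list ns = n" by (rule assms(3))
 have q: "q > 0" using assms(1) by (simp add: primepow_gt_0_nat)
 \<comment> \<open>Stated for arbitrary m > 0, so that the instances m = q and m = 1 supply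
   \<open>Fh\<close> and \<open>Fg\<close>.\<close>
 have inv: "\<exists>F. natural_op F \<and> (\<forall>x\<in>carrier \<sigma>. mact q (sum_list ns) (lev ns) \<sigma>
   (Ag ((lvar a - lconst (of_nat m) * lvar b) * F (lvar a - lconst (of_nat m) * lvar b))) x = x)"
  if "m > 0" "apart ns a b" for m a b
  by (rule separated_blocks_invertible[OF assms(2)[folded n] assms(5,9,11) that])
 obtain Fh where Fh: "!!a b. apart ns a b ==> natural_op (Fh a b) \<and> (\<forall>x\<in>carrier \<sigma>. mact q (sum_list ns) (lev ns) \<sigma>
   (Ag ((lvar a - lconst (of_nat q) * lvar b) * Fh a b (lvar a - lconst (of_nat q) * lvar b))) x = x)"
  using inv[OF q] by metis
 obtain Fg where Fg: "!!a b. apart ns a b ==> natural_op (Fg a b) \<and> (\<forall>x\<in>carrier \<sigma>. mact q (sum_list ns) (lev ns) \<sigma>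
   (Ag ((lvar a - lvar b) * Fg a b (lvar a - lvar b))) x = x)"
  using inv[of 1] by (simp only: of_nat_1 lconst_1 mult_1 zero_less_one simp_thms) metis
 interpret separated q ns \<sigma> Fg Fh
  by (rule separated.intro[OF q assms(9)]) (use Fg Fh in auto)
 show ?thesis using BZ_induced[of i \<pi>] assms(12,13) unfolding n by blast
qed

end
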